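(* The system $\mathsf{RCA}_0^\omega$ proves $\mathsf{BOOT}\to[\mathsf{open}+\mathsf{ACA}]\to\mathsf{BOOT}^-$, and the system $\mathsf{RCA}_0^\omega+\mathsf{IND}^\omega$ proves $\mathsf{NFP}\to\mathsf{BOOT}\to\mathsf{HBU}_{\mathrm{closed}}$.
   Context: Framework: Kohlenbach's higher-order arithmetic. $\mathsf{RCA}_0^\omega$ is the base theory in the language with variables of all finite types over $\mathbb{N}$ (basic arithmetic, combinators, primitive recursor $\mathbf{R}_0$, extensionality, quantifier-free induction, $\mathsf{QF\text{-}AC}^{1,0}$). $\mathsf{IND}^\omega$ is the induction schema for all formulas of this language. $\mathsf{ACA}$ is arithmetical comprehension. Reals are represented by fast-converging Cauchy sequences of rationals. A set of reals is given by a function $Y:\mathbb{R}\to\mathbb{R}$, where $x\in Y$ means $Y(x)>0$; $Y$ is open if for every $x\in Y$ there is a rational $r>0$ with $B(x,r)\subseteq Y$; $Y$ is closed if its complement is open. Fix an enumeration $(q_n,r_n)_{n\in\mathbb{N}}$ of all pairs of rationals with $r_n>0$. $\mathsf{BOOT}$: for every $Y^2$ (taking $f^1$ and $n^0$) there is $X\subseteq\mathbb{N}$ with $(\forall n)(n\in X\leftrightarrow(\exists f^1)(Y(f,n)=0))$. $\mathsf{BOOT}^-$: the same, restricted to $Y$ such that for every $n$ there is at most one $f^1$ with $Y(f,n)=0$. $\mathsf{open}$: for every open set $Y\subseteq\mathbb{R}$ there is $X\subseteq\mathbb{N}$ with $(\forall n)(n\in X\leftrightarrow B(q_n,r_n)\subseteq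 Y)$. $\mathsf{NFP}$: for every formula $A$ (of arbitrary complexity, with any parameters), $(\forall f^1)(\exists n^0)A(\bar f n)\to(\exists\gamma^1\in K_0)(\forall f^1)A(\bar f\gamma(f))$, where $\bar f n=\langle f(0),\dots,f(n-1)\rangle$, and $\gamma\in K_0$ (``$\gamma$ is an associate'') means $(\forall f^1)(\exists n)(\gamma(\bar f n)>0)\wedge(\forall n,m,f)(m>n\wedge\gamma(\bar f n)>0\to\gamma(\bar f n)=\gamma(\bar f m))$, with $\gamma(f)$ defined as the unique value $\gamma(\bar f n)-1$ for $n$ large enough. $\mathsf{HBU}_{\mathrm{closed}}$: for every closed $C\subseteq[0,1]$ and $\Psi:\mathbb{R}\to\mathbb{R}^+$ there are $y_1,\dots,y_k\in C$ with $C\subseteq\bigcup_{i\le k}(y_i-\Psi(y_i),y_i+\Psi(y_i))$. *)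

theory Defs
  imports Main
begin

section \<open>The language of all finite types\<close>

datatype ty = Ty0 | Fn ty ty  (infixr "\<rightarrow>" 60)

abbreviation Ty1 :: ty where "Ty1 \<equiv> Ty0 \<rightarrow> Ty0"

datatype cst =
    Zero | One | Plus | Times
  | CombK ty ty       \<comment> \<open>Kohlenbach's \<open>\<Pi>\<close>\<close>
  | CombS ty ty ty    \<comment> \<open>Kohlenbach's \<open>\<Sigma>\<close>\<close>
  | Rec0

fun cty :: "cst \<Rightarrow> ty" where
  "cty Zero = Ty0"
| "cty One = Ty0"
| "cty Plus = (Ty0 \<rightarrow> Ty0 \<rightarrow> Ty0)"
| "cty Times = (Ty0 \<rightarrow> Ty0 \<rightarrow> Ty0)"
| "cty (CombK \<sigma> \<tau>) = (\<sigma> \<rightarrow> \<tau> \<rightarrow> \<sigma>)"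
| "cty (CombS \<rho> \<sigma> \<tau>) = ((\<rho> \<rightarrow> \<sigma> \<rightarrow> \<tau>) \<rightarrow> (\<rho> \<rightarrow> \<sigma>) \<rightarrow> \<rho> \<rightarrow> \<tau>)"
| "cty Rec0 = ((Ty0 \<rightarrow> Ty0 \<rightarrow> Ty0) \<rightarrow> Ty0 \<rightarrow> Ty0 \<rightarrow> Ty0)"

text \<open>Variables are de Bruijn indices annotated with their type. The only primitive predicates are
  \<open>=\<close> and \<open><\<close> at type \<open>0\<close>; equality at higher types is defined below. The logic is classical, so
  that the remaining connectives are defined from \<open>\<bottom>\<close>, \<open>\<longrightarrow>\<close> and \<open>\<forall>\<close>.\<close>

datatype tm = Var nat ty | Cst cst | App tm tm

datatype fm = Eq tm tm | Less tm tm | Bot | Imp fm fm | All ty fm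

fun ty_of :: "tm \<Rightarrow> ty" where
  "ty_of (Var n \<tau>) = \<tau>"
| "ty_of (Cst c) = cty c"
| "ty_of (App s t) = (case ty_of s of \<rho> \<rightarrow> \<sigma> \<Rightarrow> \<sigma> | Ty0 \<Rightarrow> Ty0)"

text \<open>Well-formedness in a context \<open>\<Gamma>\<close>, where \<open>\<Gamma> ! n\<close> is the type of variable \<open>n\<close>.\<close>

fun wt :: "ty list \<Rightarrow> tm \<Rightarrow> bool" where
  "wt \<Gamma> (Var n \<tau>) \<longleftrightarrow> n < length \<Gamma> \<and> \<Gamma> ! n = \<tau>"
| "wt \<Gamma> (Cst c) \<longleftrightarrow> True"
| "wt \<Gamma> (App s t) \<longleftrightarrow> wt \<Gamma> s \<and> wt \<Gamma> t \<and> (case ty_of s of \<rho> \<rightarrow> \<sigma> \<Rightarrow> \<rho> = ty_of t | Ty0 \<Rightarrow> False)"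

fun wff :: "ty list \<Rightarrow> fm \<Rightarrow> bool" where
  "wff \<Gamma> (Eq s t) \<longleftrightarrow> wt \<Gamma> s \<and> wt \<Gamma> t \<and> ty_of s = Ty0 \<and> ty_of t = Ty0"
| "wff \<Gamma> (Less s t) \<longleftrightarrow> wt \<Gamma> s \<and> wt \<Gamma> t \<and> ty_of s = Ty0 \<and> ty_of t = Ty0"
| "wff \<Gamma> Bot \<longleftrightarrow> True"
| "wff \<Gamma> (Imp A B) \<longleftrightarrow> wff \<Gamma> A \<and> wff \<Gamma> B"
| "wff \<Gamma> (All \<tau> A) \<longleftrightarrow> wff (\<tau> # \<Gamma>) A"

fun tsub :: "(nat \<Rightarrow> ty \<Rightarrow> tm) \<Rightarrow> tm \<Rightarrow> tm" where
  "tsub \<theta> (Var n \<tau>) = \<theta> n \<tau>"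
| "tsub \<theta> (Cst c) = Cst c"
| "tsub \<theta> (App s t) = App (tsub \<theta> s) (tsub \<theta> t)"

definition shift :: "nat \<Rightarrow> ty \<Rightarrow> tm" where
  "shift n \<tau> = Var (Suc n) \<tau>"

definition push :: "(nat \<Rightarrow> ty \<Rightarrow> tm) \<Rightarrow> nat \<Rightarrow> ty \<Rightarrow> tm" where
  "push \<theta> n \<tau> = (case n of 0 \<Rightarrow> Var 0 \<tau> | Suc m \<Rightarrow> tsub shift (\<theta> m \<tau>))"

fun fsub :: "(nat \<Rightarrow> ty \<Rightarrow> tm) \<Rightarrow> fm \<Rightarrow> fm" where
  "fsub \<theta> (Eq s t) = Eq (tsub \<theta> s) (tsub \<theta> t)"
| "fsub \<theta> (Less s t) = Less (tsub \<theta> s) (tsub \<theta> t)"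
| "fsub \<theta> Bot = Bot"
| "fsub \<theta> (Imp A B) = Imp (fsub \<theta> A) (fsub \<theta> B)"
| "fsub \<theta> (All \<tau> A) = All \<tau> (fsub (push \<theta>) A)"

text \<open>\<open>inst t A\<close> removes the outermost variable (index 0) of \<open>A\<close>, putting \<open>t\<close> in its place.\<close>

definition inst :: "tm \<Rightarrow> fm \<Rightarrow> fm" where
  "inst t A = fsub (\<lambda>n \<tau>. case n of 0 \<Rightarrow> t | Suc m \<Rightarrow> Var m \<tau>) A"


section \<open>Provability\<close>

text \<open>Classical many-sorted natural deduction with \<open>=\<close> at type \<open>0\<close> as a logical symbol:
  \<open>T; \<Gamma>; H \<turnstile> A\<close>, with free variables typed by \<open>\<Gamma>\<close> and hypotheses \<open>H\<close>. The axioms used from \<open>T\<close>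
  are sentences.\<close>

inductive derives :: "fm set \<Rightarrow> ty list \<Rightarrow> fm list \<Rightarrow> fm \<Rightarrow> bool" for T :: "fm set" where
  Ax: "A \<in> T \<Longrightarrow> wff [] A \<Longrightarrow> derives T \<Gamma> H A"
| Hyp: "A \<in> set H \<Longrightarrow> wff \<Gamma> A \<Longrightarrow> derives T \<Gamma> H A"
| ImpI: "wff \<Gamma> A \<Longrightarrow> derives T \<Gamma> (A # H) B \<Longrightarrow> derives T \<Gamma> H (Imp A B)"
| ImpE: "derives T \<Gamma> H (Imp A B) \<Longrightarrow> derives T \<Gamma> H A \<Longrightarrow> derives T \<Gamma> H B"
| Raa: "wff \<Gamma> A \<Longrightarrow> derives T \<Gamma> (Imp A Bot # H) Bot \<Longrightarrow> derives T \<Gamma> H A"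
| AllI: "derives T (\<tau> # \<Gamma>) (map (fsub shift) H) A \<Longrightarrow> derives T \<Gamma> H (All \<tau> A)"
| AllE: "derives T \<Gamma> H (All \<tau> A) \<Longrightarrow> wt \<Gamma> t \<Longrightarrow> ty_of t = \<tau> \<Longrightarrow> derives T \<Gamma> H (inst t A)"
| EqI: "wt \<Gamma> t \<Longrightarrow> ty_of t = Ty0 \<Longrightarrow> derives T \<Gamma> H (Eq t t)"
| EqE: "wff (Ty0 # \<Gamma>) A \<Longrightarrow> derives T \<Gamma> H (Eq s t) \<Longrightarrow> derives T \<Gamma> H (inst s A) \<Longrightarrow>
        derives T \<Gamma> H (inst t A)"

definition proves :: "fm set \<Rightarrow> fm \<Rightarrow> bool"  (infix "\<turnstile>" 40) where
  "T \<turnstile> A \<longleftrightarrow> derives T [] [] A"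


section \<open>Writing formulas with bound HOL variables\<close>

text \<open>To avoid explicit de Bruijn indices, object terms and formulas are written as functions of
  the number \<open>d\<close> of enclosing binders. A binder at depth \<open>d\<close> passes to its body a term that denotes,
  at any greater depth \<open>e\<close>, the variable bound there, i.e. index \<open>e - Suc d\<close>. The closed formula
  denoted by \<open>P\<close> is \<open>P 0\<close>.\<close>

type_synonym htm = "nat \<Rightarrow> tm"
type_synonym hfm = "nat \<Rightarrow> fm"

definition hvar :: "ty \<Rightarrow> nat \<Rightarrow> htm" where
  "hvar \<tau> d = (\<lambda>e. Var (e - Suc d) \<tau>)"

definition hcst :: "cst \<Rightarrow> htm" where
  "hcst c = (\<lambda>d. Cst c)"

definition happ :: "htm \<Rightarrow> htm \<Rightarrow> htm"  (infixl "\<cdot>" 90) where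
  "s \<cdot> t = (\<lambda>d. App (s d) (t d))"

definition hzero :: htm  ("\<^bold>0") where "\<^bold>0 = hcst Zero"
definition hone :: htm  ("\<^bold>1") where "\<^bold>1 = hcst One"
definition hplus :: "htm \<Rightarrow> htm \<Rightarrow> htm"  (infixl "\<^bold>+" 65) where "s \<^bold>+ t = hcst Plus \<cdot> s \<cdot> t"
definition htimes :: "htm \<Rightarrow> htm \<Rightarrow> htm"  (infixl "\<^bold>*" 70) where "s \<^bold>* t = hcst Times \<cdot> s \<cdot> t"

definition heq :: "htm \<Rightarrow> htm \<Rightarrow> hfm"  (infix "\<^bold>=" 50) where
  "(s \<^bold>= t) = (\<lambda>d. Eq (s d) (t d))"
definition hless :: "htm \<Rightarrow> htm \<Rightarrow> hfm"  (infix "\<^bold><" 50) where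
  "(s \<^bold>< t) = (\<lambda>d. Less (s d) (t d))"
definition hbot :: hfm  ("\<^bold>\<bottom>") where
  "\<^bold>\<bottom> = (\<lambda>d. Bot)"
definition himp :: "hfm \<Rightarrow> hfm \<Rightarrow> hfm"  (infixr "\<^bold>\<longrightarrow>" 25) where
  "(P \<^bold>\<longrightarrow> Q) = (\<lambda>d. Imp (P d) (Q d))"
definition hneg :: "hfm \<Rightarrow> hfm"  ("\<^bold>\<not> _" [40] 40) where
  "(\<^bold>\<not> P) = (P \<^bold>\<longrightarrow> \<^bold>\<bottom>)"
definition hconj :: "hfm \<Rightarrow> hfm \<Rightarrow> hfm"  (infixr "\<^bold>\<and>" 35) where
  "(P \<^bold>\<and> Q) = (\<^bold>\<not> (P \<^bold>\<longrightarrow> \<^bold>\<not> Q))"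
definition hdisj :: "hfm \<Rightarrow> hfm \<Rightarrow> hfm"  (infixr "\<^bold>\<or>" 30) where
  "(P \<^bold>\<or> Q) = (\<^bold>\<not> P \<^bold>\<longrightarrow> Q)"
definition hiff :: "hfm \<Rightarrow> hfm \<Rightarrow> hfm"  (infixr "\<^bold>\<longleftrightarrow>" 25) where
  "(P \<^bold>\<longleftrightarrow> Q) = ((P \<^bold>\<longrightarrow> Q) \<^bold>\<and> (Q \<^bold>\<longrightarrow> P))"
definition hall :: "ty \<Rightarrow> (htm \<Rightarrow> hfm) \<Rightarrow> hfm" where
  "hall \<tau> F = (\<lambda>d. All \<tau> (F (hvar \<tau> d) (Suc d)))"
definition hex :: "ty \<Rightarrow> (htm \<Rightarrow> hfm) \<Rightarrow> hfm" where
  "hex \<tau> F = (\<^bold>\<not> hall \<tau> (\<lambda>x. \<^bold>\<not> F x))"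

abbreviation hall0 (binder "\<^bold>\<forall>\<^sub>0" 10) where "hall0 \<equiv> hall Ty0"
abbreviation hall1 (binder "\<^bold>\<forall>\<^sub>1" 10) where "hall1 \<equiv> hall Ty1"
abbreviation hex0 (binder "\<^bold>\<exists>\<^sub>0" 10) where "hex0 \<equiv> hex Ty0"
abbreviation hex1 (binder "\<^bold>\<exists>\<^sub>1" 10) where "hex1 \<equiv> hex Ty1"

text \<open>Equality at all finite types: \<open>x =\<^sub>\<tau> y\<close> is \<open>\<forall>z\<^sub>1 \<dots> z\<^sub>k. x z\<^sub>1 \<dots> z\<^sub>k = y z\<^sub>1 \<dots> z\<^sub>k\<close>.\<close>

fun heqT :: "ty \<Rightarrow> htm \<Rightarrow> htm \<Rightarrow> hfm" where
  "heqT Ty0 s t = (s \<^bold>= t)"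
| "heqT (\<sigma> \<rightarrow> \<tau>) s t = hall \<sigma> (\<lambda>z. heqT \<tau> (s \<cdot> z) (t \<cdot> z))"

text \<open>\<open>\<lambda>\<close>-abstraction is the usual defined notion: \<open>bracket \<tau> t\<close> abstracts index 0, of type \<open>\<tau>\<close>, in \<open>t\<close>.\<close>

fun occurs0 :: "tm \<Rightarrow> bool" where
  "occurs0 (Var n \<tau>) \<longleftrightarrow> n = 0"
| "occurs0 (Cst c) \<longleftrightarrow> False"
| "occurs0 (App s t) \<longleftrightarrow> occurs0 s \<or> occurs0 t"

fun bracket :: "ty \<Rightarrow> tm \<Rightarrow> tm" where
  "bracket \<tau> (Var n \<rho>) = (case n of
      0 \<Rightarrow> App (App (Cst (CombS \<tau> (\<tau> \<rightarrow> \<tau>) \<tau>)) (Cst (CombK \<tau> (\<tau> \<rightarrow> \<tau>)))) (Cst (CombK \<tau> \<tau>))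
    | Suc m \<Rightarrow> App (Cst (CombK \<rho> \<tau>)) (Var m \<rho>))"
| "bracket \<tau> (Cst c) = App (Cst (CombK (cty c) \<tau>)) (Cst c)"
| "bracket \<tau> (App s t) =
     (if occurs0 (App s t)
      then App (App (Cst (CombS \<tau> (ty_of t) (ty_of (App s t)))) (bracket \<tau> s)) (bracket \<tau> t)
      else App (Cst (CombK (ty_of (App s t)) \<tau>)) (tsub (\<lambda>n \<rho>. Var (n - 1) \<rho>) (App s t)))"

definition hlam0 :: "(htm \<Rightarrow> htm) \<Rightarrow> htm"  (binder "\<^bold>\<lambda>\<^sub>0" 10) where
  "hlam0 F = (\<lambda>d. bracket Ty0 (F (hvar Ty0 d) (Suc d)))"

text \<open>Schemas: a formula \<open>A\<close> in context \<open>[\<tau>\<^sub>1, \<dots>, \<tau>\<^sub>k] @ \<Gamma>\<close> has argument variables \<open>0, \<dots>, k - 1\<close> and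
  parameters typed by \<open>\<Gamma>\<close>. \<open>A\<langle>ts\<rangle>\<close> plugs the terms \<open>ts\<close> into the argument variables; the parameters
  are bound outside of everything else, by \<open>closure \<Gamma>\<close>.\<close>

definition plug :: "fm \<Rightarrow> htm list \<Rightarrow> hfm"  ("_\<langle>_\<rangle>" [1000, 0] 1000) where
  "A\<langle>ts\<rangle> = (\<lambda>d. fsub (\<lambda>n \<tau>. if n < length ts then (ts ! n) d else Var (n - length ts + d) \<tau>) A)"

fun closure :: "ty list \<Rightarrow> fm \<Rightarrow> fm" where
  "closure [] A = A"
| "closure (\<tau> # \<Gamma>) A = closure \<Gamma> (All \<tau> A)"

fun quantifier_free :: "fm \<Rightarrow> bool" where
  "quantifier_free (Imp A B) \<longleftrightarrow> quantifier_free A \<and> quantifier_free B"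
| "quantifier_free (All \<tau> A) \<longleftrightarrow> False"
| "quantifier_free _ \<longleftrightarrow> True"

fun number_quantifiers_only :: "fm \<Rightarrow> bool" where
  "number_quantifiers_only (Imp A B) \<longleftrightarrow> number_quantifiers_only A \<and> number_quantifiers_only B"
| "number_quantifiers_only (All \<tau> A) \<longleftrightarrow> \<tau> = Ty0 \<and> number_quantifiers_only A"
| "number_quantifiers_only _ \<longleftrightarrow> True"


section \<open>The base theory\<close>

text \<open>The basic axioms are those of second-order arithmetic; with quantifier-free induction they
  amount to \<open>0, 1, +, \<times>, <\<close> forming a discretely ordered semiring.\<close>

definition basic_axioms :: "hfm set" where
  "basic_axioms =
    {\<^bold>\<forall>\<^sub>0 m. \<^bold>\<not> (m \<^bold>+ \<^bold>1 \<^bold>= \<^bold>0),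
     \<^bold>\<forall>\<^sub>0 m. \<^bold>\<forall>\<^sub>0 n. m \<^bold>+ \<^bold>1 \<^bold>= n \<^bold>+ \<^bold>1 \<^bold>\<longrightarrow> m \<^bold>= n,
     \<^bold>\<forall>\<^sub>0 m. m \<^bold>+ \<^bold>0 \<^bold>= m,
     \<^bold>\<forall>\<^sub>0 m. \<^bold>\<forall>\<^sub>0 n. m \<^bold>+ (n \<^bold>+ \<^bold>1) \<^bold>= (m \<^bold>+ n) \<^bold>+ \<^bold>1,
     \<^bold>\<forall>\<^sub>0 m. m \<^bold>* \<^bold>0 \<^bold>= \<^bold>0,
     \<^bold>\<forall>\<^sub>0 m. \<^bold>\<forall>\<^sub>0 n. m \<^bold>* (n \<^bold>+ \<^bold>1) \<^bold>= m \<^bold>* n \<^bold>+ m,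
     \<^bold>\<forall>\<^sub>0 m. \<^bold>\<not> (m \<^bold>< \<^bold>0),
     \<^bold>\<forall>\<^sub>0 m. \<^bold>\<forall>\<^sub>0 n. m \<^bold>< n \<^bold>+ \<^bold>1 \<^bold>\<longleftrightarrow> (m \<^bold>< n \<^bold>\<or> m \<^bold>= n)}"

definition combinator_axioms :: "hfm set" where
  "combinator_axioms =
    {hall \<sigma> (\<lambda>x. hall \<tau> (\<lambda>y. heqT \<sigma> (hcst (CombK \<sigma> \<tau>) \<cdot> x \<cdot> y) x)) | \<sigma> \<tau>. True} \<union>
    {hall (\<rho> \<rightarrow> \<sigma> \<rightarrow> \<tau>) (\<lambda>x. hall (\<rho> \<rightarrow> \<sigma>) (\<lambda>y. hall \<rho> (\<lambda>z.
       heqT \<tau> (hcst (CombS \<rho> \<sigma> \<tau>) \<cdot> x \<cdot> y \<cdot> z) (x \<cdot> z \<cdot> (y \<cdot> z))))) | \<rho> \<sigma> \<tau>. True}"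

definition recursor_axioms :: "hfm set" where
  "recursor_axioms =
    {hall (Ty0 \<rightarrow> Ty0 \<rightarrow> Ty0) (\<lambda>f. \<^bold>\<forall>\<^sub>0 m. hcst Rec0 \<cdot> f \<cdot> m \<cdot> \<^bold>0 \<^bold>= m),
     hall (Ty0 \<rightarrow> Ty0 \<rightarrow> Ty0) (\<lambda>f. \<^bold>\<forall>\<^sub>0 m. \<^bold>\<forall>\<^sub>0 n.
       hcst Rec0 \<cdot> f \<cdot> m \<cdot> (n \<^bold>+ \<^bold>1) \<^bold>= f \<cdot> n \<cdot> (hcst Rec0 \<cdot> f \<cdot> m \<cdot> n))}"

definition extensionality_axioms :: "hfm set" where
  "extensionality_axioms =
    {hall \<rho> (\<lambda>x. hall \<rho> (\<lambda>y. hall (\<rho> \<rightarrow> \<tau>) (\<lambda>\<phi>.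
       heqT \<rho> x y \<^bold>\<longrightarrow> heqT \<tau> (\<phi> \<cdot> x) (\<phi> \<cdot> y)))) | \<rho> \<tau>. True}"

definition induction :: "fm \<Rightarrow> hfm" where
  "induction A = (A\<langle>[\<^bold>0]\<rangle> \<^bold>\<and> (\<^bold>\<forall>\<^sub>0 n. A\<langle>[n]\<rangle> \<^bold>\<longrightarrow> A\<langle>[n \<^bold>+ \<^bold>1]\<rangle>) \<^bold>\<longrightarrow> (\<^bold>\<forall>\<^sub>0 n. A\<langle>[n]\<rangle>))"

definition QF_IND :: "fm set" where
  "QF_IND = {closure \<Gamma> (induction A 0) | \<Gamma> A. wff (Ty0 # \<Gamma>) A \<and> quantifier_free A}"

definition QF_AC_1_0 :: "fm set" where
  "QF_AC_1_0 =
    {closure \<Gamma> (((\<^bold>\<forall>\<^sub>1 x. \<^bold>\<exists>\<^sub>0 y. A\<langle>[x, y]\<rangle>) \<^bold>\<longrightarrow> hex (Ty1 \<rightarrow> Ty0) (\<lambda>Y. \<^bold>\<forall>\<^sub>1 x. A\<langle>[x, Y \<cdot> x]\<rangle>)) 0)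
      | \<Gamma> A. wff (Ty1 # Ty0 # \<Gamma>) A \<and> quantifier_free A}"

definition RCA0_omega :: "fm set" where
  "RCA0_omega =
    (\<lambda>P. P 0) ` (basic_axioms \<union> combinator_axioms \<union> recursor_axioms \<union> extensionality_axioms)
    \<union> QF_IND \<union> QF_AC_1_0"

definition IND_omega :: "fm set" where
  "IND_omega = {closure \<Gamma> (induction A 0) | \<Gamma> A. wff (Ty0 # \<Gamma>) A}"


section \<open>Coding of pairs, rationals, reals and finite sequences\<close>

text \<open>Operations on codes are closed terms applied to their arguments, which keeps terms small.\<close>

definition hfun1 :: "(htm \<Rightarrow> htm) \<Rightarrow> htm \<Rightarrow> htm" where
  "hfun1 F t = (\<^bold>\<lambda>\<^sub>0 x. F x) \<cdot> t"
definition hfun2 :: "(htm \<Rightarrow> htm \<Rightarrow> htm) \<Rightarrow> htm \<Rightarrow> htm \<Rightarrow> htm" where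
  "hfun2 F s t = (\<^bold>\<lambda>\<^sub>0 x. \<^bold>\<lambda>\<^sub>0 y. F x y) \<cdot> s \<cdot> t"

text \<open>\<open>hrec F s t\<close> is the \<open>t\<close>-th value of \<open>m\<^sub>0 = s\<close>, \<open>m\<^sub>k\<^sub>+\<^sub>1 = F k m\<^sub>k\<close>.\<close>

definition hrec :: "(htm \<Rightarrow> htm \<Rightarrow> htm) \<Rightarrow> htm \<Rightarrow> htm \<Rightarrow> htm" where
  "hrec F s t = hcst Rec0 \<cdot> (\<^bold>\<lambda>\<^sub>0 k. \<^bold>\<lambda>\<^sub>0 m. F k m) \<cdot> s \<cdot> t"

definition hpred :: "htm \<Rightarrow> htm" where
  "hpred t = hrec (\<lambda>k m. k) \<^bold>0 t"
definition hmonus :: "htm \<Rightarrow> htm \<Rightarrow> htm" where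
  "hmonus s t = hrec (\<lambda>k m. hpred m) s t"

text \<open>\<open>if c = 0 then s else t\<close>\<close>
definition hifz :: "htm \<Rightarrow> htm \<Rightarrow> htm \<Rightarrow> htm" where
  "hifz c s t = hrec (\<lambda>k m. t) s c"
definition hpow2 :: "htm \<Rightarrow> htm" where
  "hpow2 t = hrec (\<lambda>k m. m \<^bold>+ m) \<^bold>1 t"

text \<open>Cantor's bijective pairing \<open>(a, b) \<mapsto> (a + b)(a + b + 1)/2 + a\<close> and its projections;
  \<open>hroot z\<close> is the largest \<open>w\<close> with \<open>w(w + 1)/2 \<le> z\<close>.\<close>

definition htri :: "htm \<Rightarrow> htm" where
  "htri t = hrec (\<lambda>k m. m \<^bold>+ (k \<^bold>+ \<^bold>1)) \<^bold>0 t"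
definition hpair :: "htm \<Rightarrow> htm \<Rightarrow> htm" where
  "hpair = hfun2 (\<lambda>a b. htri (a \<^bold>+ b) \<^bold>+ a)"
definition hroot :: "htm \<Rightarrow> htm" where
  "hroot z = hrec (\<lambda>k m. hifz (hmonus (htri (m \<^bold>+ \<^bold>1)) (k \<^bold>+ \<^bold>1)) (m \<^bold>+ \<^bold>1) m) \<^bold>0 z"
definition hfst :: "htm \<Rightarrow> htm" where
  "hfst = hfun1 (\<lambda>z. hmonus z (htri (hroot z)))"
definition hsnd :: "htm \<Rightarrow> htm" where
  "hsnd = hfun1 (\<lambda>z. hmonus (hroot z) (hfst z))"

text \<open>Every number codes a rational: \<open>rat a b c\<close> codes \<open>(a - b)/(c + 1)\<close>.\<close>

definition rat :: "htm \<Rightarrow> htm \<Rightarrow> htm \<Rightarrow> htm" where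
  "rat a b c = hpair (hpair a b) c"
definition qpos :: "htm \<Rightarrow> htm" where "qpos q = hfst (hfst q)"
definition qneg :: "htm \<Rightarrow> htm" where "qneg q = hsnd (hfst q)"
definition qden :: "htm \<Rightarrow> htm" where "qden q = hsnd q \<^bold>+ \<^bold>1"

definition q0 :: htm where "q0 = rat \<^bold>0 \<^bold>0 \<^bold>0"
definition q1 :: htm where "q1 = rat \<^bold>1 \<^bold>0 \<^bold>0"
definition qadd :: "htm \<Rightarrow> htm \<Rightarrow> htm" where
  "qadd = hfun2 (\<lambda>q r.
     rat (qpos q \<^bold>* qden r \<^bold>+ qpos r \<^bold>* qden q) (qneg q \<^bold>* qden r \<^bold>+ qneg r \<^bold>* qden q)
         (hpred (qden q \<^bold>* qden r)))"
definition qminus :: "htm \<Rightarrow> htm" where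
  "qminus = hfun1 (\<lambda>q. rat (qneg q) (qpos q) (hsnd q))"
definition qsub :: "htm \<Rightarrow> htm \<Rightarrow> htm" where
  "qsub q r = qadd q (qminus r)"
definition qabs :: "htm \<Rightarrow> htm" where
  "qabs = hfun1 (\<lambda>q. hifz (hmonus (qneg q) (qpos q)) q (qminus q))"
definition qless :: "htm \<Rightarrow> htm \<Rightarrow> hfm"  (infix "\<^bold><\<^sub>Q" 50) where
  "(q \<^bold><\<^sub>Q r) = (qpos q \<^bold>* qden r \<^bold>+ qneg r \<^bold>* qden q \<^bold>< qpos r \<^bold>* qden q \<^bold>+ qneg q \<^bold>* qden r)"
definition qle :: "htm \<Rightarrow> htm \<Rightarrow> hfm"  (infix "\<^bold>\<le>\<^sub>Q" 50) where
  "(q \<^bold>\<le>\<^sub>Q r) = (\<^bold>\<not> (r \<^bold><\<^sub>Q q))"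

text \<open>The rational \<open>m / 2\<^sup>n\<close>.\<close>
definition qdyadic :: "htm \<Rightarrow> htm \<Rightarrow> htm" where
  "qdyadic m n = rat m \<^bold>0 (hpred (hpow2 n))"

text \<open>A real is a type 1 object \<open>x\<close>, read as a sequence of rationals with
  \<open>|x\<^sub>n - x\<^sub>n\<^sub>+\<^sub>i| < 2\<^sup>-\<^sup>n\<close>. Hence \<open>x = y\<close> iff \<open>|x\<^sub>n - y\<^sub>n| \<le> 2\<^sup>-\<^sup>n\<^sup>+\<^sup>1\<close> for all \<open>n\<close>, and \<open>x < y\<close> iff
  \<open>x\<^sub>n + 2\<^sup>-\<^sup>n\<^sup>+\<^sup>1 < y\<^sub>n\<close> for some \<open>n\<close>. Sums and differences shift the index by one to stay
  fast-converging.\<close>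

definition is_real :: "htm \<Rightarrow> hfm" where
  "is_real x = (\<^bold>\<forall>\<^sub>0 n. \<^bold>\<forall>\<^sub>0 i. qabs (qsub (x \<cdot> n) (x \<cdot> (n \<^bold>+ i))) \<^bold><\<^sub>Q qdyadic \<^bold>1 n)"
definition req :: "htm \<Rightarrow> htm \<Rightarrow> hfm"  (infix "\<^bold>=\<^sub>R" 50) where
  "(x \<^bold>=\<^sub>R y) = (\<^bold>\<forall>\<^sub>0 n. qabs (qsub (x \<cdot> n) (y \<cdot> n)) \<^bold>\<le>\<^sub>Q qdyadic (\<^bold>1 \<^bold>+ \<^bold>1) n)"
definition rless :: "htm \<Rightarrow> htm \<Rightarrow> hfm"  (infix "\<^bold><\<^sub>R" 50) where
  "(x \<^bold><\<^sub>R y) = (\<^bold>\<exists>\<^sub>0 n. qadd (x \<cdot> n) (qdyadic (\<^bold>1 \<^bold>+ \<^bold>1) n) \<^bold><\<^sub>Q y \<cdot> n)"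
definition rle :: "htm \<Rightarrow> htm \<Rightarrow> hfm"  (infix "\<^bold>\<le>\<^sub>R" 50) where
  "(x \<^bold>\<le>\<^sub>R y) = (\<^bold>\<not> (y \<^bold><\<^sub>R x))"
definition rconst :: "htm \<Rightarrow> htm" where
  "rconst q = (\<^bold>\<lambda>\<^sub>0 n. q)"
definition radd :: "htm \<Rightarrow> htm \<Rightarrow> htm" where
  "radd x y = (\<^bold>\<lambda>\<^sub>0 n. qadd (x \<cdot> (n \<^bold>+ \<^bold>1)) (y \<cdot> (n \<^bold>+ \<^bold>1)))"
definition rsub :: "htm \<Rightarrow> htm \<Rightarrow> htm" where
  "rsub x y = (\<^bold>\<lambda>\<^sub>0 n. qsub (x \<cdot> (n \<^bold>+ \<^bold>1)) (y \<cdot> (n \<^bold>+ \<^bold>1)))"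
definition rabs :: "htm \<Rightarrow> htm" where
  "rabs x = (\<^bold>\<lambda>\<^sub>0 n. qabs (x \<cdot> n))"

definition hallR :: "(htm \<Rightarrow> hfm) \<Rightarrow> hfm"  (binder "\<^bold>\<forall>\<^sub>R" 10) where
  "hallR F = (\<^bold>\<forall>\<^sub>1 x. is_real x \<^bold>\<longrightarrow> F x)"

text \<open>\<open>F : \<real> \<rightarrow> \<real>\<close> is given by a type \<open>1 \<rightarrow> 1\<close> object that maps equal reals to equal reals.\<close>

definition real_function :: "htm \<Rightarrow> hfm" where
  "real_function F =
    ((\<^bold>\<forall>\<^sub>R x. is_real (F \<cdot> x)) \<^bold>\<and> (\<^bold>\<forall>\<^sub>R x. \<^bold>\<forall>\<^sub>R y. x \<^bold>=\<^sub>R y \<^bold>\<longrightarrow> F \<cdot> x \<^bold>=\<^sub>R F \<cdot> y))"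

text \<open>\<open>seqbar f n\<close> is \<open>\<langle>f 0, \<dots>, f (n - 1)\<rangle>\<close>: the empty sequence is \<open>0\<close>, and appending \<open>x\<close> to \<open>s\<close>
  gives \<open>(s, x) + 1\<close>, so that every number codes exactly one finite sequence.\<close>

definition seqbar :: "htm \<Rightarrow> htm \<Rightarrow> htm" where
  "seqbar f n = hrec (\<lambda>k s. hpair s (f \<cdot> k) \<^bold>+ \<^bold>1) \<^bold>0 n"


section \<open>The principles\<close>

text \<open>A set \<open>X \<subseteq> \<nat>\<close> is given by its binary characteristic function.\<close>

definition hex_set :: "(htm \<Rightarrow> hfm) \<Rightarrow> hfm"  (binder "\<^bold>\<exists>\<^sub>S" 10) where
  "hex_set F = (\<^bold>\<exists>\<^sub>1 X. (\<^bold>\<forall>\<^sub>0 n. X \<cdot> n \<^bold>= \<^bold>0 \<^bold>\<or> X \<cdot> n \<^bold>= \<^bold>1) \<^bold>\<and> F X)"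
definition mem :: "htm \<Rightarrow> htm \<Rightarrow> hfm"  (infix "\<^bold>\<in>" 50) where
  "(n \<^bold>\<in> X) = (X \<cdot> n \<^bold>= \<^bold>1)"

definition BOOT :: hfm where
  "BOOT = hall (Ty1 \<rightarrow> Ty0 \<rightarrow> Ty0) (\<lambda>Y.
     \<^bold>\<exists>\<^sub>S X. \<^bold>\<forall>\<^sub>0 n. n \<^bold>\<in> X \<^bold>\<longleftrightarrow> (\<^bold>\<exists>\<^sub>1 f. Y \<cdot> f \<cdot> n \<^bold>= \<^bold>0))"

definition BOOT_minus :: hfm where
  "BOOT_minus = hall (Ty1 \<rightarrow> Ty0 \<rightarrow> Ty0) (\<lambda>Y.
     (\<^bold>\<forall>\<^sub>0 n. \<^bold>\<forall>\<^sub>1 f. \<^bold>\<forall>\<^sub>1 g. Y \<cdot> f \<cdot> n \<^bold>= \<^bold>0 \<^bold>\<and> Y \<cdot> g \<cdot> n \<^bold>= \<^bold>0 \<^bold>\<longrightarrow> heqT Ty1 f g) \<^bold>\<longrightarrow>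
     (\<^bold>\<exists>\<^sub>S X. \<^bold>\<forall>\<^sub>0 n. n \<^bold>\<in> X \<^bold>\<longleftrightarrow> (\<^bold>\<exists>\<^sub>1 f. Y \<cdot> f \<cdot> n \<^bold>= \<^bold>0)))"

text \<open>Arithmetical formulas may have number and set (i.e. type 0 and type 1) parameters.\<close>

definition ACA :: "fm set" where
  "ACA = {closure \<Gamma> ((\<^bold>\<exists>\<^sub>S X. \<^bold>\<forall>\<^sub>0 n. n \<^bold>\<in> X \<^bold>\<longleftrightarrow> A\<langle>[n]\<rangle>) 0)
           | \<Gamma> A. set \<Gamma> \<subseteq> {Ty0, Ty1} \<and> wff (Ty0 # \<Gamma>) A \<and> number_quantifiers_only A}"

definition in_real_set :: "htm \<Rightarrow> htm \<Rightarrow> hfm"  (infix "\<^bold>\<in>\<^sub>R" 50) where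
  "(x \<^bold>\<in>\<^sub>R Y) = (rconst q0 \<^bold><\<^sub>R Y \<cdot> x)"

definition in_ball :: "htm \<Rightarrow> htm \<Rightarrow> htm \<Rightarrow> hfm" where
  "in_ball x r y = (rabs (rsub x y) \<^bold><\<^sub>R rconst r)"

definition open_pred :: "(htm \<Rightarrow> hfm) \<Rightarrow> hfm" where
  "open_pred P =
    (\<^bold>\<forall>\<^sub>R x. P x \<^bold>\<longrightarrow> (\<^bold>\<exists>\<^sub>0 r. q0 \<^bold><\<^sub>Q r \<^bold>\<and> (\<^bold>\<forall>\<^sub>R y. in_ball x r y \<^bold>\<longrightarrow> P y)))"

definition open_set :: "htm \<Rightarrow> hfm" where
  "open_set Y = (real_function Y \<^bold>\<and> open_pred (\<lambda>x. x \<^bold>\<in>\<^sub>R Y))"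
definition closed_set :: "htm \<Rightarrow> hfm" where
  "closed_set Y = (real_function Y \<^bold>\<and> open_pred (\<lambda>x. \<^bold>\<not> (x \<^bold>\<in>\<^sub>R Y)))"

text \<open>The enumeration of all pairs of rationals \<open>(q\<^sub>n, r\<^sub>n)\<close> with \<open>r\<^sub>n > 0\<close>: if \<open>n\<close> codes \<open>(q, (a, c))\<close>
  then \<open>q\<^sub>n\<close> is the rational coded by \<open>q\<close>, and \<open>r\<^sub>n = (a + 1)/(c + 1)\<close>.\<close>

definition center :: "htm \<Rightarrow> htm" where
  "center n = hfst n"
definition radius :: "htm \<Rightarrow> htm" where
  "radius n = rat (hfst (hsnd n) \<^bold>+ \<^bold>1) \<^bold>0 (hsnd (hsnd n))"

definition OPEN :: hfm where
  "OPEN = hall (Ty1 \<rightarrow> Ty1) (\<lambda>Y. open_set Y \<^bold>\<longrightarrow>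
     (\<^bold>\<exists>\<^sub>S X. \<^bold>\<forall>\<^sub>0 n. n \<^bold>\<in> X \<^bold>\<longleftrightarrow> (\<^bold>\<forall>\<^sub>R y. in_ball (rconst (center n)) (radius n) y \<^bold>\<longrightarrow> y \<^bold>\<in>\<^sub>R Y)))"

definition K0 :: "htm \<Rightarrow> hfm" where
  "K0 \<gamma> = ((\<^bold>\<forall>\<^sub>1 f. \<^bold>\<exists>\<^sub>0 n. \<^bold>0 \<^bold>< \<gamma> \<cdot> seqbar f n) \<^bold>\<and>
     (\<^bold>\<forall>\<^sub>0 n. \<^bold>\<forall>\<^sub>0 m. \<^bold>\<forall>\<^sub>1 f. n \<^bold>< m \<^bold>\<and> \<^bold>0 \<^bold>< \<gamma> \<cdot> seqbar f n \<^bold>\<longrightarrow>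
        \<gamma> \<cdot> seqbar f n \<^bold>= \<gamma> \<cdot> seqbar f m))"

text \<open>\<open>\<gamma>(f) = v\<close>, for \<open>\<gamma> \<in> K\<^sub>0\<close>: the number \<open>v\<close> is \<open>\<gamma>(seqbar f n) - 1\<close> for \<open>n\<close> large enough.\<close>

definition assoc_value :: "htm \<Rightarrow> htm \<Rightarrow> htm \<Rightarrow> hfm" where
  "assoc_value \<gamma> f v = (\<^bold>\<exists>\<^sub>0 k. \<^bold>\<forall>\<^sub>0 n. k \<^bold>< n \<^bold>\<longrightarrow> \<gamma> \<cdot> seqbar f n \<^bold>= v \<^bold>+ \<^bold>1)"

definition NFP :: "fm set" where
  "NFP = {closure \<Gamma> (((\<^bold>\<forall>\<^sub>1 f. \<^bold>\<exists>\<^sub>0 n. A\<langle>[seqbar f n]\<rangle>) \<^bold>\<longrightarrow>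
             (\<^bold>\<exists>\<^sub>1 \<gamma>. K0 \<gamma> \<^bold>\<and> (\<^bold>\<forall>\<^sub>1 f. \<^bold>\<exists>\<^sub>0 v. assoc_value \<gamma> f v \<^bold>\<and> A\<langle>[seqbar f v]\<rangle>))) 0)
           | \<Gamma> A. wff (Ty0 # \<Gamma>) A}"

text \<open>The finite sequence \<open>y\<^sub>1, \<dots>, y\<^sub>k\<close> consists of the first \<open>k\<close> values of a type \<open>0 \<rightarrow> 1\<close> object.\<close>

definition HBU_closed :: hfm where
  "HBU_closed = hall (Ty1 \<rightarrow> Ty1) (\<lambda>C. hall (Ty1 \<rightarrow> Ty1) (\<lambda>\<Psi>.
     closed_set C \<^bold>\<and> (\<^bold>\<forall>\<^sub>R x. x \<^bold>\<in>\<^sub>R C \<^bold>\<longrightarrow> rconst q0 \<^bold>\<le>\<^sub>R x \<^bold>\<and> x \<^bold>\<le>\<^sub>R rconst q1) \<^bold>\<and>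
     real_function \<Psi> \<^bold>\<and> (\<^bold>\<forall>\<^sub>R x. rconst q0 \<^bold><\<^sub>R \<Psi> \<cdot> x) \<^bold>\<longrightarrow>
     (\<^bold>\<exists>\<^sub>0 k. hex (Ty0 \<rightarrow> Ty1) (\<lambda>y.
        (\<^bold>\<forall>\<^sub>0 i. i \<^bold>< k \<^bold>\<longrightarrow> is_real (y \<cdot> i) \<^bold>\<and> y \<cdot> i \<^bold>\<in>\<^sub>R C) \<^bold>\<and>
        (\<^bold>\<forall>\<^sub>R x. x \<^bold>\<in>\<^sub>R C \<^bold>\<longrightarrow> (\<^bold>\<exists>\<^sub>0 i. i \<^bold>< k \<^bold>\<and>
           rsub (y \<cdot> i) (\<Psi> \<cdot> (y \<cdot> i)) \<^bold><\<^sub>R x \<^bold>\<and> x \<^bold><\<^sub>R radd (y \<cdot> i) (\<Psi> \<cdot> (y \<cdot> i))))))))"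

end

theory Submission
  imports Defs "HOL-Library.Countable" "HOL-Computational_Algebra.Fraction_Field"
begin

text \<open>By a Henkin construction it suffices to consider extensional models of the base theory, whose
  numbers form a possibly nonstandard discretely ordered semiring. By Grilliot's trick, either \<open>\<exists>\<^sup>2\<close>
  exists in such a model or all its type 2 functionals are continuous; in the latter case quantifiers over
  functions can often be replaced by quantifiers over finite sequences.

  Bootstrap gives the Turing jump and hence arithmetical comprehension. Under \<open>\<exists>\<^sup>2\<close>, a point of
  \<open>B(q, r) \ Y\<close> is asked for by a single instance of bootstrap; in the continuous case the fan theorem
  makes the inclusion of dyadic intervals in \<open>Y\<close> arithmetical. Conversely, under \<open>\<exists>\<^sup>2\<close> the unique \<open>f\<close>
  with \<open>Y(f, n) = 0\<close> is coded by a real in \<open>[3n, 3n + 1]\<close>; the complement of the discrete set of all these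
  codes is open, and it contains \<open>B(3n, 2)\<close> iff there is no such \<open>f\<close>.

  The neighbourhood function principle yields bootstrap when applied to a formula that holds of \<open>\<langle>n\<rangle>\<close> if
  \<open>\<exists>f. Y(f, n) = 0\<close> and of sequences of length two starting with \<open>n\<close> otherwise. For the Heine-Borel
  principle, the dyadic intervals that miss \<open>C\<close> or lie in some \<open>(y - \<Psi>(y), y + \<Psi>(y))\<close> with \<open>y \<in> C\<close> form
  a bar that exists by bootstrap. Some level consists of such intervals by the fan theorem, and
  induction chooses the finitely many points \<open>y\<close>.\<close>

section \<open>Substitution\<close>

text \<open>Explicit derivations in the calculus would involve de Bruijn terms of enormous size,
  which is why the argument is semantic. The price is that the numbers of a model may be
  nonstandard: ordinary induction over the naturals does not reach them, and each induction has to
  concern a predicate that the model can decide or, once the Turing jump exists, an arithmetical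
  one. Most auxiliary facts are therefore closure properties saying that some functional or
  predicate is present in the model.

  Uniqueness in the restricted bootstrap makes the set of codes discrete: each interval [3n, 3n + 1]
  contains at most one code, and the gaps of length 2 keep the open ball of radius 2 around 3n away
  from all other intervals. Full induction enters the Heine-Borel principle because the finitely
  many chosen points are type 1 objects, whereas quantifier-free choice supplies numbers
  only.\<close>

lemma tsub_tsub: "tsub \<theta> (tsub \<eta> t) = tsub (\<lambda>n \<tau>. tsub \<theta> (\<eta> n \<tau>)) t"
  by (induction t) auto

lemma tsub_Var [simp]: "tsub Var t = t"
  by (induction t) auto

lemma push_Var [simp]: "push Var = Var"
  by (rule ext, rule ext) (simp add: push_def shift_def split: nat.split)

lemma fsub_Var [simp]: "fsub Var A = A"
  by (induction A) auto

lemma push_comp: "(\<lambda>n \<tau>. tsub (push \<theta>) (push \<eta> n \<tau>)) = push (\<lambda>n \<tau>. tsub \<theta> (\<eta> n \<tau>))"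
  by (rule ext, rule ext) (auto simp: push_def shift_def tsub_tsub split: nat.split)

lemma fsub_fsub: "fsub \<theta> (fsub \<eta> A) = fsub (\<lambda>n \<tau>. tsub \<theta> (\<eta> n \<tau>)) A"
  by (induction A arbitrary: \<theta> \<eta>) (auto simp: tsub_tsub push_comp)

lemma tsub_cong:
  "wt \<Gamma> t \<Longrightarrow> (\<And>n. n < length \<Gamma> \<Longrightarrow> \<theta> n (\<Gamma> ! n) = \<eta> n (\<Gamma> ! n)) \<Longrightarrow> tsub \<theta> t = tsub \<eta> t"
  by (induction t) auto

lemma fsub_cong:
  "wff \<Gamma> A \<Longrightarrow> (\<And>n. n < length \<Gamma> \<Longrightarrow> \<theta> n (\<Gamma> ! n) = \<eta> n (\<Gamma> ! n)) \<Longrightarrow> fsub \<theta> A = fsub \<eta> A"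
proof (induction A arbitrary: \<Gamma> \<theta> \<eta>)
  case (All \<tau> A)
  have "fsub (push \<theta>) A = fsub (push \<eta>) A"
    by (rule All.IH[of "\<tau> # \<Gamma>"]) (use All.prems in \<open>auto simp: push_def nth_Cons split: nat.split\<close>)
  then show ?case by simp
next
  case (Eq s t)
  then show ?case using tsub_cong[of \<Gamma> _ \<theta> \<eta>] by auto
next
  case (Less s t)
  then show ?case using tsub_cong[of \<Gamma> _ \<theta> \<eta>] by auto
next
  case (Imp A B)
  from Imp.IH(1)[of \<Gamma> \<theta> \<eta>] Imp.IH(2)[of \<Gamma> \<theta> \<eta>] Imp.prems show ?case by auto
qed simp

lemma fsub_closed: "wff [] A \<Longrightarrow> fsub \<theta> A = A"
  using fsub_cong[of "[]" A \<theta> Var] by simp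

definition subst_typed :: "ty list \<Rightarrow> (nat \<Rightarrow> ty \<Rightarrow> tm) \<Rightarrow> ty list \<Rightarrow> bool" where
  "subst_typed \<Delta> \<theta> \<Gamma> \<longleftrightarrow>
     (\<forall>n < length \<Gamma>. wt \<Delta> (\<theta> n (\<Gamma> ! n)) \<and> ty_of (\<theta> n (\<Gamma> ! n)) = \<Gamma> ! n)"

lemma wt_tsub:
  assumes "subst_typed \<Delta> \<theta> \<Gamma>"
  shows "wt \<Gamma> t \<Longrightarrow> wt \<Delta> (tsub \<theta> t) \<and> ty_of (tsub \<theta> t) = ty_of t"
  using assms by (induction t) (auto simp: subst_typed_def split: ty.splits)

lemma subst_typed_shift: "subst_typed (\<tau> # \<Gamma>) shift \<Gamma>"
  by (simp add: subst_typed_def shift_def)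

lemma subst_typed_push:
  assumes "subst_typed \<Delta> \<theta> \<Gamma>" shows "subst_typed (\<tau> # \<Delta>) (push \<theta>) (\<tau> # \<Gamma>)"
  unfolding subst_typed_def
proof (intro allI impI)
  fix n assume n: "n < length (\<tau> # \<Gamma>)"
  show "wt (\<tau> # \<Delta>) (push \<theta> n ((\<tau> # \<Gamma>) ! n)) \<and> ty_of (push \<theta> n ((\<tau> # \<Gamma>) ! n)) = (\<tau> # \<Gamma>) ! n"
  proof (cases n)
    case 0
    then show ?thesis by (simp add: push_def)
  next
    case (Suc m)
    then show ?thesis
      using n assms wt_tsub[OF subst_typed_shift, of \<Delta> "\<theta> m (\<Gamma> ! m)" \<tau>]
      by (auto simp: push_def subst_typed_def)
  qed
qed

lemma wff_fsub: "wff \<Gamma> A \<Longrightarrow> subst_typed \<Delta> \<theta> \<Gamma> \<Longrightarrow> wff \<Delta> (fsub \<theta> A)"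
proof (induction A arbitrary: \<Gamma> \<Delta> \<theta>)
  case (All \<tau> A)
  then show ?case using subst_typed_push by (metis fsub.simps(5) wff.simps(5))
next
  case (Eq s t)
  then show ?case using wt_tsub by auto
next
  case (Less s t)
  then show ?case using wt_tsub by auto
qed auto

lemma wt_append: "wt \<Gamma> t \<Longrightarrow> wt (\<Gamma> @ \<Delta>) t"
  by (induction t) (auto simp: nth_append split: ty.splits)

lemma wff_append: "wff \<Gamma> A \<Longrightarrow> wff (\<Gamma> @ \<Delta>) A"
  by (induction A arbitrary: \<Gamma>) (auto simp: wt_append, metis append_Cons)

lemma fsub_inst: "fsub \<theta> (inst t A) = inst (tsub \<theta> t) (fsub (push \<theta>) A)"
  unfolding inst_def fsub_fsub
  by (rule arg_cong[where f="\<lambda>\<theta>. fsub \<theta> A"], rule ext, rule ext)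
     (auto simp: push_def tsub_tsub shift_def split: nat.split)

lemma fsub_push_shift: "fsub (push \<theta>) (fsub shift A) = fsub shift (fsub \<theta> A)"
  unfolding fsub_fsub
  by (rule arg_cong[where f="\<lambda>\<theta>. fsub \<theta> A"], rule ext, rule ext) (auto simp: push_def shift_def)

lemma wff_inst: "wff (\<tau> # \<Gamma>) A \<Longrightarrow> wt \<Gamma> t \<Longrightarrow> ty_of t = \<tau> \<Longrightarrow> wff \<Gamma> (inst t A)"
  unfolding inst_def
  by (erule wff_fsub) (auto simp: subst_typed_def nth_Cons split: nat.split)

section \<open>Structural properties of derivability\<close>

text \<open>Typed substitutions act on whole derivations. Weakening of the context and the renaming
  behind \<open>derives_generalise\<close> are both instances.\<close>

lemma derives_subst:
  "derives T \<Gamma> H A \<Longrightarrow> subst_typed \<Delta> \<theta> \<Gamma> \<Longrightarrow> derives T \<Delta> (map (fsub \<theta>) H) (fsub \<theta> A)"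
proof (induction arbitrary: \<Delta> \<theta> rule: derives.induct)
  case (Ax A \<Gamma> H)
  then show ?case using fsub_closed[OF \<open>wff [] A\<close>, of \<theta>] derives.Ax[of A T] by metis
next
  case (Hyp A H \<Gamma>)
  then show ?case using wff_fsub[of \<Gamma> A \<Delta> \<theta>] by (intro derives.Hyp) auto
next
  case (ImpI \<Gamma> A H B)
  then show ?case using wff_fsub[of \<Gamma> A \<Delta> \<theta>] ImpI.IH[of \<Delta> \<theta>] by (simp add: derives.ImpI)
next
  case (ImpE \<Gamma> H A B)
  show ?case
    using ImpE.IH(1)[OF ImpE.prems] ImpE.IH(2)[OF ImpE.prems] by (simp add: derives.ImpE[where A="fsub \<theta> A"])
next
  case (Raa \<Gamma> A H)
  show ?case
    by (rule derives.Raa) (use wff_fsub[OF Raa.hyps(1) Raa.prems] Raa.IH[OF Raa.prems] in auto)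
next
  case (AllI \<tau> \<Gamma> H A)
  have "derives T (\<tau> # \<Delta>) (map (fsub (push \<theta>)) (map (fsub shift) H)) (fsub (push \<theta>) A)"
    by (rule AllI.IH[OF subst_typed_push[OF AllI.prems]])
  then have "derives T (\<tau> # \<Delta>) (map (fsub shift) (map (fsub \<theta>) H)) (fsub (push \<theta>) A)"
    by (simp add: comp_def fsub_push_shift)
  then show ?case by (simp add: derives.AllI)
next
  case (AllE \<Gamma> H \<tau> A t)
  then show ?case
    using wt_tsub[of \<Delta> \<theta> \<Gamma> t] AllE.IH[of \<Delta> \<theta>] derives.AllE[of T \<Delta> "map (fsub \<theta>) H" \<tau> "fsub (push \<theta>) A" "tsub \<theta> t"]
    by (simp add: fsub_inst)
next
  case (EqI \<Gamma> t H)
  then show ?case using wt_tsub[of \<Delta> \<theta> \<Gamma> t] by (simp add: derives.EqI)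
next
  case (EqE \<Gamma> A H s t)
  then show ?case
    using derives.EqE[of \<Delta> "fsub (push \<theta>) A" T "map (fsub \<theta>) H" "tsub \<theta> s" "tsub \<theta> t"]
      wff_fsub[OF EqE.hyps(1) subst_typed_push, of \<Delta> \<theta>] EqE.IH[of \<Delta> \<theta>]
    by (simp add: fsub_inst)
qed

text \<open>Types appended at the far end of a context leave all indices unchanged, so the identity
  substitution does the work.\<close>

lemma derives_append: "derives T \<Gamma> H A \<Longrightarrow> derives T (\<Gamma> @ \<Delta>) H A"
  using derives_subst[of T \<Gamma> H A "\<Gamma> @ \<Delta>" Var]
  by (simp add: subst_typed_def nth_append list.map_ident_strong)

lemma derives_weaken: "derives T \<Gamma> H A \<Longrightarrow> set H \<subseteq> set H' \<Longrightarrow> derives T \<Gamma> H' A"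
proof (induction arbitrary: H' rule: derives.induct)
  case (ImpI \<Gamma> A H B)
  then show ?case by (auto intro!: derives.ImpI ImpI.IH)
next
  case (Raa \<Gamma> A H)
  then show ?case by (auto intro!: derives.Raa Raa.IH)
next
  case (AllI \<tau> \<Gamma> H A)
  then show ?case by (intro derives.AllI AllI.IH) auto
qed (blast intro: derives.intros)+

abbreviation Neg :: "fm \<Rightarrow> fm" where "Neg A \<equiv> Imp A Bot"

lemma derives_BotE: "derives T \<Gamma> H Bot \<Longrightarrow> wff \<Gamma> A \<Longrightarrow> derives T \<Gamma> H A"
  by (rule derives.Raa) (auto intro: derives_weaken)

text \<open>A variable at the end of the context that does not occur in the hypotheses can be moved to
  index 0 and generalised.\<close>

lemma derives_generalise:
  assumes d: "derives T (\<Gamma> @ [\<tau>]) H (inst (Var (length \<Gamma>) \<tau>) B)"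
    and H: "\<And>A. A \<in> set H \<Longrightarrow> wff \<Gamma> A" and B: "wff (\<tau> # \<Gamma>) B"
  shows "derives T \<Gamma> H (All \<tau> B)"
proof -
  define \<theta> where "\<theta> n (\<rho>::ty) = (if n < length \<Gamma> then Var (Suc n) \<rho> else Var 0 \<rho>)" for n \<rho>
  have "subst_typed (\<tau> # \<Gamma>) \<theta> (\<Gamma> @ [\<tau>])"
    by (auto simp: subst_typed_def \<theta>_def nth_append)
  from derives_subst[OF d this]
  have "derives T (\<tau> # \<Gamma>) (map (fsub \<theta>) H) (fsub \<theta> (inst (Var (length \<Gamma>) \<tau>) B))" .
  also have "map (fsub \<theta>) H = map (fsub shift) H"
    using fsub_cong[OF H, of _ \<theta> shift] by (auto simp: \<theta>_def shift_def)
  also have "fsub \<theta> (inst (Var (length \<Gamma>) \<tau>) B) = fsub Var B"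
    unfolding inst_def fsub_fsub
    by (rule fsub_cong[OF B]) (auto simp: \<theta>_def nth_Cons split: nat.split)
  finally show ?thesis by (auto intro: derives.AllI)
qed

section \<open>Completeness\<close>

instance ty :: countable by countable_datatype
instance cst :: countable by countable_datatype
instance tm :: countable by countable_datatype
instance fm :: countable by countable_datatype

text \<open>Witnesses are fresh variables instead of new constants, so a stage carries a context
  besides its hypotheses. They go to the end of the context, where they do not disturb earlier
  indices. A refuted universal formula receives its counterexample in the same step.\<close>

definition henkin_step :: "fm set \<Rightarrow> fm \<Rightarrow> ty list \<times> fm list \<Rightarrow> ty list \<times> fm list" where
  "henkin_step T A S = (let \<Gamma> = fst S; H = snd S in
     if \<not> wff \<Gamma> A then (\<Gamma>, H)
     else if \<not> derives T \<Gamma> (A # H) Bot then (\<Gamma>, A # H)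
     else case A of
         All \<tau> B \<Rightarrow> (\<Gamma> @ [\<tau>], Neg (inst (Var (length \<Gamma>) \<tau>) B) # Neg A # H)
       | _ \<Rightarrow> (\<Gamma>, Neg A # H))"

text \<open>The ignored second component of \<open>prod_decode\<close> makes every formula recur at
  arbitrarily late stages. This matters because a formula may become well-formed only after enough
  witnesses have been added.\<close>

fun henkin_stage :: "fm set \<Rightarrow> fm list \<Rightarrow> nat \<Rightarrow> ty list \<times> fm list" where
  "henkin_stage T H 0 = ([], H)"
| "henkin_stage T H (Suc k) = henkin_step T (from_nat (fst (prod_decode k))) (henkin_stage T H k)"

definition good_stage :: "fm set \<Rightarrow> ty list \<times> fm list \<Rightarrow> bool" where
  "good_stage T S \<longleftrightarrow> (\<forall>A \<in> set (snd S). wff (fst S) A) \<and> \<not> derives T (fst S) (snd S) Bot"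

lemma henkin_step_good:
  assumes "good_stage T S" shows "good_stage T (henkin_step T A S)"
proof -
  obtain \<Gamma> H where S: "S = (\<Gamma>, H)" by force
  have wf: "\<And>B. B \<in> set H \<Longrightarrow> wff \<Gamma> B" and con: "\<not> derives T \<Gamma> H Bot"
    using assms by (auto simp: S good_stage_def)
  show ?thesis
  proof (cases "wff \<Gamma> A \<and> derives T \<Gamma> (A # H) Bot")
    case False
    then show ?thesis using assms by (auto simp: henkin_step_def S good_stage_def)
  next
    case True
    then have neg: "derives T \<Gamma> H (Neg A)" by (auto intro: derives.ImpI)
    have c: "\<not> derives T \<Gamma> (Neg A # H) Bot"
    proof
      assume "derives T \<Gamma> (Neg A # H) Bot"
      then have "derives T \<Gamma> H A" using True derives.Raa by blast
      with neg con show False using derives.ImpE by blast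
    qed
    show ?thesis
    proof (cases "\<exists>\<tau> B. A = All \<tau> B")
      case False
      then have "henkin_step T A S = (\<Gamma>, Neg A # H)"
        using True by (auto simp: henkin_step_def S split: fm.splits)
      then show ?thesis using True wf c by (auto simp: good_stage_def)
    next
      case All: True
      then obtain \<tau> B where A: "A = All \<tau> B" by auto
      let ?w = "inst (Var (length \<Gamma>) \<tau>) B"
      have B: "wff (\<tau> # \<Gamma>) B" using True A by simp
      have w: "wff (\<Gamma> @ [\<tau>]) ?w"
        using wff_append[OF B, of "[\<tau>]"] by (auto intro: wff_inst)
      have "\<not> derives T (\<Gamma> @ [\<tau>]) (Neg ?w # Neg A # H) Bot"
      proof
        assume "derives T (\<Gamma> @ [\<tau>]) (Neg ?w # Neg A # H) Bot"
        then have "derives T (\<Gamma> @ [\<tau>]) (Neg A # H) ?w" using w derives.Raa by blast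
        \<comment> \<open>The witness is fresh, so its instance generalises to \<open>A\<close>
          itself and contradicts \<open>Neg A\<close>.\<close>
        then have "derives T \<Gamma> (Neg A # H) A"
          unfolding A by (rule derives_generalise) (use wf B A in auto)
        moreover have "derives T \<Gamma> (Neg A # H) (Neg A)" using True by (intro derives.Hyp) auto
        ultimately show False using c derives.ImpE by blast
      qed
      moreover have "henkin_step T A S = (\<Gamma> @ [\<tau>], Neg ?w # Neg A # H)"
        using True by (auto simp: henkin_step_def S A)
      ultimately show ?thesis using w True wf by (auto simp: good_stage_def wff_append A simp del: wff.simps(5))
    qed
  qed
qed

lemma henkin_step_mono:
  "\<exists>\<Delta>. fst (henkin_step T A S) = fst S @ \<Delta> \<and> set (snd S) \<subseteq> set (snd (henkin_step T A S))"
  by (auto simp: henkin_step_def Let_def split: fm.splits)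

locale henkin =
  fixes T :: "fm set" and H0 :: "fm list"
  assumes good0: "good_stage T ([], H0)"
begin

definition ctx :: "nat \<Rightarrow> ty list" where "ctx k = fst (henkin_stage T H0 k)"
definition hyps :: "nat \<Rightarrow> fm list" where "hyps k = snd (henkin_stage T H0 k)"
definition holds :: "fm \<Rightarrow> bool" where "holds A \<longleftrightarrow> (\<exists>k. A \<in> set (hyps k))"
definition wft :: "tm \<Rightarrow> bool" where "wft t \<longleftrightarrow> (\<exists>k. wt (ctx k) t)"
definition wffm :: "fm \<Rightarrow> bool" where "wffm A \<longleftrightarrow> (\<exists>k. wff (ctx k) A)"

lemma good: "good_stage T (henkin_stage T H0 k)"
  by (induction k) (auto simp: good0 henkin_step_good)

lemma hyps_wff: "A \<in> set (hyps k) \<Longrightarrow> wff (ctx k) A"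
  and hyps_consistent: "\<not> derives T (ctx k) (hyps k) Bot"
  using good[of k] by (auto simp: good_stage_def ctx_def hyps_def)

lemma stage_mono:
  assumes "k \<le> l" shows "\<exists>\<Delta>. ctx l = ctx k @ \<Delta> \<and> set (hyps k) \<subseteq> set (hyps l)"
  using assms
proof (induction l rule: dec_induct)
  case (step l)
  then show ?case
    using henkin_step_mono[of T "from_nat (fst (prod_decode l))" "henkin_stage T H0 l"]
    by (fastforce simp: ctx_def hyps_def)
qed auto

lemma wt_mono: "wt (ctx k) t \<Longrightarrow> k \<le> l \<Longrightarrow> wt (ctx l) t"
  using stage_mono wt_append by metis

lemma wff_mono: "wff (ctx k) A \<Longrightarrow> k \<le> l \<Longrightarrow> wff (ctx l) A"
  using stage_mono wff_append by metis

lemma hyps_mono: "A \<in> set (hyps k) \<Longrightarrow> k \<le> l \<Longrightarrow> A \<in> set (hyps l)"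
  using stage_mono by blast

lemma derives_mono: "derives T (ctx k) H A \<Longrightarrow> k \<le> l \<Longrightarrow> derives T (ctx l) H A"
  using stage_mono derives_append by metis

lemma visit:
  assumes "wff (ctx k) A"
  obtains l where "k \<le> l" "wff (ctx l) A"
    "henkin_stage T H0 (Suc l) = henkin_step T A (henkin_stage T H0 l)"
proof -
  define l where "l = prod_encode (to_nat A, k)"
  have "k \<le> l" by (simp add: l_def le_prod_encode_2)
  then show ?thesis using that[of l] wff_mono[OF assms] by (simp add: l_def)
qed

lemma decided:
  assumes "wffm A" shows "holds A \<or> holds (Neg A)"
proof -
  obtain k where "wff (ctx k) A" using assms by (auto simp: wffm_def)
  then obtain l where l: "wff (ctx l) A"
      "henkin_stage T H0 (Suc l) = henkin_step T A (henkin_stage T H0 l)"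
    using visit by metis
  then have "A \<in> set (hyps (Suc l)) \<or> Neg A \<in> set (hyps (Suc l))"
    unfolding hyps_def l(2) using l(1) by (auto simp: henkin_step_def Let_def ctx_def split: fm.splits)
  then show ?thesis by (auto simp: holds_def)
qed

lemma holds_stage:
  assumes "\<And>A. A \<in> set H \<Longrightarrow> holds A" shows "\<exists>k. set H \<subseteq> set (hyps k)"
  using assms
proof (induction H)
  case (Cons A H)
  then obtain k where k: "set H \<subseteq> set (hyps k)" by auto
  obtain l where "A \<in> set (hyps l)" using Cons.prems by (auto simp: holds_def)
  then have "set (A # H) \<subseteq> set (hyps (max k l))" using k hyps_mono by fastforce
  then show ?case by blast
qed auto

text \<open>Finitely many hypotheses occur together at some stage. Had \<open>A\<close> been decided
  negatively, a common later stage would be inconsistent.\<close>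

lemma holds_derives:
  assumes d: "derives T (ctx k) H A" and H: "\<And>B. B \<in> set H \<Longrightarrow> holds B" and A: "wffm A"
  shows "holds A"
proof (rule ccontr)
  assume "\<not> holds A"
  with decided[OF A] have "holds (Neg A)" by simp
  then have "\<exists>l. set (Neg A # H) \<subseteq> set (hyps l)"
    using H by (intro holds_stage) auto
  then obtain l where l: "set (Neg A # H) \<subseteq> set (hyps l)" by blast
  define m where "m = max k l"
  have s: "set (Neg A # H) \<subseteq> set (hyps m)" using l hyps_mono by (fastforce simp: m_def)
  have "derives T (ctx m) (hyps m) A"
    using derives_weaken[OF derives_mono[OF d, of m]] s by (auto simp: m_def)
  moreover have "derives T (ctx m) (hyps m) (Neg A)"
    using s hyps_wff[of "Neg A" m] by (intro derives.Hyp) auto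
  ultimately show False using hyps_consistent derives.ImpE by blast
qed

lemma not_holds_Bot: "\<not> holds Bot"
proof
  assume "holds Bot"
  then obtain k where "Bot \<in> set (hyps k)" by (auto simp: holds_def)
  then have "derives T (ctx k) (hyps k) Bot" by (intro derives.Hyp) auto
  then show False using hyps_consistent by blast
qed

lemma holds_Imp:
  assumes "wffm (Imp A B)" shows "holds (Imp A B) \<longleftrightarrow> (holds A \<longrightarrow> holds B)"
proof -
  obtain k where k: "wff (ctx k) A" "wff (ctx k) B" using assms by (auto simp: wffm_def)
  have mp: "holds B" if "holds (Imp A B)" "holds A" for A B
  proof -
    have "\<exists>k. set [Imp A B, A] \<subseteq> set (hyps k)"
      using \<open>holds (Imp A B)\<close> \<open>holds A\<close> by (intro holds_stage) auto
    then obtain k where "set [Imp A B, A] \<subseteq> set (hyps k)" by blast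
    then have w: "wff (ctx k) (Imp A B)" "wff (ctx k) A"
      using hyps_wff[of "Imp A B" k] by auto
    have "derives T (ctx k) [Imp A B, A] B"
      by (rule derives.ImpE[of _ _ _ A]) (use w in \<open>auto intro: derives.Hyp\<close>)
    then show ?thesis by (rule holds_derives) (use that w in \<open>auto simp: wffm_def\<close>)
  qed
  have "holds (Imp A B)" if "holds B"
  proof -
    have "derives T (ctx k) [B] (Imp A B)"
      using k by (intro derives.ImpI derives.Hyp) auto
    then show ?thesis by (rule holds_derives) (use that assms in auto)
  qed
  moreover have "holds (Imp A B)" if "\<not> holds A"
  proof -
    have "wffm A" using k by (auto simp: wffm_def)
    with that decided have n: "holds (Neg A)" by blast
    have "derives T (ctx k) [A, Neg A] Bot"
      by (rule derives.ImpE[of _ _ _ A]) (use k in \<open>auto intro: derives.Hyp\<close>)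
    then have "derives T (ctx k) [Neg A] (Imp A B)"
      using k by (auto intro!: derives.ImpI intro: derives_BotE[of T "ctx k"])
    then show ?thesis by (rule holds_derives) (use n assms in auto)
  qed
  ultimately show ?thesis using mp by blast
qed

lemma holds_All:
  assumes "wffm (All \<tau> B)"
  shows "holds (All \<tau> B) \<longleftrightarrow> (\<forall>t. wft t \<and> ty_of t = \<tau> \<longrightarrow> holds (inst t B))"
proof (intro iffI allI impI)
  fix t assume h: "holds (All \<tau> B)" and t: "wft t \<and> ty_of t = \<tau>"
  obtain k l where kl: "wff (ctx k) (All \<tau> B)" "wt (ctx l) t"
    using assms t unfolding wffm_def wft_def by blast
  define m where "m = max k l"
  have m: "wff (ctx m) (All \<tau> B)" "wt (ctx m) t"
    using wff_mono[OF kl(1), of m] wt_mono[OF kl(2), of m] by (auto simp: m_def)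
  have "derives T (ctx m) [All \<tau> B] (inst t B)"
    by (rule derives.AllE[OF derives.Hyp]) (use m t in auto)
  then show "holds (inst t B)"
  proof (rule holds_derives)
    show "wffm (inst t B)" using m t wff_inst[of \<tau> "ctx m" B t] unfolding wffm_def by auto
  qed (use h in auto)
next
  assume all: "\<forall>t. wft t \<and> ty_of t = \<tau> \<longrightarrow> holds (inst t B)"
  show "holds (All \<tau> B)"
  proof (rule ccontr)
    assume n: "\<not> holds (All \<tau> B)"
    obtain k where "wff (ctx k) (All \<tau> B)" using assms unfolding wffm_def by blast
    then obtain l where l: "wff (ctx l) (All \<tau> B)"
        "henkin_stage T H0 (Suc l) = henkin_step T (All \<tau> B) (henkin_stage T H0 l)"
      by (rule visit)
    let ?w = "inst (Var (length (ctx l)) \<tau>) B"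
    have "All \<tau> B \<notin> set (hyps (Suc l))" using n by (auto simp: holds_def)
    then have e: "henkin_stage T H0 (Suc l) = (ctx l @ [\<tau>], Neg ?w # Neg (All \<tau> B) # hyps l)"
      unfolding hyps_def l(2) using l(1)
      by (auto simp: henkin_step_def Let_def ctx_def split: if_splits)
    have "Neg ?w \<in> set (hyps (Suc l))" by (simp add: hyps_def e del: henkin_stage.simps)
    then have nw: "holds (Neg ?w)" by (auto simp: holds_def)
    have "wt (ctx (Suc l)) (Var (length (ctx l)) \<tau>)" by (simp add: ctx_def e del: henkin_stage.simps)
    then have "holds ?w" using all by (auto simp: wft_def simp del: wt.simps)
    moreover have "wffm (Neg ?w)" using \<open>Neg ?w \<in> set (hyps (Suc l))\<close> hyps_wff wffm_def by blast
    ultimately show False using nw holds_Imp not_holds_Bot by blast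
  qed
qed

lemma holds_axiom: "A \<in> T \<Longrightarrow> wff [] A \<Longrightarrow> holds A"
  using derives.Ax[of A T "ctx 0" "[]"] holds_derives[of 0 "[]" A] wff_append[of "[]" A "ctx 0"]
  by (auto simp: wffm_def)

lemma holds_Eq_refl: "wft t \<Longrightarrow> ty_of t = Ty0 \<Longrightarrow> holds (Eq t t)"
  unfolding wft_def using derives.EqI holds_derives[of _ "[]" "Eq t t"] by (fastforce simp: wffm_def)

text \<open>Variable 0 marks the place of replacement, variable 1 is a fixed parameter. The
  instances taken in \<open>eqv_term_model\<close> are symmetry, transitivity and invariance of
  \<open>Less\<close>.\<close>

lemma holds_Eq_subst:
  assumes e: "holds (Eq s t)" and A: "wff [Ty0, Ty0] A"
    and u: "wft u" "ty_of u = Ty0"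
    and h: "holds (fsub (\<lambda>n \<tau>. if n = 0 then s else u) A)"
  shows "holds (fsub (\<lambda>n \<tau>. if n = 0 then t else u) A)"
proof -
  obtain k where k: "Eq s t \<in> set (hyps k)" using e by (auto simp: holds_def)
  obtain l where l: "wt (ctx l) u" using u(1) unfolding wft_def by blast
  define m where "m = max k l"
  have w: "wff (ctx m) (Eq s t)" "wt (ctx m) u"
    using wff_mono[OF hyps_wff[OF k], of m] wt_mono[OF l, of m] by (auto simp: m_def)
  define B where "B = fsub (\<lambda>n \<tau>. if n = 0 then Var 0 \<tau> else tsub shift u) A"
  have st: "subst_typed (Ty0 # ctx m) (\<lambda>n \<tau>. if n = 0 then Var 0 \<tau> else tsub shift u) [Ty0, Ty0]"
    using wt_tsub[OF subst_typed_shift w(2)] u by (auto simp: subst_typed_def nth_Cons split: nat.split)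
  have B: "wff (Ty0 # ctx m) B" unfolding B_def using A st by (rule wff_fsub)
  have i: "inst r B = fsub (\<lambda>n \<tau>. if n = 0 then r else u) A" for r
    unfolding B_def inst_def fsub_fsub
    by (rule arg_cong[where f="\<lambda>\<theta>. fsub \<theta> A"], rule ext, rule ext)
       (auto simp: tsub_tsub shift_def)
  have wi: "wff (ctx m) (inst s B)" "wff (ctx m) (inst t B)" using w B wff_inst by auto
  have "derives T (ctx m) [Eq s t, inst s B] (inst t B)"
    by (rule derives.EqE[OF B, of _ _ s]; rule derives.Hyp) (use w wi in auto)
  then have "holds (inst t B)"
  proof (rule holds_derives)
    show "wffm (inst t B)" using wi unfolding wffm_def by blast
  qed (use e h i in auto)
  then show ?thesis by (simp add: i)
qed

end

section \<open>Interpretations\<close>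

record 'a interp =
  Dom :: "ty \<Rightarrow> 'a set"
  ap :: "'a \<Rightarrow> 'a \<Rightarrow> 'a"
  con :: "cst \<Rightarrow> 'a"
  eqv :: "'a \<Rightarrow> 'a \<Rightarrow> bool"
  lss :: "'a \<Rightarrow> 'a \<Rightarrow> bool"

fun teval :: "'a interp \<Rightarrow> 'a list \<Rightarrow> tm \<Rightarrow> 'a" where
  "teval M vs (Var n \<tau>) = vs ! n"
| "teval M vs (Cst c) = con M c"
| "teval M vs (App s t) = ap M (teval M vs s) (teval M vs t)"

fun feval :: "'a interp \<Rightarrow> 'a list \<Rightarrow> fm \<Rightarrow> bool" where
  "feval M vs (Eq s t) \<longleftrightarrow> eqv M (teval M vs s) (teval M vs t)"
| "feval M vs (Less s t) \<longleftrightarrow> lss M (teval M vs s) (teval M vs t)"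
| "feval M vs Bot \<longleftrightarrow> False"
| "feval M vs (Imp A B) \<longleftrightarrow> (feval M vs A \<longrightarrow> feval M vs B)"
| "feval M vs (All \<tau> A) \<longleftrightarrow> (\<forall>x \<in> Dom M \<tau>. feval M (x # vs) A)"

definition typed :: "'a interp \<Rightarrow> ty list \<Rightarrow> 'a list \<Rightarrow> bool" where
  "typed M \<Gamma> vs \<longleftrightarrow> list_all2 (\<lambda>\<tau> x. x \<in> Dom M \<tau>) \<Gamma> vs"

fun requal :: "'a interp \<Rightarrow> ty \<Rightarrow> 'a \<Rightarrow> 'a \<Rightarrow> bool" where
  "requal M Ty0 x y \<longleftrightarrow> eqv M x y"
| "requal M (\<sigma> \<rightarrow> \<tau>) f g \<longleftrightarrow> (\<forall>x \<in> Dom M \<sigma>. requal M \<tau> (ap M f x) (ap M g x))"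

lemma typed_Cons [simp]: "typed M (\<tau> # \<Gamma>) (x # vs) \<longleftrightarrow> x \<in> Dom M \<tau> \<and> typed M \<Gamma> vs"
  and typed_Nil [simp]: "typed M [] []"
  by (auto simp: typed_def)

locale interp =
  fixes M :: "'a interp"
  assumes ap_closed: "f \<in> Dom M (\<sigma> \<rightarrow> \<tau>) \<Longrightarrow> x \<in> Dom M \<sigma> \<Longrightarrow> ap M f x \<in> Dom M \<tau>"
    and con_closed: "con M c \<in> Dom M (cty c)"

lemma (in interp) teval_closed:
  "typed M \<Gamma> vs \<Longrightarrow> wt \<Gamma> t \<Longrightarrow> teval M vs t \<in> Dom M (ty_of t)"
proof (induction t)
  case (App s t)
  then show ?case by (auto split: ty.splits intro: ap_closed)
qed (auto simp: typed_def list_all2_conv_all_nth con_closed)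

lemma teval_tsub:
  "wt \<Gamma> t \<Longrightarrow> teval M vs (tsub \<theta> t) = teval M (map (\<lambda>n. teval M vs (\<theta> n (\<Gamma> ! n))) [0..<length \<Gamma>]) t"
  by (induction t) (auto split: ty.splits)

lemma teval_shift: "teval M (x # vs) (tsub shift t) = teval M vs t"
  by (induction t) (auto simp: shift_def)

lemma feval_fsub:
  "wff \<Gamma> A \<Longrightarrow> feval M vs (fsub \<theta> A) = feval M (map (\<lambda>n. teval M vs (\<theta> n (\<Gamma> ! n))) [0..<length \<Gamma>]) A"
proof (induction A arbitrary: \<Gamma> vs \<theta>)
  case (All \<tau> A)
  have "map (\<lambda>n. teval M (x # vs) (push \<theta> n ((\<tau> # \<Gamma>) ! n))) [0..<length (\<tau> # \<Gamma>)]
      = x # map (\<lambda>n. teval M vs (\<theta> n (\<Gamma> ! n))) [0..<length \<Gamma>]" for x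
    by (rule nth_equalityI) (auto simp: push_def teval_shift nth_Cons simp del: upt_Suc split: nat.split)
  then show ?case using All.IH[of "\<tau> # \<Gamma>" _ "push \<theta>"] All.prems by (simp del: upt_Suc)
next
  case (Eq s t)
  then show ?case by (simp add: teval_tsub[of \<Gamma>])
next
  case (Less s t)
  then show ?case by (simp add: teval_tsub[of \<Gamma>])
next
  case (Imp A B)
  then show ?case using Imp.IH[of \<Gamma>] by auto
qed auto

lemma teval_append: "wt \<Gamma> t \<Longrightarrow> length vs = length \<Gamma> \<Longrightarrow> teval M (vs @ us) t = teval M vs t"
  by (induction t) (auto simp: nth_append split: ty.splits)

lemma feval_append: "wff \<Gamma> A \<Longrightarrow> length vs = length \<Gamma> \<Longrightarrow> feval M (vs @ us) A = feval M vs A"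
proof (induction A arbitrary: \<Gamma> vs)
  case (All \<tau> A)
  then have "feval M ((x # vs) @ us) A = feval M (x # vs) A" for x
    by (intro All.IH[of "\<tau> # \<Gamma>"]) auto
  then show ?case by simp
qed (auto simp: teval_append)

lemma wff_closure: "wff [] (closure \<Gamma> A) \<longleftrightarrow> wff \<Gamma> A"
  by (induction \<Gamma> arbitrary: A) auto

lemma feval_closure: "feval M [] (closure \<Gamma> A) \<longleftrightarrow> (\<forall>vs. typed M \<Gamma> vs \<longrightarrow> feval M vs A)"
proof (induction \<Gamma> arbitrary: A)
  case (Cons \<tau> \<Gamma>)
  show ?case
    by (auto simp: Cons.IH) (auto simp: typed_def list_all2_Cons1)
qed (auto simp: typed_def)

section \<open>The term model of a Henkin theory\<close>

context henkin begin

text \<open>Equality is interpreted by the equations that hold, so at this point it is only an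
  equivalence relation; the quotient is taken separately.\<close>

definition term_model :: "tm interp" where
  "term_model = \<lparr>Dom = \<lambda>\<tau>. {t. wft t \<and> ty_of t = \<tau>}, ap = App, con = Cst,
     eqv = \<lambda>s t. holds (Eq s t), lss = \<lambda>s t. holds (Less s t)\<rparr>"

lemma typed_term_model:
  "typed term_model \<Gamma> vs \<Longrightarrow> \<exists>k. subst_typed (ctx k) (\<lambda>n \<tau>. vs ! n) \<Gamma>"
proof (induction \<Gamma> arbitrary: vs)
  case (Cons \<tau> \<Gamma>)
  then obtain x ws where vs: "vs = x # ws" and x: "wft x" "ty_of x = \<tau>" and ws: "typed term_model \<Gamma> ws"
    by (auto simp: typed_def list_all2_Cons1 term_model_def)
  obtain k where k: "subst_typed (ctx k) (\<lambda>n \<tau>. ws ! n) \<Gamma>" using Cons.IH[OF ws] by blast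
  obtain l where l: "wt (ctx l) x" using x unfolding wft_def by blast
  have "subst_typed (ctx (max k l)) (\<lambda>n \<tau>. vs ! n) (\<tau> # \<Gamma>)"
    using k x wt_mono[OF l, of "max k l"] wt_mono[of k _ "max k l"]
    by (auto simp: subst_typed_def vs nth_Cons split: nat.split)
  then show ?case by blast
qed (auto simp: subst_typed_def)

lemma teval_term_model: "teval term_model vs t = tsub (\<lambda>n \<tau>. vs ! n) t"
  by (induction t) (auto simp: term_model_def)

lemma wffm_fsub: "wff \<Gamma> A \<Longrightarrow> typed term_model \<Gamma> vs \<Longrightarrow> wffm (fsub (\<lambda>n \<tau>. vs ! n) A)"
  using typed_term_model wff_fsub wffm_def by blast

lemma truth:
  "wff \<Gamma> A \<Longrightarrow> typed term_model \<Gamma> vs \<Longrightarrow> feval term_model vs A \<longleftrightarrow> holds (fsub (\<lambda>n \<tau>. vs ! n) A)"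
proof (induction A arbitrary: \<Gamma> vs)
  case (Eq s t)
  then show ?case by (simp add: teval_term_model) (simp add: term_model_def)
next
  case (Less s t)
  then show ?case by (simp add: teval_term_model) (simp add: term_model_def)
next
  case Bot
  then show ?case by (simp add: not_holds_Bot)
next
  case (Imp A B)
  then show ?case using holds_Imp[of "fsub (\<lambda>n \<tau>. vs ! n) A" "fsub (\<lambda>n \<tau>. vs ! n) B"]
    wffm_fsub[OF Imp.prems] Imp.IH[of \<Gamma> vs] Imp.prems by simp
next
  case (All \<tau> A)
  have i: "inst t (fsub (push (\<lambda>n \<tau>. vs ! n)) A) = fsub (\<lambda>n \<tau>. (t # vs) ! n) A" for t
    unfolding inst_def fsub_fsub
    by (rule arg_cong[where f="\<lambda>\<theta>. fsub \<theta> A"], rule ext, rule ext)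
       (auto simp: push_def tsub_tsub shift_def split: nat.split)
  have "feval term_model vs (All \<tau> A)
    \<longleftrightarrow> (\<forall>t. wft t \<and> ty_of t = \<tau> \<longrightarrow> feval term_model (t # vs) A)"
    by (auto simp: term_model_def)
  also have "\<dots> \<longleftrightarrow> (\<forall>t. wft t \<and> ty_of t = \<tau> \<longrightarrow> holds (fsub (\<lambda>n \<tau>. (t # vs) ! n) A))"
  proof -
    have "feval term_model (t # vs) A \<longleftrightarrow> holds (fsub (\<lambda>n \<tau>. (t # vs) ! n) A)" if "wft t \<and> ty_of t = \<tau>" for t
      by (rule All.IH[of "\<tau> # \<Gamma>"]) (use All.prems that in \<open>auto simp: term_model_def\<close>)
    then show ?thesis by auto
  qed
  also have "\<dots> \<longleftrightarrow> holds (fsub (\<lambda>n \<tau>. vs ! n) (All \<tau> A))"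
    using holds_All[of \<tau> "fsub (push (\<lambda>n \<tau>. vs ! n)) A"] wffm_fsub[OF All.prems] by (simp add: i)
  finally show ?case .
qed

lemma truth_closed: "wff [] A \<Longrightarrow> feval term_model [] A \<longleftrightarrow> holds A"
  using truth[of "[]" A "[]"] by (simp add: fsub_closed)

lemma interp_term_model: "interp term_model"
proof
  fix f x \<sigma> \<tau> assume "f \<in> Dom term_model (\<sigma> \<rightarrow> \<tau>)" "x \<in> Dom term_model \<sigma>"
  then show "ap term_model f x \<in> Dom term_model \<tau>"
    using typed_term_model[of "[\<sigma> \<rightarrow> \<tau>, \<sigma>]" "[f, x]"]
    by (auto simp: term_model_def wft_def subst_typed_def All_less_Suc2)
qed (auto simp: term_model_def wft_def)

lemma eqv_term_model:
  assumes "s \<in> Dom term_model Ty0" "t \<in> Dom term_model Ty0" "u \<in> Dom term_model Ty0"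
  shows "eqv term_model s s"
    and "eqv term_model s t \<Longrightarrow> eqv term_model t s"
    and "eqv term_model s t \<Longrightarrow> eqv term_model t u \<Longrightarrow> eqv term_model s u"
    and "eqv term_model s t \<Longrightarrow> lss term_model s u \<Longrightarrow> lss term_model t u"
    and "eqv term_model s t \<Longrightarrow> lss term_model u s \<Longrightarrow> lss term_model u t"
  using assms holds_Eq_refl[of s]
    holds_Eq_subst[of s t "Eq (Var 0 Ty0) (Var 1 Ty0)" s]
    holds_Eq_subst[of t u "Eq (Var 1 Ty0) (Var 0 Ty0)" s]
    holds_Eq_subst[of s t "Less (Var 0 Ty0) (Var 1 Ty0)" u]
    holds_Eq_subst[of s t "Less (Var 1 Ty0) (Var 0 Ty0)" u]
  by (simp_all add: term_model_def)

end

section \<open>Evaluating formulas written with bound HOL variables\<close>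

text \<open>A context \<open>C\<close> lists the types and values of the variables bound since depth 0, innermost
  first; \<open>R\<close> does the same for the parameters of a schema, which are bound outside of depth 0.
  Denotations are required in all extensions of \<open>C\<close>, so that they persist under further binders.\<close>

definition well_typed :: "'a interp \<Rightarrow> (ty \<times> 'a) list \<Rightarrow> bool" where
  "well_typed M C \<longleftrightarrow> (\<forall>(\<tau>, x) \<in> set C. x \<in> Dom M \<tau>)"

definition extends :: "'a interp \<Rightarrow> (ty \<times> 'a) list \<Rightarrow> (ty \<times> 'a) list \<Rightarrow> (ty \<times> 'a) list \<Rightarrow> bool" where
  "extends M R C C' \<longleftrightarrow> (\<exists>D. C' = D @ C) \<and> well_typed M (C' @ R)"

definition den :: "'a interp \<Rightarrow> (ty \<times> 'a) list \<Rightarrow> (ty \<times> 'a) list \<Rightarrow> htm \<Rightarrow> ty \<Rightarrow> 'a \<Rightarrow> bool" where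
  "den M R C t \<tau> v \<longleftrightarrow> (\<forall>C'. extends M R C C' \<longrightarrow>
     wt (map fst (C' @ R)) (t (length C')) \<and> ty_of (t (length C')) = \<tau> \<and>
     teval M (map snd (C' @ R)) (t (length C')) = v)"

definition sat :: "'a interp \<Rightarrow> (ty \<times> 'a) list \<Rightarrow> (ty \<times> 'a) list \<Rightarrow> hfm \<Rightarrow> bool \<Rightarrow> bool" where
  "sat M R C P b \<longleftrightarrow> (\<forall>C'. extends M R C C' \<longrightarrow>
     wff (map fst (C' @ R)) (P (length C')) \<and> feval M (map snd (C' @ R)) (P (length C')) = b)"

lemma well_typed_typed: "well_typed M C \<Longrightarrow> typed M (map fst C) (map snd C)"
  by (auto simp: well_typed_def typed_def list_all2_conv_all_nth split_beta)

lemma typed_well_typed: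
  assumes "typed M \<Gamma> vs"
  shows "well_typed M (zip \<Gamma> vs)" "map fst (zip \<Gamma> vs) = \<Gamma>" "map snd (zip \<Gamma> vs) = vs"
  using assms by (auto simp: typed_def well_typed_def list_all2_iff)

lemma extends_trans [trans]: "extends M R C C' \<Longrightarrow> extends M R C' C'' \<Longrightarrow> extends M R C C''"
  by (auto simp: extends_def)

lemma den_lift: "den M R C t \<tau> v \<Longrightarrow> extends M R C C' \<Longrightarrow> den M R C' t \<tau> v"
  unfolding den_def using extends_trans by blast

lemma extends_refl: "extends M R C C' \<Longrightarrow> extends M R C' C'"
  by (auto simp: extends_def)

lemma sat_sentence:
  assumes "sat M [] [] P b" shows "wff [] (P 0)" "feval M [] (P 0) = b"
  using assms[unfolded sat_def, rule_format, of "[]"] by (simp_all add: extends_def well_typed_def)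

lemma sat_schema:
  assumes "sat M R [] P b" "well_typed M R"
  shows "wff (map fst R) (P 0)" "feval M (map snd R) (P 0) = b"
  using assms(1)[unfolded sat_def, rule_format, of "[]"] assms(2) by (simp_all add: extends_def)

named_theorems den_intros

lemma den_cst: "den M R C (hcst c) (cty c) (con M c)"
  by (simp add: den_def hcst_def)

lemma den_app:
  "den M R C s (\<sigma> \<rightarrow> \<tau>) f \<Longrightarrow> den M R C t \<sigma> x \<Longrightarrow> den M R C (s \<cdot> t) \<tau> (ap M f x)"
  by (simp add: den_def happ_def)

lemma sat_eq: "den M R C s Ty0 x \<Longrightarrow> den M R C t Ty0 y \<Longrightarrow> sat M R C (s \<^bold>= t) (eqv M x y)"
  by (simp add: den_def sat_def heq_def)

lemma sat_less: "den M R C s Ty0 x \<Longrightarrow> den M R C t Ty0 y \<Longrightarrow> sat M R C (s \<^bold>< t) (lss M x y)"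
  by (simp add: den_def sat_def hless_def)

lemma sat_bot: "sat M R C \<^bold>\<bottom> False"
  by (simp add: sat_def hbot_def)

lemma sat_imp [den_intros]: "sat M R C P p \<Longrightarrow> sat M R C Q q \<Longrightarrow> sat M R C (P \<^bold>\<longrightarrow> Q) (p \<longrightarrow> q)"
  by (simp add: sat_def himp_def)

lemma sat_neg [den_intros]: "sat M R C P p \<Longrightarrow> sat M R C (\<^bold>\<not> P) (\<not> p)"
  unfolding hneg_def by (rule sat_imp[of _ _ _ P p _ False, simplified]) (auto intro: sat_bot)

lemma sat_conj [den_intros]: "sat M R C P p \<Longrightarrow> sat M R C Q q \<Longrightarrow> sat M R C (P \<^bold>\<and> Q) (p \<and> q)"
  unfolding hconj_def by (rule sat_neg[OF sat_imp[OF _ sat_neg], simplified])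

lemma sat_disj [den_intros]: "sat M R C P p \<Longrightarrow> sat M R C Q q \<Longrightarrow> sat M R C (P \<^bold>\<or> Q) (p \<or> q)"
  unfolding hdisj_def disj_imp by (intro sat_imp sat_neg)

lemma sat_iff [den_intros]: "sat M R C P p \<Longrightarrow> sat M R C Q q \<Longrightarrow> sat M R C (P \<^bold>\<longleftrightarrow> Q) (p \<longleftrightarrow> q)"
  unfolding hiff_def iff_conv_conj_imp by (intro sat_imp sat_conj)

lemma den_hvar:
  assumes "x \<in> Dom M \<tau>" shows "den M R ((\<tau>, x) # C) (hvar \<tau> (length C)) \<tau> x"
  unfolding den_def hvar_def extends_def by (auto simp: nth_append)

context interp begin

text \<open>The body of a quantifier is known to be well-formed only at actual values, so
  \<open>sat_all\<close> needs an inhabitant. At function types a constant function serves.\<close>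

lemma Dom_nonempty: "Dom M \<tau> \<noteq> {}"
proof (induction \<tau>)
  case Ty0
  then show ?case using con_closed[of Zero] by auto
next
  case (Fn \<sigma> \<tau>)
  then show ?case using ap_closed[of "con M (CombK \<tau> \<sigma>)" \<tau> "\<sigma> \<rightarrow> \<tau>"] con_closed[of "CombK \<tau> \<sigma>"] by auto
qed

lemma sat_all:
  assumes "\<And>C' x t. extends M R C C' \<Longrightarrow> x \<in> Dom M \<tau> \<Longrightarrow> den M R C' t \<tau> x \<Longrightarrow> sat M R C' (F t) (Q x)"
  shows "sat M R C (hall \<tau> F) (\<forall>x \<in> Dom M \<tau>. Q x)"
  unfolding sat_def
proof (intro allI impI)
  fix C' assume C': "extends M R C C'"
  let ?t = "hvar \<tau> (length C')"
  have s: "wff (map fst (((\<tau>, x) # C') @ R)) (F ?t (Suc (length C'))) \<and>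
      feval M (map snd (((\<tau>, x) # C') @ R)) (F ?t (Suc (length C'))) = Q x" if x: "x \<in> Dom M \<tau>" for x
  proof -
    have e: "extends M R C ((\<tau>, x) # C')" "extends M R ((\<tau>, x) # C') ((\<tau>, x) # C')"
      using C' x by (auto simp: extends_def well_typed_def)
    from assms[OF e(1) x den_hvar[OF x]] e(2) show ?thesis
      unfolding sat_def by fastforce
  qed
  obtain x where "x \<in> Dom M \<tau>" using Dom_nonempty by blast
  with s show "wff (map fst (C' @ R)) (hall \<tau> F (length C')) \<and>
      feval M (map snd (C' @ R)) (hall \<tau> F (length C')) = (\<forall>x\<in>Dom M \<tau>. Q x)"
    by (auto simp: hall_def)
qed

lemma sat_ex:
  assumes "\<And>C' x t. extends M R C C' \<Longrightarrow> x \<in> Dom M \<tau> \<Longrightarrow> den M R C' t \<tau> x \<Longrightarrow> sat M R C' (F t) (Q x)"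
  shows "sat M R C (hex \<tau> F) (\<exists>x \<in> Dom M \<tau>. Q x)"
  unfolding hex_def
  by (rule sat_neg[of M R C _ "\<forall>x\<in>Dom M \<tau>. \<not> Q x", simplified]) (intro sat_all sat_neg assms)

lemma sat_heqT:
  "den M R C s \<tau> u \<Longrightarrow> den M R C t \<tau> v \<Longrightarrow> sat M R C (heqT \<tau> s t) (requal M \<tau> u v)"
proof (induction \<tau> arbitrary: C s t u v)
  case Ty0
  then show ?case by (simp add: sat_eq)
next
  case (Fn \<sigma> \<tau>)
  then show ?case
    by (auto intro!: sat_all Fn.IH(2) den_app[where \<sigma>=\<sigma>] intro: den_lift)
qed

lemma sat_plug:
  assumes "wff (\<tau>s @ map fst R) A" "length ts = length \<tau>s" "length vs = length \<tau>s"
    and "\<And>i. i < length ts \<Longrightarrow> den M R C (ts ! i) (\<tau>s ! i) (vs ! i)"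
  shows "sat M R C (A\<langle>ts\<rangle>) (feval M (vs @ map snd R) A)"
  unfolding sat_def
proof (intro allI impI)
  fix C' assume C': "extends M R C C'"
  let ?\<theta> = "\<lambda>n \<tau>. if n < length ts then (ts ! n) (length C') else Var (n - length ts + length C') \<tau>"
  have d: "wt (map fst (C' @ R)) ((ts ! i) (length C')) \<and> ty_of ((ts ! i) (length C')) = \<tau>s ! i \<and>
     teval M (map snd (C' @ R)) ((ts ! i) (length C')) = vs ! i" if "i < length ts" for i
    using assms(4)[OF that] C' by (auto simp: den_def)
  have st: "subst_typed (map fst (C' @ R)) ?\<theta> (\<tau>s @ map fst R)"
    unfolding subst_typed_def using d assms(2) by (auto simp: nth_append)
  have "map (\<lambda>n. teval M (map snd (C' @ R)) (?\<theta> n ((\<tau>s @ map fst R) ! n))) [0..<length (\<tau>s @ map fst R)]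
      = vs @ map snd R"
    by (rule nth_equalityI) (use d assms(2,3) in \<open>auto simp: nth_append\<close>)
  then show "wff (map fst (C' @ R)) (A\<langle>ts\<rangle> (length C')) \<and>
      feval M (map snd (C' @ R)) (A\<langle>ts\<rangle> (length C')) = feval M (vs @ map snd R) A"
    unfolding plug_def using feval_fsub[OF assms(1), of M "map snd (C' @ R)" ?\<theta>] wff_fsub[OF assms(1) st]
    by simp
qed

end

lemma models_closure:
  assumes "feval M [] (closure \<Gamma> (P 0))" "well_typed M R" "\<Gamma> = map fst R" "sat M R [] P b"
  shows b
  using assms sat_schema[of M R P b] well_typed_typed[of M R] by (auto simp: feval_closure)

section \<open>Extensional interpretations and the quotient by extensional equality\<close>

locale ext_interp = interp +
  assumes eqv_eq: "eqv M = (=)"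
    and extensional: "f \<in> Dom M (\<sigma> \<rightarrow> \<tau>) \<Longrightarrow> g \<in> Dom M (\<sigma> \<rightarrow> \<tau>) \<Longrightarrow>
      (\<And>x. x \<in> Dom M \<sigma> \<Longrightarrow> ap M f x = ap M g x) \<Longrightarrow> f = g"
begin

lemma requal_eq: "x \<in> Dom M \<tau> \<Longrightarrow> y \<in> Dom M \<tau> \<Longrightarrow> requal M \<tau> x y \<longleftrightarrow> x = y"
proof (induction \<tau> arbitrary: x y)
  case (Fn \<sigma> \<tau>)
  then show ?case using extensional[of x \<sigma> \<tau> y] ap_closed by auto
qed (simp add: eqv_eq)

end

text \<open>\<open>tyf\<close> recovers the type from an element, so that the class of an element
  can be formed without carrying its type along. The assumption \<open>ext\<close> is what the
  extensionality axioms say.\<close>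

locale ext_quotient = interp +
  fixes tyf :: "'a \<Rightarrow> ty"
  assumes tyf: "x \<in> Dom M \<tau> \<Longrightarrow> tyf x = \<tau>"
    and eqv_refl: "x \<in> Dom M Ty0 \<Longrightarrow> eqv M x x"
    and eqv_sym: "x \<in> Dom M Ty0 \<Longrightarrow> y \<in> Dom M Ty0 \<Longrightarrow> eqv M x y \<Longrightarrow> eqv M y x"
    and eqv_trans: "x \<in> Dom M Ty0 \<Longrightarrow> y \<in> Dom M Ty0 \<Longrightarrow> z \<in> Dom M Ty0 \<Longrightarrow>
      eqv M x y \<Longrightarrow> eqv M y z \<Longrightarrow> eqv M x z"
    and lss_cong: "x \<in> Dom M Ty0 \<Longrightarrow> x' \<in> Dom M Ty0 \<Longrightarrow> y \<in> Dom M Ty0 \<Longrightarrow> y' \<in> Dom M Ty0 \<Longrightarrow>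
      eqv M x x' \<Longrightarrow> eqv M y y' \<Longrightarrow> lss M x y \<Longrightarrow> lss M x' y'"
    and ext: "\<phi> \<in> Dom M (\<rho> \<rightarrow> \<tau>) \<Longrightarrow> x \<in> Dom M \<rho> \<Longrightarrow> y \<in> Dom M \<rho> \<Longrightarrow>
      requal M \<rho> x y \<Longrightarrow> requal M \<tau> (ap M \<phi> x) (ap M \<phi> y)"
begin

lemma requal_refl: "x \<in> Dom M \<tau> \<Longrightarrow> requal M \<tau> x x"
  by (induction \<tau> arbitrary: x) (auto simp: eqv_refl intro: ap_closed)

lemma requal_sym: "x \<in> Dom M \<tau> \<Longrightarrow> y \<in> Dom M \<tau> \<Longrightarrow> requal M \<tau> x y \<Longrightarrow> requal M \<tau> y x"
proof (induction \<tau> arbitrary: x y)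
  case (Fn \<sigma> \<tau>)
  then show ?case using ap_closed by (metis requal.simps(2))
qed (auto intro: eqv_sym)

lemma requal_trans:
  "x \<in> Dom M \<tau> \<Longrightarrow> y \<in> Dom M \<tau> \<Longrightarrow> z \<in> Dom M \<tau> \<Longrightarrow> requal M \<tau> x y \<Longrightarrow> requal M \<tau> y z \<Longrightarrow> requal M \<tau> x z"
proof (induction \<tau> arbitrary: x y z)
  case (Fn \<sigma> \<tau>)
  show ?case
    unfolding requal.simps
  proof
    fix w assume w: "w \<in> Dom M \<sigma>"
    show "requal M \<tau> (ap M x w) (ap M z w)"
      by (rule Fn.IH(2)[of _ "ap M y w"]) (use Fn.prems w ap_closed in auto)
  qed
qed (auto intro: eqv_trans)

definition cls :: "'a \<Rightarrow> 'a set" where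
  "cls x = {y \<in> Dom M (tyf x). requal M (tyf x) x y}"

definition repr :: "'a set \<Rightarrow> 'a" where
  "repr X = (SOME x. x \<in> X)"

definition quotient :: "'a set interp" where
  "quotient = \<lparr>Dom = \<lambda>\<tau>. cls ` Dom M \<tau>, ap = \<lambda>F X. cls (ap M (repr F) (repr X)), con = \<lambda>c. cls (con M c),
     eqv = (=), lss = \<lambda>X Y. lss M (repr X) (repr Y)\<rparr>"

lemma cls_eq:
  assumes x: "x \<in> Dom M \<tau>" and y: "y \<in> Dom M \<tau>"
  shows "cls x = cls y \<longleftrightarrow> requal M \<tau> x y"
proof
  assume "cls x = cls y"
  then have "y \<in> cls x" using requal_refl[OF y] tyf[OF y] y by (simp add: cls_def)
  then show "requal M \<tau> x y" using tyf[OF x] by (simp add: cls_def)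
next
  assume e: "requal M \<tau> x y"
  have "requal M \<tau> x z \<longleftrightarrow> requal M \<tau> y z" if "z \<in> Dom M \<tau>" for z
    using requal_trans[OF x y that e] requal_trans[OF y x that requal_sym[OF x y e]] by blast
  then show "cls x = cls y" using tyf[OF x] tyf[OF y] by (auto simp: cls_def)
qed

lemma repr_cls: "x \<in> Dom M \<tau> \<Longrightarrow> repr (cls x) \<in> Dom M \<tau> \<and> requal M \<tau> x (repr (cls x))"
  unfolding repr_def using someI[of "\<lambda>y. y \<in> cls x" x] requal_refl[of x \<tau>] tyf[of x \<tau>] by (auto simp: cls_def)

text \<open>Extensionality moves the argument to its representative, pointwise equality moves the
  function.\<close>

lemma ap_quotient:
  assumes "f \<in> Dom M (\<sigma> \<rightarrow> \<tau>)" "x \<in> Dom M \<sigma>"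
  shows "ap quotient (cls f) (cls x) = cls (ap M f x)"
proof -
  note f = repr_cls[OF assms(1)] and x = repr_cls[OF assms(2)]
  have "requal M \<tau> (ap M f x) (ap M f (repr (cls x)))" using ext assms x by blast
  moreover have "requal M \<tau> (ap M f (repr (cls x))) (ap M (repr (cls f)) (repr (cls x)))"
    using f x by auto
  ultimately have "requal M \<tau> (ap M f x) (ap M (repr (cls f)) (repr (cls x)))"
    using requal_trans[of "ap M f x" \<tau>] ap_closed assms f x by blast
  then have "cls (ap M f x) = cls (ap M (repr (cls f)) (repr (cls x)))"
    using cls_eq[OF ap_closed[OF assms] ap_closed[of "repr (cls f)" \<sigma> \<tau> "repr (cls x)"]] f x by blast
  then show ?thesis by (simp add: quotient_def)
qed

lemma ext_interp_quotient: "ext_interp quotient"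
proof
  fix F X \<sigma> \<tau> assume "F \<in> Dom quotient (\<sigma> \<rightarrow> \<tau>)" "X \<in> Dom quotient \<sigma>"
  then obtain f x where "F = cls f" "X = cls x" "f \<in> Dom M (\<sigma> \<rightarrow> \<tau>)" "x \<in> Dom M \<sigma>"
    by (auto simp: quotient_def)
  then show "ap quotient F X \<in> Dom quotient \<tau>"
    using ap_quotient[of f \<sigma> \<tau> x] ap_closed by (auto simp: quotient_def)
next
  fix F G \<sigma> \<tau> assume "F \<in> Dom quotient (\<sigma> \<rightarrow> \<tau>)" "G \<in> Dom quotient (\<sigma> \<rightarrow> \<tau>)"
    and e: "\<And>X. X \<in> Dom quotient \<sigma> \<Longrightarrow> ap quotient F X = ap quotient G X"
  then obtain f g where fg: "F = cls f" "G = cls g" "f \<in> Dom M (\<sigma> \<rightarrow> \<tau>)" "g \<in> Dom M (\<sigma> \<rightarrow> \<tau>)"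
    by (auto simp: quotient_def)
  have "requal M \<tau> (ap M f x) (ap M g x)" if x: "x \<in> Dom M \<sigma>" for x
    using e[of "cls x"] x fg ap_quotient[of _ \<sigma> \<tau> x] cls_eq[of "ap M f x" \<tau> "ap M g x"] ap_closed[of _ \<sigma> \<tau> x]
    by (auto simp: quotient_def)
  then show "F = G" using fg cls_eq[of f "\<sigma> \<rightarrow> \<tau>" g] by auto
qed (auto simp: quotient_def con_closed)

lemma teval_quotient:
  "typed M \<Gamma> vs \<Longrightarrow> wt \<Gamma> t \<Longrightarrow> teval quotient (map cls vs) t = cls (teval M vs t)"
proof (induction t)
  case (App s t)
  then show ?case
    using teval_closed[of \<Gamma> vs s] teval_closed[of \<Gamma> vs t]
      ap_quotient[of "teval M vs s" "ty_of t" _ "teval M vs t"] by (auto split: ty.splits)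
qed (auto simp: quotient_def typed_def list_all2_conv_all_nth)

lemma feval_quotient:
  "typed M \<Gamma> vs \<Longrightarrow> wff \<Gamma> A \<Longrightarrow> feval quotient (map cls vs) A \<longleftrightarrow> feval M vs A"
proof (induction A arbitrary: \<Gamma> vs)
  case (Eq s t)
  then show ?case
    using teval_closed[of \<Gamma> vs s] teval_closed[of \<Gamma> vs t] cls_eq[of "teval M vs s" Ty0 "teval M vs t"]
    by (auto simp: teval_quotient) (auto simp: quotient_def)
next
  case (Less s t)
  define x y where "x = teval M vs s" and "y = teval M vs t"
  have xy: "x \<in> Dom M Ty0" "y \<in> Dom M Ty0"
    using teval_closed[of \<Gamma> vs s] teval_closed[of \<Gamma> vs t] Less by (auto simp: x_def y_def)
  note rx = repr_cls[OF xy(1)] and ry = repr_cls[OF xy(2)]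
  have "lss M (repr (cls x)) (repr (cls y)) \<longleftrightarrow> lss M x y"
  proof
    assume "lss M (repr (cls x)) (repr (cls y))"
    then show "lss M x y"
      by (rule lss_cong[rotated -1]) (use rx ry xy eqv_sym in auto)
  next
    assume "lss M x y"
    then show "lss M (repr (cls x)) (repr (cls y))"
      by (rule lss_cong[rotated -1]) (use rx ry xy in auto)
  qed
  then have "lss quotient (cls x) (cls y) \<longleftrightarrow> lss M x y" by (simp add: quotient_def)
  then show ?case using Less by (auto simp: teval_quotient x_def y_def)
next
  case (Imp A B)
  then show ?case using Imp.IH[of \<Gamma> vs] by auto
next
  case (All \<tau> A)
  have "feval quotient (map cls (x # vs)) A \<longleftrightarrow> feval M (x # vs) A" if "x \<in> Dom M \<tau>" for x
    by (rule All.IH[of "\<tau> # \<Gamma>"]) (use All.prems that in auto)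
  then show ?case by (simp add: quotient_def)
qed auto

end

text \<open>The extensionality axioms make \<open>requal\<close> a congruence, so the term model may
  be replaced by its quotient. Elements of the quotient are sets of terms, which is why models over
  \<open>tm set\<close> suffice.\<close>

theorem completeness:
  assumes A: "wff [] A" and T: "(\<lambda>P. P 0) ` extensionality_axioms \<subseteq> T"
    and models: "\<And>M :: tm set interp. ext_interp M \<Longrightarrow>
      (\<And>B. B \<in> T \<Longrightarrow> wff [] B \<Longrightarrow> feval M [] B) \<Longrightarrow> feval M [] A"
  shows "T \<turnstile> A"
proof (rule ccontr)
  assume n: "\<not> T \<turnstile> A"
  have "\<not> derives T [] [Neg A] Bot"
    using n derives.Raa[OF A, of T "[]"] by (auto simp: proves_def)
  then interpret henkin T "[Neg A]"
    by unfold_locales (use A in \<open>auto simp: good_stage_def\<close>)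
  interpret interp term_model by (rule interp_term_model)
  have ext: "requal term_model \<tau> (ap term_model \<phi> x) (ap term_model \<phi> y)"
    if "\<phi> \<in> Dom term_model (\<rho> \<rightarrow> \<tau>)" "x \<in> Dom term_model \<rho>" "y \<in> Dom term_model \<rho>"
      "requal term_model \<rho> x y" for \<phi> x y \<rho> \<tau>
  proof -
    let ?P = "hall \<rho> (\<lambda>x. hall \<rho> (\<lambda>y. hall (\<rho> \<rightarrow> \<tau>) (\<lambda>\<phi>. heqT \<rho> x y \<^bold>\<longrightarrow> heqT \<tau> (\<phi> \<cdot> x) (\<phi> \<cdot> y))))"
    have s: "sat term_model [] [] ?P
      (\<forall>x\<in>Dom term_model \<rho>. \<forall>y\<in>Dom term_model \<rho>. \<forall>\<phi>\<in>Dom term_model (\<rho> \<rightarrow> \<tau>).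
         requal term_model \<rho> x y \<longrightarrow> requal term_model \<tau> (ap term_model \<phi> x) (ap term_model \<phi> y))"
      by (intro sat_all sat_imp sat_heqT den_app[where \<sigma>=\<rho>]) (blast intro: den_lift)+
    have "?P 0 \<in> T" using T by (auto simp: extensionality_axioms_def)
    then have "feval term_model [] (?P 0)"
      using sat_sentence[OF s] holds_axiom truth_closed by blast
    with sat_sentence(2)[OF s] that show ?thesis by blast
  qed
  interpret ext_quotient term_model ty_of
  proof
    fix x x' y y' assume d: "x \<in> Dom term_model Ty0" "x' \<in> Dom term_model Ty0" "y \<in> Dom term_model Ty0"
      "y' \<in> Dom term_model Ty0" and e: "eqv term_model x x'" "eqv term_model y y'" "lss term_model x y"
    show "lss term_model x' y'"
      using eqv_term_model(4)[OF d(1,2,3) e(1,3)] eqv_term_model(5)[OF d(3,4,2) e(2)] by blast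
  next
    show "ty_of x = \<tau>" if "x \<in> Dom term_model \<tau>" for x \<tau> using that by (simp add: term_model_def)
  qed (use ext eqv_term_model in blast)+
  have "feval quotient [] A"
  proof (rule models[OF ext_interp_quotient])
    fix B assume B: "B \<in> T" "wff [] B"
    then have "feval term_model [] B" using holds_axiom truth_closed by blast
    then show "feval quotient [] B" using feval_quotient[of "[]" "[]" B] B by simp
  qed
  then have "holds A" using feval_quotient[of "[]" "[]" A] truth_closed A by simp
  moreover have "holds (Neg A)" unfolding holds_def hyps_def by (rule exI[of _ 0]) simp
  ultimately show False
    using holds_Imp[of A Bot] not_holds_Bot A wff_append[of "[]" "Neg A" "ctx 0"] by (auto simp: wffm_def)
qed

section \<open>Models of the base theory\<close>

lemma quantifier_free_fsub [simp]: "quantifier_free (fsub \<theta> A) = quantifier_free A"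
  by (induction A arbitrary: \<theta>) auto

locale rca = ext_interp M for M :: "'a interp" +
  assumes RCA: "A \<in> RCA0_omega \<Longrightarrow> wff [] A \<Longrightarrow> feval M [] A"
begin

abbreviation N :: "'a set" where "N \<equiv> Dom M Ty0"
abbreviation zr :: 'a where "zr \<equiv> con M Zero"
abbreviation on :: 'a where "on \<equiv> con M One"
abbreviation pl :: "'a \<Rightarrow> 'a \<Rightarrow> 'a"  (infixl "\<oplus>" 65) where "x \<oplus> y \<equiv> ap M (ap M (con M Plus) x) y"
abbreviation mu :: "'a \<Rightarrow> 'a \<Rightarrow> 'a"  (infixl "\<otimes>" 70) where "x \<otimes> y \<equiv> ap M (ap M (con M Times) x) y"
abbreviation ls :: "'a \<Rightarrow> 'a \<Rightarrow> bool"  (infix "\<prec>" 50) where "x \<prec> y \<equiv> lss M x y"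
abbreviation le :: "'a \<Rightarrow> 'a \<Rightarrow> bool"  (infix "\<preceq>" 50) where "x \<preceq> y \<equiv> x \<prec> y \<or> x = y"
abbreviation K where "K \<sigma> \<tau> \<equiv> con M (CombK \<sigma> \<tau>)"
abbreviation S where "S \<rho> \<sigma> \<tau> \<equiv> con M (CombS \<rho> \<sigma> \<tau>)"

lemma den_cst': "\<tau> = cty c \<Longrightarrow> den M R C (hcst c) \<tau> (con M c)"
  using den_cst by metis

lemma sat_eq' [den_intros]:
  "den M R C s Ty0 x \<Longrightarrow> den M R C t Ty0 y \<Longrightarrow> sat M R C (s \<^bold>= t) (x = y)"
  using sat_eq eqv_eq by metis

lemmas [den_intros] = sat_less

lemma den_zero: "den M R C \<^bold>0 Ty0 zr"
  and den_one: "den M R C \<^bold>1 Ty0 on"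
  unfolding hzero_def hone_def using den_cst[of M R C Zero] den_cst[of M R C One] by simp_all

lemma den_plus: "den M R C s Ty0 x \<Longrightarrow> den M R C t Ty0 y \<Longrightarrow> den M R C (s \<^bold>+ t) Ty0 (x \<oplus> y)"
  and den_times: "den M R C s Ty0 x \<Longrightarrow> den M R C t Ty0 y \<Longrightarrow> den M R C (s \<^bold>* t) Ty0 (x \<otimes> y)"
  unfolding hplus_def htimes_def by (auto intro!: den_app den_cst')

lemma axiom: "P 0 \<in> RCA0_omega \<Longrightarrow> sat M [] [] P b \<Longrightarrow> b"
  using RCA sat_sentence by blast

lemmas rca_intros = den_intros den_zero den_one den_plus den_times

lemma basic:
  "\<forall>m\<in>N. \<not> m \<oplus> on = zr"
  "\<forall>m\<in>N. \<forall>n\<in>N. m \<oplus> on = n \<oplus> on \<longrightarrow> m = n"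
  "\<forall>m\<in>N. m \<oplus> zr = m"
  "\<forall>m\<in>N. \<forall>n\<in>N. m \<oplus> (n \<oplus> on) = (m \<oplus> n) \<oplus> on"
  "\<forall>m\<in>N. m \<otimes> zr = zr"
  "\<forall>m\<in>N. \<forall>n\<in>N. m \<otimes> (n \<oplus> on) = m \<otimes> n \<oplus> m"
  "\<forall>m\<in>N. \<not> m \<prec> zr"
  "\<forall>m\<in>N. \<forall>n\<in>N. m \<prec> n \<oplus> on \<longleftrightarrow> (m \<prec> n \<or> m = n)"
proof -
  show "\<forall>m\<in>N. \<not> m \<oplus> on = zr"
    by (rule axiom[of "\<^bold>\<forall>\<^sub>0 m. \<^bold>\<not> (m \<^bold>+ \<^bold>1 \<^bold>= \<^bold>0)"])
       (simp add: RCA0_omega_def basic_axioms_def, (intro sat_all rca_intros; (assumption | erule den_lift)+))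
  show "\<forall>m\<in>N. \<forall>n\<in>N. m \<oplus> on = n \<oplus> on \<longrightarrow> m = n"
    by (rule axiom[of "\<^bold>\<forall>\<^sub>0 m. \<^bold>\<forall>\<^sub>0 n. m \<^bold>+ \<^bold>1 \<^bold>= n \<^bold>+ \<^bold>1 \<^bold>\<longrightarrow> m \<^bold>= n"])
       (simp add: RCA0_omega_def basic_axioms_def, (intro sat_all rca_intros; (assumption | erule den_lift)+))
  show "\<forall>m\<in>N. m \<oplus> zr = m"
    by (rule axiom[of "\<^bold>\<forall>\<^sub>0 m. m \<^bold>+ \<^bold>0 \<^bold>= m"])
       (simp add: RCA0_omega_def basic_axioms_def, (intro sat_all rca_intros; (assumption | erule den_lift)+))
  show "\<forall>m\<in>N. \<forall>n\<in>N. m \<oplus> (n \<oplus> on) = (m \<oplus> n) \<oplus> on"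
    by (rule axiom[of "\<^bold>\<forall>\<^sub>0 m. \<^bold>\<forall>\<^sub>0 n. m \<^bold>+ (n \<^bold>+ \<^bold>1) \<^bold>= (m \<^bold>+ n) \<^bold>+ \<^bold>1"])
       (simp add: RCA0_omega_def basic_axioms_def, (intro sat_all rca_intros; (assumption | erule den_lift)+))
  show "\<forall>m\<in>N. m \<otimes> zr = zr"
    by (rule axiom[of "\<^bold>\<forall>\<^sub>0 m. m \<^bold>* \<^bold>0 \<^bold>= \<^bold>0"])
       (simp add: RCA0_omega_def basic_axioms_def, (intro sat_all rca_intros; (assumption | erule den_lift)+))
  show "\<forall>m\<in>N. \<forall>n\<in>N. m \<otimes> (n \<oplus> on) = m \<otimes> n \<oplus> m"
    by (rule axiom[of "\<^bold>\<forall>\<^sub>0 m. \<^bold>\<forall>\<^sub>0 n. m \<^bold>* (n \<^bold>+ \<^bold>1) \<^bold>= m \<^bold>* n \<^bold>+ m"])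
       (simp add: RCA0_omega_def basic_axioms_def, (intro sat_all rca_intros; (assumption | erule den_lift)+))
  show "\<forall>m\<in>N. \<not> m \<prec> zr"
    by (rule axiom[of "\<^bold>\<forall>\<^sub>0 m. \<^bold>\<not> (m \<^bold>< \<^bold>0)"])
       (simp add: RCA0_omega_def basic_axioms_def, (intro sat_all rca_intros; (assumption | erule den_lift)+))
  show "\<forall>m\<in>N. \<forall>n\<in>N. m \<prec> n \<oplus> on \<longleftrightarrow> (m \<prec> n \<or> m = n)"
    by (rule axiom[of "\<^bold>\<forall>\<^sub>0 m. \<^bold>\<forall>\<^sub>0 n. m \<^bold>< n \<^bold>+ \<^bold>1 \<^bold>\<longleftrightarrow> (m \<^bold>< n \<^bold>\<or> m \<^bold>= n)"])
       (simp add: RCA0_omega_def basic_axioms_def, (intro sat_all rca_intros; (assumption | erule den_lift)+))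
qed

lemma combK: 
  assumes "x \<in> Dom M \<sigma>" "y \<in> Dom M \<tau>" shows "ap M (ap M (K \<sigma> \<tau>) x) y = x"
proof -
  have "\<forall>x\<in>Dom M \<sigma>. \<forall>y\<in>Dom M \<tau>. requal M \<sigma> (ap M (ap M (K \<sigma> \<tau>) x) y) x"
    by (rule axiom[of "hall \<sigma> (\<lambda>x. hall \<tau> (\<lambda>y. heqT \<sigma> (hcst (CombK \<sigma> \<tau>) \<cdot> x \<cdot> y) x))"])
       (use combinator_axioms_def RCA0_omega_def in force,
        (intro sat_all sat_heqT den_app[where \<sigma>=\<tau>] den_app[where \<sigma>=\<sigma> and \<tau>="\<tau> \<rightarrow> \<sigma>"] den_cst'; (assumption | erule den_lift | simp)+))
  then show ?thesis
    using assms requal_eq[of "ap M (ap M (K \<sigma> \<tau>) x) y" \<sigma> x] con_closed[of "CombK \<sigma> \<tau>"]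
    by (auto intro: ap_closed)
qed

lemma combS:
  assumes "x \<in> Dom M (\<rho> \<rightarrow> \<sigma> \<rightarrow> \<tau>)" "y \<in> Dom M (\<rho> \<rightarrow> \<sigma>)" "z \<in> Dom M \<rho>"
  shows "ap M (ap M (ap M (S \<rho> \<sigma> \<tau>) x) y) z = ap M (ap M x z) (ap M y z)"
proof -
  have "\<forall>x\<in>Dom M (\<rho> \<rightarrow> \<sigma> \<rightarrow> \<tau>). \<forall>y\<in>Dom M (\<rho> \<rightarrow> \<sigma>). \<forall>z\<in>Dom M \<rho>.
    requal M \<tau> (ap M (ap M (ap M (S \<rho> \<sigma> \<tau>) x) y) z) (ap M (ap M x z) (ap M y z))"
    by (rule axiom[of "hall (\<rho> \<rightarrow> \<sigma> \<rightarrow> \<tau>) (\<lambda>x. hall (\<rho> \<rightarrow> \<sigma>) (\<lambda>y. hall \<rho> (\<lambda>z.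
       heqT \<tau> (hcst (CombS \<rho> \<sigma> \<tau>) \<cdot> x \<cdot> y \<cdot> z) (x \<cdot> z \<cdot> (y \<cdot> z)))))"])
       (use combinator_axioms_def RCA0_omega_def in force,
        (intro sat_all sat_heqT;
          (rule den_app den_cst' | assumption | erule den_lift extends_trans | simp)+))
  then show ?thesis
    using assms requal_eq[of "ap M (ap M (ap M (S \<rho> \<sigma> \<tau>) x) y) z" \<tau> "ap M (ap M x z) (ap M y z)"] con_closed[of "CombS \<rho> \<sigma> \<tau>"]
    by (auto intro: ap_closed)
qed

abbreviation Rc :: "'a \<Rightarrow> 'a \<Rightarrow> 'a \<Rightarrow> 'a" where "Rc f m n \<equiv> ap M (ap M (ap M (con M Rec0) f) m) n"

lemma recursor:
  assumes "f \<in> Dom M (Ty0 \<rightarrow> Ty0 \<rightarrow> Ty0)" "m \<in> N"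
  shows "Rc f m zr = m"
    and "n \<in> N \<Longrightarrow> Rc f m (n \<oplus> on) = ap M (ap M f n) (Rc f m n)"
proof -
  have "\<forall>f\<in>Dom M (Ty0 \<rightarrow> Ty0 \<rightarrow> Ty0). \<forall>m\<in>N. Rc f m zr = m"
    by (rule axiom[of "hall (Ty0 \<rightarrow> Ty0 \<rightarrow> Ty0) (\<lambda>f. \<^bold>\<forall>\<^sub>0 m. hcst Rec0 \<cdot> f \<cdot> m \<cdot> \<^bold>0 \<^bold>= m)"])
       (simp add: RCA0_omega_def recursor_axioms_def, (intro sat_all rca_intros;
          (rule den_app den_cst' den_zero | assumption | erule den_lift extends_trans | simp)+))
  then show "Rc f m zr = m" using assms by blast
  have "\<forall>f\<in>Dom M (Ty0 \<rightarrow> Ty0 \<rightarrow> Ty0). \<forall>m\<in>N. \<forall>n\<in>N. Rc f m (n \<oplus> on) = ap M (ap M f n) (Rc f m n)"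
    by (rule axiom[of "hall (Ty0 \<rightarrow> Ty0 \<rightarrow> Ty0) (\<lambda>f. \<^bold>\<forall>\<^sub>0 m. \<^bold>\<forall>\<^sub>0 n.
       hcst Rec0 \<cdot> f \<cdot> m \<cdot> (n \<^bold>+ \<^bold>1) \<^bold>= f \<cdot> n \<cdot> (hcst Rec0 \<cdot> f \<cdot> m \<cdot> n))"])
       (simp add: RCA0_omega_def recursor_axioms_def, (intro sat_all rca_intros;
          (rule den_plus den_one | rule den_app den_cst' | assumption | erule den_lift extends_trans | simp)+))
  then show "n \<in> N \<Longrightarrow> Rc f m (n \<oplus> on) = ap M (ap M f n) (Rc f m n)" using assms by blast
qed

lemma N_closed [simp, intro]: "zr \<in> N" "on \<in> N" "x \<in> N \<Longrightarrow> y \<in> N \<Longrightarrow> x \<oplus> y \<in> N"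
  "x \<in> N \<Longrightarrow> y \<in> N \<Longrightarrow> x \<otimes> y \<in> N"
  using con_closed[of Zero] con_closed[of One] con_closed[of Plus] con_closed[of Times]
  by (auto intro: ap_closed)

lemma K_closed: "K \<sigma> \<tau> \<in> Dom M (\<sigma> \<rightarrow> \<tau> \<rightarrow> \<sigma>)"
  and S_closed: "S \<rho> \<sigma> \<tau> \<in> Dom M ((\<rho> \<rightarrow> \<sigma> \<rightarrow> \<tau>) \<rightarrow> (\<rho> \<rightarrow> \<sigma>) \<rightarrow> \<rho> \<rightarrow> \<tau>)"
  and Rec_closed: "con M Rec0 \<in> Dom M ((Ty0 \<rightarrow> Ty0 \<rightarrow> Ty0) \<rightarrow> Ty0 \<rightarrow> Ty0 \<rightarrow> Ty0)"
  and Plus_closed: "con M Plus \<in> Dom M (Ty0 \<rightarrow> Ty0 \<rightarrow> Ty0)"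
  and Times_closed: "con M Times \<in> Dom M (Ty0 \<rightarrow> Ty0 \<rightarrow> Ty0)"
  using con_closed[of "CombK \<sigma> \<tau>"] con_closed[of "CombS \<rho> \<sigma> \<tau>"] con_closed[of Rec0]
    con_closed[of Plus] con_closed[of Times] by simp_all

subsection \<open>Representable functions\<close>

definition rep :: "ty \<Rightarrow> ty \<Rightarrow> ('a \<Rightarrow> 'a) \<Rightarrow> bool" where
  "rep \<sigma> \<tau> g \<longleftrightarrow> (\<exists>f \<in> Dom M (\<sigma> \<rightarrow> \<tau>). \<forall>x \<in> Dom M \<sigma>. ap M f x = g x)"

text \<open>Extensionality makes the representing element unique.\<close>

definition lam :: "ty \<Rightarrow> ty \<Rightarrow> ('a \<Rightarrow> 'a) \<Rightarrow> 'a" where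
  "lam \<sigma> \<tau> g = (THE f. f \<in> Dom M (\<sigma> \<rightarrow> \<tau>) \<and> (\<forall>x \<in> Dom M \<sigma>. ap M f x = g x))"

lemma lam_eq: "f \<in> Dom M (\<sigma> \<rightarrow> \<tau>) \<Longrightarrow> (\<And>x. x \<in> Dom M \<sigma> \<Longrightarrow> ap M f x = g x) \<Longrightarrow> lam \<sigma> \<tau> g = f"
  unfolding lam_def by (rule the_equality, blast, rule extensional[of _ \<sigma> \<tau>]) simp_all

lemma lam:
  assumes "rep \<sigma> \<tau> g"
  shows "lam \<sigma> \<tau> g \<in> Dom M (\<sigma> \<rightarrow> \<tau>)" "x \<in> Dom M \<sigma> \<Longrightarrow> ap M (lam \<sigma> \<tau> g) x = g x"
proof -
  obtain f where f: "f \<in> Dom M (\<sigma> \<rightarrow> \<tau>)" "\<forall>x\<in>Dom M \<sigma>. ap M f x = g x"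
    using assms unfolding rep_def by blast
  then have "lam \<sigma> \<tau> g = f" by (intro lam_eq) auto
  with f show "lam \<sigma> \<tau> g \<in> Dom M (\<sigma> \<rightarrow> \<tau>)" "x \<in> Dom M \<sigma> \<Longrightarrow> ap M (lam \<sigma> \<tau> g) x = g x" by auto
qed

lemma rep_const: "c \<in> Dom M \<tau> \<Longrightarrow> rep \<sigma> \<tau> (\<lambda>_. c)"
  unfolding rep_def
  by (rule bexI[of _ "ap M (K \<tau> \<sigma>) c"]) (simp_all add: combK ap_closed[OF K_closed])

lemma rep_app:
  assumes "rep \<sigma> (\<rho> \<rightarrow> \<tau>) f" "rep \<sigma> \<rho> g" shows "rep \<sigma> \<tau> (\<lambda>x. ap M (f x) (g x))"
proof -
  obtain F G where F: "F \<in> Dom M (\<sigma> \<rightarrow> \<rho> \<rightarrow> \<tau>)" "\<forall>x\<in>Dom M \<sigma>. ap M F x = f x"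
    and G: "G \<in> Dom M (\<sigma> \<rightarrow> \<rho>)" "\<forall>x\<in>Dom M \<sigma>. ap M G x = g x"
    using assms unfolding rep_def by blast
  show ?thesis
    unfolding rep_def
    by (rule bexI[OF _ ap_closed[OF ap_closed[OF S_closed F(1)] G(1)]]) (simp add: combS[OF F(1) G(1)] F(2) G(2))
qed

lemma rep_fun: "f \<in> Dom M (\<sigma> \<rightarrow> \<tau>) \<Longrightarrow> rep \<sigma> \<tau> (ap M f)"
  unfolding rep_def by blast

lemma rep_id: "rep \<sigma> \<sigma> (\<lambda>x. x)"
proof -
  let ?I = "ap M (ap M (S \<sigma> (\<sigma> \<rightarrow> \<sigma>) \<sigma>) (K \<sigma> (\<sigma> \<rightarrow> \<sigma>))) (K \<sigma> \<sigma>)"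
  have "?I \<in> Dom M (\<sigma> \<rightarrow> \<sigma>)" by (rule ap_closed[OF ap_closed[OF S_closed K_closed] K_closed])
  moreover have "ap M ?I x = x" if "x \<in> Dom M \<sigma>" for x
    using combS[OF K_closed K_closed that] combK[OF that ap_closed[OF K_closed that]] by simp
  ultimately show ?thesis unfolding rep_def by blast
qed

lemma rep_plus: "rep \<sigma> Ty0 f \<Longrightarrow> rep \<sigma> Ty0 g \<Longrightarrow> rep \<sigma> Ty0 (\<lambda>x. f x \<oplus> g x)"
  and rep_times: "rep \<sigma> Ty0 f \<Longrightarrow> rep \<sigma> Ty0 g \<Longrightarrow> rep \<sigma> Ty0 (\<lambda>x. f x \<otimes> g x)"
  by (rule rep_app[where \<rho>=Ty0], rule rep_app[where \<rho>=Ty0], rule rep_const, rule Plus_closed Times_closed, assumption+)+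

lemmas rep_intros = rep_plus rep_times rep_id rep_const N_closed

lemma bracket_no_occurs:
  "\<not> occurs0 t \<Longrightarrow> wt (\<tau> # \<Gamma>) t \<Longrightarrow> wt \<Gamma> (tsub (\<lambda>n \<rho>. Var (n - 1) \<rho>) t) \<and>
     ty_of (tsub (\<lambda>n \<rho>. Var (n - 1) \<rho>) t) = ty_of t \<and>
     teval M vs (tsub (\<lambda>n \<rho>. Var (n - 1) \<rho>) t) = teval M (x # vs) t"
  by (induction t) (auto simp: nth_Cons split: nat.splits ty.splits)

lemma bracket:
  assumes "wt (\<tau> # \<Gamma>) t"
  shows "wt \<Gamma> (bracket \<tau> t)" "ty_of (bracket \<tau> t) = (\<tau> \<rightarrow> ty_of t)"
    "typed M \<Gamma> vs \<Longrightarrow> x \<in> Dom M \<tau> \<Longrightarrow> ap M (teval M vs (bracket \<tau> t)) x = teval M (x # vs) t"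
proof -
  have "wt \<Gamma> (bracket \<tau> t) \<and> ty_of (bracket \<tau> t) = (\<tau> \<rightarrow> ty_of t) \<and>
    (typed M \<Gamma> vs \<longrightarrow> x \<in> Dom M \<tau> \<longrightarrow> ap M (teval M vs (bracket \<tau> t)) x = teval M (x # vs) t)"
    using assms
  proof (induction t)
    case (Var n \<rho>)
    show ?case
    proof (cases n)
      case 0
      then show ?thesis using Var
        by (auto simp: combS[OF K_closed K_closed] combK[OF _ ap_closed[OF K_closed]])
    next
      case (Suc m)
      then show ?thesis using Var by (auto simp: combK typed_def list_all2_conv_all_nth)
    qed
  next
    case (Cst c)
    then show ?case by (auto simp: combK con_closed)
  next
    case (App s t)
    then obtain \<sigma> where s: "ty_of s = (ty_of t \<rightarrow> \<sigma>)" and w: "wt (\<tau> # \<Gamma>) s" "wt (\<tau> # \<Gamma>) t"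
      by (auto split: ty.splits)
    show ?case
    proof (cases "occurs0 (App s t)")
      case True
      have "teval M vs (bracket \<tau> s) \<in> Dom M (\<tau> \<rightarrow> ty_of t \<rightarrow> \<sigma>)" "teval M vs (bracket \<tau> t) \<in> Dom M (\<tau> \<rightarrow> ty_of t)"
        if "typed M \<Gamma> vs"
        using teval_closed[OF that, of "bracket \<tau> s"] teval_closed[OF that, of "bracket \<tau> t"] App.IH w s by auto
      then show ?thesis using True App.IH w s by (auto simp: combS)
    next
      case False
      have "typed M \<Gamma> vs \<Longrightarrow> teval M vs (tsub (\<lambda>n \<rho>. Var (n - 1) \<rho>) (App s t)) \<in> Dom M (ty_of (App s t))"
        using teval_closed[of \<Gamma> vs] bracket_no_occurs[OF False App.prems] by metis
      then show ?thesis using False bracket_no_occurs[OF False App.prems, of vs x]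
        by (simp add: combK del: tsub.simps wt.simps ty_of.simps occurs0.simps(3)) simp
    qed
  qed
  then show "wt \<Gamma> (bracket \<tau> t)" "ty_of (bracket \<tau> t) = (\<tau> \<rightarrow> ty_of t)"
    "typed M \<Gamma> vs \<Longrightarrow> x \<in> Dom M \<tau> \<Longrightarrow> ap M (teval M vs (bracket \<tau> t)) x = teval M (x # vs) t"
    by blast+
qed

text \<open>The second claim asks for some extension \<open>C0\<close> of the context, since
  otherwise the assumption about extensions could be vacuous.\<close>

lemma den_lam0:
  assumes "\<And>C' n t. extends M R C C' \<Longrightarrow> n \<in> N \<Longrightarrow> den M R C' t Ty0 n \<Longrightarrow> den M R C' (F t) \<tau> (g n)"
  shows "den M R C (hlam0 F) (Ty0 \<rightarrow> \<tau>) (lam Ty0 \<tau> g)"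
    and "extends M R C C0 \<Longrightarrow> rep Ty0 \<tau> g"
proof -
  have *: "wt (map fst (C' @ R)) (hlam0 F (length C')) \<and> ty_of (hlam0 F (length C')) = (Ty0 \<rightarrow> \<tau>) \<and>
      (\<forall>n \<in> N. ap M (teval M (map snd (C' @ R)) (hlam0 F (length C'))) n = g n)"
    if C': "extends M R C C'" for C'
  proof -
    let ?t = "F (hvar Ty0 (length C')) (Suc (length C'))"
    have s: "wt (Ty0 # map fst (C' @ R)) ?t \<and> ty_of ?t = \<tau> \<and> teval M (n # map snd (C' @ R)) ?t = g n"
      if n: "n \<in> N" for n
    proof -
      have e: "extends M R C ((Ty0, n) # C')" "extends M R ((Ty0, n) # C') ((Ty0, n) # C')"
        using C' n by (auto simp: extends_def well_typed_def)
      from assms[OF e(1) n den_hvar[OF n]] e(2) show ?thesis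
        unfolding den_def by fastforce
    qed
    have ty: "typed M (map fst (C' @ R)) (map snd (C' @ R))"
      using C' by (intro well_typed_typed) (simp add: extends_def)
    show ?thesis
      using bracket[of Ty0 "map fst (C' @ R)" ?t] s[of zr] s ty by (auto simp: hlam0_def)
  qed
  have r: "teval M (map snd (C' @ R)) (hlam0 F (length C')) \<in> Dom M (Ty0 \<rightarrow> \<tau>)"
    if C': "extends M R C C'" for C'
    using *[OF C'] teval_closed[OF well_typed_typed, of "C' @ R" "hlam0 F (length C')"] C'
    by (auto simp: extends_def)
  show "den M R C (hlam0 F) (Ty0 \<rightarrow> \<tau>) (lam Ty0 \<tau> g)"
    unfolding den_def
  proof (intro allI impI)
    fix C' assume C': "extends M R C C'"
    have "lam Ty0 \<tau> g = teval M (map snd (C' @ R)) (hlam0 F (length C'))"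
      by (rule lam_eq) (use r[OF C'] *[OF C'] in auto)
    then show "wt (map fst (C' @ R)) (hlam0 F (length C')) \<and> ty_of (hlam0 F (length C')) = (Ty0 \<rightarrow> \<tau>) \<and>
        teval M (map snd (C' @ R)) (hlam0 F (length C')) = lam Ty0 \<tau> g" using *[OF C'] by auto
  qed
  show "rep Ty0 \<tau> g" if "extends M R C C0"
    unfolding rep_def using *[OF that] r[OF that] by blast
qed

subsection \<open>Quantifier-free induction and choice\<close>

text \<open>The predicates on numbers to which the axiom of quantifier-free induction applies, with
  parameters of arbitrary type.\<close>

definition qfp :: "('a \<Rightarrow> bool) \<Rightarrow> bool" where
  "qfp P \<longleftrightarrow> (\<exists>\<Gamma> vs A. wff (Ty0 # \<Gamma>) A \<and> quantifier_free A \<and> typed M \<Gamma> vs \<and>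
     (\<forall>n \<in> N. feval M (n # vs) A = P n))"

lemma sat_induction:
  assumes "wff (Ty0 # map fst R) A"
  shows "sat M R [] (induction A) (feval M (zr # map snd R) A \<and>
    (\<forall>n\<in>N. feval M (n # map snd R) A \<longrightarrow> feval M ((n \<oplus> on) # map snd R) A) \<longrightarrow> (\<forall>n\<in>N. feval M (n # map snd R) A))"
proof -
  have p: "sat M R C (A\<langle>[t]\<rangle>) (feval M (n # map snd R) A)" if "den M R C t Ty0 n" for C t n
    using sat_plug[of "[Ty0]" R A "[t]" "[n]" C] assms that by simp
  show ?thesis
    unfolding induction_def
    by (intro sat_imp sat_conj sat_all p den_plus den_zero den_one; assumption)
qed

lemma feval_induction:
  assumes ax: "feval M [] (closure \<Gamma> (induction A 0))" and A: "wff (Ty0 # \<Gamma>) A" and vs: "typed M \<Gamma> vs"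
    and "feval M (zr # vs) A" "\<And>n. n \<in> N \<Longrightarrow> feval M (n # vs) A \<Longrightarrow> feval M ((n \<oplus> on) # vs) A" "n \<in> N"
  shows "feval M (n # vs) A"
  using models_closure[OF ax typed_well_typed(1)[OF vs] _ sat_induction] typed_well_typed[OF vs] A assms(4-)
  by auto

lemma qf_induct:
  assumes "qfp P" and 0: "P zr" and Suc: "\<And>n. n \<in> N \<Longrightarrow> P n \<Longrightarrow> P (n \<oplus> on)" and n: "n \<in> N"
  shows "P n"
proof -
  obtain \<Gamma> vs A where A: "wff (Ty0 # \<Gamma>) A" "quantifier_free A" and vs: "typed M \<Gamma> vs"
    and P: "\<And>n. n \<in> N \<Longrightarrow> feval M (n # vs) A = P n"
    using assms(1) by (auto simp: qfp_def)
  have w: "wff \<Gamma> (induction A 0)"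
    using sat_schema(1)[OF sat_induction typed_well_typed(1)[OF vs], of A] typed_well_typed[OF vs] A by simp
  have "closure \<Gamma> (induction A 0) \<in> RCA0_omega" using A by (auto simp: RCA0_omega_def QF_IND_def)
  then have "feval M [] (closure \<Gamma> (induction A 0))" using RCA w by (simp add: wff_closure)
  from feval_induction[OF this A(1) vs] show ?thesis using P 0 Suc n by auto
qed

lemma qfp_eq: "rep Ty0 Ty0 f \<Longrightarrow> rep Ty0 Ty0 g \<Longrightarrow> qfp (\<lambda>n. f n = g n)"
  and qfp_less: "rep Ty0 Ty0 f \<Longrightarrow> rep Ty0 Ty0 g \<Longrightarrow> qfp (\<lambda>n. f n \<prec> g n)"
proof -
  assume "rep Ty0 Ty0 f" "rep Ty0 Ty0 g"
  then obtain x y where xy: "x \<in> Dom M Ty1" "y \<in> Dom M Ty1"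
    "\<forall>n\<in>N. ap M x n = f n" "\<forall>n\<in>N. ap M y n = g n"
    unfolding rep_def by blast
  show "qfp (\<lambda>n. f n = g n)"
    unfolding qfp_def
    by (rule exI[of _ "[Ty1, Ty1]"], rule exI[of _ "[x, y]"],
      rule exI[of _ "Eq (App (Var 1 Ty1) (Var 0 Ty0)) (App (Var 2 Ty1) (Var 0 Ty0))"]) (simp add: xy eqv_eq)
  show "qfp (\<lambda>n. f n \<prec> g n)"
    unfolding qfp_def
    by (rule exI[of _ "[Ty1, Ty1]"], rule exI[of _ "[x, y]"],
      rule exI[of _ "Less (App (Var 1 Ty1) (Var 0 Ty0)) (App (Var 2 Ty1) (Var 0 Ty0))"]) (simp add: xy)
qed

lemma qfp_False: "qfp (\<lambda>n. False)"
  unfolding qfp_def by (rule exI[of _ "[]"], rule exI[of _ "[]"], rule exI[of _ Bot]) simp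

lemma qfp_imp:
  assumes "qfp P" "qfp Q" shows "qfp (\<lambda>n. P n \<longrightarrow> Q n)"
proof -
  obtain \<Gamma> vs A where A: "wff (Ty0 # \<Gamma>) A" "quantifier_free A" and vs: "typed M \<Gamma> vs"
    and P: "\<And>n. n \<in> N \<Longrightarrow> feval M (n # vs) A = P n" using assms(1) by (auto simp: qfp_def)
  obtain \<Delta> us B where B: "wff (Ty0 # \<Delta>) B" "quantifier_free B" and us: "typed M \<Delta> us"
    and Q: "\<And>n. n \<in> N \<Longrightarrow> feval M (n # us) B = Q n" using assms(2) by (auto simp: qfp_def)
  have l: "length vs = length \<Gamma>" "length us = length \<Delta>" using vs us by (auto simp: typed_def list_all2_iff)
  \<comment> \<open>The parameters of \<open>B\<close> move behind those of \<open>A\<close>, while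
    index 0, the induction variable, stays shared.\<close>
  let ?\<theta> = "\<lambda>n \<tau>. if n = 0 then Var 0 \<tau> else Var (n + length \<Gamma>) \<tau>"
  have "subst_typed (Ty0 # \<Gamma> @ \<Delta>) ?\<theta> (Ty0 # \<Delta>)"
    by (auto simp: subst_typed_def nth_Cons nth_append split: nat.split)
  then have wB: "wff (Ty0 # \<Gamma> @ \<Delta>) (fsub ?\<theta> B)" using B(1) wff_fsub by blast
  have "map (\<lambda>i. teval M (n # vs @ us) (?\<theta> i ((Ty0 # \<Delta>) ! i))) [0..<length (Ty0 # \<Delta>)] = n # us" for n
    by (rule nth_equalityI) (use l in \<open>auto simp: nth_Cons nth_append simp del: upt_Suc split: nat.split\<close>)
  then have "feval M (n # vs @ us) (fsub ?\<theta> B) = feval M (n # us) B" for n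
    using feval_fsub[OF B(1), of M "n # vs @ us" ?\<theta>] by simp
  moreover have "feval M (n # vs @ us) A = feval M (n # vs) A" for n
    using feval_append[OF A(1), of "n # vs" M us] l by simp
  ultimately show ?thesis
    unfolding qfp_def using A B wB P Q wff_append[OF A(1), of \<Delta>] vs us
    by (intro exI[of _ "\<Gamma> @ \<Delta>"] exI[of _ "vs @ us"] exI[of _ "Imp A (fsub ?\<theta> B)"])
       (auto simp: typed_def list_all2_appendI)
qed

lemma qfp_not: "qfp P \<Longrightarrow> qfp (\<lambda>n. \<not> P n)"
  using qfp_imp[OF _ qfp_False, of P] by simp

lemma qfp_disj: "qfp P \<Longrightarrow> qfp Q \<Longrightarrow> qfp (\<lambda>n. P n \<or> Q n)"
  using qfp_imp[OF qfp_not, of P Q] by (simp add: disj_imp)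

lemmas qfp_intros = qfp_eq qfp_less qfp_imp qfp_not qfp_disj rep_intros

text \<open>An equation with one functional parameter is general enough, because decidable
  conditions will be represented by their characteristic functions.\<close>

lemma QF_AC:
  assumes Y: "Y \<in> Dom M (Ty1 \<rightarrow> Ty0 \<rightarrow> Ty0)" and ex: "\<And>x. x \<in> Dom M Ty1 \<Longrightarrow> \<exists>n\<in>N. ap M (ap M Y x) n = zr"
  shows "\<exists>Z\<in>Dom M (Ty1 \<rightarrow> Ty0). \<forall>x\<in>Dom M Ty1. ap M (ap M Y x) (ap M Z x) = zr"
proof -
  let ?A = "Eq (App (App (Var 2 (Ty1 \<rightarrow> Ty0 \<rightarrow> Ty0)) (Var 0 Ty1)) (Var 1 Ty0)) (Cst Zero)"
  let ?P = "(\<^bold>\<forall>\<^sub>1 x. \<^bold>\<exists>\<^sub>0 y. ?A\<langle>[x, y]\<rangle>) \<^bold>\<longrightarrow> hex (Ty1 \<rightarrow> Ty0) (\<lambda>Y. \<^bold>\<forall>\<^sub>1 x. ?A\<langle>[x, Y \<cdot> x]\<rangle>)"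
  let ?R = "[(Ty1 \<rightarrow> Ty0 \<rightarrow> Ty0, Y)]"
  have p: "sat M ?R C (?A\<langle>[s, t]\<rangle>) (ap M (ap M Y x) n = zr)" if "den M ?R C s Ty1 x" "den M ?R C t Ty0 n" for C s t n x
    using sat_plug[of "[Ty1, Ty0]" ?R ?A "[s, t]" "[x, n]" C] that by (auto simp: nth_Cons eqv_eq split: nat.splits)
  have s: "sat M ?R [] ?P ((\<forall>x\<in>Dom M Ty1. \<exists>n\<in>N. ap M (ap M Y x) n = zr) \<longrightarrow>
      (\<exists>Z\<in>Dom M (Ty1 \<rightarrow> Ty0). \<forall>x\<in>Dom M Ty1. ap M (ap M Y x) (ap M Z x) = zr))"
    by (intro sat_imp sat_all sat_ex p den_app[where \<sigma>=Ty1]) (assumption | erule (1) den_lift)+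
  have r: "well_typed M ?R" using Y by (simp add: well_typed_def)
  have c: "closure [Ty1 \<rightarrow> Ty0 \<rightarrow> Ty0] (?P 0) \<in> RCA0_omega"
    unfolding RCA0_omega_def QF_AC_1_0_def
    by (rule UnI2, rule CollectI, rule exI[of _ "[Ty1 \<rightarrow> Ty0 \<rightarrow> Ty0]"], rule exI[of _ ?A]) simp
  have "feval M [] (closure [Ty1 \<rightarrow> Ty0 \<rightarrow> Ty0] (?P 0))"
    by (rule RCA[OF c]) (use sat_schema(1)[OF s r] in \<open>simp only: wff_closure list.map fst_conv\<close>)
  from models_closure[OF this r _ s] show ?thesis using ex by auto
qed

end

context rca begin

subsection \<open>Arithmetic\<close>

lemma add_zr [simp]: "m \<in> N \<Longrightarrow> m \<oplus> zr = m"
  and add_Suc: "m \<in> N \<Longrightarrow> n \<in> N \<Longrightarrow> m \<oplus> (n \<oplus> on) = m \<oplus> n \<oplus> on"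
  and mul_zr [simp]: "m \<in> N \<Longrightarrow> m \<otimes> zr = zr"
  and mul_Suc: "m \<in> N \<Longrightarrow> n \<in> N \<Longrightarrow> m \<otimes> (n \<oplus> on) = m \<otimes> n \<oplus> m"
  and Suc_inject: "m \<in> N \<Longrightarrow> n \<in> N \<Longrightarrow> m \<oplus> on = n \<oplus> on \<longleftrightarrow> m = n"
  and Suc_not_zr: "m \<in> N \<Longrightarrow> m \<oplus> on \<noteq> zr"
  and not_less_zr: "m \<in> N \<Longrightarrow> \<not> m \<prec> zr"
  and less_Suc: "m \<in> N \<Longrightarrow> n \<in> N \<Longrightarrow> m \<prec> n \<oplus> on \<longleftrightarrow> m \<preceq> n"
  using basic by auto

lemma zr_add [simp]: "n \<in> N \<Longrightarrow> zr \<oplus> n = n"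
  by (rule qf_induct[where n=n]) ((intro qfp_intros; simp) | simp add: add_Suc)+

lemma Suc_add: "m \<in> N \<Longrightarrow> n \<in> N \<Longrightarrow> (m \<oplus> on) \<oplus> n = (m \<oplus> n) \<oplus> on"
  by (rule qf_induct[where n=n]) ((intro qfp_intros; simp) | simp add: add_Suc)+

lemma add_commute: "m \<in> N \<Longrightarrow> n \<in> N \<Longrightarrow> m \<oplus> n = n \<oplus> m"
  by (rule qf_induct[where n=n]) ((intro qfp_intros; simp) | simp add: add_Suc Suc_add)+

lemma add_assoc: "a \<in> N \<Longrightarrow> b \<in> N \<Longrightarrow> c \<in> N \<Longrightarrow> a \<oplus> b \<oplus> c = a \<oplus> (b \<oplus> c)"
  by (rule qf_induct[where n=c]) ((intro qfp_intros; simp) | simp add: add_Suc)+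

lemma add_left_commute: "a \<in> N \<Longrightarrow> b \<in> N \<Longrightarrow> c \<in> N \<Longrightarrow> a \<oplus> (b \<oplus> c) = b \<oplus> (a \<oplus> c)"
  using add_assoc[of a b c] add_assoc[of b a c] add_commute[of a b] by simp

lemma zr_mul [simp]: "n \<in> N \<Longrightarrow> zr \<otimes> n = zr"
  by (rule qf_induct[where n=n]) ((intro qfp_intros; simp) | simp add: mul_Suc)+

lemma Suc_mul: "m \<in> N \<Longrightarrow> n \<in> N \<Longrightarrow> (m \<oplus> on) \<otimes> n = m \<otimes> n \<oplus> n"
proof (rule qf_induct[where n=n])
  fix n assume "n \<in> N" "m \<in> N" "(m \<oplus> on) \<otimes> n = m \<otimes> n \<oplus> n"
  then show "(m \<oplus> on) \<otimes> (n \<oplus> on) = m \<otimes> (n \<oplus> on) \<oplus> (n \<oplus> on)"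
    using mul_Suc[of "m \<oplus> on" n] mul_Suc[of m n] add_assoc[of "m \<otimes> n" n "m \<oplus> on"]
      add_assoc[of "m \<otimes> n" m "n \<oplus> on"] add_left_commute[of n m on] by simp
qed ((intro qfp_intros; simp) | simp)+

lemma mul_commute: "m \<in> N \<Longrightarrow> n \<in> N \<Longrightarrow> m \<otimes> n = n \<otimes> m"
  by (rule qf_induct[where n=n]) ((intro qfp_intros; simp) | simp add: mul_Suc Suc_mul)+

lemma distrib_left: "a \<in> N \<Longrightarrow> b \<in> N \<Longrightarrow> c \<in> N \<Longrightarrow> a \<otimes> (b \<oplus> c) = a \<otimes> b \<oplus> a \<otimes> c"
  by (rule qf_induct[where n=c]) ((intro qfp_intros; simp) | simp add: mul_Suc add_Suc add_assoc[symmetric])+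

lemma mul_on [simp]: "m \<in> N \<Longrightarrow> m \<otimes> on = m"
  using mul_Suc[of m zr] by simp

lemma mul_assoc: "a \<in> N \<Longrightarrow> b \<in> N \<Longrightarrow> c \<in> N \<Longrightarrow> a \<otimes> b \<otimes> c = a \<otimes> (b \<otimes> c)"
  by (rule qf_induct[where n=c]) ((intro qfp_intros; simp) | simp add: mul_Suc distrib_left)+

lemma less_trans: "a \<in> N \<Longrightarrow> b \<in> N \<Longrightarrow> c \<in> N \<Longrightarrow> a \<prec> b \<Longrightarrow> b \<prec> c \<Longrightarrow> a \<prec> c"
proof -
  assume h: "a \<in> N" "b \<in> N" "c \<in> N" "a \<prec> b" "b \<prec> c"
  have "b \<prec> c \<longrightarrow> a \<prec> c"
    by (rule qf_induct[where n=c]) (use h in \<open>(intro qfp_intros; simp) | auto simp: not_less_zr less_Suc\<close>)+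
  with h show ?thesis by blast
qed

lemma zr_le: "n \<in> N \<Longrightarrow> zr \<preceq> n"
  by (rule qf_induct[where n=n]) ((intro qfp_intros; simp) | auto simp: less_Suc)+

lemma less_Suc_mono: "a \<in> N \<Longrightarrow> b \<in> N \<Longrightarrow> a \<prec> b \<Longrightarrow> a \<oplus> on \<prec> b \<oplus> on"
proof -
  assume h: "a \<in> N" "b \<in> N" "a \<prec> b"
  have "a \<prec> b \<longrightarrow> a \<oplus> on \<prec> b \<oplus> on"
    by (rule qf_induct[where n=b]) (use h in \<open>(intro qfp_intros; simp) | auto simp: not_less_zr less_Suc\<close>)+
  with h show ?thesis by blast
qed

lemma less_Suc_le: "a \<in> N \<Longrightarrow> b \<in> N \<Longrightarrow> a \<prec> b \<Longrightarrow> a \<oplus> on \<preceq> b"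
  using less_Suc_mono[of a b] less_Suc[of "a \<oplus> on" b] by auto

lemma linear: "a \<in> N \<Longrightarrow> b \<in> N \<Longrightarrow> a \<prec> b \<or> a = b \<or> b \<prec> a"
proof (rule qf_induct[where n=b])
  fix n assume "a \<in> N" "n \<in> N" "a \<prec> n \<or> a = n \<or> n \<prec> a"
  then show "a \<prec> n \<oplus> on \<or> a = n \<oplus> on \<or> n \<oplus> on \<prec> a"
    using less_Suc_le[of n a] by (auto simp: less_Suc)
qed (use zr_le in \<open>(intro qfp_intros; simp) | auto\<close>)+

lemma less_irrefl: "n \<in> N \<Longrightarrow> \<not> n \<prec> n"
proof (rule qf_induct[where n=n])
  fix n assume n: "n \<in> N" "\<not> n \<prec> n"
  then show "\<not> n \<oplus> on \<prec> n \<oplus> on"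
  proof -
    have "n \<prec> n \<oplus> on" using n less_Suc[of n n] by simp
    then show ?thesis using n less_trans[of n "n \<oplus> on" n] less_Suc[of "n \<oplus> on" n] by auto
  qed
qed ((intro qfp_intros; simp) | simp add: not_less_zr)+

lemma add_right_cancel: "a \<in> N \<Longrightarrow> b \<in> N \<Longrightarrow> c \<in> N \<Longrightarrow> a \<oplus> c = b \<oplus> c \<Longrightarrow> a = b"
proof -
  assume h: "a \<in> N" "b \<in> N" "c \<in> N" "a \<oplus> c = b \<oplus> c"
  have "a \<oplus> c = b \<oplus> c \<longrightarrow> a = b"
    by (rule qf_induct[where n=c]) (use h in \<open>(intro qfp_intros; simp) | simp add: add_Suc Suc_inject\<close>)+
  with h show ?thesis by blast
qed

text \<open>The predecessor: with \<open>K\<close> as its step the recursion returns the counter and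
  forgets the previous value.\<close>

definition prd :: 'a where "prd = ap M (ap M (con M Rec0) (K Ty0 Ty0)) zr"

lemma prd: "prd \<in> Dom M Ty1" "ap M prd zr = zr" "n \<in> N \<Longrightarrow> ap M prd (n \<oplus> on) = n"
proof -
  show p: "prd \<in> Dom M Ty1"
    unfolding prd_def by (rule ap_closed[OF ap_closed[OF Rec_closed K_closed]]) simp
  show "ap M prd zr = zr" using recursor(1)[OF K_closed, of zr] by (simp add: prd_def)
  show "n \<in> N \<Longrightarrow> ap M prd (n \<oplus> on) = n"
    using recursor(2)[OF K_closed, of zr n] combK[of n Ty0 "ap M prd n" Ty0] ap_closed[OF p]
    by (simp add: prd_def)
qed

lemma prd_Suc: "n \<in> N \<Longrightarrow> n \<noteq> zr \<Longrightarrow> ap M prd n \<oplus> on = n"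
proof -
  have "n \<in> N \<Longrightarrow> n = zr \<or> ap M prd n \<oplus> on = n"
    by (rule qf_induct[where n=n]) ((intro qfp_intros rep_fun prd(1); simp) | simp add: prd)+
  then show "n \<in> N \<Longrightarrow> n \<noteq> zr \<Longrightarrow> ap M prd n \<oplus> on = n" by blast
qed

text \<open>Iterated predecessor: \<open>ap M (mns a) b\<close> is the truncated difference of
  \<open>a\<close> and \<open>b\<close>.\<close>

definition mns :: "'a \<Rightarrow> 'a" where "mns a = ap M (ap M (con M Rec0) (ap M (K Ty1 Ty0) prd)) a"

lemma mns: 
  assumes "a \<in> N"
  shows "mns a \<in> Dom M Ty1" "ap M (mns a) zr = a" "n \<in> N \<Longrightarrow> ap M (mns a) (n \<oplus> on) = ap M prd (ap M (mns a) n)"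
proof -
  have k: "ap M (K Ty1 Ty0) prd \<in> Dom M (Ty0 \<rightarrow> Ty0 \<rightarrow> Ty0)" by (rule ap_closed[OF K_closed prd(1)])
  show "mns a \<in> Dom M Ty1" unfolding mns_def by (rule ap_closed[OF ap_closed[OF Rec_closed k] assms])
  show "ap M (mns a) zr = a" "n \<in> N \<Longrightarrow> ap M (mns a) (n \<oplus> on) = ap M prd (ap M (mns a) n)"
    using recursor[OF k assms] by (simp_all add: mns_def combK[OF prd(1)])
qed

text \<open>The existence of a difference is not a quantifier-free statement. Naming the difference
  by a term makes it accessible to the available induction, and \<open>le_iff_add\<close> then
  follows.\<close>

lemma le_add_mns:
  assumes a: "a \<in> N" and n: "n \<in> N" and le: "a \<preceq> n"
  shows "a \<oplus> ap M (mns n) a = n"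
proof -
  have "a \<preceq> n \<longrightarrow> a \<oplus> ap M (mns n) a = n"
  proof (rule qf_induct[where n=a])
    fix a assume a: "a \<in> N" and IH: "a \<preceq> n \<longrightarrow> a \<oplus> ap M (mns n) a = n"
    show "a \<oplus> on \<preceq> n \<longrightarrow> a \<oplus> on \<oplus> ap M (mns n) (a \<oplus> on) = n"
    proof
      assume le: "a \<oplus> on \<preceq> n"
      have an: "a \<prec> n" using le less_Suc[of a a] less_trans[of a "a \<oplus> on" n] a n by auto
      let ?d = "ap M (mns n) a"
      have d: "?d \<in> N" using mns(1)[OF n] a by (rule ap_closed)
      have "?d \<noteq> zr" using IH an a n less_irrefl[of n] by auto
      then have "ap M prd ?d \<oplus> on = ?d" using prd_Suc d by blast
      then show "a \<oplus> on \<oplus> ap M (mns n) (a \<oplus> on) = n"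
        using IH an a d mns(3)[OF n a] Suc_add[of a "ap M prd ?d"] add_Suc[of a "ap M prd ?d"] ap_closed[OF prd(1) d]
        by auto
    qed
  qed (use a n mns in \<open>(intro qfp_intros rep_fun mns(1); simp) | simp\<close>)+
  with le show ?thesis by blast
qed

lemma le_iff_add: "a \<in> N \<Longrightarrow> b \<in> N \<Longrightarrow> a \<preceq> b \<longleftrightarrow> (\<exists>c\<in>N. b = a \<oplus> c)"
proof
  assume "a \<in> N" "b \<in> N" "a \<preceq> b"
  then show "\<exists>c\<in>N. b = a \<oplus> c" using le_add_mns[of a b] ap_closed[OF mns(1)[of b], of a] by metis
next
  assume a: "a \<in> N" and b: "b \<in> N" and "\<exists>c\<in>N. b = a \<oplus> c"
  then obtain c where c: "c \<in> N" "b = a \<oplus> c" by blast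
  have "a \<preceq> a \<oplus> c"
    by (rule qf_induct[where n=c]) (use a c in \<open>(intro qfp_intros; simp) | auto simp: add_Suc less_Suc\<close>)+
  then show "a \<preceq> b" using c by simp
qed

lemma mul_pos: "a \<in> N \<Longrightarrow> b \<in> N \<Longrightarrow> a \<noteq> zr \<Longrightarrow> b \<noteq> zr \<Longrightarrow> a \<otimes> b \<noteq> zr"
proof -
  assume h: "a \<in> N" "b \<in> N" "a \<noteq> zr" "b \<noteq> zr"
  let ?a = "ap M prd a" and ?b = "ap M prd b"
  have c: "?a \<in> N" "?b \<in> N" using h prd(1) ap_closed by auto
  have "a \<otimes> b = a \<otimes> ?b \<oplus> ?a \<oplus> on"
    using prd_Suc[of a] prd_Suc[of b] h c mul_Suc[of a ?b] add_Suc[of "a \<otimes> ?b" ?a] by simp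
  then show "a \<otimes> b \<noteq> zr" using Suc_not_zr[of "a \<otimes> ?b \<oplus> ?a"] h c by simp
qed

lemma zr_neq_on: "zr \<noteq> on"
  using Suc_not_zr[of zr] by simp

end

context rca begin

subsection \<open>Representable functions of two arguments\<close>

definition rep2 :: "ty \<Rightarrow> ty \<Rightarrow> ty \<Rightarrow> ('a \<Rightarrow> 'a \<Rightarrow> 'a) \<Rightarrow> bool" where
  "rep2 \<sigma> \<tau> \<rho> g \<longleftrightarrow> (\<exists>G \<in> Dom M (\<sigma> \<rightarrow> \<tau> \<rightarrow> \<rho>). \<forall>x \<in> Dom M \<sigma>. \<forall>y \<in> Dom M \<tau>. ap M (ap M G x) y = g x y)"

lemma rep2_rep:
  assumes "rep \<sigma> (\<tau> \<rightarrow> \<rho>) h" "\<And>x y. x \<in> Dom M \<sigma> \<Longrightarrow> y \<in> Dom M \<tau> \<Longrightarrow> ap M (h x) y = g x y"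
  shows "rep2 \<sigma> \<tau> \<rho> g"
proof -
  obtain f where f: "f \<in> Dom M (\<sigma> \<rightarrow> \<tau> \<rightarrow> \<rho>)" "\<forall>x\<in>Dom M \<sigma>. ap M f x = h x"
    using assms(1) unfolding rep_def by blast
  show ?thesis unfolding rep2_def by (rule bexI[OF _ f(1)]) (simp add: f(2) assms(2))
qed

lemma rep2_cong:
  "rep2 \<sigma> \<tau> \<rho> g \<Longrightarrow> (\<And>x y. x \<in> Dom M \<sigma> \<Longrightarrow> y \<in> Dom M \<tau> \<Longrightarrow> g x y = g' x y) \<Longrightarrow> rep2 \<sigma> \<tau> \<rho> g'"
  unfolding rep2_def by (erule bexE, rule bexI) auto

lemma rep2_const: "c \<in> Dom M \<rho> \<Longrightarrow> rep2 \<sigma> \<tau> \<rho> (\<lambda>x y. c)"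
  by (rule rep2_rep[OF rep_const[OF ap_closed[OF K_closed]]]) (auto simp: combK)

lemma rep2_fst: "rep2 \<sigma> \<tau> \<sigma> (\<lambda>x y. x)"
  unfolding rep2_def by (rule bexI[OF _ K_closed]) (simp add: combK)

lemma rep2_snd: "rep2 \<sigma> \<tau> \<tau> (\<lambda>x y. y)"
  by (rule rep2_rep[OF rep_const[OF lam(1)[OF rep_id]]]) (simp add: lam(2)[OF rep_id])

lemma rep2_app:
  assumes "rep2 \<sigma> \<tau> (\<alpha> \<rightarrow> \<rho>) f" "rep2 \<sigma> \<tau> \<alpha> g"
  shows "rep2 \<sigma> \<tau> \<rho> (\<lambda>x y. ap M (f x y) (g x y))"
proof -
  obtain F where F: "F \<in> Dom M (\<sigma> \<rightarrow> \<tau> \<rightarrow> \<alpha> \<rightarrow> \<rho>)" "\<forall>x\<in>Dom M \<sigma>. \<forall>y\<in>Dom M \<tau>. ap M (ap M F x) y = f x y"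
    using assms(1) unfolding rep2_def by blast
  obtain G where G: "G \<in> Dom M (\<sigma> \<rightarrow> \<tau> \<rightarrow> \<alpha>)" "\<forall>x\<in>Dom M \<sigma>. \<forall>y\<in>Dom M \<tau>. ap M (ap M G x) y = g x y"
    using assms(2) unfolding rep2_def by blast
  have "rep \<sigma> (\<tau> \<rightarrow> \<rho>) (\<lambda>x. ap M (ap M (S \<tau> \<alpha> \<rho>) (ap M F x)) (ap M G x))"
    by (rule rep_app, rule rep_app, rule rep_const, rule S_closed, rule rep_fun[OF F(1)], rule rep_fun[OF G(1)])
  then show ?thesis
    by (rule rep2_rep) (simp add: combS[OF ap_closed[OF F(1)] ap_closed[OF G(1)]] F(2) G(2))
qed

text \<open>Composition with \<open>u\<close> on the left, as an element that can itself depend on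
  further arguments through \<open>u\<close>.\<close>

abbreviation cmpl where "cmpl \<rho> \<sigma> \<tau> u \<equiv> ap M (S \<rho> \<sigma> \<tau>) (ap M (K (\<sigma> \<rightarrow> \<tau>) \<rho>) u)"

lemma cmpl:
  assumes "u \<in> Dom M (\<sigma> \<rightarrow> \<tau>)"
  shows "cmpl \<rho> \<sigma> \<tau> u \<in> Dom M ((\<rho> \<rightarrow> \<sigma>) \<rightarrow> \<rho> \<rightarrow> \<tau>)"
    and "v \<in> Dom M (\<rho> \<rightarrow> \<sigma>) \<Longrightarrow> x \<in> Dom M \<rho> \<Longrightarrow> ap M (ap M (cmpl \<rho> \<sigma> \<tau> u) v) x = ap M u (ap M v x)"
  using combS[OF ap_closed[OF K_closed assms], of v \<rho> x] combK[OF assms, of x \<rho>]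
    ap_closed[OF S_closed ap_closed[OF K_closed assms]] by auto

lemma rep2_cmpl: "rep2 \<alpha> \<beta> (\<sigma> \<rightarrow> \<tau>) f \<Longrightarrow> rep2 \<alpha> \<beta> ((\<rho> \<rightarrow> \<sigma>) \<rightarrow> \<rho> \<rightarrow> \<tau>) (\<lambda>x y. cmpl \<rho> \<sigma> \<tau> (f x y))"
  by (rule rep2_app, rule rep2_const, rule S_closed, rule rep2_app, rule rep2_const, rule K_closed)

lemma rep2_D1: "x \<in> Dom M Ty1 \<Longrightarrow> rep2 \<sigma> \<tau> Ty0 f \<Longrightarrow> rep2 \<sigma> \<tau> Ty0 (\<lambda>u v. ap M x (f u v))"
  by (rule rep2_app[OF rep2_const])

end

text \<open>The numbers of the model are carried over to a type of class
  \<open>linordered_semidom\<close>, so that algebraic simplification and the construction of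
  fractions become available for possibly nonstandard numbers.\<close>

locale num_model = rca M for M :: "'a interp" +
  fixes e :: "'n::linordered_semidom \<Rightarrow> 'a"
  assumes e_bij: "bij_betw e UNIV (Dom M Ty0)"
    and e_0: "e 0 = con M Zero" and e_1: "e 1 = con M One"
    and e_add: "e (a + b) = ap M (ap M (con M Plus) (e a)) (e b)"
    and e_mult: "e (a * b) = ap M (ap M (con M Times) (e a)) (e b)"
    and e_less: "lss M (e a) (e b) \<longleftrightarrow> a < b"
begin

abbreviation dd :: "'a \<Rightarrow> 'n" where "dd \<equiv> inv e"

lemma e_N [simp, intro]: "e n \<in> N" using e_bij by (auto simp: bij_betw_def)
lemma e_inject [simp]: "e a = e b \<longleftrightarrow> a = b" using e_bij by (auto simp: bij_betw_def inj_def)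
lemma dd_e [simp]: "dd (e n) = n" using e_bij by (simp add: bij_betw_def)
lemma e_dd [simp]: "x \<in> N \<Longrightarrow> e (dd x) = x"
  using e_bij f_inv_into_f[of x e UNIV] by (simp add: bij_betw_def)
lemma N_cases: "x \<in> N \<Longrightarrow> (\<And>n. x = e n \<Longrightarrow> P) \<Longrightarrow> P" using e_dd by metis

lemma discrete: "(a::'n) < b + 1 \<longleftrightarrow> a \<le> b"
  using less_Suc[of "e a" "e b"] e_less[of a "b + 1"] e_less[of a b] by (auto simp: e_add e_1 le_less)

lemma zero_le [simp]: "(0::'n) \<le> n"
  using zr_le[of "e n"] e_less[of 0 n] by (auto simp: e_0[symmetric])

subsection \<open>Type 1 objects as functions\<close>

text \<open>Type 1 objects are treated as HOL functions. In general \<open>F1\<close> contains only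
  some of all functions on the number type, so membership has to be established each time.\<close>

definition fn :: "'a \<Rightarrow> 'n \<Rightarrow> 'n" where "fn x n = dd (ap M x (e n))"
definition F1 :: "('n \<Rightarrow> 'n) set" where "F1 = fn ` Dom M Ty1"
definition c1 :: "('n \<Rightarrow> 'n) \<Rightarrow> 'a" where "c1 = inv_into (Dom M Ty1) fn"

lemma ap_fn: "x \<in> Dom M Ty1 \<Longrightarrow> ap M x (e n) = e (fn x n)"
  using ap_closed[of x Ty0 Ty0 "e n"] by (simp add: fn_def)

lemma fn_inj: "inj_on fn (Dom M Ty1)"
proof (rule inj_onI)
  fix x y assume xy: "x \<in> Dom M Ty1" "y \<in> Dom M Ty1" "fn x = fn y"
  show "x = y"
    by (rule extensional[OF xy(1,2)]) (use ap_fn xy in \<open>auto elim!: N_cases\<close>)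
qed

lemma c1 [simp]: "g \<in> F1 \<Longrightarrow> c1 g \<in> Dom M Ty1" "g \<in> F1 \<Longrightarrow> fn (c1 g) = g"
  by (auto simp: F1_def c1_def inv_into_into f_inv_into_f)

lemma fn_F1 [simp]: "x \<in> Dom M Ty1 \<Longrightarrow> fn x \<in> F1"
  and c1_fn [simp]: "x \<in> Dom M Ty1 \<Longrightarrow> c1 (fn x) = x"
  by (auto simp: F1_def c1_def fn_inj)

lemma ap_c1: "g \<in> F1 \<Longrightarrow> ap M (c1 g) (e n) = e (g n)"
  by (simp add: ap_fn)

lemma D1_cases: "x \<in> Dom M Ty1 \<Longrightarrow> (\<And>g. g \<in> F1 \<Longrightarrow> x = c1 g \<Longrightarrow> P) \<Longrightarrow> P"
  by (metis c1_fn fn_F1)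

text \<open>Functionals of one type 1 and one type 0 argument; those with further number arguments are
  treated by pairing.\<close>

definition dfn :: "(('n \<Rightarrow> 'n) \<Rightarrow> 'n \<Rightarrow> 'n) \<Rightarrow> bool" where
  "dfn \<Phi> \<longleftrightarrow> rep2 Ty1 Ty0 Ty0 (\<lambda>x y. e (\<Phi> (fn x) (dd y)))"

definition bfn :: "('n \<Rightarrow> 'n \<Rightarrow> 'n) \<Rightarrow> bool" where
  "bfn h \<longleftrightarrow> rep2 Ty0 Ty0 Ty0 (\<lambda>x y. e (h (dd x) (dd y)))"

definition c2 :: "(('n \<Rightarrow> 'n) \<Rightarrow> 'n \<Rightarrow> 'n) \<Rightarrow> 'a" where
  "c2 \<Phi> = (SOME G. G \<in> Dom M (Ty1 \<rightarrow> Ty0 \<rightarrow> Ty0) \<and> (\<forall>x\<in>Dom M Ty1. \<forall>y\<in>N. ap M (ap M G x) y = e (\<Phi> (fn x) (dd y))))"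

lemma c2:
  assumes "dfn \<Phi>"
  shows "c2 \<Phi> \<in> Dom M (Ty1 \<rightarrow> Ty0 \<rightarrow> Ty0)" "f \<in> F1 \<Longrightarrow> ap M (c2 \<Phi>) (c1 f) = c1 (\<Phi> f)" "f \<in> F1 \<Longrightarrow> \<Phi> f \<in> F1"
proof -
  have "\<exists>G. G \<in> Dom M (Ty1 \<rightarrow> Ty0 \<rightarrow> Ty0) \<and> (\<forall>x\<in>Dom M Ty1. \<forall>y\<in>N. ap M (ap M G x) y = e (\<Phi> (fn x) (dd y)))"
    using assms unfolding dfn_def rep2_def by blast
  from someI_ex[OF this]
  have c: "c2 \<Phi> \<in> Dom M (Ty1 \<rightarrow> Ty0 \<rightarrow> Ty0)"
    "\<And>x y. x \<in> Dom M Ty1 \<Longrightarrow> y \<in> N \<Longrightarrow> ap M (ap M (c2 \<Phi>) x) y = e (\<Phi> (fn x) (dd y))"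
    unfolding c2_def by blast+
  show "c2 \<Phi> \<in> Dom M (Ty1 \<rightarrow> Ty0 \<rightarrow> Ty0)" by (rule c(1))
  assume f: "f \<in> F1"
  have a: "ap M (c2 \<Phi>) (c1 f) \<in> Dom M Ty1" by (rule ap_closed[OF c(1) c1(1)[OF f]])
  have "fn (ap M (c2 \<Phi>) (c1 f)) = \<Phi> f" using c(2)[OF c1(1)[OF f]] f by (simp add: fn_def fun_eq_iff)
  then show "ap M (c2 \<Phi>) (c1 f) = c1 (\<Phi> f)" "\<Phi> f \<in> F1" using c1_fn[OF a] fn_F1[OF a] by simp_all
qed

lemma D2_cases: "G \<in> Dom M (Ty1 \<rightarrow> Ty0 \<rightarrow> Ty0) \<Longrightarrow> (\<And>\<Phi>. dfn \<Phi> \<Longrightarrow> G = c2 \<Phi> \<Longrightarrow> P) \<Longrightarrow> P"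
proof -
  assume G: "G \<in> Dom M (Ty1 \<rightarrow> Ty0 \<rightarrow> Ty0)" and P: "\<And>\<Phi>. dfn \<Phi> \<Longrightarrow> G = c2 \<Phi> \<Longrightarrow> P"
  define \<Phi> where "\<Phi> f = fn (ap M G (c1 f))" for f
  have cl: "ap M G x \<in> Dom M Ty1" if "x \<in> Dom M Ty1" for x by (rule ap_closed[OF G that])
  have "ap M (ap M G x) y = e (\<Phi> (fn x) (dd y))" if "x \<in> Dom M Ty1" "y \<in> N" for x y
    using ap_fn[OF cl[OF that(1)], of "dd y"] that by (simp add: \<Phi>_def)
  then have d: "dfn \<Phi>" unfolding dfn_def rep2_def by (intro bexI[OF _ G]) simp
  have "ap M G x = ap M (c2 \<Phi>) x" if "x \<in> Dom M Ty1" for x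
    using that c2(2)[OF d fn_F1[OF that]] c1_fn[OF cl[OF that]] by (simp add: \<Phi>_def)
  then have "G = c2 \<Phi>" by (rule extensional[OF G c2(1)[OF d]])
  with P d show P by blast
qed

text \<open>A functional that ignores its function argument amounts to a single function; in this
  way the closure rules for \<open>dfn\<close> also prove membership in \<open>F1\<close>.\<close>

lemma F1I: "dfn (\<lambda>_. g) \<Longrightarrow> g \<in> F1"
  using c2(3)[of "\<lambda>_. g", OF _ fn_F1[OF ap_closed[OF K_closed N_closed(1)]]] by blast

lemma dfn_cong: "dfn \<Phi> \<Longrightarrow> (\<And>f n. f \<in> F1 \<Longrightarrow> \<Phi> f n = \<Psi> f n) \<Longrightarrow> dfn \<Psi>"
  unfolding dfn_def by (erule rep2_cong) auto

lemma dfn_const: "dfn (\<lambda>f n. c)"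
  unfolding dfn_def by (rule rep2_const) simp

lemma dfn_arg: "dfn (\<lambda>f n. n)"
  unfolding dfn_def by (rule rep2_cong[OF rep2_snd]) auto

lemma dfn_F1: "g \<in> F1 \<Longrightarrow> dfn A \<Longrightarrow> dfn (\<lambda>f n. g (A f n))"
  unfolding dfn_def by (rule rep2_cong[OF rep2_D1[of "c1 g"]]) (auto simp: ap_c1)

lemma dfn_app: "dfn A \<Longrightarrow> dfn (\<lambda>f n. f (A f n))"
  unfolding dfn_def by (rule rep2_cong[OF rep2_app[OF rep2_fst]]) (auto simp: ap_fn)

lemma dfn_bin:
  assumes "G \<in> Dom M (Ty0 \<rightarrow> Ty0 \<rightarrow> Ty0)" "\<And>a b. ap M (ap M G (e a)) (e b) = e (h a b)" "dfn A" "dfn B"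
  shows "dfn (\<lambda>f n. h (A f n) (B f n))"
proof -
  have "rep2 Ty1 Ty0 Ty0 (\<lambda>x y. ap M (ap M G (e (A (fn x) (dd y)))) (e (B (fn x) (dd y))))"
    by (rule rep2_app, rule rep2_app, rule rep2_const, rule assms(1),
      rule assms(3)[unfolded dfn_def], rule assms(4)[unfolded dfn_def])
  then show ?thesis unfolding dfn_def by (simp add: assms(2))
qed

lemma bfn_bin:
  assumes "G \<in> Dom M (Ty0 \<rightarrow> Ty0 \<rightarrow> Ty0)" "\<And>a b. ap M (ap M G (e a)) (e b) = e (h a b)" "bfn A" "bfn B"
  shows "bfn (\<lambda>f n. h (A f n) (B f n))"
proof -
  have "rep2 Ty0 Ty0 Ty0 (\<lambda>x y. ap M (ap M G (e (A (dd x) (dd y)))) (e (B (dd x) (dd y))))"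
    by (rule rep2_app, rule rep2_app, rule rep2_const, rule assms(1),
      rule assms(3)[unfolded bfn_def], rule assms(4)[unfolded bfn_def])
  then show ?thesis unfolding bfn_def by (simp add: assms(2))
qed

lemma dfn_plus: "dfn A \<Longrightarrow> dfn B \<Longrightarrow> dfn (\<lambda>f n. A f n + B f n)"
  and dfn_times: "dfn A \<Longrightarrow> dfn B \<Longrightarrow> dfn (\<lambda>f n. A f n * B f n)"
  and bfn_plus: "bfn a \<Longrightarrow> bfn b \<Longrightarrow> bfn (\<lambda>k m. a k m + b k m)"
  and bfn_times: "bfn a \<Longrightarrow> bfn b \<Longrightarrow> bfn (\<lambda>k m. a k m * b k m)"
  by (rule dfn_bin bfn_bin, rule Plus_closed Times_closed, simp add: e_add e_mult, assumption+)+

lemma bfn_const: "bfn (\<lambda>k m. c)"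
  unfolding bfn_def by (rule rep2_const) simp

lemma bfn_fst: "bfn (\<lambda>k m. k)"
  unfolding bfn_def by (rule rep2_cong[OF rep2_fst]) simp

lemma bfn_snd: "bfn (\<lambda>k m. m)"
  unfolding bfn_def by (rule rep2_cong[OF rep2_snd]) simp

lemma bfn_F1: "g \<in> F1 \<Longrightarrow> bfn a \<Longrightarrow> bfn (\<lambda>k m. g (a k m))"
  unfolding bfn_def by (rule rep2_cong[OF rep2_D1[of "c1 g"]]) (assumption | simp add: ap_c1)+

lemma F1_D1: "g \<in> F1 \<Longrightarrow> rep Ty0 Ty0 (\<lambda>x. e (g (dd x)))"
  unfolding rep_def by (rule bexI[of _ "c1 g"]) (auto elim!: N_cases simp: ap_c1)

text \<open>Later inductions over decidable predicates rest on this one. Equality of two functions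
  of the model is quantifier-free, and \<open>dec_induct\<close> turns a decidable predicate into
  such an equation with the constant 0.\<close>

lemma F1_eq_induct:
  assumes "s \<in> F1" "t \<in> F1" "s 0 = t 0" "\<And>n. s n = t n \<Longrightarrow> s (n + 1) = t (n + 1)"
  shows "s n = t n"
proof -
  have "e (s (dd (e n))) = e (t (dd (e n)))"
  proof (rule qf_induct[where n="e n"])
    show "qfp (\<lambda>x. e (s (dd x)) = e (t (dd x)))" by (intro qfp_eq F1_D1 assms)
    show "e (s (dd zr)) = e (t (dd zr))" using assms(3) by (simp add: e_0[symmetric])
  next
    fix x assume x: "x \<in> N" "e (s (dd x)) = e (t (dd x))"
    obtain n where n: "x = e n" using x(1) by (rule N_cases)
    have "x \<oplus> on = e (n + 1)" by (simp add: n e_add e_1)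
    then show "e (s (dd (x \<oplus> on))) = e (t (dd (x \<oplus> on)))" using assms(4)[of n] x(2) n by simp
  qed simp
  then show ?thesis by simp
qed

text \<open>On a nonstandard carrier the recursion equations alone do not determine a function.
  Membership in \<open>F1\<close> does, by induction inside the model.\<close>

definition nrec :: "('n \<Rightarrow> 'n \<Rightarrow> 'n) \<Rightarrow> 'n \<Rightarrow> 'n \<Rightarrow> 'n" where
  "nrec h a n = (THE s. s \<in> F1 \<and> s 0 = a \<and> (\<forall>k. s (k + 1) = h k (s k))) n"

lemma nrec_unique:
  assumes "s \<in> F1" "s 0 = a" "\<And>k. s (k + 1) = h k (s k)" shows "nrec h a = s"
proof -
  have "(THE s. s \<in> F1 \<and> s 0 = a \<and> (\<forall>k. s (k + 1) = h k (s k))) = s"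
  proof (rule the_equality)
    fix t assume t: "t \<in> F1 \<and> t 0 = a \<and> (\<forall>k. t (k + 1) = h k (t k))"
    show "t = s" by (rule ext, rule F1_eq_induct) (use t assms in auto)
  qed (use assms in auto)
  then show ?thesis by (simp add: nrec_def fun_eq_iff)
qed

lemma nrec_Rc:
  assumes H: "H \<in> Dom M (Ty0 \<rightarrow> Ty0 \<rightarrow> Ty0)" "\<And>k m. ap M (ap M H (e k)) (e m) = e (h k m)"
  shows "e (nrec h a n) = Rc H (e a) (e n)" "nrec h a \<in> F1" "nrec h a 0 = a" "nrec h a (k + 1) = h k (nrec h a k)"
proof -
  let ?s = "ap M (ap M (con M Rec0) H) (e a)"
  have s: "?s \<in> Dom M Ty1" by (rule ap_closed[OF ap_closed[OF Rec_closed H(1)]]) simp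
  have f: "fn ?s \<in> F1" "fn ?s 0 = a"
    using fn_F1[OF s] recursor(1)[OF H(1) e_N, of a] by (simp_all add: fn_def[of _ 0] e_0)
  have g: "fn ?s (k + 1) = h k (fn ?s k)" for k
  proof -
    have "ap M ?s (e k \<oplus> on) = e (h k (fn ?s k))"
      using recursor(2)[OF H(1) e_N e_N, of a k] H(2)[of k "fn ?s k"] ap_fn[OF s, of k] by simp
    then show ?thesis by (simp add: fn_def[of _ "k + 1"] e_add e_1)
  qed
  have n: "nrec h a = fn ?s" by (rule nrec_unique) (use f g in auto)
  show "e (nrec h a n) = Rc H (e a) (e n)" using ap_fn[OF s, of n] by (simp add: n)
  show "nrec h a \<in> F1" "nrec h a 0 = a" "nrec h a (k + 1) = h k (nrec h a k)" using f g[of k] by (simp_all only: n)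
qed

lemma nrec:
  assumes "bfn h"
  shows "nrec h a \<in> F1" "nrec h a 0 = a" "nrec h a (k + 1) = h k (nrec h a k)"
proof -
  obtain H where "H \<in> Dom M (Ty0 \<rightarrow> Ty0 \<rightarrow> Ty0)" "\<And>x y. x \<in> N \<Longrightarrow> y \<in> N \<Longrightarrow> ap M (ap M H x) y = e (h (dd x) (dd y))"
    using assms unfolding bfn_def rep2_def by blast
  then show "nrec h a \<in> F1" "nrec h a 0 = a" "nrec h a (k + 1) = h k (nrec h a k)"
    using nrec_Rc[of H h a] by auto
qed

definition mn :: "'n \<Rightarrow> 'n \<Rightarrow> 'n" where "mn a b = (if b \<le> a then a - b else 0)"

lemma mn_add: "b \<le> a \<Longrightarrow> mn a b + b = a" and mn_0: "a \<le> b \<Longrightarrow> mn a b = 0"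
  by (auto simp: mn_def)

lemma mn_eq_0 [simp]: "mn a b = 0 \<longleftrightarrow> a \<le> b"
  using mn_add[of b a] mn_0[of a b] by (cases "b \<le> a") auto

definition pred :: "'n \<Rightarrow> 'n" where "pred n = mn n 1"

lemma pred_F1: "pred \<in> F1" and fn_prd: "fn prd = pred"
proof -
  have s: "fn prd (n + 1) = n" for n using prd(3)[of "e n"] by (simp add: fn_def e_add e_1)
  have z: "fn prd 0 = 0" using prd(2) by (simp add: fn_def e_0[symmetric])
  show "fn prd = pred"
  proof
    fix n show "fn prd n = pred n"
    proof (cases "n = 0")
      case True then show ?thesis using z by (simp add: pred_def)
    next
      case False
      then have "1 \<le> n" using discrete[of 0 "n - 1"] zero_le[of n] discrete[of n 0] by (metis add_0 le_less not_le)
      then have "pred n + 1 = n" unfolding pred_def by (rule mn_add)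
      then show ?thesis using s[of "pred n"] by simp
    qed
  qed
  then show "pred \<in> F1" using fn_F1[OF prd(1)] by simp
qed

end

context num_model begin

lemma le_Suc: "a \<le> b + 1 \<longleftrightarrow> a \<le> b \<or> a = b + (1::'n)"
  using discrete[of a b] by (auto simp: le_less)

lemma Suc_le: "a + 1 \<le> b \<longleftrightarrow> a < (b::'n)"
  using discrete[of b a] by (auto simp: not_less[symmetric])

lemma num_cases: obtains "(n::'n) = 0" | m where "n = m + 1"
proof (cases "n = 0")
  case False
  then have "0 + 1 \<le> n" using Suc_le[of 0 n] zero_le[of n] by (simp add: less_le)
  then have "mn n 1 + 1 = n" using mn_add by simp
  then show ?thesis using that by metis
qed (use that in auto)

lemma mns_mn: "ap M (mns (e a)) (e b) = e (mn a b)"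
proof -
  let ?s = "mns (e a)"
  have s: "?s \<in> Dom M Ty1" by (rule mns) simp
  have add: "b + fn ?s b = a" if "b \<le> a" for b
  proof -
    have "e b \<preceq> e a" using that e_less[of b a] by (auto simp: le_less)
    then have "e (b + fn ?s b) = e a" using le_add_mns[of "e b" "e a"] ap_fn[OF s, of b] by (simp add: e_add)
    then show ?thesis by simp
  qed
  have step: "fn ?s (n + 1) = pred (fn ?s n)" for n
  proof -
    have "ap M ?s (e (n + 1)) = e (pred (fn ?s n))"
      using mns(3)[of "e a" "e n"] ap_fn[OF s, of n] ap_fn[OF prd(1), of "fn ?s n"] by (simp add: e_add e_1 fn_prd)
    then show ?thesis by (simp add: fn_def[of _ "n + 1"])
  qed
  have z: "fn ?s (a + c) = 0" for c
  proof (rule F1_eq_induct[where s="\<lambda>c. fn ?s (a + c)" and t="\<lambda>_. 0" and n=c])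
    show "(\<lambda>c. fn ?s (a + c)) \<in> F1" "(\<lambda>_. 0 :: 'n) \<in> F1"
      by (rule F1I, intro dfn_F1[OF fn_F1[OF s]] dfn_plus dfn_const dfn_arg)+
    show "fn ?s (a + 0) = 0" using add[of a] by (metis add.right_neutral add_left_cancel order_refl)
    show "fn ?s (a + (n + 1)) = 0" if "fn ?s (a + n) = 0" for n
      using step[of "a + n"] that by (simp add: add.assoc pred_def)
  qed
  have "fn ?s b = mn a b"
  proof (cases "b \<le> a")
    case True
    then show ?thesis using add[of b] mn_add[of b a] by (metis add.commute add_left_cancel)
  next
    case False
    then have "mn b a + a = b" by (intro mn_add) simp
    then show ?thesis using z[of "mn b a"] False mn_0[of a b] by (simp add: add.commute)
  qed
  then show ?thesis using ap_fn[OF s, of b] by simp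
qed

abbreviation mns_elem :: 'a where "mns_elem \<equiv> ap M (con M Rec0) (ap M (K Ty1 Ty0) prd)"

lemma mns_elem: "mns_elem \<in> Dom M (Ty0 \<rightarrow> Ty0 \<rightarrow> Ty0)" "ap M (ap M mns_elem (e a)) (e b) = e (mn a b)"
  using ap_closed[OF Rec_closed ap_closed[OF K_closed prd(1)]] mns_mn[of a b] by (simp_all add: mns_def)

lemmas dfn_mn = dfn_bin[OF mns_elem] and bfn_mn = bfn_bin[OF mns_elem]

text \<open>\<open>mn 1 c\<close> is 1 for c = 0 and 0 otherwise, so case distinction reduces to
  sums, products and truncated differences and needs no recursion of its own.\<close>

lemma ifz_eq: "(if c = 0 then a else b) = mn 1 c * a + mn 1 (mn 1 c) * (b::'n)"
proof -
  have "mn 1 0 = (1::'n)" by (simp add: mn_def)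
  moreover have "mn 1 c = 0" if "c \<noteq> 0"
    using that Suc_le[of 0 c] zero_le[of c] by (simp add: le_less)
  ultimately show ?thesis by (cases "c = 0") (simp, simp del: mn_eq_0)
qed

lemma dfn_ifz: "dfn C \<Longrightarrow> dfn A \<Longrightarrow> dfn B \<Longrightarrow> dfn (\<lambda>f n. if C f n = 0 then A f n else B f n)"
  unfolding ifz_eq by (intro dfn_plus dfn_times dfn_mn dfn_const)

lemma bfn_ifz: "bfn c \<Longrightarrow> bfn a \<Longrightarrow> bfn b \<Longrightarrow> bfn (\<lambda>k m. if c k m = 0 then a k m else b k m)"
  unfolding ifz_eq by (intro bfn_plus bfn_times bfn_mn bfn_const)

subsection \<open>Decidable predicates\<close>

text \<open>Truth is coded by 0, to match the equations \<open>= 0\<close> in choice and bootstrap.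
  Conjunction and disjunction then are sum and product of characteristic functions.\<close>

definition dec :: "(('n \<Rightarrow> 'n) \<Rightarrow> 'n \<Rightarrow> bool) \<Rightarrow> bool" where
  "dec P \<longleftrightarrow> dfn (\<lambda>f n. if P f n then 0 else 1)"

lemma decI: "dfn C \<Longrightarrow> (\<And>f n. f \<in> F1 \<Longrightarrow> C f n = 0 \<longleftrightarrow> P f n) \<Longrightarrow> dec P"
  unfolding dec_def by (rule dfn_cong[OF dfn_ifz[OF _ dfn_const dfn_const, of C 0 1]]) auto

lemma dec_cong: "dec P \<Longrightarrow> (\<And>f n. f \<in> F1 \<Longrightarrow> P f n \<longleftrightarrow> Q f n) \<Longrightarrow> dec Q"
  unfolding dec_def by (erule dfn_cong) auto

lemma dfn_if: "dec P \<Longrightarrow> dfn A \<Longrightarrow> dfn B \<Longrightarrow> dfn (\<lambda>f n. if P f n then A f n else B f n)"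
  unfolding dec_def by (rule dfn_cong[OF dfn_ifz]) (assumption | simp)+

lemma dec_le: "dfn A \<Longrightarrow> dfn B \<Longrightarrow> dec (\<lambda>f n. A f n \<le> B f n)"
  by (rule decI[OF dfn_mn]) auto

lemma dec_not: "dec P \<Longrightarrow> dec (\<lambda>f n. \<not> P f n)"
  unfolding dec_def by (rule dfn_cong[OF dfn_if[unfolded dec_def, OF _ dfn_const dfn_const, of P 1 0]]) auto

lemma dec_and: "dec P \<Longrightarrow> dec Q \<Longrightarrow> dec (\<lambda>f n. P f n \<and> Q f n)"
  by (rule decI[OF dfn_plus[OF dec_def[THEN iffD1] dec_def[THEN iffD1]], of P Q]) auto

lemma dec_or: "dec P \<Longrightarrow> dec Q \<Longrightarrow> dec (\<lambda>f n. P f n \<or> Q f n)"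
  by (rule decI[OF dfn_times[OF dec_def[THEN iffD1] dec_def[THEN iffD1]], of P Q]) auto

lemma dec_imp: "dec P \<Longrightarrow> dec Q \<Longrightarrow> dec (\<lambda>f n. P f n \<longrightarrow> Q f n)"
  unfolding imp_conv_disj by (intro dec_or dec_not)

lemma dec_less: "dfn A \<Longrightarrow> dfn B \<Longrightarrow> dec (\<lambda>f n. A f n < B f n)"
  unfolding not_le[symmetric] by (intro dec_not dec_le)

lemma dec_eq: "dfn A \<Longrightarrow> dfn B \<Longrightarrow> dec (\<lambda>f n. A f n = B f n)"
  unfolding order.eq_iff by (intro dec_and dec_le)

lemma dec_const: "dec (\<lambda>f n. c)"
  unfolding dec_def by (rule dfn_const)

lemma dec_induct:
  assumes "dec (\<lambda>_. P)" "P 0" "\<And>n. P n \<Longrightarrow> P (n + 1)" shows "P n"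
proof -
  have "(if P n then 0 else 1) = (0::'n)"
    by (rule F1_eq_induct[where s="\<lambda>n. if P n then 0 else 1" and t="\<lambda>_. 0"])
       (use assms in \<open>auto simp: dec_def intro!: F1I dfn_const split: if_splits\<close>)
  then show ?thesis by (simp split: if_splits)
qed

subsection \<open>Pairing\<close>

definition tri :: "'n \<Rightarrow> 'n" where "tri = nrec (\<lambda>k m. m + (k + 1)) 0"
definition root :: "'n \<Rightarrow> 'n" where
  "root = nrec (\<lambda>k m. if mn (tri (m + 1)) (k + 1) = 0 then m + 1 else m) 0"
definition pr :: "'n \<Rightarrow> 'n \<Rightarrow> 'n" where "pr a b = tri (a + b) + a"
definition pf :: "'n \<Rightarrow> 'n" where "pf z = mn z (tri (root z))"
definition ps :: "'n \<Rightarrow> 'n" where "ps z = mn (root z) (pf z)"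

lemma bfn_tri_step: "bfn (\<lambda>k m. m + (k + 1))"
  by (intro bfn_plus bfn_const bfn_fst bfn_snd)

lemma tri: "tri \<in> F1" "tri 0 = 0" "tri (n + 1) = tri n + (n + 1)"
  unfolding tri_def using nrec[OF bfn_tri_step] by auto

lemma bfn_root_step: "bfn (\<lambda>k m. if mn (tri (m + 1)) (k + 1) = 0 then m + 1 else m)"
  by (intro bfn_ifz bfn_mn bfn_F1[OF tri(1)] bfn_plus bfn_const bfn_fst bfn_snd)

lemma root: "root \<in> F1" "root 0 = 0"
  "root (k + 1) = (if tri (root k + 1) \<le> k + 1 then root k + 1 else root k)"
  unfolding root_def using nrec[OF bfn_root_step] by auto

lemma tri_mono: "a \<le> b \<Longrightarrow> tri a \<le> tri b"
proof -
  assume "a \<le> b"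
  then have "mn b a + a = b" by (rule mn_add)
  moreover have "tri a \<le> tri (a + c)" for c
  proof (rule dec_induct[where P="\<lambda>c. tri a \<le> tri (a + c)"])
    show "dec (\<lambda>_ c. tri a \<le> tri (a + c))"
      by (intro dec_le dfn_F1[OF tri(1)] dfn_plus dfn_const dfn_arg)
    show "tri a \<le> tri (a + (n + 1))" if "tri a \<le> tri (a + n)" for n
      using tri(3)[of "a + n"] that zero_le[of "a + n + 1"] by (simp add: add.assoc) (metis add.assoc add_increasing2 zero_le)
  qed simp
  ultimately show ?thesis by (metis add.commute)
qed

lemma root_bounds: "tri (root z) \<le> z \<and> z < tri (root z + 1)"
proof (rule dec_induct[where P="\<lambda>z. tri (root z) \<le> z \<and> z < tri (root z + 1)"])
  show "dec (\<lambda>_ z. tri (root z) \<le> z \<and> z < tri (root z + 1))"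
    by (intro dec_and dec_le dec_less dfn_F1[OF tri(1)] dfn_F1[OF root(1)] dfn_plus dfn_const dfn_arg)
  show "tri (root 0) \<le> 0 \<and> 0 < tri (root 0 + 1)" using tri(3)[of 0] by (simp add: root tri)
next
  fix z assume IH: "tri (root z) \<le> z \<and> z < tri (root z + 1)"
  have "z + 1 < tri (root z + 1 + 1)"
  proof -
    have "z + 1 \<le> tri (root z + 1)" using IH by (simp add: Suc_le)
    also have "\<dots> < tri (root z + 1 + 1)"
      using tri(3)[of "root z + 1"] zero_le[of "root z"] by (simp add: add_nonneg_pos)
    finally show ?thesis .
  qed
  then show "tri (root (z + 1)) \<le> z + 1 \<and> z + 1 < tri (root (z + 1) + 1)"
    using IH order_trans[of "tri (root z)" z "z + 1"] by (simp add: root(3) not_le)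
qed

lemma root_pr: "root (pr a b) = a + b"
proof -
  have 1: "tri (a + b) \<le> pr a b" by (simp add: pr_def)
  have "a < a + b + 1" by (simp only: discrete) simp
  then have 2: "pr a b < tri (a + b + 1)" by (simp add: pr_def tri(3))
  have "\<not> root (pr a b) + 1 \<le> a + b" using tri_mono root_bounds[of "pr a b"] 1 by (meson leD le_less_trans order_trans)
  moreover have "\<not> a + b + 1 \<le> root (pr a b)" using tri_mono root_bounds[of "pr a b"] 2 by (meson leD le_less_trans order_trans)
  ultimately show ?thesis by (simp add: Suc_le)
qed

lemma pf_pr [simp]: "pf (pr a b) = a"
  unfolding pf_def root_pr by (simp add: pr_def mn_def)

lemma ps_pr [simp]: "ps (pr a b) = b"
  unfolding ps_def root_pr by (simp add: mn_def)

lemma pr_surj [simp]: "pr (pf z) (ps z) = z"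
proof -
  have a: "pf z + tri (root z) = z" unfolding pf_def using root_bounds by (intro mn_add) simp
  have "pf z + tri (root z) < tri (root z) + (root z + 1)" using a root_bounds[of z] by (simp add: tri(3))
  then have "pf z \<le> root z" by (simp add: discrete add.commute[of "pf z"])
  then have "ps z + pf z = root z" unfolding ps_def by (rule mn_add)
  then show ?thesis using a by (simp add: pr_def add.commute)
qed

lemma pr_inject [simp]: "pr a b = pr c d \<longleftrightarrow> a = c \<and> b = d"
  by (metis pf_pr ps_pr)

lemma tri_ge: "n \<le> tri n"
proof (cases n rule: num_cases)
  case (2 m)
  then show ?thesis using tri(3)[of m] zero_le[of "tri m"] by simp
qed simp

lemma le_pr: "a \<le> pr a b" "b \<le> pr a b"
proof -
  show "a \<le> pr a b" by (simp add: pr_def)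
  have "b \<le> a + b" by simp
  also have "\<dots> \<le> tri (a + b)" by (rule tri_ge)
  also have "\<dots> \<le> pr a b" by (simp add: pr_def)
  finally show "b \<le> pr a b" .
qed

lemma pr_0 [simp]: "pr 0 0 = 0" "pf 0 = 0" "ps 0 = 0"
proof -
  show "pr 0 0 = 0" by (simp add: pr_def tri)
  then show "pf 0 = 0" "ps 0 = 0" using pf_pr[of 0 0] ps_pr[of 0 0] by simp_all
qed

lemma dfn_pr: "dfn A \<Longrightarrow> dfn B \<Longrightarrow> dfn (\<lambda>f n. pr (A f n) (B f n))"
  and dfn_pf: "dfn A \<Longrightarrow> dfn (\<lambda>f n. pf (A f n))"
  and dfn_ps: "dfn A \<Longrightarrow> dfn (\<lambda>f n. ps (A f n))"
  unfolding pr_def pf_def ps_def by (intro dfn_plus dfn_mn dfn_F1[OF tri(1)] dfn_F1[OF root(1)]; assumption)+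

lemma bfn_pr: "bfn pr"
  unfolding pr_def[abs_def] by (intro bfn_plus bfn_F1[OF tri(1)] bfn_fst bfn_snd)

subsection \<open>Abstraction, recursion and choice\<close>

definition PR :: 'a where "PR = (SOME G. G \<in> Dom M (Ty0 \<rightarrow> Ty0 \<rightarrow> Ty0) \<and> (\<forall>a b. ap M (ap M G (e a)) (e b) = e (pr a b)))"

lemma PR: "PR \<in> Dom M (Ty0 \<rightarrow> Ty0 \<rightarrow> Ty0)" "ap M (ap M PR (e a)) (e b) = e (pr a b)"
proof -
  have "\<exists>G. G \<in> Dom M (Ty0 \<rightarrow> Ty0 \<rightarrow> Ty0) \<and> (\<forall>a b. ap M (ap M G (e a)) (e b) = e (pr a b))"
    using bfn_pr unfolding bfn_def rep2_def by (metis dd_e e_N)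
  from someI_ex[OF this] show "PR \<in> Dom M (Ty0 \<rightarrow> Ty0 \<rightarrow> Ty0)" "ap M (ap M PR (e a)) (e b) = e (pr a b)"
    unfolding PR_def by blast+
qed

text \<open>A family of functions is presented uncurried, index and argument packed by
  \<open>pr\<close>. Composition with the section \<open>ap M PR y\<close> performs the currying
  inside the model.\<close>

lemma dfn_fn:
  assumes "dfn \<Psi>"
  shows "rep2 Ty1 Ty0 Ty1 (\<lambda>x y. c1 (\<lambda>m. \<Psi> (fn x) (pr (dd y) m)))"
    and "f \<in> F1 \<Longrightarrow> (\<lambda>m. \<Psi> f (pr n m)) \<in> F1"
proof -
  have P: "ap M PR (e n) \<in> Dom M Ty1" for n by (rule ap_closed[OF PR(1)]) simp
  have c: "fn (ap M (cmpl Ty0 Ty0 Ty0 (c1 (\<Psi> f))) (ap M PR (e n))) = (\<lambda>m. \<Psi> f (pr n m))"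
    and cD: "ap M (cmpl Ty0 Ty0 Ty0 (c1 (\<Psi> f))) (ap M PR (e n)) \<in> Dom M Ty1" if "f \<in> F1" for f n
  proof -
    note g = c2(3)[OF assms that]
    show "ap M (cmpl Ty0 Ty0 Ty0 (c1 (\<Psi> f))) (ap M PR (e n)) \<in> Dom M Ty1"
      by (rule ap_closed[OF cmpl(1)[OF c1(1)[OF g]] P])
    show "fn (ap M (cmpl Ty0 Ty0 Ty0 (c1 (\<Psi> f))) (ap M PR (e n))) = (\<lambda>m. \<Psi> f (pr n m))"
      by (rule ext) (simp add: fn_def cmpl(2)[OF c1(1)[OF g] P] PR(2) ap_c1[OF g])
  qed
  show "f \<in> F1 \<Longrightarrow> (\<lambda>m. \<Psi> f (pr n m)) \<in> F1" using c[of f n] fn_F1[OF cD, of f n] by simp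
  have "rep2 Ty1 Ty0 Ty1 (\<lambda>x y. ap M (cmpl Ty0 Ty0 Ty0 (ap M (c2 \<Psi>) x)) (ap M PR y))"
    by (rule rep2_app[OF rep2_cmpl[OF rep2_app[OF rep2_const rep2_fst]] rep2_app[OF rep2_const rep2_snd]])
       (rule c2(1)[OF assms] PR(1))+
  then show "rep2 Ty1 Ty0 Ty1 (\<lambda>x y. c1 (\<lambda>m. \<Psi> (fn x) (pr (dd y) m)))"
  proof (rule rep2_cong)
    fix x y assume x: "x \<in> Dom M Ty1" and y: "y \<in> N"
    show "ap M (cmpl Ty0 Ty0 Ty0 (ap M (c2 \<Psi>) x)) (ap M PR y) = c1 (\<lambda>m. \<Psi> (fn x) (pr (dd y) m))"
      using c2(2)[OF assms fn_F1[OF x]] c[OF fn_F1[OF x], of "dd y"] c1_fn[OF cD[OF fn_F1[OF x], of "dd y"]] x y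
      by simp
  qed
qed

lemma dfn_subst:
  assumes "dfn \<Theta>" "dfn \<Psi>" "dfn \<chi>"
  shows "dfn (\<lambda>f n. \<Theta> (\<lambda>m. \<Psi> f (pr n m)) (\<chi> f n))"
proof -
  have "rep2 Ty1 Ty0 Ty0 (\<lambda>x y. ap M (ap M (c2 \<Theta>) (c1 (\<lambda>m. \<Psi> (fn x) (pr (dd y) m)))) (e (\<chi> (fn x) (dd y))))"
    by (rule rep2_app, rule rep2_app, rule rep2_const, rule c2(1)[OF assms(1)], rule dfn_fn(1)[OF assms(2)],
      rule assms(3)[unfolded dfn_def])
  then show ?thesis
    unfolding dfn_def
    by (rule rep2_cong) (simp add: c2(2)[OF assms(1) dfn_fn(2)[OF assms(2)]] ap_c1[OF c2(3)[OF assms(1) dfn_fn(2)[OF assms(2)]]])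
qed

lemma dfn_functional:
  assumes Z: "Z \<in> Dom M (Ty1 \<rightarrow> Ty0)" and "dfn \<Psi>"
  shows "dfn (\<lambda>f n. dd (ap M Z (c1 (\<lambda>m. \<Psi> f (pr n m)))))"
proof -
  have "rep2 Ty1 Ty0 Ty0 (\<lambda>x y. ap M Z (c1 (\<lambda>m. \<Psi> (fn x) (pr (dd y) m))))"
    by (rule rep2_app, rule rep2_const, rule Z, rule dfn_fn(1)[OF assms(2)])
  then show ?thesis
    unfolding dfn_def
    by (rule rep2_cong) (simp add: ap_closed[OF Z c1(1)[OF dfn_fn(2)[OF assms(2)]]])
qed

lemma dfn_nrec:
  assumes "dfn \<Psi>" "dfn \<chi>" "dfn \<xi>"
  shows "dfn (\<lambda>f n. nrec (\<lambda>k m. \<Psi> f (pr n (pr k m))) (\<chi> f n) (\<xi> f n))"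
    and "f \<in> F1 \<Longrightarrow> bfn (\<lambda>k m. \<Psi> f (pr n (pr k m)))"
proof -
  \<comment> \<open>Assembled so that applying it to numbers k and m yields \<open>\<Psi> f\<close>
    at the code of (n, (k, m)).\<close>
  let ?H = "\<lambda>x y. ap M (cmpl Ty0 Ty1 Ty1 (cmpl Ty0 Ty0 Ty0 (ap M (c2 \<Psi>) x)))
     (ap M (cmpl Ty0 Ty1 Ty1 (cmpl Ty0 Ty0 Ty0 (ap M PR y))) PR)"
  have r: "rep2 Ty1 Ty0 (Ty0 \<rightarrow> Ty0 \<rightarrow> Ty0) ?H"
    by (intro rep2_app[of Ty1 Ty0 "Ty0 \<rightarrow> Ty1"] rep2_cmpl rep2_app[OF rep2_const rep2_fst] rep2_app[OF rep2_const rep2_snd]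
      rep2_const c2(1)[OF assms(1)] PR(1))
  have H: "?H (c1 f) (e n) \<in> Dom M (Ty0 \<rightarrow> Ty0 \<rightarrow> Ty0)"
    "ap M (ap M (?H (c1 f) (e n)) (e k)) (e m) = e (\<Psi> f (pr n (pr k m)))" if f: "f \<in> F1" for f n k m
  proof -
    have P: "ap M PR (e n) \<in> Dom M Ty1" for n by (rule ap_closed[OF PR(1)]) simp
    have g: "ap M (c2 \<Psi>) (c1 f) \<in> Dom M Ty1" using c2(2,3)[OF assms(1) f] by simp
    note A = cmpl(1)[OF g, of Ty0] and B = cmpl(1)[OF P[of n], of Ty0]
    note A' = cmpl(1)[OF A, of Ty0] and B' = ap_closed[OF cmpl(1)[OF B] PR(1)]
    show "?H (c1 f) (e n) \<in> Dom M (Ty0 \<rightarrow> Ty0 \<rightarrow> Ty0)" by (rule ap_closed[OF A' B'])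
    have Bk: "ap M (cmpl Ty0 Ty0 Ty0 (ap M PR (e n))) (ap M PR (e k)) \<in> Dom M Ty1" by (rule ap_closed[OF B P])
    show "ap M (ap M (?H (c1 f) (e n)) (e k)) (e m) = e (\<Psi> f (pr n (pr k m)))"
      using cmpl(2)[OF A B', of "e k"] cmpl(2)[OF B PR(1), of "e k"] cmpl(2)[OF g Bk, of "e m"] cmpl(2)[OF P P, of "e m" n k]
        c2(2)[OF assms(1) f] ap_c1[OF c2(3)[OF assms(1) f]]
      by (simp add: PR(2))
  qed
  show "bfn (\<lambda>k m. \<Psi> f (pr n (pr k m)))" if "f \<in> F1"
    unfolding bfn_def rep2_def by (rule bexI[OF _ H(1)[OF that, of n]]) (use H(2)[OF that] in \<open>auto elim!: N_cases\<close>)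
  have "rep2 Ty1 Ty0 Ty0 (\<lambda>x y. Rc (?H x y) (e (\<chi> (fn x) (dd y))) (e (\<xi> (fn x) (dd y))))"
    by (rule rep2_app, rule rep2_app, rule rep2_app, rule rep2_const, rule Rec_closed, rule r,
      rule assms(2)[unfolded dfn_def], rule assms(3)[unfolded dfn_def])
  then show "dfn (\<lambda>f n. nrec (\<lambda>k m. \<Psi> f (pr n (pr k m))) (\<chi> f n) (\<xi> f n))"
    unfolding dfn_def
  proof (rule rep2_cong)
    fix x y assume x: "x \<in> Dom M Ty1" and y: "y \<in> N"
    show "Rc (?H x y) (e (\<chi> (fn x) (dd y))) (e (\<xi> (fn x) (dd y))) =
        e (nrec (\<lambda>k m. \<Psi> (fn x) (pr (dd y) (pr k m))) (\<chi> (fn x) (dd y)) (\<xi> (fn x) (dd y)))"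
      using nrec_Rc(1)[OF H[OF fn_F1[OF x], of "dd y"]] x y by simp
  qed
qed

text \<open>The axiom chooses a number for one function. The two arguments f and n are therefore
  merged into the function with first value n and tail f.\<close>

lemma dfn_choice:
  assumes \<Phi>: "dfn \<Phi>" and ex: "\<And>f n. f \<in> F1 \<Longrightarrow> \<exists>m. \<Phi> f (pr n m) = 0"
  shows "\<exists>\<Theta>. dfn \<Theta> \<and> (\<forall>f\<in>F1. \<forall>n. \<Phi> f (pr n (\<Theta> f n)) = 0)"
proof -
  let ?Y = "\<lambda>f y. \<Phi> (\<lambda>m. f (m + 1)) (pr (f 0) y)"
  have "dfn (\<lambda>f y. \<Phi> (\<lambda>m. f (ps (pr y m) + 1)) (pr (f 0) y))"
    by (rule dfn_subst[OF \<Phi>]) (intro dfn_app dfn_plus dfn_pr dfn_ps dfn_arg dfn_const)+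
  then have Y: "dfn ?Y" by simp
  have tl: "(\<lambda>m. f (m + 1)) \<in> F1" if "f \<in> F1" for f
    by (rule F1I) (intro dfn_F1[OF that] dfn_plus dfn_arg dfn_const)
  have app: "ap M (ap M (c2 ?Y) (c1 f)) (e y) = e (?Y f y)" if "f \<in> F1" for f y
    using c2(2,3)[OF Y that] ap_c1 by simp
  have "\<exists>n\<in>N. ap M (ap M (c2 ?Y) x) n = zr" if x: "x \<in> Dom M Ty1" for x
  proof -
    obtain f where f: "f \<in> F1" "x = c1 f" using D1_cases[OF x] by blast
    obtain y where "?Y f y = 0" using ex[OF tl[OF f(1)], of "f 0"] by blast
    then have "ap M (ap M (c2 ?Y) x) (e y) = zr" using app[OF f(1), of y] f(2) by (simp add: e_0)
    then show ?thesis by blast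
  qed
  from QF_AC[OF c2(1)[OF Y] this] obtain Z where Z: "Z \<in> Dom M (Ty1 \<rightarrow> Ty0)"
    "\<And>x. x \<in> Dom M Ty1 \<Longrightarrow> ap M (ap M (c2 ?Y) x) (ap M Z x) = zr" by blast
  \<comment> \<open>At the code of (n, m) this is the m-th value of the function with head n and
    tail f.\<close>
  let ?cons = "\<lambda>f z. if ps z = 0 then pf z else f (pred (ps z))"
  have cons: "dfn ?cons"
    by (intro dfn_ifz dfn_ps dfn_pf dfn_app dfn_F1[OF pred_F1] dfn_arg)
  let ?\<Theta> = "\<lambda>f n. dd (ap M Z (c1 (\<lambda>m. ?cons f (pr n m))))"
  have "\<Phi> f (pr n (?\<Theta> f n)) = 0" if f: "f \<in> F1" for f n
  proof -
    let ?g = "\<lambda>m. ?cons f (pr n m)"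
    have g: "?g \<in> F1" by (rule dfn_fn(2)[OF cons f])
    have s: "(\<lambda>m. ?g (m + 1)) = f"
    proof
      fix m :: 'n
      have "m + 1 \<noteq> 0" using discrete[of 0 m] zero_le[of m] by auto
      moreover have "pred (m + 1) = m" by (simp add: pred_def mn_def)
      ultimately show "?g (m + 1) = f m" by simp
    qed
    have "ap M Z (c1 ?g) \<in> N" by (rule ap_closed[OF Z(1) c1(1)[OF g]])
    then have "e (?Y ?g (?\<Theta> f n)) = e 0"
      using Z(2)[OF c1(1)[OF g]] app[OF g, of "?\<Theta> f n"] by (simp add: e_0)
    then have "?Y ?g (?\<Theta> f n) = 0" by (simp only: e_inject)
    then show ?thesis using s by simp
  qed
  moreover have "dfn ?\<Theta>" by (rule dfn_functional[OF Z(1) cons])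
  ultimately show ?thesis by blast
qed

end

section \<open>Differences and fractions\<close>

text \<open>The ring of formal differences makes the number semiring an ordered integral domain,
  whose field of fractions serves as the rationals of the model.\<close>

definition difference_rel :: "'n::linordered_semidom \<times> 'n \<Rightarrow> 'n \<times> 'n \<Rightarrow> bool" where
  "difference_rel x y \<longleftrightarrow> fst x + snd y = fst y + snd x"

lemma equivp_difference_rel: "equivp (difference_rel :: 'n::linordered_semidom \<times> 'n \<Rightarrow> _)"
proof (rule equivpI)
  show "transp (difference_rel :: 'n \<times> 'n \<Rightarrow> _)"
  proof (rule transpI)
    fix x y z :: "'n \<times> 'n" assume h: "difference_rel x y" "difference_rel y z"
    have "fst x + snd z + (fst y + snd y) = fst z + snd x + (fst y + snd y)"
      using h unfolding difference_rel_def by (metis add.assoc add.commute)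
    then show "difference_rel x z" by (simp add: difference_rel_def)
  qed
qed (auto simp: difference_rel_def intro!: reflpI sympI)

quotient_type (overloaded) 'n signed = "'n::linordered_semidom \<times> 'n" / difference_rel
  morphisms Rep_signed Abs_signed
  by (rule equivp_difference_rel)

lemma difference_rel_times:
  fixes a b c d :: "'n::linordered_semidom"
  assumes "a + b' = a' + b" "c + d' = c' + d"
  shows "(a * c + b * d) + (a' * d' + b' * c') = (a' * c' + b' * d') + (a * d + b * c)"
proof -
  have 1: "(a + b') * c + (a' + b) * d + (a' * (c' + d) + b' * (c + d'))
      = (a' + b) * c + (a + b') * d + (a' * (c + d') + b' * (c' + d))"
    using assms by (simp add: add.commute)
  \<comment> \<open>The added cross terms complete the products to sums to which both hypotheses
    apply; they are cancelled at the end.\<close>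
  have "(a * c + b * d) + (a' * d' + b' * c') + (b' * c + a' * d + a' * c + b' * d)
      = (a + b') * c + (a' + b) * d + (a' * (c + d') + b' * (c' + d))"
    by (simp add: algebra_simps)
  also have "\<dots> = (a' + b) * c + (a + b') * d + (a' * (c' + d) + b' * (c + d'))"
    using assms by (simp add: add.commute)
  also have "\<dots> = (a' * c' + b' * d') + (a * d + b * c) + (b' * c + a' * d + a' * c + b' * d)"
    by (simp add: algebra_simps)
  finally show ?thesis by (simp only: add_right_cancel)
qed

instantiation signed :: (linordered_semidom) linordered_idom
begin

lift_definition zero_signed :: "'a signed" is "(0, 0)" .
lift_definition one_signed :: "'a signed" is "(1, 0)" .
lift_definition plus_signed :: "'a signed \<Rightarrow> 'a signed \<Rightarrow> 'a signed"
  is "\<lambda>x y. (fst x + fst y, snd x + snd y)"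
proof -
  fix x x' y y' :: "'a \<times> 'a" assume h: "difference_rel x x'" "difference_rel y y'"
  then have "(fst x + snd x') + (fst y + snd y') = (fst x' + snd x) + (fst y' + snd y)"
    by (simp add: difference_rel_def)
  then show "difference_rel (fst x + fst y, snd x + snd y) (fst x' + fst y', snd x' + snd y')"
    by (simp add: difference_rel_def algebra_simps)
qed
lift_definition uminus_signed :: "'a signed \<Rightarrow> 'a signed" is "\<lambda>x. (snd x, fst x)"
  by (simp add: difference_rel_def add.commute)
lift_definition times_signed :: "'a signed \<Rightarrow> 'a signed \<Rightarrow> 'a signed"
  is "\<lambda>x y. (fst x * fst y + snd x * snd y, fst x * snd y + snd x * fst y)"
proof -
  fix x x' y y' :: "'a \<times> 'a" assume "difference_rel x x'" "difference_rel y y'"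
  then show "difference_rel (fst x * fst y + snd x * snd y, fst x * snd y + snd x * fst y)
      (fst x' * fst y' + snd x' * snd y', fst x' * snd y' + snd x' * fst y')"
    using difference_rel_times[of "fst x" "snd x'" "fst x'" "snd x" "fst y" "snd y'" "fst y'" "snd y"]
    by (simp add: difference_rel_def)
qed
lift_definition less_eq_signed :: "'a signed \<Rightarrow> 'a signed \<Rightarrow> bool"
  is "\<lambda>x y. fst x + snd y \<le> fst y + snd x"
proof -
  fix x x' y y' :: "'a \<times> 'a" assume h: "difference_rel x x'" "difference_rel y y'"
  have "fst x + snd y \<le> fst y + snd x \<longleftrightarrow>
      fst x + snd y + (snd x' + snd y') \<le> fst y + snd x + (snd x' + snd y')" by simp
  also have "fst x + snd y + (snd x' + snd y') = fst x' + snd y' + (snd x + snd y)"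
    using h unfolding difference_rel_def by (metis add.assoc add.commute)
  also have "fst y + snd x + (snd x' + snd y') = fst y' + snd x' + (snd x + snd y)"
    using h unfolding difference_rel_def by (metis add.assoc add.commute)
  finally show "(fst x + snd y \<le> fst y + snd x) = (fst x' + snd y' \<le> fst y' + snd x')" by simp
qed
definition minus_signed :: "'a signed \<Rightarrow> 'a signed \<Rightarrow> 'a signed" where
  "minus_signed x y = x + - y"
definition less_signed :: "'a signed \<Rightarrow> 'a signed \<Rightarrow> bool" where
  "less_signed x y \<longleftrightarrow> x \<le> y \<and> \<not> y \<le> x"
definition abs_signed :: "'a signed \<Rightarrow> 'a signed" where
  "abs_signed x = (if x < 0 then - x else x)"
definition sgn_signed :: "'a signed \<Rightarrow> 'a signed" where
  "sgn_signed x = (if x = 0 then 0 else if 0 < x then 1 else - 1)"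

instance
proof
  fix i j k :: "'a signed"
  show "(i + j) + k = i + (j + k)" by transfer (simp add: difference_rel_def algebra_simps)
  show "i + j = j + i" by transfer (simp add: difference_rel_def algebra_simps)
  show "0 + i = i" by transfer (simp add: difference_rel_def)
  show "- i + i = 0" by transfer (simp add: difference_rel_def add.commute)
  show "i - j = i + - j" by (rule minus_signed_def)
  show "i + j - i = j" "i - j - k = i - (j + k)"
    unfolding minus_signed_def by (transfer; simp add: difference_rel_def algebra_simps)+
  show "0 * i = 0" "i * 0 = 0" by (transfer; simp add: difference_rel_def)+
  show "(i * j) * k = i * (j * k)" by transfer (simp add: difference_rel_def algebra_simps)
  show "i * j = j * i" by transfer (simp add: difference_rel_def algebra_simps)
  show "1 * i = i" by transfer (simp add: difference_rel_def)
  show "(i + j) * k = i * k + j * k" by transfer (simp add: difference_rel_def algebra_simps)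
  show "(0::'a signed) \<noteq> 1" by transfer (simp add: difference_rel_def)
  show "i < j \<longleftrightarrow> i \<le> j \<and> \<not> j \<le> i" by (rule less_signed_def)
  show "i \<le> i" by transfer simp
  show "i \<le> j \<Longrightarrow> j \<le> k \<Longrightarrow> i \<le> k"
  proof transfer
    fix i j k :: "'a \<times> 'a" assume "fst i + snd j \<le> fst j + snd i" "fst j + snd k \<le> fst k + snd j"
    then have "(fst i + snd j) + (fst j + snd k) \<le> (fst j + snd i) + (fst k + snd j)" by (rule add_mono)
    then have "(fst i + snd k) + (fst j + snd j) \<le> (fst k + snd i) + (fst j + snd j)" by (simp add: algebra_simps)
    then show "fst i + snd k \<le> fst k + snd i" by simp
  qed
  show "i \<le> j \<Longrightarrow> j \<le> i \<Longrightarrow> i = j" by transfer (simp add: difference_rel_def)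
  show "i \<le> j \<or> j \<le> i" by transfer (rule linear)
  show "i \<le> j \<Longrightarrow> k + i \<le> k + j"
  proof transfer
    fix i j k :: "'a \<times> 'a" assume "fst i + snd j \<le> fst j + snd i"
    then have "(fst k + snd k) + (fst i + snd j) \<le> (fst k + snd k) + (fst j + snd i)" by simp
    then show "fst (fst k + fst i, snd k + snd i) + snd (fst k + fst j, snd k + snd j)
        \<le> fst (fst k + fst j, snd k + snd j) + snd (fst k + fst i, snd k + snd i)"
      by (simp add: algebra_simps)
  qed
  show "\<bar>i\<bar> = (if i < 0 then - i else i)" by (rule abs_signed_def)
  show "sgn i = (if i = 0 then 0 else if 0 < i then 1 else - 1)" by (rule sgn_signed_def)
  show "i < j \<Longrightarrow> 0 < k \<Longrightarrow> k * i < k * j"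
    unfolding less_signed_def
  proof transfer
    fix i j k :: "'a \<times> 'a"
    assume "fst i + snd j \<le> fst j + snd i \<and> \<not> fst j + snd i \<le> fst i + snd j"
      and "fst (0, 0) + snd k \<le> fst k + snd (0, 0) \<and> \<not> fst k + snd (0, 0) \<le> fst (0, 0) + snd k"
    then have ij: "fst i + snd j < fst j + snd i" and k: "snd k < fst k" by auto
    define r where "r = fst k - snd k"
    have f: "fst k = snd k + r" using k by (simp add: r_def)
    then have "0 < r" using k by simp
    then have "r * (fst i + snd j) < r * (fst j + snd i)" using ij by (rule mult_strict_left_mono[rotated])
    moreover have "(fst k * fst i + snd k * snd i) + (fst k * snd j + snd k * fst j)
        = r * (fst i + snd j) + snd k * (fst i + snd i + fst j + snd j)"
      unfolding f by (simp add: algebra_simps)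
    moreover have "(fst k * fst j + snd k * snd j) + (fst k * snd i + snd k * fst i)
        = r * (fst j + snd i) + snd k * (fst i + snd i + fst j + snd j)"
      unfolding f by (simp add: algebra_simps)
    ultimately show "fst (fst k * fst i + snd k * snd i, fst k * snd i + snd k * fst i) +
        snd (fst k * fst j + snd k * snd j, fst k * snd j + snd k * fst j)
        \<le> fst (fst k * fst j + snd k * snd j, fst k * snd j + snd k * fst j) +
        snd (fst k * fst i + snd k * snd i, fst k * snd i + snd k * fst i) \<and>
        \<not> fst (fst k * fst j + snd k * snd j, fst k * snd j + snd k * fst j) +
        snd (fst k * fst i + snd k * snd i, fst k * snd i + snd k * fst i)
        \<le> fst (fst k * fst i + snd k * snd i, fst k * snd i + snd k * fst i) +
        snd (fst k * fst j + snd k * snd j, fst k * snd j + snd k * fst j)"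
      by (simp add: not_le less_imp_le)
  qed
qed

end

lift_definition of_num :: "'n::linordered_semidom \<Rightarrow> 'n signed" is "\<lambda>a. (a, 0)" .

lemma of_num: "of_num (a + b) = of_num a + of_num b" "of_num (a * b) = of_num a * of_num b"
  "of_num 0 = 0" "of_num 1 = 1" "of_num a \<le> of_num b \<longleftrightarrow> a \<le> b"
  by (transfer; simp add: difference_rel_def)+

lemma signed_cases: obtains a b where "z = of_num a - of_num b"
proof -
  have "\<exists>a b. z = of_num a + - of_num b"
    by transfer (auto simp: difference_rel_def)
  then show ?thesis using that by auto
qed

type_synonym 'n rational = "'n signed fract"

definition toQ :: "'n::linordered_semidom \<Rightarrow> 'n rational" where
  "toQ a = Fract (of_num a) 1"

lemma toQ_add: "toQ (a + b) = toQ a + toQ b"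
  and toQ_mult: "toQ (a * b) = toQ a * toQ b"
  and toQ_0 [simp]: "toQ 0 = 0" and toQ_1 [simp]: "toQ 1 = 1"
  and toQ_le: "toQ a \<le> toQ b \<longleftrightarrow> a \<le> b"
  by (simp_all add: toQ_def of_num Zero_fract_def One_fract_def)

lemma toQ_less: "toQ a < toQ b \<longleftrightarrow> a < b" and toQ_eq: "toQ a = toQ b \<longleftrightarrow> a = b"
  using toQ_le[of a b] toQ_le[of b a] by (auto simp: order.eq_iff less_le_not_le)

lemma rational_cases:
  obtains a b c where "(q :: 'n::linordered_semidom rational) = (toQ a - toQ b) / toQ c" "0 < c"
proof -
  obtain x y where q: "q = Fract x y" "0 < y"
  proof (cases q)
    case (Fract a b)
    then show ?thesis
      using that[of a b] that[of "- a" "- b"] by (cases "0 < b") auto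
  qed
  obtain a b where x: "x = of_num a - of_num b" by (rule signed_cases)
  obtain c d where y: "y = of_num c - of_num d" by (rule signed_cases)
  have cd: "d < c" using q(2) of_num(5)[of c d] by (simp add: y not_le[symmetric])
  define c' where "c' = c - d"
  have "c = c' + d" using cd by (simp add: c'_def)
  then have y': "y = of_num c'" by (simp add: y of_num)
  have "0 < c'" using q(2) of_num(5)[of c' 0] by (simp add: y' of_num(3) not_le[symmetric])
  moreover have "q = (toQ a - toQ b) / toQ c'"
    using q by (simp add: toQ_def x y' divide_fract_def)
  ultimately show ?thesis using that by blast
qed

context num_model begin

subsection \<open>Rationals and reals\<close>

definition mk :: "'n \<Rightarrow> 'n \<Rightarrow> 'n \<Rightarrow> 'n" where "mk a b c = pr (pr a b) c"
definition qp :: "'n \<Rightarrow> 'n" where "qp z = pf (pf z)"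
definition qn :: "'n \<Rightarrow> 'n" where "qn z = ps (pf z)"
definition qd :: "'n \<Rightarrow> 'n" where "qd z = ps z + 1"
definition qv :: "'n \<Rightarrow> 'n rational" where "qv z = (toQ (qp z) - toQ (qn z)) / toQ (qd z)"

definition ad :: "'n \<Rightarrow> 'n \<Rightarrow> 'n" where
  "ad q r = mk (qp q * qd r + qp r * qd q) (qn q * qd r + qn r * qd q) (pred (qd q * qd r))"
definition mi :: "'n \<Rightarrow> 'n" where "mi q = mk (qn q) (qp q) (ps q)"
definition ab :: "'n \<Rightarrow> 'n" where "ab q = (if mn (qn q) (qp q) = 0 then q else mi q)"
definition p2 :: "'n \<Rightarrow> 'n" where "p2 = nrec (\<lambda>k m. m + m) 1"
definition dya :: "'n \<Rightarrow> 'n \<Rightarrow> 'n" where "dya m n = mk m 0 (pred (p2 n))"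
definition dy :: "'n \<Rightarrow> 'n rational" where "dy n = 1 / toQ (p2 n)"

lemma pred_Suc: "0 < n \<Longrightarrow> pred n + 1 = n"
  unfolding pred_def using Suc_le[of 0 n] by (intro mn_add) simp

lemma Suc_pos [simp]: "0 < n + (1::'n)"
  by (simp add: discrete)

lemma qd_pos [simp]: "0 < toQ (qd z)" "toQ (qd z) \<noteq> 0"
  using toQ_less[of 0 "qd z"] by (auto simp: qd_def)

lemma qd_pos' [simp]: "0 < qd z" by (simp add: qd_def)

lemma qv_mk: "qv (mk a b c) = (toQ a - toQ b) / toQ (c + 1)"
  by (simp add: qv_def mk_def qp_def qn_def qd_def)

lemma qv_ad [simp]: "qv (ad q r) = qv q + qv r"
  unfolding ad_def qv_mk pred_Suc[OF mult_pos_pos[OF qd_pos' qd_pos']]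
  by (simp add: qv_def toQ_add toQ_mult field_simps)

lemma qv_mi [simp]: "qv (mi q) = - qv q"
  by (simp add: mi_def qv_mk) (simp add: qv_def qd_def minus_divide_left)

lemma qv_nonneg: "qn z \<le> qp z \<longleftrightarrow> 0 \<le> qv z"
  using qd_pos(1)[of z] by (simp add: qv_def zero_le_divide_iff toQ_le less_imp_le not_le del: qd_pos)

lemma qv_ab [simp]: "qv (ab q) = \<bar>qv q\<bar>"
  by (simp add: ab_def qv_nonneg abs_if)

lemma qv_less: "qp q * qd r + qn r * qd q < qp r * qd q + qn q * qd r \<longleftrightarrow> qv q < qv r"
proof -
  have "qv q < qv r \<longleftrightarrow> (toQ (qp q) - toQ (qn q)) * toQ (qd r) < (toQ (qp r) - toQ (qn r)) * toQ (qd q)"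
    by (simp add: qv_def divide_less_eq less_divide_eq field_simps)
  also have "\<dots> \<longleftrightarrow> toQ (qp q * qd r + qn r * qd q) < toQ (qp r * qd q + qn q * qd r)"
    by (simp add: toQ_add toQ_mult algebra_simps)
  finally show ?thesis by (simp add: toQ_less)
qed

lemma p2: "p2 \<in> F1" "p2 0 = 1" "p2 (n + 1) = p2 n + p2 n"
proof -
  have "bfn (\<lambda>k m. m + m)" by (intro bfn_plus bfn_snd)
  from nrec[OF this] show "p2 \<in> F1" "p2 0 = 1" "p2 (n + 1) = p2 n + p2 n" by (auto simp: p2_def)
qed

lemma p2_gt: "n < p2 n"
proof (rule dec_induct[where P="\<lambda>n. n < p2 n"])
  show "dec (\<lambda>_ n. n < p2 n)" by (intro dec_less dfn_F1[OF p2(1)] dfn_arg)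
  show "n + 1 < p2 (n + 1)" if "n < p2 n" for n
  proof -
    have "n + 1 \<le> p2 n" using that by (simp add: Suc_le)
    also have "\<dots> < p2 n + p2 n" using that zero_le[of n] by (simp add: le_less_trans)
    finally show ?thesis by (simp add: p2)
  qed
qed (simp add: p2)

lemma p2_pos [simp]: "0 < p2 n"
  using p2_gt[of n] zero_le[of n] by (rule le_less_trans[rotated])

lemma qv_dya [simp]: "qv (dya m n) = toQ m * dy n"
  by (simp add: dya_def qv_mk pred_Suc dy_def)

lemma toQ_p2_pos [simp]: "0 < toQ (p2 n)"
  using toQ_less[of 0 "p2 n"] by simp

lemma dy_pos [simp]: "0 < dy n"
  using toQ_less[of 0 "p2 n"] by (simp add: dy_def)

lemma dy_0 [simp]: "dy 0 = 1" by (simp add: dy_def p2)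

lemma dy_Suc: "dy (n + 1) = dy n / 2"
  by (simp add: dy_def p2 toQ_add)

lemma p2_add: "p2 (a + b) = p2 a * p2 b"
proof (rule dec_induct[where P="\<lambda>b. p2 (a + b) = p2 a * p2 b"])
  show "dec (\<lambda>_ b. p2 (a + b) = p2 a * p2 b)"
    by (intro dec_eq dfn_F1[OF p2(1)] dfn_plus dfn_times dfn_const dfn_arg)
  show "p2 (a + (n + 1)) = p2 a * p2 (n + 1)" if "p2 (a + n) = p2 a * p2 n" for n
    using p2(3)[of "a + n"] p2(3)[of n] that by (simp add: algebra_simps)
qed (simp add: p2)

lemma dy_add: "dy (a + b) = dy a * dy b"
  by (simp add: dy_def p2_add toQ_mult)

lemma dy_le_1: "dy n \<le> 1"
  using toQ_le[of 1 "p2 n"] Suc_le[of 0 "p2 n"] toQ_less[of 0 "p2 n"] by (simp add: dy_def)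

lemma dy_mono: "a \<le> b \<Longrightarrow> dy b \<le> dy a"
proof -
  assume "a \<le> b"
  then have "dy b = dy (mn b a) * dy a" using mn_add dy_add by metis
  also have "\<dots> \<le> 1 * dy a" by (intro mult_right_mono dy_le_1) (simp add: less_imp_le)
  finally show ?thesis by simp
qed

text \<open>Rationals are quotients of the model's own numbers, so a positive rational is at least
  1/c for its denominator c, and 1/c > 2^-c even in a nonstandard model.\<close>

lemma ex_dy_less: assumes "0 < q" shows "\<exists>n. dy n < q"
proof -
  obtain a b c where q: "q = (toQ a - toQ b) / toQ c" and c: "0 < c" by (rule rational_cases)
  have c': "0 < toQ c" using c toQ_less[of 0 c] by simp
  have "b < a" using assms c' by (simp add: q zero_less_divide_iff toQ_less)
  then have "toQ (b + 1) \<le> toQ a" by (simp only: toQ_le Suc_le)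
  then have "1 / toQ c \<le> q" unfolding q using c' by (intro divide_right_mono) (auto simp: toQ_add)
  moreover have "dy c < 1 / toQ c" unfolding dy_def using c' p2_gt[of c]
    by (intro divide_strict_left_mono mult_pos_pos) (auto simp: toQ_less)
  ultimately show ?thesis by (intro exI[of _ c]) simp
qed

lemma qv_surj: obtains z where "qv z = q"
proof -
  obtain a b c where q: "q = (toQ a - toQ b) / toQ c" "0 < c" by (rule rational_cases)
  then have "qv (mk a b (pred c)) = q" by (simp add: qv_mk pred_Suc)
  then show ?thesis using that by blast
qed

definition q0c :: 'n where "q0c = mk 0 0 0"
definition q1c :: 'n where "q1c = mk 1 0 0"

lemma qv_q0c [simp]: "qv q0c = 0" and qv_q1c [simp]: "qv q1c = 1"
  by (simp_all add: q0c_def q1c_def qv_mk)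

lemma dfn_mk: "dfn A \<Longrightarrow> dfn B \<Longrightarrow> dfn C \<Longrightarrow> dfn (\<lambda>f n. mk (A f n) (B f n) (C f n))"
  and dfn_qp: "dfn A \<Longrightarrow> dfn (\<lambda>f n. qp (A f n))"
  and dfn_qn: "dfn A \<Longrightarrow> dfn (\<lambda>f n. qn (A f n))"
  and dfn_qd: "dfn A \<Longrightarrow> dfn (\<lambda>f n. qd (A f n))"
  and dfn_pred: "dfn A \<Longrightarrow> dfn (\<lambda>f n. pred (A f n))"
  unfolding mk_def qp_def qn_def qd_def by (intro dfn_pr dfn_pf dfn_ps dfn_plus dfn_const dfn_F1[OF pred_F1]; assumption)+

lemma dfn_p2: "dfn A \<Longrightarrow> dfn (\<lambda>f n. p2 (A f n))"
  by (rule dfn_F1[OF p2(1)])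

lemma dfn_ad: "dfn A \<Longrightarrow> dfn B \<Longrightarrow> dfn (\<lambda>f n. ad (A f n) (B f n))"
  and dfn_mi: "dfn A \<Longrightarrow> dfn (\<lambda>f n. mi (A f n))"
  and dfn_ab: "dfn A \<Longrightarrow> dfn (\<lambda>f n. ab (A f n))"
  and dfn_dya: "dfn A \<Longrightarrow> dfn B \<Longrightarrow> dfn (\<lambda>f n. dya (A f n) (B f n))"
  unfolding ad_def mi_def ab_def dya_def
  by (intro dfn_mk dfn_qp dfn_qn dfn_qd dfn_pred dfn_ps dfn_plus dfn_times dfn_ifz dfn_mn dfn_const dfn_p2; assumption)+

lemma dec_qv_less: "dfn A \<Longrightarrow> dfn B \<Longrightarrow> dec (\<lambda>f n. qv (A f n) < qv (B f n))"
  unfolding qv_less[symmetric] by (intro dec_less dfn_plus dfn_times dfn_qp dfn_qn dfn_qd)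

lemma dec_qv_le: "dfn A \<Longrightarrow> dfn B \<Longrightarrow> dec (\<lambda>f n. qv (A f n) \<le> qv (B f n))"
  unfolding not_less[symmetric] by (intro dec_not dec_qv_less)

definition isR :: "('n \<Rightarrow> 'n) \<Rightarrow> bool" where
  "isR x \<longleftrightarrow> (\<forall>n i. \<bar>qv (x n) - qv (x (n + i))\<bar> < dy n)"
definition eqR :: "('n \<Rightarrow> 'n) \<Rightarrow> ('n \<Rightarrow> 'n) \<Rightarrow> bool" where
  "eqR x y \<longleftrightarrow> (\<forall>n. \<bar>qv (x n) - qv (y n)\<bar> \<le> 2 * dy n)"
definition ltR :: "('n \<Rightarrow> 'n) \<Rightarrow> ('n \<Rightarrow> 'n) \<Rightarrow> bool" where
  "ltR x y \<longleftrightarrow> (\<exists>n. qv (x n) + 2 * dy n < qv (y n))"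
definition rco :: "'n \<Rightarrow> 'n \<Rightarrow> 'n" where "rco q = (\<lambda>n. q)"
definition rad :: "('n \<Rightarrow> 'n) \<Rightarrow> ('n \<Rightarrow> 'n) \<Rightarrow> 'n \<Rightarrow> 'n" where "rad x y = (\<lambda>n. ad (x (n + 1)) (y (n + 1)))"
definition rsb :: "('n \<Rightarrow> 'n) \<Rightarrow> ('n \<Rightarrow> 'n) \<Rightarrow> 'n \<Rightarrow> 'n" where "rsb x y = (\<lambda>n. ad (x (n + 1)) (mi (y (n + 1))))"
definition rab :: "('n \<Rightarrow> 'n) \<Rightarrow> 'n \<Rightarrow> 'n" where "rab x = (\<lambda>n. ab (x n))"
definition inball :: "('n \<Rightarrow> 'n) \<Rightarrow> 'n \<Rightarrow> ('n \<Rightarrow> 'n) \<Rightarrow> bool" where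
  "inball x r y \<longleftrightarrow> ltR (rab (rsb x y)) (rco r)"
definition posR :: "('n \<Rightarrow> 'n) \<Rightarrow> bool" where "posR x \<longleftrightarrow> ltR (rco q0c) x"
definition realfun :: "(('n \<Rightarrow> 'n) \<Rightarrow> 'n \<Rightarrow> 'n) \<Rightarrow> bool" where
  "realfun F \<longleftrightarrow> (\<forall>x\<in>F1. isR x \<longrightarrow> isR (F x)) \<and>
     (\<forall>x\<in>F1. isR x \<longrightarrow> (\<forall>y\<in>F1. isR y \<longrightarrow> eqR x y \<longrightarrow> eqR (F x) (F y)))"
definition openP :: "(('n \<Rightarrow> 'n) \<Rightarrow> bool) \<Rightarrow> bool" where
  "openP P \<longleftrightarrow> (\<forall>x\<in>F1. isR x \<longrightarrow> P x \<longrightarrow> (\<exists>r. 0 < qv r \<and> (\<forall>y\<in>F1. isR y \<longrightarrow> inball x r y \<longrightarrow> P y)))"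
definition sbar :: "('n \<Rightarrow> 'n) \<Rightarrow> 'n \<Rightarrow> 'n" where
  "sbar f n = nrec (\<lambda>k s. pr s (f k) + 1) 0 n"

lemma inball: "inball x r y \<longleftrightarrow> (\<exists>n. \<bar>qv (x (n + 1)) - qv (y (n + 1))\<bar> + 2 * dy n < qv r)"
  by (simp add: inball_def ltR_def rab_def rsb_def rco_def)

lemma posR: "posR x \<longleftrightarrow> (\<exists>n. 2 * dy n < qv (x n))"
  by (simp add: posR_def ltR_def rco_def)

lemma F1_rco [simp]: "rco q \<in> F1"
  unfolding rco_def by (rule F1I) (rule dfn_const)

lemma F1_rad [simp]: "x \<in> F1 \<Longrightarrow> y \<in> F1 \<Longrightarrow> rad x y \<in> F1"
  and F1_rsb [simp]: "x \<in> F1 \<Longrightarrow> y \<in> F1 \<Longrightarrow> rsb x y \<in> F1"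
  and F1_rab [simp]: "x \<in> F1 \<Longrightarrow> rab x \<in> F1"
  unfolding rad_def rsb_def rab_def
  by (rule F1I, intro dfn_ad dfn_mi dfn_ab dfn_F1[where g=x] dfn_F1[where g=y] dfn_plus dfn_arg dfn_const, assumption+)+

subsection \<open>Evaluation of terms and formulas in number models\<close>

abbreviation den0 where "den0 R C t n \<equiv> den M R C t Ty0 (e n)"
abbreviation den1 where "den1 R C t g \<equiv> den M R C t Ty1 (c1 g)"

lemma den0_intros:
  "den0 R C \<^bold>0 0" "den0 R C \<^bold>1 1"
  "den0 R C s a \<Longrightarrow> den0 R C t b \<Longrightarrow> den0 R C (s \<^bold>+ t) (a + b)"
  "den0 R C s a \<Longrightarrow> den0 R C t b \<Longrightarrow> den0 R C (s \<^bold>* t) (a * b)"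
  using den_zero[of R C] den_one[of R C] den_plus[of R C s "e a" t "e b"] den_times[of R C s "e a" t "e b"]
  by (simp_all add: e_0 e_1 e_add e_mult)

lemma sat0_intros:
  "den0 R C s a \<Longrightarrow> den0 R C t b \<Longrightarrow> sat M R C (s \<^bold>= t) (a = b)"
  "den0 R C s a \<Longrightarrow> den0 R C t b \<Longrightarrow> sat M R C (s \<^bold>< t) (a < b)"
  using sat_eq'[of R C s "e a" t "e b"] sat_less[of M R C s "e a" t "e b"] by (simp_all add: e_less)

lemma ball_N: "(\<forall>x\<in>N. Q x) \<longleftrightarrow> (\<forall>n. Q (e n))" and bex_N: "(\<exists>x\<in>N. Q x) \<longleftrightarrow> (\<exists>n. Q (e n))"
  by (metis e_N e_dd)+

lemma ball_D1: "(\<forall>x\<in>Dom M Ty1. Q x) \<longleftrightarrow> (\<forall>f\<in>F1. Q (c1 f))" and bex_D1: "(\<exists>x\<in>Dom M Ty1. Q x) \<longleftrightarrow> (\<exists>f\<in>F1. Q (c1 f))"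
  by (metis c1(1) c1_fn fn_F1)+

lemma sat_all0:
  "(\<And>C' n t. extends M R C C' \<Longrightarrow> den0 R C' t n \<Longrightarrow> sat M R C' (F t) (Q n)) \<Longrightarrow> sat M R C (hall Ty0 F) (\<forall>n. Q n)"
  using sat_all[of R C Ty0 F "\<lambda>x. Q (dd x)"] by (simp add: ball_N)

lemma sat_ex0:
  "(\<And>C' n t. extends M R C C' \<Longrightarrow> den0 R C' t n \<Longrightarrow> sat M R C' (F t) (Q n)) \<Longrightarrow> sat M R C (hex Ty0 F) (\<exists>n. Q n)"
  using sat_ex[of R C Ty0 F "\<lambda>x. Q (dd x)"] by (simp add: bex_N)

lemma sat_all1:
  "(\<And>C' f t. extends M R C C' \<Longrightarrow> f \<in> F1 \<Longrightarrow> den1 R C' t f \<Longrightarrow> sat M R C' (F t) (Q f)) \<Longrightarrow>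
     sat M R C (hall Ty1 F) (\<forall>f\<in>F1. Q f)"
  using sat_all[of R C Ty1 F "\<lambda>x. Q (fn x)"] by (simp add: ball_D1)

lemma sat_ex1:
  "(\<And>C' f t. extends M R C C' \<Longrightarrow> f \<in> F1 \<Longrightarrow> den1 R C' t f \<Longrightarrow> sat M R C' (F t) (Q f)) \<Longrightarrow>
     sat M R C (hex Ty1 F) (\<exists>f\<in>F1. Q f)"
  using sat_ex[of R C Ty1 F "\<lambda>x. Q (fn x)"] by (simp add: bex_D1)

text \<open>Values outside of \<open>F1\<close> are normalised to make functionals unique.\<close>

definition dfnc :: "(('n \<Rightarrow> 'n) \<Rightarrow> 'n \<Rightarrow> 'n) \<Rightarrow> bool" where
  "dfnc \<Phi> \<longleftrightarrow> dfn \<Phi> \<and> (\<forall>f. f \<notin> F1 \<longrightarrow> \<Phi> f = (\<lambda>_. 0))"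

definition res :: "(('n \<Rightarrow> 'n) \<Rightarrow> 'n \<Rightarrow> 'n) \<Rightarrow> ('n \<Rightarrow> 'n) \<Rightarrow> 'n \<Rightarrow> 'n" where
  "res \<Phi> f = (if f \<in> F1 then \<Phi> f else (\<lambda>_. 0))"

lemma res [simp]: "f \<in> F1 \<Longrightarrow> res \<Phi> f = \<Phi> f" and dfnc_res: "dfn \<Phi> \<Longrightarrow> dfnc (res \<Phi>)" and dfncD: "dfnc \<Phi> \<Longrightarrow> dfn \<Phi>"
  by (auto simp: res_def dfnc_def elim: dfn_cong)

lemma D2_dfnc:
  assumes "G \<in> Dom M (Ty1 \<rightarrow> Ty0 \<rightarrow> Ty0)" shows "\<exists>!\<Phi>. dfnc \<Phi> \<and> G = c2 \<Phi>"
proof -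
  obtain \<Phi> where \<Phi>: "dfn \<Phi>" "G = c2 \<Phi>" using D2_cases[OF assms] by blast
  have "c2 \<Phi> = c2 (res \<Phi>)"
  proof (rule extensional[OF c2(1)[OF \<Phi>(1)] c2(1)[OF dfncD[OF dfnc_res[OF \<Phi>(1)]]]])
    fix x assume "x \<in> Dom M Ty1"
    then obtain f where "f \<in> F1" "x = c1 f" using D1_cases by blast
    then show "ap M (c2 \<Phi>) x = ap M (c2 (res \<Phi>)) x"
      using c2(2)[OF \<Phi>(1)] c2(2)[OF dfncD[OF dfnc_res[OF \<Phi>(1)]]] by simp
  qed
  moreover have "\<Psi> = \<Psi>'" if "dfnc \<Psi>" "dfnc \<Psi>'" "c2 \<Psi> = c2 \<Psi>'" for \<Psi> \<Psi>'
  proof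
    fix f show "\<Psi> f = \<Psi>' f"
    proof (cases "f \<in> F1")
      case True
      have "c1 (\<Psi> f) = c1 (\<Psi>' f)" using c2(2)[of \<Psi> f] c2(2)[of \<Psi>' f] that True by (simp add: dfncD)
      then have "fn (c1 (\<Psi> f)) = fn (c1 (\<Psi>' f))" by simp
      then show ?thesis using c1(2)[OF c2(3)] that True by (simp add: dfncD)
    next
      case False then show ?thesis using that by (simp add: dfnc_def)
    qed
  qed
  ultimately show ?thesis using \<Phi> dfnc_res by metis
qed

lemma sat_all2:
  assumes "\<And>C' \<Phi> t. extends M R C C' \<Longrightarrow> dfn \<Phi> \<Longrightarrow> den M R C' t (Ty1 \<rightarrow> Ty0 \<rightarrow> Ty0) (c2 \<Phi>) \<Longrightarrow> sat M R C' (F t) (Q \<Phi>)"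
  shows "sat M R C (hall (Ty1 \<rightarrow> Ty0 \<rightarrow> Ty0) F) (\<forall>\<Phi>. dfnc \<Phi> \<longrightarrow> Q \<Phi>)"
proof -
  define cn where "cn G = (THE \<Phi>. dfnc \<Phi> \<and> G = c2 \<Phi>)" for G
  have cn: "dfnc (cn G) \<and> c2 (cn G) = G" if "G \<in> Dom M (Ty1 \<rightarrow> Ty0 \<rightarrow> Ty0)" for G
    using theI'[OF D2_dfnc[OF that]] by (auto simp: cn_def)
  have cn_c2: "cn (c2 \<Phi>) = \<Phi>" if "dfnc \<Phi>" for \<Phi>
    using the1_equality[OF D2_dfnc[OF c2(1)[OF dfncD[OF that]]], of \<Phi>] that by (simp add: cn_def)
  have "sat M R C (hall (Ty1 \<rightarrow> Ty0 \<rightarrow> Ty0) F) (\<forall>x\<in>Dom M (Ty1 \<rightarrow> Ty0 \<rightarrow> Ty0). Q (cn x))"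
    by (rule sat_all, rule assms) (use cn dfncD in auto)
  moreover have "(\<forall>x\<in>Dom M (Ty1 \<rightarrow> Ty0 \<rightarrow> Ty0). Q (cn x)) \<longleftrightarrow> (\<forall>\<Phi>. dfnc \<Phi> \<longrightarrow> Q \<Phi>)"
    using cn cn_c2 c2(1)[OF dfncD] by metis
  ultimately show ?thesis by simp
qed

lemma den_app0: "den1 R C s g \<Longrightarrow> g \<in> F1 \<Longrightarrow> den0 R C t n \<Longrightarrow> den0 R C (s \<cdot> t) (g n)"
  using den_app[of M R C s Ty0 Ty0 "c1 g" t "e n"] by (simp add: ap_c1)

lemma den_app1: "den M R C s (Ty1 \<rightarrow> Ty0 \<rightarrow> Ty0) (c2 \<Phi>) \<Longrightarrow> dfn \<Phi> \<Longrightarrow> den1 R C t f \<Longrightarrow> f \<in> F1 \<Longrightarrow> den1 R C (s \<cdot> t) (\<Phi> f)"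
  using den_app[of M R C s Ty1 Ty1 "c2 \<Phi>" t "c1 f"] by (simp add: c2)

text \<open>Denotation speaks about extensions only, so the existence of a well-typed one may be
  assumed, as \<open>den_lam0\<close> demands.\<close>

lemma den_vacuous: "(\<And>C'. extends M R C C' \<Longrightarrow> den M R C' t \<tau> v) \<Longrightarrow> den M R C t \<tau> v"
  unfolding den_def using extends_refl by blast

lemma den1_lam:
  assumes "\<And>C' t n. extends M R C C' \<Longrightarrow> den0 R C' t n \<Longrightarrow> den0 R C' (F t) (g n)"
  shows "den1 R C (hlam0 F) g"
proof (rule den_vacuous)
  fix C0 assume C0: "extends M R C C0"
  have h: "\<And>C' n t. extends M R C C' \<Longrightarrow> n \<in> N \<Longrightarrow> den M R C' t Ty0 n \<Longrightarrow> den M R C' (F t) Ty0 (e (g (dd n)))"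
    using assms by (metis e_dd)
  have r: "rep Ty0 Ty0 (\<lambda>x. e (g (dd x)))" by (rule den_lam0(2)[OF h C0])
  have "fn (lam Ty0 Ty0 (\<lambda>x. e (g (dd x)))) = g" using lam(2)[OF r] by (simp add: fn_def fun_eq_iff)
  then have "lam Ty0 Ty0 (\<lambda>x. e (g (dd x))) = c1 g" using c1_fn[OF lam(1)[OF r]] by simp
  then show "den1 R C0 (hlam0 F) g" using den_lift[OF den_lam0(1)[where F=F and g="\<lambda>x. e (g (dd x))", OF h] C0] by simp
qed

lemma den0_fun1:
  assumes "\<And>C' t n. extends M R C C' \<Longrightarrow> den0 R C' t n \<Longrightarrow> den0 R C' (F t) (g n)" "den0 R C t n"
  shows "den0 R C (hfun1 F t) (g n)"
proof (rule den_vacuous)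
  fix C0 assume C0: "extends M R C C0"
  have h: "\<And>C' n t. extends M R C C' \<Longrightarrow> n \<in> N \<Longrightarrow> den M R C' t Ty0 n \<Longrightarrow> den M R C' (F t) Ty0 (e (g (dd n)))"
    using assms by (metis e_dd)
  have r: "rep Ty0 Ty0 (\<lambda>x. e (g (dd x)))" by (rule den_lam0(2)[OF h C0])
  have "den M R C0 (hfun1 F t) Ty0 (ap M (lam Ty0 Ty0 (\<lambda>x. e (g (dd x)))) (e n))"
    unfolding hfun1_def by (rule den_app[OF den_lift[OF den_lam0(1)[OF h] C0] den_lift[OF assms(2) C0]])
  then show "den0 R C0 (hfun1 F t) (g n)" using lam(2)[OF r] by simp
qed

lemma den_lam2:
  assumes "\<And>C' s t k m. extends M R C C' \<Longrightarrow> den0 R C' s k \<Longrightarrow> den0 R C' t m \<Longrightarrow> den0 R C' (F s t) (h k m)"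
    and C0: "extends M R C C0"
  obtains H where "H \<in> Dom M (Ty0 \<rightarrow> Ty0 \<rightarrow> Ty0)" "\<And>k m. ap M (ap M H (e k)) (e m) = e (h k m)"
    "den M R C0 (hlam0 (\<lambda>x. hlam0 (F x))) (Ty0 \<rightarrow> Ty0 \<rightarrow> Ty0) H"
proof -
  have d: "\<And>C' n t. extends M R C C' \<Longrightarrow> n \<in> N \<Longrightarrow> den M R C' t Ty0 n \<Longrightarrow> den M R C' (hlam0 (F t)) Ty1 (c1 (h (dd n)))"
    by (rule den1_lam, rule assms(1)) (auto intro: extends_trans den_lift)
  have d': "den M R C (hlam0 (\<lambda>t. hlam0 (F t))) (Ty0 \<rightarrow> Ty1) (lam Ty0 Ty1 (\<lambda>x. c1 (h (dd x))))"
    by (rule den_lam0(1)) (rule d)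
  have r: "rep Ty0 Ty1 (\<lambda>x. c1 (h (dd x)))" by (rule den_lam0(2)[OF _ C0]) (rule d)
  let ?H = "lam Ty0 Ty1 (\<lambda>x. c1 (h (dd x)))"
  have F: "h k \<in> F1" for k
  proof -
    have e1: "extends M R C ((Ty0, e k) # C0)" "extends M R ((Ty0, e k) # C0) ((Ty0, e k) # C0)"
      using C0 by (auto simp: extends_def well_typed_def)
    have "rep Ty0 Ty0 (\<lambda>x. e (h k (dd x)))"
    proof (rule den_lam0(2)[OF _ e1(2)])
      fix C' n t assume c: "extends M R ((Ty0, e k) # C0) C'" "n \<in> N" "den M R C' t Ty0 n"
      show "den M R C' (F (hvar Ty0 (length C0)) t) Ty0 (e (h k (dd n)))"
        by (rule assms(1)[OF extends_trans[OF e1(1) c(1)] den_lift[OF den_hvar c(1)]]) (use c in auto)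
    qed
    note l = lam[OF this]
    have "fn (lam Ty0 Ty0 (\<lambda>x. e (h k (dd x)))) = h k" using l(2) by (simp add: fn_def fun_eq_iff)
    then show ?thesis using fn_F1[OF l(1)] by simp
  qed
  show ?thesis
  proof (rule that)
    show "?H \<in> Dom M (Ty0 \<rightarrow> Ty0 \<rightarrow> Ty0)" by (rule lam(1)[OF r])
    show "ap M (ap M ?H (e k)) (e m) = e (h k m)" for k m using lam(2)[OF r, of "e k"] ap_c1[OF F] by simp
    show "den M R C0 (hlam0 (\<lambda>x. hlam0 (F x))) (Ty0 \<rightarrow> Ty0 \<rightarrow> Ty0) ?H"
      by (rule den_lift[OF d' C0])
  qed
qed

lemma den0_fun2:
  assumes "\<And>C' s t k m. extends M R C C' \<Longrightarrow> den0 R C' s k \<Longrightarrow> den0 R C' t m \<Longrightarrow> den0 R C' (F s t) (h k m)"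
    "den0 R C s a" "den0 R C t b"
  shows "den0 R C (hfun2 F s t) (h a b)"
proof (rule den_vacuous)
  fix C0 assume C0: "extends M R C C0"
  obtain H where H: "H \<in> Dom M (Ty0 \<rightarrow> Ty0 \<rightarrow> Ty0)" "\<And>k m. ap M (ap M H (e k)) (e m) = e (h k m)"
    "den M R C0 (hlam0 (\<lambda>x. hlam0 (F x))) (Ty0 \<rightarrow> Ty0 \<rightarrow> Ty0) H" using den_lam2[where F=F and h=h, OF assms(1) C0] by blast
  show "den0 R C0 (hfun2 F s t) (h a b)"
    unfolding hfun2_def H(2)[symmetric]
    by (rule den_app[OF den_app[OF H(3)] den_lift[OF assms(3) C0]]) (rule den_lift[OF assms(2) C0])
qed

lemma den0_rec:
  assumes "\<And>C' s t k m. extends M R C C' \<Longrightarrow> den0 R C' s k \<Longrightarrow> den0 R C' t m \<Longrightarrow> den0 R C' (F s t) (h k m)"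
    "den0 R C s a" "den0 R C t b"
  shows "den0 R C (hrec F s t) (nrec h a b)"
proof (rule den_vacuous)
  fix C0 assume C0: "extends M R C C0"
  obtain H where H: "H \<in> Dom M (Ty0 \<rightarrow> Ty0 \<rightarrow> Ty0)" "\<And>k m. ap M (ap M H (e k)) (e m) = e (h k m)"
    "den M R C0 (hlam0 (\<lambda>x. hlam0 (F x))) (Ty0 \<rightarrow> Ty0 \<rightarrow> Ty0) H" using den_lam2[where F=F and h=h, OF assms(1) C0] by blast
  show "den0 R C0 (hrec F s t) (nrec h a b)"
    unfolding hrec_def nrec_Rc(1)[OF H(1,2)]
    by (rule den_app[OF den_app[OF den_app[OF den_cst' H(3)]] den_lift[OF assms(3) C0]])
       (simp, rule den_lift[OF assms(2) C0])
qed

end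

section \<open>Denotations of the coding functions, of reals and of sets\<close>

context num_model begin

lemma toQ_2 [simp]: "toQ 2 = 2"
  using toQ_add[of 1 1] by simp

lemma mn_Suc: "mn a (k + 1) = pred (mn a k)"
proof (cases "k < a")
  case True
  then have 1: "mn a (k + 1) + (k + 1) = a" by (intro mn_add) (simp add: Suc_le)
  have 2: "mn a k + k = a" using True by (intro mn_add) simp
  have "mn a k + k = mn a (k + 1) + 1 + k"
    using 1 2 by (simp only: add.assoc add.commute[of 1 k])
  then have "mn a k = mn a (k + 1) + 1" by simp
  then show ?thesis by (simp add: pred_def mn_def)
next
  case False
  then have "a \<le> k" "a \<le> k + 1" using le_Suc[of a k] by auto
  then have "mn a k = 0" "mn a (k + 1) = 0" by simp_all
  then show ?thesis using mn_0[of 0 1] by (simp only: pred_def) simp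
qed

lemma nrec_pred: "nrec (\<lambda>k m. k) 0 n = pred n"
  using nrec_unique[OF pred_F1, of 0 "\<lambda>k m. k"] by (simp add: pred_def mn_def)

lemma nrec_mn: "nrec (\<lambda>k m. pred m) a n = mn a n"
proof -
  have "mn a \<in> F1" by (rule F1I) (intro dfn_mn dfn_const dfn_arg)
  then show ?thesis using nrec_unique[of "mn a" a "\<lambda>k m. pred m"] mn_Suc by (simp add: mn_def)
qed

lemma nrec_ifz: "nrec (\<lambda>k m. t) s c = (if c = 0 then s else t)"
proof -
  have "(\<lambda>c. if c = 0 then s else t) \<in> F1" by (rule F1I) (intro dfn_ifz dfn_const dfn_arg)
  moreover have "k + 1 \<noteq> (0::'n)" for k by (metis Suc_pos order_less_irrefl)
  ultimately show ?thesis using nrec_unique[of "\<lambda>c. if c = 0 then s else t" s "\<lambda>k m. t"] by simp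
qed

lemma den0_pred: "den0 R C t n \<Longrightarrow> den0 R C (hpred t) (pred n)"
  unfolding hpred_def nrec_pred[symmetric] by (intro den0_rec den0_intros)

lemma den0_monus: "den0 R C s m \<Longrightarrow> den0 R C t n \<Longrightarrow> den0 R C (hmonus s t) (mn m n)"
  unfolding hmonus_def nrec_mn[symmetric] by (intro den0_rec den0_pred)

lemma den0_ifz: "den0 R C c k \<Longrightarrow> den0 R C s m \<Longrightarrow> den0 R C t n \<Longrightarrow> den0 R C (hifz c s t) (if k = 0 then m else n)"
  unfolding hifz_def nrec_ifz[symmetric] by (intro den0_rec) (auto intro: den_lift)

lemma den0_pow2: "den0 R C t n \<Longrightarrow> den0 R C (hpow2 t) (p2 n)"
  unfolding hpow2_def p2_def by (intro den0_rec den0_intros)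

lemma den0_tri: "den0 R C t n \<Longrightarrow> den0 R C (htri t) (tri n)"
  unfolding htri_def tri_def by (intro den0_rec den0_intros)

lemma den0_pair: "den0 R C s a \<Longrightarrow> den0 R C t b \<Longrightarrow> den0 R C (hpair s t) (pr a b)"
  unfolding hpair_def pr_def by (intro den0_fun2[where h="\<lambda>a b. tri (a + b) + a"] den0_tri den0_intros)

lemma den0_root: "den0 R C t n \<Longrightarrow> den0 R C (hroot t) (root n)"
  unfolding hroot_def root_def by (intro den0_rec den0_ifz den0_monus den0_tri den0_intros)

lemma den0_fst: "den0 R C t n \<Longrightarrow> den0 R C (hfst t) (pf n)"
  unfolding hfst_def pf_def by (intro den0_fun1[where g="\<lambda>z. mn z (tri (root z))"] den0_monus den0_tri den0_root)

lemma den0_snd: "den0 R C t n \<Longrightarrow> den0 R C (hsnd t) (ps n)"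
  unfolding hsnd_def ps_def by (intro den0_fun1[where g="\<lambda>z. mn (root z) (pf z)"] den0_monus den0_fst den0_root)

lemmas den0_pairing = den0_pair den0_fst den0_snd

lemma den0_rat: "den0 R C s a \<Longrightarrow> den0 R C t b \<Longrightarrow> den0 R C u c \<Longrightarrow> den0 R C (rat s t u) (mk a b c)"
  unfolding rat_def mk_def by (intro den0_pairing)

lemma den0_qproj:
  "den0 R C t n \<Longrightarrow> den0 R C (qpos t) (qp n)"
  "den0 R C t n \<Longrightarrow> den0 R C (qneg t) (qn n)"
  "den0 R C t n \<Longrightarrow> den0 R C (qden t) (qd n)"
  unfolding qpos_def qneg_def qden_def qp_def qn_def qd_def by (intro den0_pairing den0_intros; assumption)+

lemma den0_q0: "den0 R C q0 q0c" and den0_q1: "den0 R C q1 q1c"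
  unfolding q0_def q1_def q0c_def q1c_def by (intro den0_rat den0_intros)+

lemma den0_qadd: "den0 R C s a \<Longrightarrow> den0 R C t b \<Longrightarrow> den0 R C (qadd s t) (ad a b)"
  unfolding qadd_def ad_def
  by (intro den0_fun2[where h="\<lambda>q r. mk (qp q * qd r + qp r * qd q) (qn q * qd r + qn r * qd q) (pred (qd q * qd r))"]
    den0_rat den0_qproj den0_pred den0_intros)

lemma den0_qminus: "den0 R C t a \<Longrightarrow> den0 R C (qminus t) (mi a)"
  unfolding qminus_def mi_def
  by (intro den0_fun1[where g="\<lambda>q. mk (qn q) (qp q) (ps q)"] den0_rat den0_qproj den0_pairing)

lemma den0_qsub: "den0 R C s a \<Longrightarrow> den0 R C t b \<Longrightarrow> den0 R C (qsub s t) (ad a (mi b))"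
  unfolding qsub_def by (intro den0_qadd den0_qminus)

lemma den0_qabs: "den0 R C t a \<Longrightarrow> den0 R C (qabs t) (ab a)"
  unfolding qabs_def ab_def
  by (intro den0_fun1[where g="\<lambda>q. if mn (qn q) (qp q) = 0 then q else mi q"] den0_ifz den0_monus den0_qproj den0_qminus)

lemma den0_qdyadic: "den0 R C s a \<Longrightarrow> den0 R C t b \<Longrightarrow> den0 R C (qdyadic s t) (dya a b)"
  unfolding qdyadic_def dya_def by (intro den0_rat den0_pred den0_pow2 den0_intros)

lemma sat_qless: "den0 R C s a \<Longrightarrow> den0 R C t b \<Longrightarrow> sat M R C (s \<^bold><\<^sub>Q t) (qv a < qv b)"
  unfolding qless_def qv_less[symmetric] by (intro sat0_intros den0_intros den0_qproj)

lemma sat_qle: "den0 R C s a \<Longrightarrow> den0 R C t b \<Longrightarrow> sat M R C (s \<^bold>\<le>\<^sub>Q t) (qv a \<le> qv b)"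
  unfolding qle_def not_less[symmetric] by (intro sat_neg sat_qless)

lemmas rat_intros = den0_qadd den0_qsub den0_qabs den0_qdyadic den0_q0 den0_q1 sat_qless sat_qle
  den0_pairing den0_rat den0_intros sat0_intros sat_neg sat_conj sat_disj sat_iff sat_imp sat_all0 sat_ex0 sat_all1 sat_ex1

text \<open>With the value as a variable, applying these rules needs no higher-order unification.\<close>

lemma den_app0': "den1 R C s g \<Longrightarrow> den0 R C t n \<Longrightarrow> g \<in> F1 \<Longrightarrow> v = g n \<Longrightarrow> den0 R C (s \<cdot> t) v"
  using den_app0 by simp

lemma den_app1': "den M R C s (Ty1 \<rightarrow> Ty0 \<rightarrow> Ty0) (c2 \<Phi>) \<Longrightarrow> den1 R C t f \<Longrightarrow> dfn \<Phi> \<Longrightarrow> f \<in> F1 \<Longrightarrow> g = \<Phi> f \<Longrightarrow>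
    den1 R C (s \<cdot> t) g"
  using den_app1 by simp

lemma sat_cong: "sat M R C P p \<Longrightarrow> p = q \<Longrightarrow> sat M R C P q"
  by simp

lemma sat_is_real: "den1 R C x g \<Longrightarrow> g \<in> F1 \<Longrightarrow> sat M R C (is_real x) (isR g)"
  unfolding is_real_def
  by (rule sat_cong[where p="\<forall>n i. qv (ab (ad (g n) (mi (g (n + i))))) < qv (dya 1 n)"],
      (assumption | rule refl | rule rat_intros den_app0' | erule den_lift | erule extends_trans)+, simp add: isR_def)

lemma sat_req: "den1 R C x g \<Longrightarrow> den1 R C y h \<Longrightarrow> g \<in> F1 \<Longrightarrow> h \<in> F1 \<Longrightarrow> sat M R C (x \<^bold>=\<^sub>R y) (eqR g h)"
  unfolding req_def
  by (rule sat_cong[where p="\<forall>n. qv (ab (ad (g n) (mi (h n)))) \<le> qv (dya (1 + 1) n)"],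
      (assumption | rule refl | rule rat_intros den_app0' | erule den_lift | erule extends_trans)+, simp add: eqR_def toQ_add)

lemma sat_rless: "den1 R C x g \<Longrightarrow> den1 R C y h \<Longrightarrow> g \<in> F1 \<Longrightarrow> h \<in> F1 \<Longrightarrow> sat M R C (x \<^bold><\<^sub>R y) (ltR g h)"
  unfolding rless_def
  by (rule sat_cong[where p="\<exists>n. qv (ad (g n) (dya (1 + 1) n)) < qv (h n)"],
      (assumption | rule refl | rule rat_intros den_app0' | erule den_lift | erule extends_trans)+, simp add: ltR_def toQ_add)

lemma sat_rle: "den1 R C x g \<Longrightarrow> den1 R C y h \<Longrightarrow> g \<in> F1 \<Longrightarrow> h \<in> F1 \<Longrightarrow> sat M R C (x \<^bold>\<le>\<^sub>R y) (\<not> ltR h g)"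
  unfolding rle_def by (intro sat_neg sat_rless)

lemma den1_rconst: "den0 R C t q \<Longrightarrow> den1 R C (rconst t) (rco q)"
  unfolding rconst_def rco_def by (intro den1_lam) (rule den_lift)

lemma den1_radd: "den1 R C x g \<Longrightarrow> den1 R C y h \<Longrightarrow> g \<in> F1 \<Longrightarrow> h \<in> F1 \<Longrightarrow> den1 R C (radd x y) (rad g h)"
  unfolding radd_def rad_def
  by (assumption | rule refl | rule den1_lam den0_qadd den_app0' den0_intros | erule den_lift)+

lemma den1_rsub: "den1 R C x g \<Longrightarrow> den1 R C y h \<Longrightarrow> g \<in> F1 \<Longrightarrow> h \<in> F1 \<Longrightarrow> den1 R C (rsub x y) (rsb g h)"
  unfolding rsub_def rsb_def
  by (assumption | rule refl | rule den1_lam den0_qsub den_app0' den0_intros | erule den_lift)+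

lemma den1_rabs: "den1 R C x g \<Longrightarrow> g \<in> F1 \<Longrightarrow> den1 R C (rabs x) (rab g)"
  unfolding rabs_def rab_def
  by (assumption | rule refl | rule den1_lam den0_qabs den_app0' | erule den_lift)+

lemmas real_intros = sat_is_real sat_req sat_rless sat_rle den1_rconst den1_radd den1_rsub den1_rabs
lemmas F1_intros = F1_rco F1_rad F1_rsb F1_rab

lemma sat_in_ball: "den1 R C x g \<Longrightarrow> den0 R C r q \<Longrightarrow> den1 R C y h \<Longrightarrow> g \<in> F1 \<Longrightarrow> h \<in> F1 \<Longrightarrow>
    sat M R C (in_ball x r y) (inball g q h)"
  unfolding in_ball_def inball_def by (intro real_intros F1_intros)

lemma sat_in_set:
  assumes "den M R C Y (Ty1 \<rightarrow> Ty0 \<rightarrow> Ty0) (c2 \<Phi>)" "den1 R C x g" "dfn \<Phi>" "g \<in> F1" "b = posR (\<Phi> g)"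
  shows "sat M R C (x \<^bold>\<in>\<^sub>R Y) b"
  unfolding in_real_set_def posR_def assms(5)
  by (rule sat_rless[OF den1_rconst[OF den0_q0] den_app1'[OF assms(1,2,3,4) refl] F1_rco c2(3)[OF assms(3,4)]])

lemma sat_allR:
  assumes "\<And>C' f t. extends M R C C' \<Longrightarrow> f \<in> F1 \<Longrightarrow> den1 R C' t f \<Longrightarrow> sat M R C' (F t) (Q f)"
  shows "sat M R C (hallR F) (\<forall>f\<in>F1. isR f \<longrightarrow> Q f)"
  unfolding hallR_def
proof (rule sat_all1)
  fix C' f t assume h: "extends M R C C'" "f \<in> F1" "den1 R C' t f"
  show "sat M R C' (is_real t \<^bold>\<longrightarrow> F t) (isR f \<longrightarrow> Q f)"
    by (rule sat_imp[OF sat_is_real[OF h(3,2)] assms[OF h]])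
qed

lemmas set_intros = sat_in_ball sat_in_set sat_allR

lemma sat_real_function:
  "den M R C F (Ty1 \<rightarrow> Ty0 \<rightarrow> Ty0) (c2 \<Phi>) \<Longrightarrow> dfn \<Phi> \<Longrightarrow> sat M R C (real_function F) (realfun \<Phi>)"
  unfolding real_function_def realfun_def
  by (assumption | rule refl | rule sat_conj set_intros sat_imp real_intros den_app1' | erule den_lift | erule extends_trans | metis c2(3))+

lemma sat_open_pred:
  assumes "\<And>C' x t. extends M R C C' \<Longrightarrow> x \<in> F1 \<Longrightarrow> den1 R C' t x \<Longrightarrow> sat M R C' (P t) (p x)"
  shows "sat M R C (open_pred P) (openP p)"
proof -
  have "sat M R C (open_pred P) (\<forall>x\<in>F1. isR x \<longrightarrow> p x \<longrightarrow> (\<exists>r. qv q0c < qv r \<and> (\<forall>y\<in>F1. isR y \<longrightarrow> inball x r y \<longrightarrow> p y)))"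
    unfolding open_pred_def
    by (assumption | rule refl | rule set_intros rat_intros assms | erule den_lift | erule extends_trans)+
  then show ?thesis by (simp add: openP_def)
qed

definition openS :: "(('n \<Rightarrow> 'n) \<Rightarrow> 'n \<Rightarrow> 'n) \<Rightarrow> bool" where
  "openS Y \<longleftrightarrow> realfun Y \<and> openP (\<lambda>x. posR (Y x))"
definition closedS :: "(('n \<Rightarrow> 'n) \<Rightarrow> 'n \<Rightarrow> 'n) \<Rightarrow> bool" where
  "closedS Y \<longleftrightarrow> realfun Y \<and> openP (\<lambda>x. \<not> posR (Y x))"

lemma sat_open_set: "den M R C F (Ty1 \<rightarrow> Ty0 \<rightarrow> Ty0) (c2 \<Phi>) \<Longrightarrow> dfn \<Phi> \<Longrightarrow> sat M R C (open_set F) (openS \<Phi>)"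
  and sat_closed_set: "den M R C F (Ty1 \<rightarrow> Ty0 \<rightarrow> Ty0) (c2 \<Phi>) \<Longrightarrow> dfn \<Phi> \<Longrightarrow> sat M R C (closed_set F) (closedS \<Phi>)"
  unfolding open_set_def closed_set_def openS_def closedS_def
  by (assumption | rule refl | rule sat_conj sat_real_function sat_open_pred sat_neg sat_in_set | erule den_lift)+

lemma sat_ex_set:
  assumes "\<And>C' f t. extends M R C C' \<Longrightarrow> f \<in> F1 \<Longrightarrow> den1 R C' t f \<Longrightarrow> sat M R C' (F t) (Q f)"
  shows "sat M R C (hex_set F) (\<exists>X\<in>F1. (\<forall>n. X n = 0 \<or> X n = 1) \<and> Q X)"
  unfolding hex_set_def
  by (assumption | rule refl | rule sat_ex1 sat_conj assms rat_intros den_app0' | erule den_lift | erule extends_trans)+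

lemma sat_mem: "den0 R C t n \<Longrightarrow> den1 R C X g \<Longrightarrow> g \<in> F1 \<Longrightarrow> sat M R C (t \<^bold>\<in> X) (g n = 1)"
  unfolding mem_def by (assumption | rule refl | rule rat_intros den_app0')+

definition isset :: "('n \<Rightarrow> bool) \<Rightarrow> bool" where "isset P \<longleftrightarrow> dec (\<lambda>_. P)"

lemma isset_char: "(\<exists>X\<in>F1. (\<forall>n. X n = 0 \<or> X n = 1) \<and> (\<forall>n. X n = 1 \<longleftrightarrow> P n)) \<longleftrightarrow> isset P"
proof
  assume "\<exists>X\<in>F1. (\<forall>n. X n = 0 \<or> X n = 1) \<and> (\<forall>n. X n = 1 \<longleftrightarrow> P n)"
  then obtain X where X: "X \<in> F1" "\<And>n. X n = 1 \<longleftrightarrow> P n" by blast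
  then have "dec (\<lambda>_ n. X n = 1)" by (intro dec_eq dfn_const dfn_F1[OF X(1)] dfn_arg)
  then show "isset P" using X(2) by (simp add: isset_def)
next
  assume "isset P"
  then have "dfn (\<lambda>_ n. if P n then 1 else 0)" unfolding isset_def by (intro dfn_if dfn_const)
  then show "\<exists>X\<in>F1. (\<forall>n. X n = 0 \<or> X n = 1) \<and> (\<forall>n. X n = 1 \<longleftrightarrow> P n)"
    by (intro bexI[of _ "\<lambda>n. if P n then 1 else 0"] F1I) auto
qed

section \<open>The principles as properties of a number model\<close>

definition boot :: bool where
  "boot \<longleftrightarrow> (\<forall>Y. dfnc Y \<longrightarrow> isset (\<lambda>n. \<exists>f\<in>F1. Y f n = 0))"
definition boot_minus :: bool where
  "boot_minus \<longleftrightarrow> (\<forall>Y. dfnc Y \<longrightarrow> (\<forall>n. \<forall>f\<in>F1. \<forall>g\<in>F1. Y f n = 0 \<and> Y g n = 0 \<longrightarrow> f = g) \<longrightarrow>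
     isset (\<lambda>n. \<exists>f\<in>F1. Y f n = 0))"
definition opn :: bool where
  "opn \<longleftrightarrow> (\<forall>Y. dfnc Y \<longrightarrow> openS Y \<longrightarrow>
     isset (\<lambda>n. \<forall>y\<in>F1. isR y \<longrightarrow> inball (rco (pf n)) (mk (pf (ps n) + 1) 0 (ps (ps n))) y \<longrightarrow> posR (Y y)))"
definition hbu :: bool where
  "hbu \<longleftrightarrow> (\<forall>D. dfnc D \<longrightarrow> (\<forall>\<Psi>. dfnc \<Psi> \<longrightarrow>
     closedS D \<and> (\<forall>x\<in>F1. isR x \<longrightarrow> posR (D x) \<longrightarrow> \<not> ltR x (rco q0c) \<and> \<not> ltR (rco q1c) x) \<and>
     realfun \<Psi> \<and> (\<forall>x\<in>F1. isR x \<longrightarrow> posR (\<Psi> x)) \<longrightarrow>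
     (\<exists>k. \<exists>y. (\<lambda>z. y (pf z) (ps z)) \<in> F1 \<and>
        (\<forall>i. i < k \<longrightarrow> isR (y i) \<and> posR (D (y i))) \<and>
        (\<forall>x\<in>F1. isR x \<longrightarrow> posR (D x) \<longrightarrow> (\<exists>i. i < k \<and>
           ltR (rsb (y i) (\<Psi> (y i))) x \<and> ltR x (rad (y i) (\<Psi> (y i))))))))"

lemma sat_BOOT: "sat M R C BOOT boot"
proof -
  have "sat M R C BOOT (\<forall>Y. dfnc Y \<longrightarrow> (\<exists>X\<in>F1. (\<forall>n. X n = 0 \<or> X n = 1) \<and> (\<forall>n. X n = 1 \<longleftrightarrow> (\<exists>f\<in>F1. Y f n = 0))))"
    unfolding BOOT_def
    by (assumption | rule refl | rule sat_all2 sat_ex_set rat_intros sat_mem den_app0' den_app1'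
      | erule den_lift | erule extends_trans | metis c2(3))+
  then show ?thesis by (simp add: boot_def isset_char)
qed

lemma sat_BOOT_minus: "sat M R C BOOT_minus boot_minus"
proof -
  have h: "sat M R C (heqT Ty1 s t) (f = g)" if "den1 R C s f" "den1 R C t g" "f \<in> F1" "g \<in> F1" for R C s t f g
  proof -
    have "c1 f = c1 g \<longleftrightarrow> f = g" using c1(2)[OF that(3)] c1(2)[OF that(4)] by metis
    then have "requal M Ty1 (c1 f) (c1 g) = (f = g)"
      using requal_eq[OF c1(1)[OF that(3)] c1(1)[OF that(4)]] by (rule trans[rotated])
    then show ?thesis using sat_heqT[OF that(1,2)] by (simp only:)
  qed
  have "sat M R C BOOT_minus (\<forall>Y. dfnc Y \<longrightarrow>
     (\<forall>n. \<forall>f\<in>F1. \<forall>g\<in>F1. Y f n = 0 \<and> Y g n = 0 \<longrightarrow> f = g) \<longrightarrow>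
     (\<exists>X\<in>F1. (\<forall>n. X n = 0 \<or> X n = 1) \<and> (\<forall>n. X n = 1 \<longleftrightarrow> (\<exists>f\<in>F1. Y f n = 0))))"
    unfolding BOOT_minus_def
    by (assumption | rule refl | rule sat_all2 sat_ex_set h rat_intros sat_mem den_app0' den_app1'
      | erule den_lift | erule extends_trans | metis c2(3))+
  then show ?thesis by (simp add: boot_minus_def isset_char)
qed

lemma den0_center_radius:
  "den0 R C t n \<Longrightarrow> den0 R C (center t) (pf n)"
  "den0 R C t n \<Longrightarrow> den0 R C (radius t) (mk (pf (ps n) + 1) 0 (ps (ps n)))"
  unfolding center_def radius_def by (intro den0_pairing den0_rat den0_intros; assumption)+

lemma sat_OPEN: "sat M R C OPEN opn"
proof -
  have "sat M R C OPEN (\<forall>Y. dfnc Y \<longrightarrow> openS Y \<longrightarrow>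
     (\<exists>X\<in>F1. (\<forall>n. X n = 0 \<or> X n = 1) \<and> (\<forall>n. X n = 1 \<longleftrightarrow>
       (\<forall>y\<in>F1. isR y \<longrightarrow> inball (rco (pf n)) (mk (pf (ps n) + 1) 0 (ps (ps n))) y \<longrightarrow> posR (Y y)))))"
    unfolding OPEN_def
    by (assumption | rule refl | rule sat_all2 sat_ex_set sat_open_set set_intros rat_intros real_intros F1_rco
         den0_center_radius sat_mem den_app0' den_app1'
      | erule den_lift | erule extends_trans | metis c2(3))+
  then show ?thesis by (simp add: opn_def isset_char)
qed

text \<open>Objects of type \<open>0 \<rightarrow> 1\<close> are uncurried.\<close>

definition c01 :: "('n \<Rightarrow> 'n \<Rightarrow> 'n) \<Rightarrow> 'a" where
  "c01 y = lam Ty0 Ty1 (\<lambda>x. c1 (y (dd x)))"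

definition F01 :: "('n \<Rightarrow> 'n \<Rightarrow> 'n) set" where
  "F01 = {y. (\<lambda>z. y (pf z) (ps z)) \<in> F1}"

lemma F01_sec: assumes "y \<in> F01" shows "y i \<in> F1"
proof (rule F1I)
  have "dfn (\<lambda>_ n. (\<lambda>z. y (pf z) (ps z)) (pr i n))"
    by (intro dfn_F1[of "\<lambda>z. y (pf z) (ps z)"] dfn_pr dfn_const dfn_arg) (use assms in \<open>simp add: F01_def\<close>)
  then show "dfn (\<lambda>_. y i)" by simp
qed

lemma c01:
  assumes "y \<in> F01"
  shows "c01 y \<in> Dom M (Ty0 \<rightarrow> Ty1)" "ap M (c01 y) (e i) = c1 (y i)"
proof -
  let ?g = "\<lambda>z. y (pf z) (ps z)"
  have g: "?g \<in> F1" using assms by (simp add: F01_def)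
  have P: "ap M PR (e n) \<in> Dom M Ty1" for n by (rule ap_closed[OF PR(1)]) simp
  have c: "ap M (cmpl Ty0 Ty0 Ty0 (c1 ?g)) (ap M PR (e i)) = c1 (y i)" for i
  proof -
    have d: "ap M (cmpl Ty0 Ty0 Ty0 (c1 ?g)) (ap M PR (e i)) \<in> Dom M Ty1"
      by (rule ap_closed[OF cmpl(1)[OF c1(1)[OF g]] P])
    have "fn (ap M (cmpl Ty0 Ty0 Ty0 (c1 ?g)) (ap M PR (e i))) = y i"
      by (rule ext) (simp add: fn_def cmpl(2)[OF c1(1)[OF g] P] PR(2) ap_c1[OF g])
    then show ?thesis using c1_fn[OF d] by simp
  qed
  have "rep Ty0 Ty1 (\<lambda>x. ap M (cmpl Ty0 Ty0 Ty0 (c1 ?g)) (ap M PR x))"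
    by (rule rep_app[OF rep_const[OF cmpl(1)[OF c1(1)[OF g]]] rep_fun[OF PR(1)]])
  then obtain f where f: "f \<in> Dom M (Ty0 \<rightarrow> Ty1)" "\<forall>x\<in>N. ap M f x = ap M (cmpl Ty0 Ty0 Ty0 (c1 ?g)) (ap M PR x)"
    unfolding rep_def by blast
  have "ap M f x = c1 (y (dd x))" if "x \<in> N" for x using f(2) c[of "dd x"] that by simp
  then have r: "rep Ty0 Ty1 (\<lambda>x. c1 (y (dd x)))" using f(1) unfolding rep_def by blast
  show "c01 y \<in> Dom M (Ty0 \<rightarrow> Ty1)" "ap M (c01 y) (e i) = c1 (y i)"
    using lam(1)[OF r] lam(2)[OF r, of "e i"] by (simp_all add: c01_def)
qed

lemma D01_cases:
  assumes "x \<in> Dom M (Ty0 \<rightarrow> Ty1)" obtains y where "y \<in> F01" "x = c01 y"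
proof -
  define y where "y i = fn (ap M x (e i))" for i
  have s: "ap M x (e i) \<in> Dom M Ty1" for i by (rule ap_closed[OF assms]) simp
  have "rep2 Ty0 Ty0 Ty0 (\<lambda>a b. e (y (dd a) (dd b)))"
    unfolding rep2_def by (rule bexI[OF _ assms]) (use ap_fn[OF s] in \<open>auto simp: y_def elim!: N_cases\<close>)
  then obtain G where G: "G \<in> Dom M (Ty0 \<rightarrow> Ty0 \<rightarrow> Ty0)" "\<And>a b. ap M (ap M G (e a)) (e b) = e (y a b)"
    unfolding rep2_def by (metis dd_e e_N)
  have "(\<lambda>z. y (pf z) (ps z)) \<in> F1" by (rule F1I) (intro dfn_bin[OF G] dfn_pf dfn_ps dfn_arg)
  then have y: "y \<in> F01" by (simp add: F01_def)
  have "x = c01 y"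
  proof (rule extensional[OF assms c01(1)[OF y]])
    fix a assume "a \<in> N"
    then obtain i where i: "a = e i" by (rule N_cases)
    show "ap M x a = ap M (c01 y) a" using c01(2)[OF y, of i] c1_fn[OF s[of i]] by (simp add: i y_def)
  qed
  then show ?thesis using that y by blast
qed

lemma sat_ex01:
  assumes "\<And>C' y t. extends M R C C' \<Longrightarrow> y \<in> F01 \<Longrightarrow> den M R C' t (Ty0 \<rightarrow> Ty1) (c01 y) \<Longrightarrow> sat M R C' (F t) (Q y)"
  shows "sat M R C (hex (Ty0 \<rightarrow> Ty1) F) (\<exists>y\<in>F01. Q y)"
proof -
  define yy where "yy x i = fn (ap M x (e i))" for x i
  have yy: "x = c01 (yy x) \<and> yy x \<in> F01" if x: "x \<in> Dom M (Ty0 \<rightarrow> Ty1)" for x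
  proof -
    obtain y where y: "y \<in> F01" "x = c01 y" using D01_cases[OF x] by blast
    have "yy x = y" using c01(2)[OF y(1)] c1(2)[OF F01_sec[OF y(1)]] by (simp add: yy_def fun_eq_iff y(2))
    then show ?thesis using y by simp
  qed
  have yc: "yy (c01 y) = y" if "y \<in> F01" for y
    using c01(2)[OF that] c1(2)[OF F01_sec[OF that]] by (simp add: yy_def fun_eq_iff)
  have "sat M R C (hex (Ty0 \<rightarrow> Ty1) F) (\<exists>x\<in>Dom M (Ty0 \<rightarrow> Ty1). Q (yy x))"
    by (rule sat_ex, rule assms) (use yy in auto)
  moreover have "(\<exists>x\<in>Dom M (Ty0 \<rightarrow> Ty1). Q (yy x)) \<longleftrightarrow> (\<exists>y\<in>F01. Q y)"
    using yy yc c01(1) by metis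
  ultimately show ?thesis by simp
qed

lemma den_app01:
  "den M R C s (Ty0 \<rightarrow> Ty1) (c01 y) \<Longrightarrow> den0 R C t i \<Longrightarrow> y \<in> F01 \<Longrightarrow> g = y i \<Longrightarrow> den1 R C (s \<cdot> t) g"
  using den_app[of M R C s Ty0 Ty1 "c01 y" t "e i"] by (simp add: c01)

lemma sat_HBU: "sat M R C HBU_closed hbu"
proof -
  have "sat M R C HBU_closed (\<forall>D. dfnc D \<longrightarrow> (\<forall>\<Psi>. dfnc \<Psi> \<longrightarrow>
     closedS D \<and> (\<forall>x\<in>F1. isR x \<longrightarrow> posR (D x) \<longrightarrow> \<not> ltR x (rco q0c) \<and> \<not> ltR (rco q1c) x) \<and>
     realfun \<Psi> \<and> (\<forall>x\<in>F1. isR x \<longrightarrow> ltR (rco q0c) (\<Psi> x)) \<longrightarrow>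
     (\<exists>k. \<exists>y\<in>F01.
        (\<forall>i. i < k \<longrightarrow> isR (y i) \<and> posR (D (y i))) \<and>
        (\<forall>x\<in>F1. isR x \<longrightarrow> posR (D x) \<longrightarrow> (\<exists>i. i < k \<and>
           ltR (rsb (y i) (\<Psi> (y i))) x \<and> ltR x (rad (y i) (\<Psi> (y i))))))))"
    unfolding HBU_closed_def
    by (assumption | rule refl | rule sat_all2 sat_ex01 sat_closed_set sat_real_function set_intros rat_intros real_intros F1_intros
         den_app01 den_app1'
      | erule den_lift | erule extends_trans | erule F01_sec | metis c2(3) F01_sec)+
  then show ?thesis by (simp add: hbu_def posR_def F01_def)
qed

definition k0 :: "('n \<Rightarrow> 'n) \<Rightarrow> bool" where
  "k0 \<gamma> \<longleftrightarrow> (\<forall>f\<in>F1. \<exists>n. 0 < \<gamma> (sbar f n)) \<and>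
     (\<forall>n m. \<forall>f\<in>F1. n < m \<and> 0 < \<gamma> (sbar f n) \<longrightarrow> \<gamma> (sbar f n) = \<gamma> (sbar f m))"

lemma den0_seqbar:
  assumes "den1 R C t f" "den0 R C s n" "f \<in> F1" shows "den0 R C (seqbar t s) (sbar f n)"
  unfolding seqbar_def sbar_def
proof (rule den0_rec)
  fix C' u v k m assume h: "extends M R C C'" "den0 R C' u k" "den0 R C' v m"
  show "den0 R C' (hpair v (t \<cdot> u) \<^bold>+ \<^bold>1) (pr m (f k) + 1)"
    by (intro den0_intros den0_pair h den_app0'[OF den_lift[OF assms(1) h(1)] h(2) assms(3) refl])
qed (use assms den0_intros in auto)

lemma sat_K0: "den1 R C t \<gamma> \<Longrightarrow> \<gamma> \<in> F1 \<Longrightarrow> sat M R C (K0 t) (k0 \<gamma>)"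
  unfolding K0_def k0_def
  by (assumption | rule refl | rule rat_intros den0_seqbar den_app0'
      | erule den_lift | erule extends_trans)+

lemma sat_assoc_value:
  "den1 R C t \<gamma> \<Longrightarrow> den1 R C u f \<Longrightarrow> den0 R C s v \<Longrightarrow> \<gamma> \<in> F1 \<Longrightarrow> f \<in> F1 \<Longrightarrow>
     sat M R C (assoc_value t u s) (\<exists>k. \<forall>n. k < n \<longrightarrow> \<gamma> (sbar f n) = v + 1)"
  unfolding assoc_value_def
  by (assumption | rule refl | rule rat_intros den0_seqbar den_app0'
      | erule den_lift | erule extends_trans)+

end

context num_model begin

subsection \<open>Bounded quantifiers and finite sequences\<close>

lemma not_less_zero [simp]: "\<not> n < (0::'n)"
  by (simp add: not_less)

lemma pos_iff: "0 < n \<longleftrightarrow> n \<noteq> (0::'n)"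
  by (auto simp: less_le)

lemma dfn_comp: "dfn \<Theta> \<Longrightarrow> dfn \<chi> \<Longrightarrow> dfn (\<lambda>f n. \<Theta> f (\<chi> f n))"
  using dfn_subst[OF _ dfn_app[OF dfn_ps[OF dfn_arg]], of \<Theta> \<chi>] by simp

lemma dec_comp: "dec P \<Longrightarrow> dfn \<chi> \<Longrightarrow> dec (\<lambda>f n. P f (\<chi> f n))"
  unfolding dec_def by (rule dfn_comp[where \<Theta>="\<lambda>f n. if P f n then 0 else 1"])

lemma dec_fix: "dec P \<Longrightarrow> f \<in> F1 \<Longrightarrow> dec (\<lambda>_. P f)"
  unfolding dec_def using dfn_F1[OF c2(3)[where \<Phi>="\<lambda>f n. if P f n then 0 else 1" and f=f] dfn_arg] by simp

lemma dfn_fapp: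
  assumes "dfn \<Theta>" "dfn (\<lambda>f w. G f (pf w) (ps w))" "dfn \<chi>"
  shows "dfn (\<lambda>f n. \<Theta> (G f n) (\<chi> f n))"
  using dfn_subst[where \<Theta>=\<Theta> and \<Psi>="\<lambda>f w. G f (pf w) (ps w)" and \<chi>=\<chi>] assms by simp

lemma dfn_rec:
  assumes "dfn (\<lambda>f z. h f (pf z) (pf (ps z)) (ps (ps z)))"
  shows "dfn \<chi> \<Longrightarrow> dfn \<xi> \<Longrightarrow> dfn (\<lambda>f n. nrec (h f n) (\<chi> f n) (\<xi> f n))" "f \<in> F1 \<Longrightarrow> bfn (h f n)"
  using dfn_nrec(1)[OF assms] dfn_nrec(2)[OF assms dfn_const dfn_const] by simp_all

lemma dec_ball:
  assumes P: "dec (\<lambda>f z. P f (pf z) (ps z))" and B: "dfn B"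
  shows "dec (\<lambda>f n. \<forall>m. m < B f n \<longrightarrow> P f n m)"
proof -
  have "dec (\<lambda>f z. P f (pf (pr (pf z) (pf (ps z)))) (ps (pr (pf z) (pf (ps z)))))"
    by (rule dec_comp[OF P]) (intro dfn_pr dfn_ps dfn_pf dfn_arg)
  then have Q: "dfn (\<lambda>f z. if P f (pf z) (pf (ps z)) then ps (ps z) else 1)"
    by (intro dfn_if dfn_ps dfn_const dfn_arg) simp
  \<comment> \<open>The recursion stays at 0 as long as \<open>P\<close> has held for all smaller
    arguments; a failure sets it to 1, and it never returns to 0.\<close>
  define s where "s f n = nrec (\<lambda>k m. if P f n k then m else 1) 0" for f n
  have s: "s f n \<in> F1" "s f n 0 = 0" "s f n (k + 1) = (if P f n k then s f n k else 1)" if "f \<in> F1" for f n k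
    using nrec[OF dfn_rec(2)[OF Q that, of n], of 0] by (simp_all add: s_def)
  have "dfn (\<lambda>f n. s f n (B f n))"
    using dfn_rec(1)[OF Q dfn_const B, of 0] by (simp add: s_def)
  then show ?thesis
  proof (rule decI)
    fix f n assume f: "f \<in> F1"
    note s = s[OF f]
    have dP: "dec (\<lambda>_ m. P f n m)"
    proof -
      have "dec (\<lambda>_ m. P f (pf (pr n m)) (ps (pr n m)))"
        by (rule dec_comp[OF dec_fix[OF P f]]) (intro dfn_pr dfn_const dfn_arg)
      then show ?thesis by simp
    qed
    have 1: "m < b \<longrightarrow> s f n b = 0 \<longrightarrow> P f n m" for m b
    proof (rule dec_induct[where n=b])
      show "dec (\<lambda>_ b. m < b \<longrightarrow> s f n b = 0 \<longrightarrow> P f n m)"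
        by (intro dec_imp dec_less dec_eq dfn_F1[OF s(1)] dfn_arg dfn_const dec_const)
      show "m < b + 1 \<longrightarrow> s f n (b + 1) = 0 \<longrightarrow> P f n m" if "m < b \<longrightarrow> s f n b = 0 \<longrightarrow> P f n m" for b
        using that by (auto simp: s discrete le_less)
    qed simp_all
    have 2: "c \<le> b \<longrightarrow> s f n c = 0" if "\<forall>m. m < b \<longrightarrow> P f n m" for b c
    proof (rule dec_induct[where n=c])
      show "dec (\<lambda>_ c. c \<le> b \<longrightarrow> s f n c = 0)"
        by (intro dec_imp dec_le dec_eq dfn_F1[OF s(1)] dfn_arg dfn_const)
      show "c + 1 \<le> b \<longrightarrow> s f n (c + 1) = 0" if "c \<le> b \<longrightarrow> s f n c = 0" for c
        using that \<open>\<forall>m. m < b \<longrightarrow> P f n m\<close> by (auto simp: s Suc_le)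
    qed (simp add: s)
    show "s f n (B f n) = 0 \<longleftrightarrow> (\<forall>m. m < B f n \<longrightarrow> P f n m)"
      using 1[of _ "B f n"] 2[of "B f n" "B f n"] by blast
  qed
qed

lemma dec_least:
  assumes P: "dec (\<lambda>_. P)" and m: "P m" shows "\<exists>j. P j \<and> (\<forall>i. i < j \<longrightarrow> \<not> P i)"
proof (rule ccontr)
  assume n: "\<not> (\<exists>j. P j \<and> (\<forall>i. i < j \<longrightarrow> \<not> P i))"
  have "\<forall>i. i < b \<longrightarrow> \<not> P i" for b
  proof (rule dec_induct[where n=b])
    have "dec (\<lambda>_ z. \<not> P (ps z))"
      by (rule dec_comp[OF dec_not[OF P]]) (intro dfn_ps dfn_arg)
    then show "dec (\<lambda>_ b. \<forall>i. i < b \<longrightarrow> \<not> P i)" by (intro dec_ball dfn_arg)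
    show "\<forall>i. i < b + 1 \<longrightarrow> \<not> P i" if "\<forall>i. i < b \<longrightarrow> \<not> P i" for b
      using that n by (auto simp: discrete le_less)
  qed simp_all
  from this[of "m + 1"] m show False by (simp add: discrete)
qed

text \<open>Iterating \<open>ps\<close> reads every number as an infinite sequence, so that no
  length is stored. The tail 0 codes the zero sequence because \<open>pr 0 0 = 0\<close>.\<close>

definition psn :: "'n \<Rightarrow> 'n \<Rightarrow> 'n" where "psn \<tau> i = nrec (\<lambda>k m. ps m) \<tau> i"
definition fs :: "'n \<Rightarrow> 'n \<Rightarrow> 'n" where "fs \<tau> i = pf (psn \<tau> i)"

lemma bfn_ps: "bfn (\<lambda>k m. ps m)"
proof -
  have "ps \<in> F1" by (rule F1I) (intro dfn_ps dfn_arg)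
  from bfn_F1[OF this bfn_snd] show ?thesis .
qed

lemma psn: "psn \<tau> \<in> F1" "psn \<tau> 0 = \<tau>" "psn \<tau> (k + 1) = ps (psn \<tau> k)"
  using nrec[OF bfn_ps, of \<tau>] by (auto simp: psn_def[abs_def])

lemma dfn_fs: "dfn A \<Longrightarrow> dfn B \<Longrightarrow> dfn (\<lambda>f n. fs (A f n) (B f n))"
  unfolding fs_def psn_def
  by (intro dfn_pf dfn_rec(1)[where h="\<lambda>_ _ k m. ps m"] dfn_ps dfn_arg)

lemma fs_F1 [simp]: "fs \<tau> \<in> F1"
  by (rule F1I) (intro dfn_fs dfn_const dfn_arg)

lemma mn_mn: "i \<le> k \<Longrightarrow> mn k (mn k i) = i"
proof -
  assume i: "i \<le> k"
  have a: "mn k i + i = k" using i by (rule mn_add)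
  then have "mn k i \<le> k" using zero_le[of i] by (metis le_add_same_cancel1)
  then have "mn k (mn k i) + mn k i = k" by (rule mn_add)
  then show ?thesis using a by (metis add.commute add_left_cancel)
qed

lemma finite_seq:
  assumes g: "g \<in> F1" shows "\<exists>\<tau>. \<forall>i. fs \<tau> i = (if i < k then g i else 0)"
proof -
  \<comment> \<open>The code is built from the last entry backwards: after j steps it contains the j
    last ones of the k entries.\<close>
  define t where "t = nrec (\<lambda>j s. pr (g (mn k (j + 1))) s) 0"
  have b: "bfn (\<lambda>j s. pr (g (mn k (j + 1))) s)"
  proof -
    have "bfn (\<lambda>j s. tri (g (mn k (j + 1)) + s) + g (mn k (j + 1)))"
      by (intro bfn_plus bfn_F1[OF tri(1)] bfn_F1[OF g] bfn_mn bfn_fst bfn_snd bfn_const)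
    then show ?thesis by (simp add: pr_def)
  qed
  have t: "t \<in> F1" "t 0 = 0" "t (j + 1) = pr (g (mn k (j + 1))) (t j)" for j
    using nrec[OF b] by (auto simp: t_def)
  have s: "i \<le> k \<longrightarrow> psn (t k) i = t (mn k i)" for i
  proof (rule dec_induct[where n=i])
    show "dec (\<lambda>_ i. i \<le> k \<longrightarrow> psn (t k) i = t (mn k i))"
      by (intro dec_imp dec_le dec_eq dfn_F1[OF psn(1)] dfn_F1[OF t(1)] dfn_mn dfn_arg dfn_const)
    show "i + 1 \<le> k \<longrightarrow> psn (t k) (i + 1) = t (mn k (i + 1))" if IH: "i \<le> k \<longrightarrow> psn (t k) i = t (mn k i)" for i
    proof
      assume i: "i + 1 \<le> k"
      then have "i \<le> k" by (simp add: Suc_le)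
      moreover have "mn k i = mn k (i + 1) + 1"
      proof -
        have "mn k i \<noteq> 0" using i by (simp add: Suc_le not_le)
        then show ?thesis using pred_Suc[of "mn k i"] mn_Suc[of k i] pos_iff[of "mn k i"] by simp
      qed
      ultimately show "psn (t k) (i + 1) = t (mn k (i + 1))" using IH t(3)[of "mn k (i + 1)"] by (simp add: psn)
    qed
  qed (simp add: psn mn_def)
  have z: "psn (t k) (k + c) = 0" for c
  proof (rule dec_induct[where n=c])
    show "dec (\<lambda>_ c. psn (t k) (k + c) = 0)"
      by (intro dec_eq dfn_F1[OF psn(1)] dfn_plus dfn_arg dfn_const)
    show "psn (t k) (k + 0) = 0" using s[of k] by (simp add: t mn_def)
    show "psn (t k) (k + (c + 1)) = 0" if "psn (t k) (k + c) = 0" for c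
      using that psn(3)[of "t k" "k + c"] by (simp add: add.assoc)
  qed
  have "fs (t k) i = (if i < k then g i else 0)" for i
  proof (cases "i < k")
    case True
    then have "i \<le> k" by simp
    obtain j where j: "mn k i = j + 1" using True by (cases "mn k i" rule: num_cases) auto
    have "fs (t k) i = g (mn k (mn k i))" using s[of i] True t(3)[of j] by (simp add: fs_def j)
    then show ?thesis using True mn_mn[OF \<open>i \<le> k\<close>] by simp
  next
    case False
    then have "mn i k + k = i" by (intro mn_add) simp
    then show ?thesis using z[of "mn i k"] False by (simp add: fs_def add.commute)
  qed
  then show ?thesis by blast
qed

subsection \<open>Kohlenbach's \<open>\<exists>\<^sup>2\<close> and continuity\<close>

text \<open>Existence of the functional that decides number quantifiers, phrased as a closure
  property of decidable predicates in which the function remains a variable.\<close>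

definition E2 :: bool where
  "E2 \<longleftrightarrow> (\<forall>\<Phi>. dfn \<Phi> \<longrightarrow> dec (\<lambda>f n. \<exists>m. \<Phi> f (pr n m) = 0))"

definition agree :: "'n \<Rightarrow> ('n \<Rightarrow> 'n) \<Rightarrow> ('n \<Rightarrow> 'n) \<Rightarrow> bool" where
  "agree k f g \<longleftrightarrow> (\<forall>i. i < k \<longrightarrow> f i = g i)"

definition cont :: "(('n \<Rightarrow> 'n) \<Rightarrow> 'n \<Rightarrow> 'n) \<Rightarrow> bool" where
  "cont \<Phi> \<longleftrightarrow> (\<forall>f\<in>F1. \<forall>n. \<exists>k. \<forall>g\<in>F1. agree k f g \<longrightarrow> \<Phi> g n = \<Phi> f n)"

lemma E2_ex:
  assumes E2 and P: "dec (\<lambda>f z. P f (pf z) (ps z))" shows "dec (\<lambda>f n. \<exists>m. P f n m)"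
proof -
  have "dec (\<lambda>f n. \<exists>m. (if P f (pf (pr n m)) (ps (pr n m)) then 0 else 1) = (0::'n))"
    using assms unfolding E2_def dec_def by blast
  then show ?thesis by (rule dec_cong) (simp split: if_splits)
qed

lemma E2_all: "E2 \<Longrightarrow> dec (\<lambda>f z. P f (pf z) (ps z)) \<Longrightarrow> dec (\<lambda>f n. \<forall>m. P f n m)"
  using dec_not[OF E2_ex[OF _ dec_not, of P]] by simp

lemma F1_curry: "s \<in> F1 \<Longrightarrow> (\<lambda>i. s (pr k i)) \<in> F1"
  by (rule F1I) (intro dfn_F1[where g=s] dfn_pr dfn_const dfn_arg)

text \<open>Grilliot's trick: a sequence \<open>s\<^sub>k \<rightarrow> g\<close> with \<open>\<Phi>(s\<^sub>k) \<noteq> \<Phi>(g)\<close> decides \<open>\<exists>j. h(j) = 0\<close>, by feeding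
  \<open>\<Phi>\<close> with \<open>s\<^sub>j\<close> for the least such \<open>j\<close> and with \<open>g\<close> if there is none.\<close>

lemma discontinuity_E2:
  assumes \<Phi>: "dfn \<Phi>" and g: "g \<in> F1" and s: "s \<in> F1"
    and lim: "\<And>k. agree k (\<lambda>i. s (pr k i)) g" and neq: "\<And>k. \<Phi> (\<lambda>i. s (pr k i)) n0 \<noteq> \<Phi> g n0"
  shows E2
  unfolding E2_def
proof (intro allI impI)
  fix \<Psi> assume \<Psi>: "dfn \<Psi>"
  \<comment> \<open>The resulting recursion is 0 until the least zero j of h has been passed and is
    constantly j + 1 from then on. The shift by one separates j = 0 from the case that nothing was
    found.\<close>
  let ?step = "\<lambda>h j b. if b = 0 then (if h j = 0 then j + 1 else 0) else b"
  have st: "dfn (\<lambda>f z. ?step (\<lambda>m. \<Psi> f (pr (pf (pf z)) m)) (pf (ps z)) (ps (ps z)))"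
    by (intro dfn_ifz dfn_plus dfn_const dfn_ps dfn_pf dfn_arg dfn_comp[OF \<Psi>] dfn_pr)
  define bs :: "('n \<Rightarrow> 'n) \<Rightarrow> 'n \<Rightarrow> 'n" where "bs h = nrec (?step h) 0" for h
  let ?h = "\<lambda>f n m. \<Psi> f (pr n m)"
  have bs: "bs (?h f n) 0 = 0" "bs (?h f n) \<in> F1" "bs (?h f n) (j + 1) = ?step (?h f n) j (bs (?h f n) j)"
    if "f \<in> F1" for f n j
    using nrec[OF dfn_rec(2)[OF st that, of "pr n 0"], of 0] unfolding bs_def by (simp_all only: pf_pr)
  \<comment> \<open>Entry i consults h only up to i. If the least zero j has not appeared by then,
    the answer \<open>g i\<close> is still right, since s_j agrees with g below j.\<close>
  let ?G = "\<lambda>f z. if bs (?h f (pf z)) (ps z + 1) = 0 then g (ps z) else s (pr (pred (bs (?h f (pf z)) (ps z + 1))) (ps z))"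
  have dbs: "dfn (\<lambda>f z. bs (?h f (pf z)) (ps z + 1))"
    unfolding bs_def by (rule dfn_rec(1)[OF st]) (intro dfn_const dfn_plus dfn_ps dfn_arg)+
  have G: "dfn ?G"
    by (intro dfn_ifz dbs dfn_F1[OF g] dfn_F1[OF s] dfn_pr dfn_pred dfn_ps dfn_arg)
  have d: "dec (\<lambda>f n. \<Phi> (\<lambda>i. ?G f (pr n i)) n0 \<noteq> \<Phi> g n0)"
    by (intro dec_not dec_eq dfn_const dfn_subst[OF \<Phi> G dfn_const])
  show "dec (\<lambda>f n. \<exists>m. \<Psi> f (pr n m) = 0)"
  proof (rule dec_cong[OF d])
    fix f n assume f: "f \<in> F1"
    define h where "h = ?h f n"
    have hF: "h \<in> F1" unfolding h_def by (rule F1_curry[OF c2(3)[OF \<Psi> f]])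
    note b = bs[OF f, of n, folded h_def]
    have none: "bs h i = 0" if hn: "\<And>j. j < i \<Longrightarrow> h j \<noteq> 0" for i
    proof -
      have "c \<le> i \<longrightarrow> bs h c = 0" for c
      proof (rule dec_induct[where n=c])
        show "dec (\<lambda>_ c. c \<le> i \<longrightarrow> bs h c = 0)"
          by (intro dec_imp dec_le dec_eq dfn_F1[OF b(2)] dfn_arg dfn_const)
        show "c + 1 \<le> i \<longrightarrow> bs h (c + 1) = 0" if "c \<le> i \<longrightarrow> bs h c = 0" for c
          using that hn[of c] b(3)[of c] by (auto simp: Suc_le h_def)
      qed (simp add: b(1))
      then show ?thesis by blast
    qed
    have G_eq: "(\<lambda>i. ?G f (pr n i)) = (\<lambda>i. if bs h (i + 1) = 0 then g i else s (pr (pred (bs h (i + 1))) i))"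
      unfolding h_def pf_pr ps_pr ..
    show "\<Phi> (\<lambda>i. ?G f (pr n i)) n0 \<noteq> \<Phi> g n0 \<longleftrightarrow> (\<exists>m. \<Psi> f (pr n m) = 0)"
    proof (cases "\<exists>m. h m = 0")
      case False
      then have "(\<lambda>i. ?G f (pr n i)) = g" unfolding G_eq using none by auto
      then show ?thesis using False by (simp add: h_def)
    next
      case True
      have "dec (\<lambda>_ m. h m = 0)" by (intro dec_eq dfn_F1[OF hF] dfn_arg dfn_const)
      from dec_least[OF this] True obtain j where j: "h j = 0" "\<And>i. i < j \<Longrightarrow> h i \<noteq> 0" by blast
      have bj: "bs h (j + 1) = j + 1" using b(3)[of j] none[of j] j fun_cong[OF h_def, of j] by simp
      have after: "bs h (j + 1 + c) = j + 1" for c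
      proof (rule dec_induct[where n=c])
        show "dec (\<lambda>_ c. bs h (j + 1 + c) = j + 1)"
          by (intro dec_eq dfn_F1[OF b(2)] dfn_plus dfn_arg dfn_const)
        show "bs h (j + 1 + (c + 1)) = j + 1" if "bs h (j + 1 + c) = j + 1" for c
        proof -
          have "j + 1 \<noteq> 0" by (metis Suc_pos order_less_irrefl)
          then show ?thesis using b(3)[of "j + 1 + c"] that by (simp add: add.assoc)
        qed
      qed (simp add: bj)
      have nz: "j + 1 \<noteq> 0" by (metis Suc_pos order_less_irrefl)
      have pj: "pred (j + 1) = j" by (simp add: pred_def mn_def)
      have "?G f (pr n i) = s (pr j i)" for i
      proof (cases "i < j")
        case True
        then have "bs h (i + 1) = 0" using j(2) by (intro none) (auto simp: discrete)
        then show ?thesis using fun_cong[OF G_eq, of i] lim[of j] True by (simp add: agree_def)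
      next
        case False
        then have "mn i j + j = i" by (intro mn_add) simp
        then have "j + 1 + mn i j = i + 1" by (metis add.assoc add.commute)
        then have "bs h (i + 1) = j + 1" using after[of "mn i j"] by simp
        then show ?thesis using fun_cong[OF G_eq, of i] nz pj by simp
      qed
      then have "(\<lambda>i. ?G f (pr n i)) = (\<lambda>i. s (pr j i))" by blast
      then show ?thesis using neq[of j] True by (simp add: h_def)
    qed
  qed
qed

text \<open>Choice yields numbers only, so the sequence converging to a discontinuity has to be
  given by codes of finite sequences. If finite sequences close to f take values different from the
  one at f, such sequences are chosen. Otherwise all finite sequences near f have the value of f,
  and the truncations of a nearby g with another value converge to g while keeping the wrong
  value.\<close>

lemma dichotomy: "E2 \<or> (\<forall>\<Phi>. dfn \<Phi> \<longrightarrow> cont \<Phi>)"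
proof (rule ccontr)
  assume "\<not> (E2 \<or> (\<forall>\<Phi>. dfn \<Phi> \<longrightarrow> cont \<Phi>))"
  then obtain \<Phi> f n where nE: "\<not> E2" and \<Phi>: "dfn \<Phi>" and f: "f \<in> F1"
    and d: "\<And>k. \<exists>g\<in>F1. agree k f g \<and> \<Phi> g n \<noteq> \<Phi> f n" by (auto simp: cont_def)
  show False
  proof (cases "\<forall>k. \<exists>\<tau>. agree k (fs \<tau>) f \<and> \<Phi> (fs \<tau>) n \<noteq> \<Phi> f n")
    case True
    let ?P = "\<lambda>_ z. agree (pf z) (fs (ps z)) f \<and> \<Phi> (fs (ps z)) n \<noteq> \<Phi> f n"
    have "dec ?P"
      unfolding agree_def
    proof (intro dec_and dec_ball dec_not dec_eq dfn_const dfn_pf dfn_arg)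
      show "dfn (\<lambda>_ z. fs (ps (pf z)) (ps z))" "dfn (\<lambda>_ z. f (ps z))"
        by (intro dfn_fs dfn_F1[OF f] dfn_ps dfn_pf dfn_arg)+
      show "dfn (\<lambda>_ z. \<Phi> (fs (ps z)) n)"
        by (intro dfn_fapp[OF \<Phi>] dfn_fs dfn_const dfn_ps dfn_pf dfn_arg)
    qed
    then have "dfn (\<lambda>u z. if ?P u z then 0 else 1)" by (simp add: dec_def)
    then have "\<exists>\<Theta>. dfn \<Theta> \<and> (\<forall>u\<in>F1. \<forall>k. (if ?P u (pr k (\<Theta> u k)) then 0 else (1::'n)) = 0)"
    proof (rule dfn_choice)
      fix u k
      obtain \<tau> where "agree k (fs \<tau>) f" "\<Phi> (fs \<tau>) n \<noteq> \<Phi> f n" using True by blast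
      then show "\<exists>m. (if ?P u (pr k m) then 0 else (1::'n)) = 0" by (intro exI[of _ \<tau>]) simp
    qed
    then obtain \<Theta> where \<Theta>: "dfn \<Theta>"
      "\<And>u k. u \<in> F1 \<Longrightarrow> (if ?P u (pr k (\<Theta> u k)) then 0 else (1::'n)) = 0" by blast
    define t where "t = \<Theta> f"
    have t: "t \<in> F1" unfolding t_def by (rule c2(3)[OF \<Theta>(1) f])
    have tp: "agree k (fs (t k)) f" "\<Phi> (fs (t k)) n \<noteq> \<Phi> f n" for k
      using \<Theta>(2)[OF f, of k] by (auto simp: t_def split: if_splits)
    have "E2"
    proof (rule discontinuity_E2[OF \<Phi> f, of "\<lambda>z. fs (t (pf z)) (ps z)" n])
      show "(\<lambda>z. fs (t (pf z)) (ps z)) \<in> F1" by (rule F1I) (intro dfn_fs dfn_F1[OF t] dfn_pf dfn_ps dfn_arg)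
    qed (use tp in simp_all)
    with nE show False ..
  next
    case False
    then obtain k0 where k0: "\<And>\<tau>. agree k0 (fs \<tau>) f \<Longrightarrow> \<Phi> (fs \<tau>) n = \<Phi> f n" by blast
    obtain g where g: "g \<in> F1" "agree k0 f g" "\<Phi> g n \<noteq> \<Phi> f n" using d by blast
    have "E2"
    proof (rule discontinuity_E2[OF \<Phi> g(1), of "\<lambda>z. if ps z < pf z + k0 then g (ps z) else 0" n])
      show "(\<lambda>z. if ps z < pf z + k0 then g (ps z) else 0) \<in> F1"
        by (rule F1I) (intro dfn_if dec_less dfn_plus dfn_F1[OF g(1)] dfn_pf dfn_ps dfn_const dfn_arg)
    next
      fix k show "agree k (\<lambda>i. if ps (pr k i) < pf (pr k i) + k0 then g (ps (pr k i)) else 0) g"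
        using zero_le[of k0] by (auto simp: agree_def intro: order_less_le_trans)
      obtain \<tau> where \<tau>: "fs \<tau> = (\<lambda>i. if i < k + k0 then g i else 0)" using finite_seq[OF g(1), of "k + k0"] by blast
      have "agree k0 (fs \<tau>) f" using g(2) zero_le[of k]
        by (auto simp: agree_def \<tau> intro: order_less_le_trans add_increasing)
      then show "\<Phi> (\<lambda>i. if ps (pr k i) < pf (pr k i) + k0 then g (ps (pr k i)) else 0) n \<noteq> \<Phi> g n"
        using k0[of \<tau>] g(3) unfolding \<tau> pf_pr ps_pr by simp
    qed
    with nE show False ..
  qed
qed

subsection \<open>Arithmetical comprehension\<close>

text \<open>In contrast to \<open>E2\<close> the function is fixed, so that a set of numbers is
  asserted to exist and not a functional.\<close>

definition jump :: bool where
  "jump \<longleftrightarrow> (\<forall>g\<in>F1. isset (\<lambda>n. \<exists>m. g (pr n m) = 0))"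

lemma isset_F1: "isset P \<Longrightarrow> (\<lambda>n. if P n then 0 else 1) \<in> F1"
  unfolding isset_def dec_def by (rule F1I)

lemma dec_isset: "isset P \<Longrightarrow> dfn A \<Longrightarrow> dec (\<lambda>f n. P (A f n))"
  unfolding dec_def by (rule dfn_F1[OF isset_F1])

lemma isset_ex: "jump \<Longrightarrow> isset (\<lambda>z. P (pf z) (ps z)) \<Longrightarrow> isset (\<lambda>n. \<exists>m. P n m)"
  unfolding jump_def by (drule bspec[OF _ isset_F1]) (auto split: if_splits)

lemma isset_not: "isset P \<Longrightarrow> isset (\<lambda>n. \<not> P n)"
  and isset_and: "isset P \<Longrightarrow> isset Q \<Longrightarrow> isset (\<lambda>n. P n \<and> Q n)"
  and isset_or: "isset P \<Longrightarrow> isset Q \<Longrightarrow> isset (\<lambda>n. P n \<or> Q n)"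
  and isset_imp: "isset P \<Longrightarrow> isset Q \<Longrightarrow> isset (\<lambda>n. P n \<longrightarrow> Q n)"
  unfolding isset_def by (intro dec_not dec_and dec_or dec_imp; assumption)+

lemma isset_all: "jump \<Longrightarrow> isset (\<lambda>z. P (pf z) (ps z)) \<Longrightarrow> isset (\<lambda>n. \<forall>m. P n m)"
  using isset_not[OF isset_ex[OF _ isset_not, of P]] by simp

lemma isset_induct: "isset P \<Longrightarrow> P 0 \<Longrightarrow> (\<And>n. P n \<Longrightarrow> P (n + 1)) \<Longrightarrow> P n"
  unfolding isset_def by (rule dec_induct)

lemma boot_isset:
  assumes boot and Y: "dfn Y" shows "isset (\<lambda>n. \<exists>f\<in>F1. Y f n = 0)"
  using assms(1)[unfolded boot_def, rule_format, OF dfnc_res[OF Y]] by (simp cong: bex_cong)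

lemma boot_isset_dec:
  assumes boot and P: "dec P" shows "isset (\<lambda>n. \<exists>f\<in>F1. P f n)"
  using boot_isset[OF assms(1) P[unfolded dec_def]] by (simp split: if_splits)

text \<open>A number quantifier is a function quantifier whose matrix looks only at the value
  \<open>f 0\<close>.\<close>

lemma boot_jump: "boot \<Longrightarrow> jump"
  unfolding jump_def
proof
  fix g assume b: boot and g: "g \<in> F1"
  have "dec (\<lambda>f n. g (pr n (f 0)) = 0)" by (intro dec_eq dfn_F1[OF g] dfn_pr dfn_app dfn_arg dfn_const)
  from boot_isset_dec[OF b this] have "isset (\<lambda>n. \<exists>f\<in>F1. g (pr n (f 0)) = 0)" .
  moreover have "(\<exists>f\<in>F1. g (pr n (f 0)) = 0) \<longleftrightarrow> (\<exists>m. g (pr n m) = 0)" for n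
  proof
    assume "\<exists>m. g (pr n m) = 0"
    then obtain m where "g (pr n m) = 0" by blast
    then show "\<exists>f\<in>F1. g (pr n (f 0)) = 0"
      by (intro bexI[of _ "\<lambda>_. m"] F1I dfn_const) auto
  qed blast
  ultimately show "isset (\<lambda>n. \<exists>m. g (pr n m) = 0)" by simp
qed

end

context num_model begin

subsection \<open>Instances of the schemas\<close>

text \<open>Parameters of a schema are bound outside of depth 0, so at depth d the i-th one has
  index i + d.\<close>

definition rv :: "nat \<Rightarrow> ty \<Rightarrow> htm" where "rv i \<tau> = (\<lambda>d. Var (i + d) \<tau>)"

lemma den_rv: "i < length R \<Longrightarrow> R ! i = (\<tau>, v) \<Longrightarrow> den M R C (rv i \<tau>) \<tau> v"
  by (auto simp: den_def rv_def extends_def nth_append add.commute[of i])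

lemma sat_plug1:
  assumes "wff (Ty0 # map fst R) A" "den0 R C t n"
  shows "sat M R C (A\<langle>[t]\<rangle>) (feval M (e n # map snd R) A)"
  using sat_plug[of "[Ty0]" R A "[t]" "[e n]" C] assms by simp

lemma sat_comprehension:
  assumes "wff (Ty0 # map fst R) A"
  shows "sat M R [] (\<^bold>\<exists>\<^sub>S X. \<^bold>\<forall>\<^sub>0 n. n \<^bold>\<in> X \<^bold>\<longleftrightarrow> A\<langle>[n]\<rangle>) (isset (\<lambda>n. feval M (e n # map snd R) A))"
proof -
  have "sat M R [] (\<^bold>\<exists>\<^sub>S X. \<^bold>\<forall>\<^sub>0 n. n \<^bold>\<in> X \<^bold>\<longleftrightarrow> A\<langle>[n]\<rangle>)
    (\<exists>X\<in>F1. (\<forall>n. X n = 0 \<or> X n = 1) \<and> (\<forall>n. X n = 1 \<longleftrightarrow> feval M (e n # map snd R) A))"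
    by (assumption | rule refl | rule sat_ex_set sat_all0 sat_iff sat_mem sat_plug1[OF assms] | erule den_lift)+
  then show ?thesis by (simp only: isset_char)
qed

text \<open>One number carries the values of all k number variables, so that a formula with several
  of them still defines a set. The innermost variable is the right component, as the quantifier step
  requires.\<close>

fun numbers :: "nat \<Rightarrow> 'n \<Rightarrow> 'a list" where
  "numbers 0 z = []"
| "numbers (Suc k) z = e (ps z) # numbers k (pf z)"

lemma length_numbers [simp]: "length (numbers k z) = k"
  by (induction k arbitrary: z) auto

lemma rep_F1: "rep Ty0 Ty0 f \<Longrightarrow> (\<lambda>z. dd (f (e z))) \<in> F1"
  using lam[of Ty0 Ty0 f] fn_F1[of "lam Ty0 Ty0 f"] by (simp add: fn_def[abs_def])

lemma rep_numbers: "i < k \<Longrightarrow> rep Ty0 Ty0 (\<lambda>x. numbers k (dd x) ! i)"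
proof -
  have "\<exists>g. dfn (\<lambda>_. g) \<and> (\<forall>z. numbers k z ! i = e (g z))" if "i < k" for i k
    using that
  proof (induction k arbitrary: i)
    case (Suc k)
    show ?case
    proof (cases i)
      case 0
      then show ?thesis by (intro exI[of _ ps]) (auto intro: dfn_ps dfn_arg)
    next
      case (Suc j)
      then obtain g where g: "dfn (\<lambda>_. g)" "\<forall>z. numbers k z ! j = e (g z)" using Suc.IH[of j] Suc.prems by auto
      have "dfn (\<lambda>_ z. g (pf z))" by (rule dfn_F1[OF F1I[OF g(1)]]) (intro dfn_pf dfn_arg)
      then show ?thesis using g(2) Suc by (intro exI[of _ "\<lambda>z. g (pf z)"]) auto
    qed
  qed simp
  then obtain g where g: "dfn (\<lambda>_. g)" "\<forall>z. numbers k z ! i = e (g z)" if "i < k" by metis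
  show "i < k \<Longrightarrow> rep Ty0 Ty0 (\<lambda>x. numbers k (dd x) ! i)"
    using F1_D1[OF F1I[OF g(1)]] g(2) by simp
qed

lemma rep_teval:
  assumes "wt (replicate k Ty0 @ \<Gamma>) t" "typed M \<Gamma> vs"
  shows "rep Ty0 (ty_of t) (\<lambda>x. teval M (numbers k (dd x) @ vs) t)"
  using assms(1)
proof (induction t)
  case (Var n \<tau>)
  show ?case
  proof (cases "n < k")
    case True
    then show ?thesis using rep_numbers[OF True] Var by (simp add: nth_append)
  next
    case False
    then show ?thesis using Var assms(2)
      by (auto simp: nth_append typed_def list_all2_conv_all_nth intro!: rep_const)
  qed
next
  case (Cst c)
  then show ?case by (simp add: rep_const con_closed)
next
  case (App s t)
  then obtain \<sigma> where "ty_of s = (ty_of t \<rightarrow> \<sigma>)" by (auto split: ty.splits)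
  then show ?case using App rep_app[of Ty0 "ty_of t" \<sigma>] by simp
qed

text \<open>Atomic formulas are decidable because their terms denote functions of the model. Each
  number quantifier is absorbed by one use of the jump, which is why all variables are packed into a
  single number.\<close>

lemma isset_arithmetical:
  assumes jump and "typed M \<Gamma> vs"
  shows "wff (replicate k Ty0 @ \<Gamma>) A \<Longrightarrow> number_quantifiers_only A \<Longrightarrow> isset (\<lambda>z. feval M (numbers k z @ vs) A)"
proof (induction A arbitrary: k)
  case (Eq s t)
  have "dec (\<lambda>_ z. dd (teval M (numbers k (dd (e z)) @ vs) s) = dd (teval M (numbers k (dd (e z)) @ vs) t))"
    by (rule dec_eq; rule dfn_F1[OF rep_F1 dfn_arg])
       (use rep_teval[OF _ assms(2), of k s] rep_teval[OF _ assms(2), of k t] Eq in auto)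
  moreover have "teval M (numbers k z @ vs) u \<in> N" if "wt (replicate k Ty0 @ \<Gamma>) u" "ty_of u = Ty0" for u z
    using rep_teval[OF that(1) assms(2)] that(2) ap_closed unfolding rep_def by (metis dd_e e_N)
  then have "(dd (teval M (numbers k z @ vs) s) = dd (teval M (numbers k z @ vs) t)) =
      (teval M (numbers k z @ vs) s = teval M (numbers k z @ vs) t)" for z
    using Eq.prems(1) by (metis e_dd wff.simps(1))
  ultimately show ?case by (simp add: isset_def eqv_eq)
next
  case (Less s t)
  have "dec (\<lambda>_ z. dd (teval M (numbers k (dd (e z)) @ vs) s) < dd (teval M (numbers k (dd (e z)) @ vs) t))"
    by (rule dec_less; rule dfn_F1[OF rep_F1 dfn_arg])
       (use rep_teval[OF _ assms(2), of k s] rep_teval[OF _ assms(2), of k t] Less in auto)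
  moreover have "teval M (numbers k z @ vs) u \<in> N" if "wt (replicate k Ty0 @ \<Gamma>) u" "ty_of u = Ty0" for u z
    using rep_teval[OF that(1) assms(2)] that(2) ap_closed unfolding rep_def by (metis dd_e e_N)
  then have "(dd (teval M (numbers k z @ vs) s) < dd (teval M (numbers k z @ vs) t)) =
      lss M (teval M (numbers k z @ vs) s) (teval M (numbers k z @ vs) t)" for z
    using Less.prems(1) by (metis e_dd e_less wff.simps(2))
  ultimately show ?case by (simp add: isset_def)
next
  case Bot
  then show ?case by (simp add: isset_def dec_const)
next
  case (Imp A B)
  then show ?case using isset_imp by simp
next
  case (All \<tau> A)
  then have "isset (\<lambda>z. feval M (numbers (Suc k) z @ vs) A)" by (intro All.IH) auto
  then have "isset (\<lambda>z. \<forall>m. feval M (e m # numbers k z @ vs) A)" by (intro isset_all[OF assms(1)]) simp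
  then show ?case using All by (simp add: ball_N)
qed

lemma jump_ACA: assumes jump and \<phi>: "\<phi> \<in> ACA" shows "feval M [] \<phi>"
proof -
  obtain \<Gamma> A where A: "\<phi> = closure \<Gamma> ((\<^bold>\<exists>\<^sub>S X. \<^bold>\<forall>\<^sub>0 n. n \<^bold>\<in> X \<^bold>\<longleftrightarrow> A\<langle>[n]\<rangle>) 0)"
    "wff (Ty0 # \<Gamma>) A" "number_quantifiers_only A" using \<phi> by (auto simp: ACA_def)
  have *: "feval M vs ((\<^bold>\<exists>\<^sub>S X. \<^bold>\<forall>\<^sub>0 n. n \<^bold>\<in> X \<^bold>\<longleftrightarrow> A\<langle>[n]\<rangle>) 0)"
    if vs: "typed M \<Gamma> vs" for vs
  proof -
    note t = typed_well_typed[OF vs]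
    have "isset (\<lambda>z. feval M (numbers 1 z @ vs) A)"
      using A by (intro isset_arithmetical[OF assms(1) vs]) simp_all
    then have "dec (\<lambda>_ n. feval M (numbers 1 (pr 0 n) @ vs) A)"
      by (rule dec_isset) (intro dfn_pr dfn_const dfn_arg)
    then have i: "isset (\<lambda>n. feval M (e n # vs) A)" by (simp add: isset_def)
    have w: "wff (Ty0 # map fst (zip \<Gamma> vs)) A" using A t by simp
    show ?thesis
      using sat_schema[OF sat_comprehension[OF w] t(1)] i t by simp
  qed
  then show "feval M [] \<phi>" by (auto simp: A(1) feval_closure)
qed

lemma ACA_jump:
  assumes "\<And>\<phi>. \<phi> \<in> ACA \<Longrightarrow> wff [] \<phi> \<Longrightarrow> feval M [] \<phi>" shows jump
  unfolding jump_def
proof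
  fix g assume g: "g \<in> F1"
  let ?P = "hex Ty0 (\<lambda>m. rv 1 Ty1 \<cdot> hpair (rv 0 Ty0) m \<^bold>= \<^bold>0)"
  let ?A = "?P 0"
  have s: "sat M [(Ty0, e n), (Ty1, c1 g)] [] ?P (\<exists>m. g (pr n m) = 0)" for n
  proof (rule sat_ex0)
    fix C' m t assume t: "den0 [(Ty0, e n), (Ty1, c1 g)] C' t m"
    show "sat M [(Ty0, e n), (Ty1, c1 g)] C' (rv 1 Ty1 \<cdot> hpair (rv 0 Ty0) t \<^bold>= \<^bold>0) (g (pr n m) = 0)"
      by (rule sat0_intros(1)[OF den_app0'[OF den_rv den0_pair[OF den_rv t] g refl] den0_intros(1)]) simp_all
  qed
  have A: "wff [Ty0, Ty1] ?A" "feval M [e n, c1 g] ?A = (\<exists>m. g (pr n m) = 0)" for n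
    using sat_schema[OF s[of n]] g by (simp_all add: well_typed_def)
  have n: "number_quantifiers_only ?A"
    by (simp add: hex_def hneg_def himp_def hall_def heq_def hbot_def)
  let ?Q = "\<^bold>\<exists>\<^sub>S X. \<^bold>\<forall>\<^sub>0 n. n \<^bold>\<in> X \<^bold>\<longleftrightarrow> ?A\<langle>[n]\<rangle>"
  have R: "well_typed M [(Ty1, c1 g)]" using g by (simp add: well_typed_def)
  have sc: "sat M [(Ty1, c1 g)] [] ?Q (isset (\<lambda>n. feval M (e n # map snd [(Ty1, c1 g)]) ?A))"
    by (rule sat_comprehension) (use A(1) in simp)
  have "closure [Ty1] (?Q 0) \<in> ACA"
    unfolding ACA_def
    by (rule CollectI, rule exI[of _ "[Ty1]"], rule exI[of _ ?A], intro conjI, rule refl, simp, rule A(1), rule n)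
  moreover have "wff [] (closure [Ty1] (?Q 0))" using sat_schema(1)[OF sc R] by (simp only: wff_closure list.map fst_conv)
  ultimately have "feval M [] (closure [Ty1] (?Q 0))" by (rule assms)
  from models_closure[OF this R _ sc] have "isset (\<lambda>n. feval M (e n # map snd [(Ty1, c1 g)]) ?A)" by simp
  then show "isset (\<lambda>n. \<exists>m. g (pr n m) = 0)" using A(2) by simp
qed

section \<open>The neighbourhood function principle implies bootstrap\<close>

lemma sbar: 
  assumes f: "f \<in> F1" shows "sbar f 0 = 0" "sbar f (k + 1) = pr (sbar f k) (f k) + 1"
proof -
  have "bfn (\<lambda>k s. pr s (f k) + 1)" unfolding pr_def
    by (intro bfn_plus bfn_F1[OF tri(1)] bfn_F1[OF f] bfn_const bfn_fst bfn_snd)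
  from nrec[OF this] show "sbar f 0 = 0" "sbar f (k + 1) = pr (sbar f k) (f k) + 1" by (simp_all add: sbar_def)
qed

lemma sbar_Suc_neq_0: "f \<in> F1 \<Longrightarrow> sbar f (k + 1) \<noteq> 0"
  by (simp add: sbar) (metis Suc_pos order_less_irrefl)

text \<open>The length of the initial segment on which \<open>\<gamma>\<close> decides reveals whether the first entry \<open>n\<close>
  satisfies \<open>\<exists>f. Y(f, n) = 0\<close>.\<close>

lemma NFP_boot:
  assumes NFP: "\<And>\<phi>. \<phi> \<in> NFP \<Longrightarrow> wff [] \<phi> \<Longrightarrow> feval M [] \<phi>" shows boot
  unfolding boot_def
proof (intro allI impI)
  fix Y assume "dfnc Y"
  then have Y: "dfn Y" by (rule dfncD)
  define B where "B n \<longleftrightarrow> (\<exists>f\<in>F1. Y f n = 0)" for n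
  define Q where "Q s \<longleftrightarrow> (\<exists>n. B n \<and> s = pr 0 n + 1) \<or> (\<exists>n m. \<not> B n \<and> s = pr (pr 0 n + 1) m + 1)" for s
  let ?b = "\<lambda>n. \<^bold>\<exists>\<^sub>1 f. rv 1 (Ty1 \<rightarrow> Ty0 \<rightarrow> Ty0) \<cdot> f \<cdot> n \<^bold>= \<^bold>0"
  let ?P = "(\<^bold>\<exists>\<^sub>0 n. ?b n \<^bold>\<and> rv 0 Ty0 \<^bold>= hpair \<^bold>0 n \<^bold>+ \<^bold>1) \<^bold>\<or>
    (\<^bold>\<exists>\<^sub>0 n. \<^bold>\<exists>\<^sub>0 m. \<^bold>\<not> ?b n \<^bold>\<and> rv 0 Ty0 \<^bold>= hpair (hpair \<^bold>0 n \<^bold>+ \<^bold>1) m \<^bold>+ \<^bold>1)"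
  let ?A = "?P 0"
  let ?R = "[(Ty1 \<rightarrow> Ty0 \<rightarrow> Ty0, c2 Y)]"
  have b: "sat M ((Ty0, e s) # ?R) C (?b t) (B n)" if "den0 ((Ty0, e s) # ?R) C t n" for C t n s
    unfolding B_def
    by (rule sat_ex1, rule sat0_intros, rule den_app0', rule den_app1', rule den_rv)
       (simp | assumption | rule Y den0_intros den_lift[OF that] refl c2(3)[OF Y])+
  have s: "sat M ((Ty0, e s) # ?R) [] ?P (Q s)" for s
    unfolding Q_def
    by (assumption | rule b rat_intros | erule den_lift | rule den_rv; simp)+
  have A: "wff [Ty0, Ty1 \<rightarrow> Ty0 \<rightarrow> Ty0] ?A" "feval M [e s, c2 Y] ?A = Q s" for s
    using sat_schema[OF s[of s]] c2(1)[OF Y] by (simp_all add: well_typed_def)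
  have R: "well_typed M ?R" using c2(1)[OF Y] by (simp add: well_typed_def)
  have p: "sat M ?R C (?A\<langle>[t]\<rangle>) (Q n)" if "den0 ?R C t n" for C t n
    using sat_plug1[of ?R ?A C t n] A that by simp
  let ?N = "(\<^bold>\<forall>\<^sub>1 f. \<^bold>\<exists>\<^sub>0 n. ?A\<langle>[seqbar f n]\<rangle>) \<^bold>\<longrightarrow>
             (\<^bold>\<exists>\<^sub>1 \<gamma>. K0 \<gamma> \<^bold>\<and> (\<^bold>\<forall>\<^sub>1 f. \<^bold>\<exists>\<^sub>0 v. assoc_value \<gamma> f v \<^bold>\<and> ?A\<langle>[seqbar f v]\<rangle>))"
  have sN: "sat M ?R [] ?N ((\<forall>f\<in>F1. \<exists>n. Q (sbar f n)) \<longrightarrow>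
     (\<exists>\<gamma>\<in>F1. k0 \<gamma> \<and> (\<forall>f\<in>F1. \<exists>v. (\<exists>k. \<forall>n. k < n \<longrightarrow> \<gamma> (sbar f n) = v + 1) \<and> Q (sbar f v))))"
    by (assumption | rule sat_imp sat_all1 sat_ex1 sat_ex0 sat_conj p sat_K0 sat_assoc_value den0_seqbar
        | erule den_lift | erule extends_trans)+
  have "closure [Ty1 \<rightarrow> Ty0 \<rightarrow> Ty0] (?N 0) \<in> NFP"
    unfolding NFP_def
    by (rule CollectI, rule exI[of _ "[Ty1 \<rightarrow> Ty0 \<rightarrow> Ty0]"], rule exI[of _ ?A], rule conjI[OF refl A(1)])
  moreover have "wff [] (closure [Ty1 \<rightarrow> Ty0 \<rightarrow> Ty0] (?N 0))"
    using sat_schema(1)[OF sN R] by (simp only: wff_closure list.map fst_conv)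
  ultimately have "feval M [] (closure [Ty1 \<rightarrow> Ty0 \<rightarrow> Ty0] (?N 0))" by (rule NFP)
  from models_closure[OF this R _ sN]
  have imp: "(\<forall>f\<in>F1. \<exists>n. Q (sbar f n)) \<longrightarrow>
     (\<exists>\<gamma>\<in>F1. k0 \<gamma> \<and> (\<forall>f\<in>F1. \<exists>v. (\<exists>k. \<forall>n. k < n \<longrightarrow> \<gamma> (sbar f n) = v + 1) \<and> Q (sbar f v)))" by simp
  have "\<exists>n. Q (sbar f n)" if f: "f \<in> F1" for f
  proof (cases "B (f 0)")
    case True
    moreover have "sbar f (0 + 1) = pr 0 (f 0) + 1" using sbar[OF f] by (simp only:)
    ultimately have "Q (sbar f (0 + 1))" unfolding Q_def by blast
    then show ?thesis by blast
  next
    case False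
    moreover have "sbar f (0 + 1 + 1) = pr (pr 0 (f 0) + 1) (f (0 + 1)) + 1" using sbar[OF f] by (simp only:)
    ultimately have "Q (sbar f (0 + 1 + 1))" unfolding Q_def by blast
    then show ?thesis by blast
  qed
  with imp obtain \<gamma> where \<gamma>: "\<gamma> \<in> F1" "k0 \<gamma>"
    "\<And>f. f \<in> F1 \<Longrightarrow> \<exists>v. (\<exists>k. \<forall>n. k < n \<longrightarrow> \<gamma> (sbar f n) = v + 1) \<and> Q (sbar f v)" by blast
  define h where "h n i = (if i = 0 then n else 0)" for n i :: 'n
  have h: "h n \<in> F1" for n unfolding h_def by (rule F1I) (intro dfn_ifz dfn_arg dfn_const)
  have ds: "dfn (\<lambda>_ z. sbar (h (pf z)) (ps z))"
    unfolding sbar_def h_def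
    by (rule dfn_rec(1)) (intro dfn_plus dfn_pr dfn_ifz dfn_pf dfn_ps dfn_const dfn_arg)+
  \<comment> \<open>An associate is only known to answer at some length. Choice makes such a length
    a function of n, which turns the final test into a decidable one; \<open>h n\<close> is the
    sequence n, 0, 0, ... .\<close>
  have "dec (\<lambda>_ z. 0 < \<gamma> (sbar (h (pf z)) (ps z)))"
    by (intro dec_less dfn_const dfn_F1[OF \<gamma>(1)] ds)
  then have "\<exists>\<Theta>. dfn \<Theta> \<and> (\<forall>f\<in>F1. \<forall>n. (if 0 < \<gamma> (sbar (h (pf (pr n (\<Theta> f n)))) (ps (pr n (\<Theta> f n)))) then 0 else 1) = (0::'n))"
    unfolding dec_def
  proof (rule dfn_choice)
    fix f n show "\<exists>m. (if 0 < \<gamma> (sbar (h (pf (pr n m))) (ps (pr n m))) then 0 else 1) = (0::'n)"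
      using \<gamma>(2) h[of n] by (auto simp: k0_def)
  qed
  then obtain \<Theta> where \<Theta>: "dfn \<Theta>" "\<And>f n. f \<in> F1 \<Longrightarrow> 0 < \<gamma> (sbar (h n) (\<Theta> f n))"
    by (auto split: if_splits)
  define t where "t = \<Theta> (h 0)"
  have t: "t \<in> F1" "0 < \<gamma> (sbar (h n) (t n))" for n
    using c2(3)[OF \<Theta>(1) h] \<Theta>(2)[OF h] by (auto simp: t_def)
  \<comment> \<open>The value v of the associate is the length of a sequence satisfying
    \<open>Q\<close>, thus 1 if \<open>B n\<close> holds and 2 otherwise, and the associate stores v
    + 1.\<close>
  have key: "\<gamma> (sbar (h n) (t n)) = 1 + 1 \<longleftrightarrow> B n" for n
  proof -
    obtain v k where v: "\<And>m. k < m \<Longrightarrow> \<gamma> (sbar (h n) m) = v + 1" "Q (sbar (h n) v)" using \<gamma>(3)[OF h] by blast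
    have m: "k < k + t n + 1" "t n < k + t n + 1" by (simp_all add: discrete)
    have e: "\<gamma> (sbar (h n) (t n)) = v + 1"
      using \<gamma>(2) h[of n] t(2)[of n] m(2) v(1)[OF m(1)] unfolding k0_def by metis
    show ?thesis
    proof (cases v rule: num_cases)
      case 1
      have "(0::'n) \<noteq> x + 1" for x by (metis Suc_pos order_less_irrefl)
      then show ?thesis using v(2) sbar(1)[OF h] 1 by (simp add: Q_def)
    next
      case (2 w)
      show ?thesis
      proof (cases w rule: num_cases)
        case 1
        have "Q (sbar (h n) (0 + 1))" using v(2) 2 1 by simp
        then have "B n" unfolding Q_def sbar(2)[OF h] sbar(1)[OF h]
        proof
          assume "\<exists>na m. \<not> B na \<and> pr 0 (h n 0) + 1 = pr (pr 0 na + 1) m + 1"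
          then show ?thesis by simp (metis Suc_pos order_less_irrefl)
        qed (simp add: h_def)
        then show ?thesis using e 2 1 by simp
      next
        case (2 u)
        have "Q (sbar (h n) (u + 1 + 1))" using v(2) \<open>v = w + 1\<close> 2 by simp
        then have "\<not> B n" unfolding Q_def sbar(2)[OF h, where k="u + 1"]
        proof (rule disjE)
          assume "\<exists>na. B na \<and> pr (sbar (h n) (u + 1)) (h n (u + 1)) + 1 = pr 0 na + 1"
          then show ?thesis using sbar_Suc_neq_0[OF h] by simp
        next
          assume "\<exists>na m. \<not> B na \<and> pr (sbar (h n) (u + 1)) (h n (u + 1)) + 1 = pr (pr 0 na + 1) m + 1"
          then obtain na where na: "\<not> B na" "sbar (h n) (u + 1) = pr 0 na + 1" by auto
          then have eq: "sbar (h n) u = 0" "h n u = na" by (simp_all add: sbar(2)[OF h])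
          have "u = 0"
          proof (cases u rule: num_cases)
            case (2 x) then show ?thesis using eq sbar_Suc_neq_0[OF h] by simp
          qed
          then show ?thesis using na eq by (simp add: h_def)
        qed
        moreover have "v + 1 \<noteq> 1 + 1"
        proof
          assume "v + 1 = 1 + 1"
          then have "(u + 1) + (1 + 1) = 0 + (1 + 1)"
            unfolding \<open>v = w + 1\<close> 2 by (simp only: add.assoc add_0)
          then have "u + 1 = 0" by (rule cancel_semigroup_add_class.add_right_cancel[THEN iffD1])
          then show False by (metis Suc_pos order_less_irrefl)
        qed
        ultimately show ?thesis using e by simp
      qed
    qed
  qed
  have "dec (\<lambda>_ n. \<gamma> (sbar (h (pf (pr n (t n)))) (ps (pr n (t n)))) = 1 + 1)"
    by (intro dec_eq dfn_const dfn_F1[OF \<gamma>(1)] dfn_comp[OF ds] dfn_pr dfn_arg dfn_F1[OF t(1)])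
  then show "isset (\<lambda>n. \<exists>f\<in>F1. Y f n = 0)" using key by (simp add: isset_def B_def)
qed

text \<open>The witnesses are functions, which quantifier-free choice does not supply. Finitely many
  of them are collected by induction on k for a formula that quantifies over objects of type
  \<open>Ty0 \<rightarrow> Ty1\<close>.\<close>

lemma IND_choice:
  assumes IND: "\<And>\<phi>. \<phi> \<in> IND_omega \<Longrightarrow> wff [] \<phi> \<Longrightarrow> feval M [] \<phi>"
    and W: "dfn W" and ex: "\<And>i. \<exists>h\<in>F1. W h i = 0"
  shows "\<exists>y\<in>F01. \<forall>i. i < k \<longrightarrow> W (y i) i = 0"
proof -
  let ?T2 = "Ty1 \<rightarrow> Ty0 \<rightarrow> Ty0"
  let ?P = "hex (Ty0 \<rightarrow> Ty1) (\<lambda>y. \<^bold>\<forall>\<^sub>0 i. i \<^bold>< rv 0 Ty0 \<^bold>\<longrightarrow> rv 1 ?T2 \<cdot> (y \<cdot> i) \<cdot> i \<^bold>= \<^bold>0)"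
  let ?A = "?P 0"
  let ?R = "[(?T2, c2 W)]"
  define Q where "Q k \<longleftrightarrow> (\<exists>y\<in>F01. \<forall>i. i < k \<longrightarrow> W (y i) i = 0)" for k
  have s: "sat M ((Ty0, e n) # ?R) [] ?P (Q n)" for n
    unfolding Q_def
    by (rule sat_ex01, rule sat_all0, rule sat_imp, rule sat0_intros, assumption, rule den_rv, simp, simp,
        rule sat0_intros, rule den_app0', rule den_app1', rule den_rv, simp, simp, rule den_app01)
       (assumption | erule den_lift | rule refl W den0_intros c2(3)[OF W] | erule F01_sec)+
  have A: "wff [Ty0, ?T2] ?A" "feval M [e s, c2 W] ?A = Q s" for s
    using sat_schema[OF s[of s]] c2(1)[OF W] by (simp_all add: well_typed_def)
  have R: "well_typed M ?R" using c2(1)[OF W] by (simp add: well_typed_def)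
  have w: "wff (Ty0 # map fst ?R) ?A" using A(1) by simp
  have ax: "closure [?T2] (induction ?A 0) \<in> IND_omega" 
    unfolding IND_omega_def
    by (rule CollectI, rule exI[of _ "[?T2]"], rule exI[of _ ?A], rule conjI[OF refl A(1)])
  have "wff [] (closure [?T2] (induction ?A 0))"
    using sat_schema(1)[OF sat_induction[OF w] R] by (simp only: wff_closure list.map fst_conv)
  note ind = feval_induction[OF IND[OF ax this] A(1), of "[c2 W]"]
  have "feval M [e k, c2 W] ?A"
  proof (rule ind)
    show "typed M [?T2] [c2 W]" using c2(1)[OF W] by simp
    have "(\<lambda>z. 0) \<in> F1" by (rule F1I) (rule dfn_const)
    then have "(\<lambda>_ _. 0) \<in> F01" by (simp add: F01_def)
    then show "feval M [zr, c2 W] ?A" using A(2)[of 0] by (auto simp: e_0 Q_def)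
  next
    fix x assume x: "x \<in> N" "feval M [x, c2 W] ?A"
    obtain n where n: "x = e n" using x(1) by (rule N_cases)
    then have "Q n" using x(2) A(2) by simp
    then obtain y where y: "y \<in> F01" "\<And>i. i < n \<Longrightarrow> W (y i) i = 0" by (auto simp: Q_def)
    obtain h where h: "h \<in> F1" "W h n = 0" using ex by blast
    have yF: "(\<lambda>z. y (pf z) (ps z)) \<in> F1" using y(1) by (simp add: F01_def)
    have "(\<lambda>z. if pf z = n then h (ps z) else y (pf z) (ps z)) \<in> F1"
      by (rule F1I) (intro dfn_if dec_eq dfn_pf dfn_const dfn_arg dfn_F1[OF h(1)] dfn_ps dfn_F1[OF yF, of "\<lambda>_ z. z"])
    moreover have "(\<lambda>z. (if pf z = n then h else y (pf z)) (ps z)) = (\<lambda>z. if pf z = n then h (ps z) else y (pf z) (ps z))"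
      by (rule ext) simp
    ultimately have "(\<lambda>i. if i = n then h else y i) \<in> F01" unfolding F01_def by simp
    moreover have "\<forall>i. i < n + 1 \<longrightarrow> W (if i = n then h else y i) i = 0"
    proof (intro allI impI)
      fix i assume "i < n + 1"
      then have "i < n \<or> i = n" by (simp only: discrete le_less)
      then show "W (if i = n then h else y i) i = 0" using y(2) h(2) by (cases "i = n") simp_all
    qed
    ultimately have "Q (n + 1)" 
      unfolding Q_def by - (rule bexI[of _ "\<lambda>i. if i = n then h else y i"])
    then show "feval M [x \<oplus> on, c2 W] ?A" using A(2)[of "n + 1"] n by (simp add: e_add e_1)
  qed simp
  then show ?thesis using A(2) by (simp add: Q_def)
qed

end

context num_model begin

subsection \<open>Binary expansions\<close>

text \<open>\<open>ev p k h\<close> is the real \<open>p + 2\<^sup>-\<^sup>k (h\<^sub>0/2 + h\<^sub>1/4 + \<dots>)\<close>.\<close>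

definition ev :: "'n \<Rightarrow> 'n \<Rightarrow> ('n \<Rightarrow> 'n) \<Rightarrow> 'n \<Rightarrow> 'n" where
  "ev p k h i = nrec (\<lambda>i s. if h i = 0 then s else ad s (dya 1 (k + i + 1))) p i"

lemma dfn_ev:
  assumes "dfn P" "dfn Kf" "dfn (\<lambda>f w. H f (pf w) (ps w))" "dfn I"
  shows "dfn (\<lambda>f n. ev (P f n) (Kf f n) (H f n) (I f n))"
  unfolding ev_def
proof (rule dfn_rec(1)[OF _ assms(1,4)])
  have K: "dfn (\<lambda>f z. Kf f (pf z))" by (intro dfn_comp[OF assms(2)] dfn_pf dfn_arg)
  have "dfn (\<lambda>f z. H f (pf (pr (pf z) (pf (ps z)))) (ps (pr (pf z) (pf (ps z)))))"
    by (rule dfn_comp[OF assms(3)]) (intro dfn_pr dfn_pf dfn_ps dfn_arg)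
  then have H: "dfn (\<lambda>f z. H f (pf z) (pf (ps z)))" by simp
  show "dfn (\<lambda>f z. if H f (pf z) (pf (ps z)) = 0 then ps (ps z) else ad (ps (ps z)) (dya 1 (Kf f (pf z) + pf (ps z) + 1)))"
    by (intro dfn_ifz H K dfn_ad dfn_dya dfn_plus dfn_const dfn_pf dfn_ps dfn_arg)
qed

lemma ev:
  assumes "h \<in> F1"
  shows "ev p k h \<in> F1" "ev p k h 0 = p"
    "ev p k h (i + 1) = (if h i = 0 then ev p k h i else ad (ev p k h i) (dya 1 (k + i + 1)))"
proof -
  show "ev p k h \<in> F1"
    by (rule F1I) (intro dfn_ev dfn_const dfn_arg dfn_F1[OF assms] dfn_ps)
  have "dfn (\<lambda>f z. if h (pf (ps z)) = 0 then ps (ps z) else ad (ps (ps z)) (dya 1 (k + pf (ps z) + 1)))"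
    by (intro dfn_ifz dfn_F1[OF assms] dfn_ad dfn_dya dfn_plus dfn_const dfn_pf dfn_ps dfn_arg)
  from nrec[OF dfn_rec(2)[where h="\<lambda>_ _ i s. if h i = 0 then s else ad s (dya 1 (k + i + 1))", OF this assms]]
  show "ev p k h 0 = p" "ev p k h (i + 1) = (if h i = 0 then ev p k h i else ad (ev p k h i) (dya 1 (k + i + 1)))"
    by (simp_all add: ev_def)
qed

lemma dy_Suc': "dy (a + i + 1) = dy (a + i) / 2" "dy (a + (i + 1)) = dy (a + i) / 2"
  using dy_Suc[of "a + i"] by (simp_all add: add.assoc)

lemma le_cases: assumes "(a::'n) \<le> b" obtains c where "b = a + c"
  using mn_add[OF assms] add.commute by metis

text \<open>The intervals of length 2^-(k+i) that start at the i-th partial sum are nested.\<close>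

lemma ev_bounds:
  assumes h: "h \<in> F1" and ij: "i \<le> j"
  shows "qv (ev p k h i) \<le> qv (ev p k h j)" "qv (ev p k h j) + dy (k + j) \<le> qv (ev p k h i) + dy (k + i)"
proof -
  obtain c where c: "j = i + c" using ij le_cases by metis
  let ?x = "ev p k h"
  note x = dfn_F1[OF ev(1)[OF h, of p k]]
  have "qv (?x i) \<le> qv (?x (i + c)) \<and> qv (ad (?x (i + c)) (dya 1 (k + (i + c)))) \<le> qv (ad (?x i) (dya 1 (k + i)))"
  proof (rule dec_induct[where n=c])
    show "dec (\<lambda>_ c. qv (?x i) \<le> qv (?x (i + c)) \<and> qv (ad (?x (i + c)) (dya 1 (k + (i + c)))) \<le> qv (ad (?x i) (dya 1 (k + i))))"
      by (intro dec_and dec_qv_le x dfn_ad dfn_dya dfn_plus dfn_const dfn_arg)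
    fix c assume IH: "qv (?x i) \<le> qv (?x (i + c)) \<and> qv (ad (?x (i + c)) (dya 1 (k + (i + c)))) \<le> qv (ad (?x i) (dya 1 (k + i)))"
    have e: "?x (i + (c + 1)) = (if h (i + c) = 0 then ?x (i + c) else ad (?x (i + c)) (dya 1 (k + (i + c) + 1)))"
      using ev(3)[OF h, of p k "i + c"] by (simp add: add.assoc)
    have d: "dy (k + (i + c) + 1) = dy (k + (i + c)) / 2" "dy (k + (i + (c + 1))) = dy (k + (i + c)) / 2"
      using dy_Suc[of "k + (i + c)"] by (simp_all add: add.assoc)
    have "0 < dy (k + (i + c))" by simp
    then show "qv (?x i) \<le> qv (?x (i + (c + 1))) \<and> qv (ad (?x (i + (c + 1))) (dya 1 (k + (i + (c + 1))))) \<le> qv (ad (?x i) (dya 1 (k + i)))"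
      using IH unfolding e by (cases "h (i + c) = 0"; simp add: d; linarith)
  qed simp
  then show "qv (?x i) \<le> qv (?x j)" "qv (?x j) + dy (k + j) \<le> qv (?x i) + dy (k + i)" by (simp_all add: c)
qed

lemma dy_add_le: "dy (k + n) \<le> dy n" "dy (n + k) \<le> dy n"
  using dy_mono[of n "k + n"] dy_mono[of n "n + k"] by simp_all

lemma isR_ev: assumes h: "h \<in> F1" shows "isR (ev p k h)"
  unfolding isR_def
proof (intro allI)
  fix n i :: 'n
  have "n \<le> n + i" by simp
  from ev_bounds[OF h this, of p k] dy_pos[of "k + (n + i)"] dy_add_le(1)[of k n]
  show "\<bar>qv (ev p k h n) - qv (ev p k h (n + i))\<bar> < dy n" by linarith
qed

lemma isR_le: "isR x \<Longrightarrow> n \<le> m \<Longrightarrow> \<bar>qv (x n) - qv (x m)\<bar> < dy n"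
  unfolding isR_def using le_cases by metis

text \<open>Comparisons of reals are made through a late index m, at a cost of at most
  \<open>4 * dy m\<close>. Letting m grow removes this cost.\<close>

lemma arch:
  assumes "\<And>m. j \<le> m \<Longrightarrow> a \<le> b + 4 * dy m" shows "a \<le> b"
proof (rule ccontr)
  assume "\<not> a \<le> b"
  then obtain m where m: "dy m < (a - b) / 4" using ex_dy_less[of "(a - b) / 4"] by auto
  have "dy (j + m) \<le> dy m" by (rule dy_add_le)
  then show False using m assms[of "j + m"] by simp
qed

text \<open>Comparison of a rational with a real: the slack \<open>dy j\<close> bounds the distance
  from the j-th approximation to the limit.\<close>

definition leq :: "'n \<Rightarrow> ('n \<Rightarrow> 'n) \<Rightarrow> bool" where "leq q y \<longleftrightarrow> (\<forall>j. qv q \<le> qv (y j) + dy j)"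
definition geq :: "'n \<Rightarrow> ('n \<Rightarrow> 'n) \<Rightarrow> bool" where "geq q y \<longleftrightarrow> (\<forall>j. qv (y j) \<le> qv q + dy j)"

lemma eqR_sym: "eqR x y \<Longrightarrow> eqR y x"
  by (simp add: eqR_def abs_minus_commute)

lemma leq_eqR: assumes "isR y" "isR z" "eqR y z" "leq q y" shows "leq q z"
  unfolding leq_def
proof
  fix j show "qv q \<le> qv (z j) + dy j"
  proof (rule arch[of j])
    fix m assume "j \<le> m"
    then have "\<bar>qv (z j) - qv (z m)\<bar> < dy j" using assms(2) isR_le by blast
    moreover have "\<bar>qv (y m) - qv (z m)\<bar> \<le> 2 * dy m" "qv q \<le> qv (y m) + dy m"
      using assms by (auto simp: eqR_def leq_def)
    ultimately show "qv q \<le> qv (z j) + dy j + 4 * dy m" using dy_pos[of m] by linarith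
  qed
qed

lemma eqR_trans: assumes "isR x" "isR y" "isR z" "eqR x y" "eqR y z" shows "eqR x z"
  unfolding eqR_def
proof
  fix j
  have "qv (x j) - qv (z j) \<le> 2 * dy j \<and> qv (z j) - qv (x j) \<le> 2 * dy j"
  proof (intro conjI; rule arch[of j])
    fix m assume "j \<le> m"
    then have "\<bar>qv (z j) - qv (z m)\<bar> < dy j" "\<bar>qv (x j) - qv (x m)\<bar> < dy j" using assms isR_le by blast+
    moreover have "\<bar>qv (x m) - qv (y m)\<bar> \<le> 2 * dy m" "\<bar>qv (y m) - qv (z m)\<bar> \<le> 2 * dy m"
      using assms by (auto simp: eqR_def)
    ultimately show "qv (x j) - qv (z j) \<le> 2 * dy j + 4 * dy m" "qv (z j) - qv (x j) \<le> 2 * dy j + 4 * dy m"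
      by linarith+
  qed
  then show "\<bar>qv (x j) - qv (z j)\<bar> \<le> 2 * dy j" by linarith
qed

lemma not_leq_geq: assumes y: "isR y" and n: "\<not> leq q y" shows "geq q y"
  unfolding geq_def
proof
  fix i
  obtain j where j: "qv (y j) + dy j < qv q" using n by (auto simp: leq_def not_le)
  show "qv (y i) \<le> qv q + dy i"
  proof (cases "i \<le> j")
    case True
    then show ?thesis using isR_le[OF y True] j dy_pos[of j] by linarith
  next
    case False
    then have "j \<le> i" by simp
    then show ?thesis using isR_le[OF y, of j i] j dy_pos[of i] by linarith
  qed
qed

lemma posR_eqR: assumes "isR x" "isR y" "eqR x y" "posR x" shows "posR y"
proof -
  obtain n where n: "2 * dy n < qv (x n)" using assms(4) posR by blast
  \<comment> \<open>Two indices further on, \<open>dy n + dy n / 2\<close> of the margin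
    \<open>2 * dy n\<close> has been lost, and what remains is exactly the required
    \<open>2 * dy ?m\<close>.\<close>
  let ?m = "n + 1 + 1"
  have "\<bar>qv (x n) - qv (x ?m)\<bar> < dy n" by (rule isR_le[OF assms(1)]) (simp add: add.assoc)
  moreover have "\<bar>qv (x ?m) - qv (y ?m)\<bar> \<le> 2 * dy ?m" using assms(3) by (simp add: eqR_def)
  moreover have "dy ?m = dy n / 4" using dy_Suc[of n] dy_Suc[of "n + 1"] by simp
  ultimately have "2 * dy ?m < qv (y ?m)" using n by linarith
  then show ?thesis using posR by blast
qed

lemma jump_leq: assumes jump and y: "y \<in> F1" shows "isset (\<lambda>q. leq q y)"
proof -
  have "isset (\<lambda>q. \<forall>j. qv q \<le> qv (ad (y j) (dya 1 j)))"
    by (rule isset_all[OF assms(1)])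
       (unfold isset_def, intro dec_qv_le dfn_ad dfn_dya dfn_F1[OF y] dfn_pf dfn_ps dfn_const dfn_arg)
  then show ?thesis by (simp add: leq_def)
qed

text \<open>The greedy expansion of a real with cut \<open>L\<close>.\<close>

definition gr :: "'n \<Rightarrow> 'n \<Rightarrow> ('n \<Rightarrow> bool) \<Rightarrow> 'n \<Rightarrow> 'n" where
  "gr p k L i = nrec (\<lambda>i s. if L (ad s (dya 1 (k + i + 1))) then ad s (dya 1 (k + i + 1)) else s) p i"
definition gd :: "'n \<Rightarrow> 'n \<Rightarrow> ('n \<Rightarrow> bool) \<Rightarrow> 'n \<Rightarrow> 'n" where
  "gd p k L i = (if L (ad (gr p k L i) (dya 1 (k + i + 1))) then 1 else 0)"

definition bin :: "('n \<Rightarrow> 'n) \<Rightarrow> bool" where "bin h \<longleftrightarrow> (\<forall>i. h i = 0 \<or> h i = 1)"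

lemma bin_gd: "bin (gd p k L)" by (simp add: bin_def gd_def)

lemma dfn_gr:
  assumes "dfn P" "dec (\<lambda>f w. L f (pf w) (ps w))" "dfn I"
  shows "dfn (\<lambda>f n. gr (P f n) k (L f n) (I f n))"
  unfolding gr_def
proof (rule dfn_rec(1)[OF _ assms(1,3)])
  let ?q = "\<lambda>z. ad (ps (ps z)) (dya 1 (k + pf (ps z) + 1))"
  have q: "dfn (\<lambda>f z. ?q z)" by (intro dfn_ad dfn_dya dfn_plus dfn_const dfn_pf dfn_ps dfn_arg)
  have "dec (\<lambda>f z. L f (pf (pr (pf z) (?q z))) (ps (pr (pf z) (?q z))))"
    by (rule dec_comp[OF assms(2)]) (intro dfn_pr q dfn_pf dfn_arg)
  then have L: "dec (\<lambda>f z. L f (pf z) (?q z))" by simp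
  show "dfn (\<lambda>f z. if L f (pf z) (?q z) then ?q z else ps (ps z))"
    by (intro dfn_if L q dfn_ps dfn_arg)
qed

lemma dfn_gd:
  assumes "dfn P" "dec (\<lambda>f w. L f (pf w) (ps w))" "dfn I"
  shows "dfn (\<lambda>f n. gd (P f n) k (L f n) (I f n))"
proof -
  let ?q = "\<lambda>f n. ad (gr (P f n) k (L f n) (I f n)) (dya 1 (k + I f n + 1))"
  have q: "dfn ?q" by (intro dfn_ad dfn_gr assms dfn_dya dfn_plus dfn_const)
  have "dec (\<lambda>f n. L f (pf (pr n (?q f n))) (ps (pr n (?q f n))))"
    by (rule dec_comp[OF assms(2)]) (intro dfn_pr q dfn_arg)
  then have "dec (\<lambda>f n. L f n (?q f n))" by simp
  then show ?thesis unfolding gd_def by (intro dfn_if dfn_const)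
qed

lemma gr:
  assumes "isset L"
  shows "gr p k L \<in> F1" "gr p k L 0 = p"
    "gr p k L (i + 1) = (if L (ad (gr p k L i) (dya 1 (k + i + 1))) then ad (gr p k L i) (dya 1 (k + i + 1)) else gr p k L i)"
    "gd p k L \<in> F1" "ev p k (gd p k L) = gr p k L"
proof -
  have L: "dec (\<lambda>f w. L (ps w))" by (rule dec_isset[OF assms]) (intro dfn_ps dfn_arg)
  show F: "gr p k L \<in> F1" by (rule F1I) (intro dfn_gr L dfn_const dfn_arg)
  show gF: "gd p k L \<in> F1" by (rule F1I) (intro dfn_gd L dfn_const dfn_arg)
  have "dfn (\<lambda>f z. if L (ad (ps (ps z)) (dya 1 (k + pf (ps z) + 1))) then ad (ps (ps z)) (dya 1 (k + pf (ps z) + 1)) else ps (ps z))"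
    by (intro dfn_if dec_isset[OF assms] dfn_ad dfn_dya dfn_plus dfn_const dfn_pf dfn_ps dfn_arg)
  from nrec[OF dfn_rec(2)[where h="\<lambda>_ _ i s. if L (ad s (dya 1 (k + i + 1))) then ad s (dya 1 (k + i + 1)) else s", OF this F]]
  show 0: "gr p k L 0 = p" and Suc: "gr p k L (i + 1) = (if L (ad (gr p k L i) (dya 1 (k + i + 1))) then ad (gr p k L i) (dya 1 (k + i + 1)) else gr p k L i)" for i
    by (simp_all add: gr_def)
  show "ev p k (gd p k L) = gr p k L"
  proof
    fix i show "ev p k (gd p k L) i = gr p k L i"
      by (rule F1_eq_induct[OF ev(1)[OF gF] F]) (simp_all add: ev(2,3)[OF gF] 0 Suc gd_def)
  qed
qed

lemma greedy:
  assumes jump and y: "y \<in> F1" "isR y" and p: "leq p y" and pk: "geq (ad p (dya 1 k)) y"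
  shows "\<exists>h\<in>F1. bin h \<and> eqR y (ev p k h)"
proof -
  let ?L = "\<lambda>q. leq q y"
  have L: "isset ?L" by (rule jump_leq[OF assms(1) y(1)])
  note g = gr[OF L]
  \<comment> \<open>The real stays in the interval of length 2^-(k+i) that starts at the i-th greedy
    sum. The jump makes this statement a set of numbers i, so that induction applies.\<close>
  have inv: "leq (gr p k ?L i) y \<and> (\<forall>j. qv (y j) \<le> qv (ad (ad (gr p k ?L i) (dya 1 (k + i))) (dya 1 j)))" for i
  proof (rule isset_induct[where n=i])
    have "dec (\<lambda>_ z. qv (y (ps z)) \<le> qv (ad (ad (gr p k ?L (pf z)) (dya 1 (k + pf z))) (dya 1 (ps z))))"
      by (intro dec_qv_le dfn_F1[OF y(1)] dfn_ad dfn_dya dfn_F1[OF g(1)] dfn_plus dfn_const dfn_pf dfn_ps dfn_arg)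
    then have "isset (\<lambda>i. \<forall>j. qv (y j) \<le> qv (ad (ad (gr p k ?L i) (dya 1 (k + i))) (dya 1 j)))"
      by (intro isset_all[OF assms(1)]) (simp add: isset_def)
    moreover have "isset (\<lambda>i. leq (gr p k ?L i) y)"
      unfolding isset_def by (rule dec_isset[OF L]) (intro dfn_F1[OF g(1)] dfn_arg)
    ultimately show "isset (\<lambda>i. leq (gr p k ?L i) y \<and> (\<forall>j. qv (y j) \<le> qv (ad (ad (gr p k ?L i) (dya 1 (k + i))) (dya 1 j))))"
      by (rule isset_and[rotated])
    show "leq (gr p k ?L 0) y \<and> (\<forall>j. qv (y j) \<le> qv (ad (ad (gr p k ?L 0) (dya 1 (k + 0))) (dya 1 j)))"
      using p pk by (simp add: g(2) geq_def)
    fix i assume IH: "leq (gr p k ?L i) y \<and> (\<forall>j. qv (y j) \<le> qv (ad (ad (gr p k ?L i) (dya 1 (k + i))) (dya 1 j)))"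
    have d: "dy (k + (i + 1)) = dy (k + i) / 2" "dy (k + i + 1) = dy (k + i) / 2" by (simp_all add: dy_Suc')
    show "leq (gr p k ?L (i + 1)) y \<and> (\<forall>j. qv (y j) \<le> qv (ad (ad (gr p k ?L (i + 1)) (dya 1 (k + (i + 1)))) (dya 1 j)))"
    proof (cases "?L (ad (gr p k ?L i) (dya 1 (k + i + 1)))")
      case True
      then have "gr p k ?L (i + 1) = ad (gr p k ?L i) (dya 1 (k + i + 1))" by (simp only: g(3) if_True)
      then show ?thesis using IH True by (simp add: d add.assoc)
    next
      case False
      then have "gr p k ?L (i + 1) = gr p k ?L i" by (simp only: g(3) if_False)
      then show ?thesis using IH not_leq_geq[OF y(2) False] by (simp add: d geq_def)
    qed
  qed
  have "eqR y (ev p k (gd p k ?L))"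
    unfolding g(5) eqR_def
  proof
    fix n
    have "qv (gr p k ?L n) \<le> qv (y n) + dy n" "qv (y n) \<le> qv (gr p k ?L n) + dy (k + n) + dy n"
      using inv[of n] by (auto simp: leq_def)
    then show "\<bar>qv (y n) - qv (gr p k ?L n)\<bar> \<le> 2 * dy n" using dy_add_le(1)[of k n] dy_pos[of n] by linarith
  qed
  then show ?thesis using g(4) bin_gd by blast
qed

lemma leq_ev: assumes h: "h \<in> F1" shows "leq (ev p k h i) (ev p k h)"
  unfolding leq_def
proof
  fix j
  show "qv (ev p k h i) \<le> qv (ev p k h j) + dy j"
  proof (cases "i \<le> j")
    case True
    then show ?thesis using ev_bounds(1)[OF h True, of p k] dy_pos[of j] by linarith
  next
    case False
    then have "j \<le> i" by simp
    then show ?thesis using ev_bounds(2)[OF h, of j i p k] dy_pos[of "k + i"] dy_add_le(1)[of k j] by linarith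
  qed
qed

text \<open>If digit i is 0 and some later digit is 0 too, the real stays strictly below the
  midpoint tested at step i, and the greedy test answers 0 as well. The later zeros exclude
  expansions like 0111..., which would be read as 1000... .\<close>

lemma greedy_unique:
  assumes jump and y: "y \<in> F1" "isR y" and h: "h \<in> F1" "bin h" and e: "eqR y (ev p k h)"
    and zeros: "\<And>i. \<exists>j. i < j \<and> h j = 0"
  shows "gd p k (\<lambda>q. leq q y) = h"
proof -
  let ?L = "\<lambda>q. leq q y" and ?x = "ev p k h"
  note g = gr[OF jump_leq[OF assms(1) y(1)]]
  have digit: "?L (ad (?x i) (dya 1 (k + i + 1))) \<longleftrightarrow> h i \<noteq> 0" for i
  proof
    assume "h i \<noteq> 0"
    then have "leq (ad (?x i) (dya 1 (k + i + 1))) ?x" using leq_ev[OF h(1), of p k "i + 1"] by (simp add: ev(3)[OF h(1)])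
    then show "?L (ad (?x i) (dya 1 (k + i + 1)))" by (rule leq_eqR[OF isR_ev[OF h(1)] y(2) eqR_sym[OF e]])
  next
    assume "?L (ad (?x i) (dya 1 (k + i + 1)))"
    then have l: "leq (ad (?x i) (dya 1 (k + i + 1))) ?x" by (rule leq_eqR[OF y(2) isR_ev[OF h(1)] e])
    show "h i \<noteq> 0"
    proof
      assume hi: "h i = 0"
      obtain j where j: "i < j" "h j = 0" using zeros by blast
      have e1: "?x (i + 1) = ?x i" "?x (j + 1) = ?x j" using ev(3)[OF h(1)] hi j(2) by simp_all
      have ij: "i + 1 \<le> j" using j(1) by (simp add: Suc_le)
      \<comment> \<open>The zero at j leaves a gap of at least half of \<open>dy (k + j)\<close>
        below the midpoint, and at index m the slack \<open>dy m\<close> is only a quarter of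
        \<open>dy (k + j)\<close>.\<close>
      define m where "m = k + j + 1 + 1"
      have jm: "j + 1 \<le> m" by (simp add: m_def add.assoc add_increasing)
      have "qv (?x m) + dy (k + m) \<le> qv (?x j) + dy (k + (j + 1))" using ev_bounds(2)[OF h(1) jm, of p k] e1 by simp
      moreover have "qv (?x j) + dy (k + j) \<le> qv (?x i) + dy (k + (i + 1))" using ev_bounds(2)[OF h(1) ij, of p k] e1 by simp
      moreover have "dy (k + (j + 1)) = dy (k + j) / 2" "dy m = dy (k + j) / 4"
        using dy_Suc[of "k + j"] dy_Suc[of "k + j + 1"] by (simp_all add: m_def add.assoc)
      moreover have "qv (?x i) + dy (k + (i + 1)) \<le> qv (?x m) + dy m" using l by (simp add: leq_def add.assoc)
      ultimately show False using dy_pos[of "k + m"] dy_pos[of "k + j"] by linarith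
    qed
  qed
  have x: "gr p k ?L i = ?x i" for i
  proof (rule F1_eq_induct[OF g(1) ev(1)[OF h(1)]])
    show "gr p k ?L 0 = ?x 0" by (simp add: g(2) ev(2)[OF h(1)])
    show "gr p k ?L (i + 1) = ?x (i + 1)" if "gr p k ?L i = ?x i" for i
      using digit[of i] that by (simp add: g(3) ev(3)[OF h(1)])
  qed
  show ?thesis
  proof
    fix i show "gd p k ?L i = h i" using digit[of i] x h(2) by (auto simp: gd_def bin_def)
  qed
qed

subsection \<open>The fan theorem\<close>

text \<open>The number whose binary digits are the first i values; on binary functions it numbers
  the nodes of level i of the binary tree by the numbers below \<open>p2 i\<close>.\<close>

definition cd :: "('n \<Rightarrow> 'n) \<Rightarrow> 'n \<Rightarrow> 'n" where "cd h i = nrec (\<lambda>i s. s + s + h i) 0 i"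

lemma dfn_cd: "dfn (\<lambda>f w. H f (pf w) (ps w)) \<Longrightarrow> dfn I \<Longrightarrow> dfn (\<lambda>f n. cd (H f n) (I f n))"
  unfolding cd_def
proof (rule dfn_rec(1)[OF _ dfn_const])
  assume "dfn (\<lambda>f w. H f (pf w) (ps w))"
  then have "dfn (\<lambda>f z. H f (pf (pr (pf z) (pf (ps z)))) (ps (pr (pf z) (pf (ps z)))))"
    by (rule dfn_comp) (intro dfn_pr dfn_pf dfn_ps dfn_arg)
  then show "dfn (\<lambda>f z. ps (ps z) + ps (ps z) + H f (pf z) (pf (ps z)))"
    by (intro dfn_plus dfn_ps dfn_arg) simp
qed

lemma cd:
  assumes "h \<in> F1" shows "cd h \<in> F1" "cd h 0 = 0" "cd h (i + 1) = cd h i + cd h i + h i"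
proof -
  have "bfn (\<lambda>i s. s + s + h i)" by (intro bfn_plus bfn_snd bfn_F1[OF assms] bfn_fst)
  from nrec[OF this] show "cd h \<in> F1" "cd h 0 = 0" "cd h (i + 1) = cd h i + cd h i + h i"
    by (simp_all add: cd_def[abs_def])
qed

text \<open>c < d forces 2c + 1 < 2d, so a doubled number plus a bit determines both.\<close>

lemma double_cancel:
  assumes "a + a + x = b + b + (y::'n)" "x = 0 \<or> x = 1" "y = 0 \<or> y = 1" shows "a = b \<and> x = y"
proof -
  have lt: "c + c + u < d + d + v" if cd: "c < d" and u: "u = 0 \<or> u = 1" for c d u v :: 'n
  proof -
    have "u \<le> 1" using u by auto
    then have "c + c + u \<le> c + c + 1" by simp
    also have "\<dots> < (c + 1) + (c + 1)" by (simp add: add.assoc add.left_commute)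
    also have "\<dots> \<le> d + d + v" using cd zero_le[of v] Suc_le[of c d] by (simp add: add_mono add_increasing2)
    finally show ?thesis .
  qed
  have "a = b" using lt[of a b x y] lt[of b a y x] assms by (metis less_linear order_less_irrefl)
  then show ?thesis using assms(1) by simp
qed

lemma cd_inject:
  assumes g: "g \<in> F1" "bin g" and h: "h \<in> F1" "bin h" and e: "cd g k = cd h k" shows "agree k g h"
proof -
  have "cd g k = cd h k \<longrightarrow> (\<forall>i. i < k \<longrightarrow> g i = h i)"
  proof (rule dec_induct[where n=k])
    show "dec (\<lambda>_ k. cd g k = cd h k \<longrightarrow> (\<forall>i. i < k \<longrightarrow> g i = h i))"
      by (intro dec_imp dec_eq dec_ball dfn_F1[OF cd(1)[OF g(1)]] dfn_F1[OF cd(1)[OF h(1)]]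
        dfn_F1[OF g(1)] dfn_F1[OF h(1)] dfn_arg dfn_ps)
    fix k assume IH: "cd g k = cd h k \<longrightarrow> (\<forall>i. i < k \<longrightarrow> g i = h i)"
    show "cd g (k + 1) = cd h (k + 1) \<longrightarrow> (\<forall>i. i < k + 1 \<longrightarrow> g i = h i)"
    proof (intro impI allI)
      fix i assume a: "cd g (k + 1) = cd h (k + 1)" "i < k + 1"
      have "cd g k = cd h k \<and> g k = h k"
        using a(1) g(2) h(2) unfolding cd(3)[OF g(1)] cd(3)[OF h(1)] bin_def by (intro double_cancel) auto
      moreover have "i < k \<or> i = k" using a(2) by (simp only: discrete le_less)
      ultimately show "g i = h i" using IH by auto
    qed
  qed simp
  then show ?thesis using e by (simp add: agree_def)
qed

lemma cd_less: assumes h: "h \<in> F1" "bin h" shows "cd h k < p2 k"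
proof (rule dec_induct[where n=k])
  show "dec (\<lambda>_ k. cd h k < p2 k)" by (intro dec_less dfn_F1[OF cd(1)[OF h(1)]] dfn_p2 dfn_arg)
  fix k assume "cd h k < p2 k"
  then have "cd h k + 1 \<le> p2 k" by (simp add: Suc_le)
  then have "(cd h k + 1) + (cd h k + 1) \<le> p2 k + p2 k" by (rule add_mono) (use \<open>cd h k + 1 \<le> p2 k\<close> in simp)
  moreover have "h k \<le> 1" using h(2) by (auto simp: bin_def dest: spec[of _ k])
  then have "cd h k + cd h k + h k < (cd h k + 1) + (cd h k + 1)"
    using add_strict_left_mono[of "h k" "1 + 1" "cd h k + cd h k"] le_less_trans[of "h k" 1 "1 + 1"]
    by (simp add: add.assoc add.left_commute)
  ultimately show "cd h (k + 1) < p2 (k + 1)" by (simp only: cd(3)[OF h(1)] p2(3) order_less_le_trans)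
qed (simp add: cd[OF h(1)] p2)

lemma cd_agree:
  assumes g: "g \<in> F1" and h: "h \<in> F1" and a: "agree k g h" shows "cd g k = cd h k"
proof -
  have "i \<le> k \<longrightarrow> cd g i = cd h i" for i
  proof (rule dec_induct[where n=i])
    show "dec (\<lambda>_ i. i \<le> k \<longrightarrow> cd g i = cd h i)"
      by (intro dec_imp dec_le dec_eq dfn_F1[OF cd(1)[OF g]] dfn_F1[OF cd(1)[OF h]] dfn_arg dfn_const)
    show "i + 1 \<le> k \<longrightarrow> cd g (i + 1) = cd h (i + 1)" if "i \<le> k \<longrightarrow> cd g i = cd h i" for i
      using that a by (auto simp: cd(3)[OF g] cd(3)[OF h] Suc_le agree_def)
  qed (simp add: cd[OF g] cd[OF h])
  then show ?thesis by simp
qed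

lemma halves: assumes jump shows "\<exists>m. n = m + m \<or> n = m + m + (1::'n)"
proof (rule isset_induct[where n=n])
  show "isset (\<lambda>n. \<exists>m. n = m + m \<or> n = m + m + 1)"
    by (rule isset_ex[OF assms]) (unfold isset_def, intro dec_or dec_eq dfn_plus dfn_pf dfn_ps dfn_const dfn_arg)
  show "\<exists>m. 0 = m + m \<or> 0 = m + m + (1::'n)" by (intro exI[of _ 0]) simp
  show "\<exists>m. n + 1 = m + m \<or> n + 1 = m + m + 1" if "\<exists>m. n = m + m \<or> n = m + m + 1" for n :: 'n
    using that
  proof (elim exE disjE)
    fix m assume "n = m + m + 1"
    then have "n + 1 = (m + 1) + (m + 1)" by (simp add: add.assoc add.left_commute)
    then show ?thesis by blast
  qed blast
qed

text \<open>A node is secured if all its descendants at some level belong to \<open>S\<close>. A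
  node with two secured children is secured, so an unsecured root would start a path of unsecured
  nodes; the bar hits this path in a node that is secured at depth 0. Being secured is arithmetical,
  hence the path exists in the model.\<close>

theorem fan:
  fixes S :: "'n \<Rightarrow> 'n \<Rightarrow> bool"
  assumes J: jump and S: "isset (\<lambda>z. S (pf z) (ps z))"
    and ext: "\<And>k j. S k j \<Longrightarrow> S (k + 1) (j + j) \<and> S (k + 1) (j + j + 1)"
    and bar: "\<And>h. h \<in> F1 \<Longrightarrow> bin h \<Longrightarrow> \<exists>k. S k (cd h k)"
  shows "\<exists>K. \<forall>j. j < p2 K \<longrightarrow> S K j"
proof -
  \<comment> \<open>The descendants of node j that lie i levels further down are the
    \<open>p2 i\<close> numbers from \<open>j * p2 i\<close> on.\<close>
  define A where "A k j i \<longleftrightarrow> (\<forall>l. l < p2 i \<longrightarrow> S (k + i) (j * p2 i + l))" for k j i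
  define V where "V k j \<longleftrightarrow> (\<exists>i. A k j i)" for k j
  have dS: "dec (\<lambda>f n. S (B f n) (C f n))" if "dfn B" "dfn C" for B C
    using dec_isset[OF S dfn_pr[OF that]] by simp
  have dA: "dec (\<lambda>f n. A (B f n) (C f n) (D f n))" if "dfn B" "dfn C" "dfn D" for B C D
    unfolding A_def
    by (intro dec_ball dS dfn_plus dfn_times dfn_p2 dfn_ps dfn_arg dfn_comp[OF that(1)] dfn_comp[OF that(2)]
      dfn_comp[OF that(3)] dfn_pf that)
  have V: "isset (\<lambda>z. V (pf z) (ps z))"
    unfolding V_def by (rule isset_ex[OF J]) (unfold isset_def, intro dA dfn_pf dfn_ps dfn_arg)
  have A_Suc: "A k j (i + 1)" if a: "A k j i" for k j i
    unfolding A_def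
  proof (intro allI impI)
    fix l assume l: "l < p2 (i + 1)"
    obtain m where m: "l = m + m \<or> l = m + m + 1" using halves[OF J] by blast
    have "m < p2 i"
    proof (rule ccontr)
      assume "\<not> m < p2 i"
      then have "p2 i + p2 i \<le> m + m" by (intro add_mono) auto
      moreover have "m + m \<le> l" using m by auto
      ultimately show False using l by (simp add: p2(3))
    qed
    then have "S (k + i) (j * p2 i + m)" using a by (simp add: A_def)
    note s = ext[OF this]
    have "k + (i + 1) = k + i + 1" by (simp add: add.assoc)
    moreover have "j * p2 (i + 1) + (m + m) = (j * p2 i + m) + (j * p2 i + m)" unfolding p2(3) by (simp add: algebra_simps)
    ultimately show "S (k + (i + 1)) (j * p2 (i + 1) + l)" using s m by (auto simp: add.assoc[symmetric])
  qed
  have A_mono: "A k j i \<longrightarrow> A k j (i + c)" for k j i c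
  proof (rule dec_induct[where n=c])
    show "dec (\<lambda>_ c. A k j i \<longrightarrow> A k j (i + c))" by (intro dec_imp dA dfn_const dfn_plus dfn_arg)
    show "A k j i \<longrightarrow> A k j (i + (c + 1))" if "A k j i \<longrightarrow> A k j (i + c)" for c
      using that A_Suc[of k j "i + c"] by (simp add: add.assoc)
  qed simp
  have V_children: "V k j" if v: "V (k + 1) (j + j)" "V (k + 1) (j + j + 1)" for k j
  proof -
    obtain i0 i1 where i: "A (k + 1) (j + j) i0" "A (k + 1) (j + j + 1) i1" using v by (auto simp: V_def)
    \<comment> \<open>The sum is a common depth for both children, as \<open>A\<close> is monotone
      in the depth.\<close>
    define i where "i = i0 + i1"
    have a: "A (k + 1) (j + j) i" "A (k + 1) (j + j + 1) i"
      using A_mono[of "k + 1" "j + j" i0 i1] A_mono[of "k + 1" "j + j + 1" i1 i0] i by (simp_all add: i_def add.commute)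
    have "A k j (i + 1)"
      unfolding A_def
    proof (intro allI impI)
      fix l assume l: "l < p2 (i + 1)"
      have k: "k + (i + 1) = k + 1 + i" by (simp add: ac_simps)
      show "S (k + (i + 1)) (j * p2 (i + 1) + l)"
      proof (cases "l < p2 i")
        case True
        then have "S (k + 1 + i) ((j + j) * p2 i + l)" using a(1) by (simp add: A_def)
        moreover have "(j + j) * p2 i + l = j * p2 (i + 1) + l" unfolding p2(3) by (simp add: algebra_simps)
        ultimately show ?thesis by (simp add: k)
      next
        case False
        then obtain m where m: "l = p2 i + m" using le_cases[of "p2 i" l] by (metis not_less)
        then have "m < p2 i" using l by (simp add: p2(3))
        then have "S (k + 1 + i) ((j + j + 1) * p2 i + m)" using a(2) by (simp add: A_def)
        moreover have "(j + j + 1) * p2 i + m = j * p2 (i + 1) + l" unfolding m p2(3) by (simp add: algebra_simps)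
        ultimately show ?thesis by (simp add: k)
      qed
    qed
    then show ?thesis by (auto simp: V_def)
  qed
  have "V 0 0"
  proof (rule ccontr)
    assume n: "\<not> V 0 0"
    \<comment> \<open>The path goes left unless the left child is secured; in that case the right
      child is not.\<close>
    let ?step = "\<lambda>k s. s + s + (if V (k + 1) (s + s) then 1 else 0)"
    define c where "c = nrec ?step 0"
    have dV: "dec (\<lambda>f n. V (B f n) (C f n))" if "dfn B" "dfn C" for B C
      using dec_isset[OF V dfn_pr[OF that]] by simp
    have z: "(\<lambda>_. 0) \<in> F1" by (rule F1I) (rule dfn_const)
    have "dfn (\<lambda>f z. ?step (pf (ps z)) (ps (ps z)))"
      by (intro dfn_plus dfn_if dV dfn_const dfn_pf dfn_ps dfn_arg)
    from nrec[OF dfn_rec(2)[where h="\<lambda>_ _. ?step", OF this z]]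
    have c: "c \<in> F1" "c 0 = 0" "c (k + 1) = ?step k (c k)" for k by (auto simp: c_def)
    define h :: "'n \<Rightarrow> 'n" where "h k = (if V (k + 1) (c k + c k) then 1 else 0)" for k
    have h: "h \<in> F1" "bin h"
      unfolding bin_def h_def by (rule F1I) (intro dfn_if dV dfn_plus dfn_F1[OF c(1)] dfn_const dfn_arg | simp)+
    have ch: "cd h k = c k" for k
      by (rule F1_eq_induct[OF cd(1)[OF h(1)] c(1)]) (simp_all add: cd[OF h(1)] c h_def)
    have nV: "\<not> V k (c k)" for k
    proof (rule dec_induct[where n=k])
      show "dec (\<lambda>_ k. \<not> V k (c k))" by (intro dec_not dV dfn_F1[OF c(1)] dfn_arg)
      show "\<not> V (k + 1) (c (k + 1))" if "\<not> V k (c k)" for k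
        using that V_children[of k "c k"] by (auto simp: c(3))
    qed (simp add: c n)
    obtain k where "S k (cd h k)" using bar[OF h] by blast
    moreover have "l = 0" if "l < p2 0" for l
      using that order.antisym[OF _ zero_le[of l]] by (simp add: p2 discrete[of l 0, simplified])
    moreover have "c k * p2 0 = c k" by (simp add: p2)
    ultimately have "A k (c k) 0" using ch unfolding A_def by (metis add_0_right)
    then show False using nV[of k] by (auto simp: V_def)
  qed
  then obtain K where "A 0 0 K" by (auto simp: V_def)
  then show ?thesis by (intro exI[of _ K]) (simp add: A_def)
qed

end

context num_model begin

subsection \<open>Bootstrap gives open sets\<close>

lemma dfn_cong2: "dfn (\<lambda>f w. G f (pf w) (ps w)) \<Longrightarrow> dfn A \<Longrightarrow> dfn B \<Longrightarrow> dfn (\<lambda>f n. G f (A f n) (B f n))"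
  using dfn_comp[of "\<lambda>f w. G f (pf w) (ps w)", OF _ dfn_pr[of A B]] by simp

lemma dec_posR: assumes E2 and G: "dfn (\<lambda>f w. G f (pf w) (ps w))" shows "dec (\<lambda>f n. posR (G f n))"
proof -
  have "dec (\<lambda>f n. \<exists>m. qv (dya 2 m) < qv (G f n m))"
    by (rule E2_ex[OF assms(1)]) (intro dec_qv_less dfn_dya dfn_const dfn_ps dfn_arg G)
  then show ?thesis by (simp add: posR)
qed

lemma dec_isR: assumes E2 shows "dec (\<lambda>f n. isR f)"
proof -
  have "dec (\<lambda>f n. \<forall>a. \<forall>b. qv (ab (ad (f a) (mi (f (a + b))))) < qv (dya 1 a))"
    by (intro E2_all[OF assms] dec_qv_less dfn_ab dfn_ad dfn_mi dfn_app dfn_dya dfn_plus dfn_const dfn_pf dfn_ps dfn_arg)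
  then show ?thesis by (simp add: isR_def)
qed

lemma dec_inball: assumes E2 "dfn A" "dfn B" shows "dec (\<lambda>f n. inball (rco (A f n)) (B f n) f)"
proof -
  have "dec (\<lambda>f n. \<exists>m. qv (ad (ab (ad (A f n) (mi (f (m + 1))))) (dya 2 m)) < qv (B f n))"
    by (intro E2_ex[OF assms(1)] dec_qv_less dfn_ab dfn_ad dfn_mi dfn_app dfn_dya dfn_plus dfn_const dfn_comp[OF assms(2)]
      dfn_comp[OF assms(3)] dfn_pf dfn_ps dfn_arg)
  then show ?thesis by (simp add: inball rco_def)
qed

lemma isset_bin_fs: assumes jump shows "isset (\<lambda>\<tau>. bin (fs \<tau>))"
  unfolding bin_def
  by (rule isset_all[OF assms]) (unfold isset_def, intro dec_or dec_eq dfn_fs dfn_pf dfn_ps dfn_const dfn_arg)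

lemma dec_bin_fs: "jump \<Longrightarrow> dfn A \<Longrightarrow> dec (\<lambda>f n. bin (fs (A f n)))"
  by (rule dec_isset[OF isset_bin_fs])

text \<open>For continuous \<open>Y\<close>, compactness of Cantor space makes inclusion of a dyadic interval in an open
  set arithmetical.\<close>

lemma cover:
  assumes J: jump and c: "\<And>\<Phi>. dfn \<Phi> \<Longrightarrow> cont \<Phi>" and Y: "dfn Y"
  shows "isset (\<lambda>z. \<forall>h\<in>F1. bin h \<longrightarrow> posR (Y (ev (pf z) (ps z) h)))"
proof -
  \<comment> \<open>Only codes of finite sequences are tested, which keeps the statement
    arithmetical. Continuity transfers the result to all binary functions.\<close>
  define R where "R p k b j n \<longleftrightarrow> (\<forall>\<tau>. bin (fs \<tau>) \<and> cd (fs \<tau>) b = j \<longrightarrow> 2 * dy n < qv (Y (ev p k (fs \<tau>)) n))" for p k b j n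
  define U where "U p k b j \<longleftrightarrow> (\<exists>n. R p k b j n)" for p k b j
  have Yc: "dfn (\<lambda>f n. Y (ev p k f) n)" for p k
    by (rule dfn_fapp[OF Y _ dfn_arg]) (intro dfn_ev dfn_const dfn_app dfn_ps dfn_arg)
  have R: "isset (\<lambda>z. R (pf (pf (pf z))) (ps (pf (pf z))) (pf (ps (pf z))) (ps (ps (pf z))) (ps z))" (is "isset (\<lambda>z. R (?p z) (?k z) (?b z) (?j z) (?n z))")
    unfolding R_def
  proof (rule isset_all[OF J])
    have "dfn (\<lambda>f z. Y (ev (?p (pf z)) (?k (pf z)) (fs (ps z))) (?n (pf z)))"
      by (rule dfn_fapp[OF Y]) (intro dfn_ev dfn_fs dfn_pf dfn_ps dfn_arg)+
    moreover have "dec (\<lambda>f z. bin (fs (ps z)) \<and> cd (fs (ps z)) (?b (pf z)) = ?j (pf z))"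
      by (intro dec_and dec_bin_fs[OF J] dec_eq dfn_cd dfn_fs dfn_pf dfn_ps dfn_arg)
    ultimately have "isset (\<lambda>z. bin (fs (ps z)) \<and> cd (fs (ps z)) (?b (pf z)) = ?j (pf z) \<longrightarrow>
        qv (dya 2 (?n (pf z))) < qv (Y (ev (?p (pf z)) (?k (pf z)) (fs (ps z))) (?n (pf z))))"
      unfolding isset_def by (intro dec_imp dec_qv_less dfn_dya dfn_const dfn_ps dfn_pf dfn_arg)
    then show "isset (\<lambda>z. bin (fs (ps z)) \<and> cd (fs (ps z)) (?b (pf z)) = ?j (pf z) \<longrightarrow>
        2 * dy (?n (pf z)) < qv (Y (ev (?p (pf z)) (?k (pf z)) (fs (ps z))) (?n (pf z))))" by simp
  qed
  have U: "isset (\<lambda>w. U (pf (pf w)) (ps (pf w)) (pf (ps w)) (ps (ps w)))"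
    unfolding U_def by (rule isset_ex[OF J R])
  have dU: "dec (\<lambda>f n. U (A f n) (B f n) (C f n) (D f n))" if "dfn A" "dfn B" "dfn C" "dfn D" for A B C D
    using dec_isset[OF U dfn_pr[OF dfn_pr[OF that(1,2)] dfn_pr[OF that(3,4)]]] by simp
  have "isset (\<lambda>z. \<exists>b. \<forall>j. j < p2 b \<longrightarrow> U (pf z) (ps z) b j)"
    by (rule isset_ex[OF J]) (unfold isset_def, intro dec_ball dU dfn_p2 dfn_pf dfn_ps dfn_arg)
  moreover have "(\<exists>b. \<forall>j. j < p2 b \<longrightarrow> U p k b j) \<longleftrightarrow> (\<forall>h\<in>F1. bin h \<longrightarrow> posR (Y (ev p k h)))" for p k
  proof
    assume h: "\<forall>h\<in>F1. bin h \<longrightarrow> posR (Y (ev p k h))"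
    show "\<exists>b. \<forall>j. j < p2 b \<longrightarrow> U p k b j"
    proof (rule fan[OF J])
      show "isset (\<lambda>z. U p k (pf z) (ps z))" unfolding isset_def by (intro dU dfn_const dfn_pf dfn_ps dfn_arg)
      show "U p k (b + 1) (j + j) \<and> U p k (b + 1) (j + j + 1)" if u: "U p k b j" for b j
      proof -
        obtain n where n: "\<And>\<tau>. bin (fs \<tau>) \<Longrightarrow> cd (fs \<tau>) b = j \<Longrightarrow> 2 * dy n < qv (Y (ev p k (fs \<tau>)) n)"
          using u by (auto simp: U_def R_def)
        have "cd (fs \<tau>) b = j" if "bin (fs \<tau>)" "cd (fs \<tau>) (b + 1) = j + j + x" "x = 0 \<or> x = 1" for \<tau> x
          using double_cancel[of "cd (fs \<tau>) b" "fs \<tau> b" j x] that by (auto simp: cd(3) bin_def)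
        from this[of _ 0] this[of _ 1] have "R p k (b + 1) (j + j) n \<and> R p k (b + 1) (j + j + 1) n"
          using n unfolding R_def by auto
        then show ?thesis unfolding U_def by blast
      qed
      fix g assume g: "g \<in> F1" "bin g"
      then obtain n where n: "2 * dy n < qv (Y (ev p k g) n)" using h by (auto simp: posR)
      obtain b where b: "\<And>f. f \<in> F1 \<Longrightarrow> agree b g f \<Longrightarrow> Y (ev p k f) n = Y (ev p k g) n"
        using c[OF Yc] g(1) unfolding cont_def by metis
      have "R p k b (cd g b) n"
        unfolding R_def
      proof (intro allI impI)
        fix \<tau> assume t: "bin (fs \<tau>) \<and> cd (fs \<tau>) b = cd g b"
        have "agree b g (fs \<tau>)" by (rule cd_inject[OF g fs_F1]) (use t in simp_all)
        then show "2 * dy n < qv (Y (ev p k (fs \<tau>)) n)" using n b[OF fs_F1] by simp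
      qed
      then show "\<exists>b. U p k b (cd g b)" unfolding U_def by blast
    qed
  next
    assume "\<exists>b. \<forall>j. j < p2 b \<longrightarrow> U p k b j"
    then obtain b where b: "\<And>j. j < p2 b \<Longrightarrow> U p k b j" by blast
    show "\<forall>h\<in>F1. bin h \<longrightarrow> posR (Y (ev p k h))"
    proof (intro ballI impI)
      fix g assume g: "g \<in> F1" "bin g"
      obtain n where n: "\<And>\<tau>. bin (fs \<tau>) \<Longrightarrow> cd (fs \<tau>) b = cd g b \<Longrightarrow> 2 * dy n < qv (Y (ev p k (fs \<tau>)) n)"
        using b[OF cd_less[OF g]] by (auto simp: U_def R_def)
      obtain b' where b': "\<And>f. f \<in> F1 \<Longrightarrow> agree b' g f \<Longrightarrow> Y (ev p k f) n = Y (ev p k g) n"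
        using c[OF Yc] g(1) unfolding cont_def by metis
      \<comment> \<open>Agreement up to b keeps the truncation in the same node of level b,
        agreement up to b' gives it the same value as g.\<close>
      obtain \<tau> where \<tau>: "\<And>i. fs \<tau> i = (if i < b + b' then g i else 0)" using finite_seq[OF g(1)] by blast
      have le: "b \<le> b + b'" "b' \<le> b + b'" by simp_all
      have "agree b (fs \<tau>) g" "agree b' g (fs \<tau>)"
        unfolding agree_def using \<tau> order_less_le_trans[OF _ le(1)] order_less_le_trans[OF _ le(2)] by simp_all
      moreover have "bin (fs \<tau>)" using g(2) by (auto simp: bin_def \<tau>)
      ultimately have "2 * dy n < qv (Y (ev p k g) n)"
        using n cd_agree[OF fs_F1 g(1)] b' by (metis fs_F1)
      then show "posR (Y (ev p k g))" using posR by blast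
    qed
  qed
  ultimately show ?thesis by simp
qed

text \<open>The interval of length 2^-n centred at the approximation with index n + 1 contains the
  real, and the slack \<open>2 * dy n\<close> keeps both of its endpoints in the ball.\<close>

lemma ball_interval:
  assumes y: "isR y" and b: "inball (rco q) r y"
  obtains p k where "\<bar>qv p - qv q\<bar> < qv r" "\<bar>qv p + dy k - qv q\<bar> < qv r" "leq p y" "geq (ad p (dya 1 k)) y"
proof -
  obtain n where n: "\<bar>qv q - qv (y (n + 1))\<bar> + 2 * dy n < qv r" using b by (auto simp: inball rco_def)
  let ?m = "n + 1" and ?p = "ad (y (n + 1)) (mi (dya 1 (n + 1)))"
  have d: "dy n = 2 * dy ?m" by (simp add: dy_Suc)
  have near: "\<bar>qv (y ?m) - qv (y j)\<bar> \<le> dy ?m + dy j" for j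
  proof (cases "?m \<le> j")
    case True
    then show ?thesis using isR_le[OF y True] dy_pos[of j] by linarith
  next
    case False
    then have "j \<le> ?m" by simp
    from isR_le[OF y this] show ?thesis using dy_pos[of ?m] by linarith
  qed
  show ?thesis
  proof (rule that[of ?p n])
    show "\<bar>qv ?p - qv q\<bar> < qv r" "\<bar>qv ?p + dy n - qv q\<bar> < qv r"
      using n dy_pos[of ?m] unfolding qv_ad qv_mi qv_dya toQ_1 mult_1_left d by linarith+
    show "leq ?p y" unfolding leq_def
    proof
      fix j show "qv ?p \<le> qv (y j) + dy j" using near[of j] unfolding qv_ad qv_mi qv_dya toQ_1 mult_1_left by linarith
    qed
    show "geq (ad ?p (dya 1 n)) y" unfolding geq_def
    proof
      fix j show "qv (y j) \<le> qv (ad ?p (dya 1 n)) + dy j"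
        using near[of j] unfolding qv_ad qv_mi qv_dya toQ_1 mult_1_left d by linarith
    qed
  qed
qed

lemma ev_range:
  assumes "h \<in> F1" shows "qv p \<le> qv (ev p k h i)" "qv (ev p k h i) \<le> qv p + dy k"
  using ev_bounds[OF assms zero_le, of p k i] dy_pos[of "k + i"] unfolding ev(2)[OF assms] add_0_right by linarith+

theorem boot_opn: assumes boot shows opn
  unfolding opn_def
proof (intro allI impI)
  fix Y assume "dfnc Y" and open_Y: "openS Y"
  then have Y: "dfn Y" by (simp add: dfncD)
  have J: jump by (rule boot_jump[OF assms])
  let ?r = "\<lambda>n. mk (pf (ps n) + 1) 0 (ps (ps n))"
  show "isset (\<lambda>n. \<forall>y\<in>F1. isR y \<longrightarrow> inball (rco (pf n)) (?r n) y \<longrightarrow> posR (Y y))"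
  proof (cases E2)
    case True
    \<comment> \<open>With \<open>E2\<close> all properties of the point f are decidable, so the
      quantifier over points is the only one left for bootstrap.\<close>
    have "dec (\<lambda>f n. isR f \<and> inball (rco (pf n)) (?r n) f \<and> \<not> posR (Y f))"
    proof (intro dec_and dec_not)
      show "dec (\<lambda>f n. isR f)" by (rule dec_isR[OF True])
      show "dec (\<lambda>f n. inball (rco (pf n)) (?r n) f)"
        by (rule dec_inball[OF True]) (intro dfn_mk dfn_plus dfn_pf dfn_ps dfn_const dfn_arg)+
      show "dec (\<lambda>f n. posR (Y f))"
        by (rule dec_posR[OF True]) (rule dfn_comp[OF Y dfn_ps[OF dfn_arg]])
    qed
    from isset_not[OF boot_isset_dec[OF assms this]] show ?thesis
      by (rule back_subst[where P=isset]) (intro ext, blast)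
  next
    case False
    then have c: "\<And>\<Phi>. dfn \<Phi> \<Longrightarrow> cont \<Phi>" using dichotomy by blast
    define W where "W z \<longleftrightarrow> (\<forall>h\<in>F1. bin h \<longrightarrow> posR (Y (ev (pf z) (ps z) h)))" for z
    have W: "isset W" unfolding W_def by (rule cover[OF J _ Y]) (rule c)
    \<comment> \<open>The ball is exhausted by the intervals [p, p + 2^-k] with both endpoints
      inside; z ranges over the codes of the pairs (p, k).\<close>
    have "isset (\<lambda>n. \<forall>z. qv (ab (ad (pf z) (mi (pf n)))) < qv (?r n) \<and>
        qv (ab (ad (ad (pf z) (dya 1 (ps z))) (mi (pf n)))) < qv (?r n) \<longrightarrow> W z)"
      by (rule isset_all[OF J]) (unfold isset_def, intro dec_imp dec_and dec_qv_less dec_isset[OF W]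
        dfn_ab dfn_ad dfn_mi dfn_dya dfn_mk dfn_plus dfn_pf dfn_ps dfn_const dfn_arg)
    moreover have "(\<forall>z. qv (ab (ad (pf z) (mi q))) < qv r \<and> qv (ab (ad (ad (pf z) (dya 1 (ps z))) (mi q))) < qv r \<longrightarrow> W z)
      \<longleftrightarrow> (\<forall>y\<in>F1. isR y \<longrightarrow> inball (rco q) r y \<longrightarrow> posR (Y y))" (is "?l \<longleftrightarrow> ?r") for q r
    proof
      assume l: ?l
      show ?r
      proof (intro ballI impI)
        fix y assume y: "y \<in> F1" "isR y" "inball (rco q) r y"
        obtain p k where p: "\<bar>qv p - qv q\<bar> < qv r" "\<bar>qv p + dy k - qv q\<bar> < qv r" "leq p y" "geq (ad p (dya 1 k)) y"
          using ball_interval[OF y(2,3)] .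
        have w: "W (pr p k)" using l[rule_format, of "pr p k"] p(1,2) by simp
        obtain h where h: "h \<in> F1" "bin h" "eqR y (ev p k h)" using greedy[OF J y(1,2) p(3,4)] by blast
        have e: "ev p k h \<in> F1" "isR (ev p k h)" using ev(1) isR_ev h(1) by auto
        have f: "isR (Y y)" "isR (Y (ev p k h))" "eqR (Y y) (Y (ev p k h))"
          using open_Y h(3) y(1,2) e by (auto simp: openS_def realfun_def)
        have "posR (Y (ev p k h))" using w h by (simp add: W_def)
        then show "posR (Y y)" by (rule posR_eqR[OF f(2,1) eqR_sym[OF f(3)]])
      qed
    next
      assume r: ?r
      show ?l
      proof (intro allI impI)
        fix z assume a: "qv (ab (ad (pf z) (mi q))) < qv r \<and> qv (ab (ad (ad (pf z) (dya 1 (ps z))) (mi q))) < qv r"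
        define p k where "p = pf z" and "k = ps z"
        have a: "\<bar>qv p - qv q\<bar> < qv r" "\<bar>qv p + dy k - qv q\<bar> < qv r" using a by (simp_all add: p_def k_def)
        \<comment> \<open>By convexity every point of the interval is at most as far from the centre
          as the farther endpoint, and n is chosen to fit into the remaining gap.\<close>
        define s where "s = max \<bar>qv p - qv q\<bar> \<bar>qv p + dy k - qv q\<bar>"
        obtain n where n: "dy n < (qv r - s) / 2" using ex_dy_less[of "(qv r - s) / 2"] a by (auto simp: s_def)
        show "W z"
          unfolding W_def p_def[symmetric] k_def[symmetric]
        proof (intro ballI impI)
          fix h assume h: "h \<in> F1"
          have "\<bar>qv q - qv (ev p k h (n + 1))\<bar> \<le> s"
            using ev_range[OF h, of p k "n + 1"] by (simp add: s_def)
          then have "inball (rco q) r (ev p k h)" using n unfolding inball rco_def by (intro exI[of _ n]) (simp add: field_simps)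
          then show "posR (Y (ev p k h))" using r ev(1)[OF h] isR_ev[OF h] by blast
        qed
      qed
    qed
    ultimately show ?thesis by simp
  qed
qed

end

context num_model begin

subsection \<open>Bootstrap gives the Heine-Borel principle\<close>

lemma toQ_3 [simp]: "toQ 3 = 3"
  using toQ_add[of 2 1] by simp

text \<open>Bootstrap quantifies over all functions. This map sends them to binary ones and fixes
  those that are binary already.\<close>

definition nz :: "('n \<Rightarrow> 'n) \<Rightarrow> 'n \<Rightarrow> 'n" where "nz h i = (if h i = 0 then 0 else 1)"

lemma bin_nz: "bin (nz h)" by (simp add: bin_def nz_def)

lemma dfn_nz: "dfn (\<lambda>f w. H f (pf w) (ps w)) \<Longrightarrow> dfn (\<lambda>f w. nz (H f (pf w)) (ps w))"
  unfolding nz_def by (intro dfn_ifz dfn_const)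

lemma nz_F1: "h \<in> F1 \<Longrightarrow> nz h \<in> F1"
  unfolding nz_def[abs_def] by (rule F1I) (intro dfn_ifz dfn_F1[where g=h] dfn_const dfn_arg)

lemma nz_bin: "bin h \<Longrightarrow> nz h = h"
  by (rule ext) (auto simp: bin_def nz_def dest: spec)

definition tl1 :: "('n \<Rightarrow> 'n) \<Rightarrow> 'n \<Rightarrow> 'n" where "tl1 f i = f (i + 1)"

lemma tl1_F1: "f \<in> F1 \<Longrightarrow> tl1 f \<in> F1"
  unfolding tl1_def[abs_def] by (rule F1I) (intro dfn_F1[where g=f] dfn_plus dfn_const dfn_arg)

lemma tl1_surj: assumes "h \<in> F1" obtains f where "f \<in> F1" "f 0 = m" "tl1 f = h"
proof
  let ?f = "\<lambda>i. if i = 0 then m else h (pred i)"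
  show "?f \<in> F1" by (rule F1I) (intro dfn_ifz dfn_F1[OF assms] dfn_pred dfn_const dfn_arg)
  show "?f 0 = m" by simp
  show "tl1 ?f = h" using pred_Suc[OF Suc_pos] Suc_pos by (auto simp: tl1_def fun_eq_iff pos_iff)
qed

abbreviation ee :: "('n \<Rightarrow> 'n) \<Rightarrow> 'n \<Rightarrow> 'n" where "ee h \<equiv> ev q0c 0 (nz h)"

lemma dfn_ee: "dfn (\<lambda>f w. H f (pf w) (ps w)) \<Longrightarrow> dfn I \<Longrightarrow> dfn (\<lambda>f n. ee (H f n) (I f n))"
  by (intro dfn_ev dfn_nz dfn_const)

text \<open>A type 1 object codes a number and a binary function, so that one instance of bootstrap handles
  both quantifiers.\<close>

lemma boot_bin:
  assumes boot "dec (\<lambda>f w. P (nz (tl1 f)) (f 0) w)"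
  shows "isset (\<lambda>w. \<exists>h\<in>F1. bin h \<and> (\<exists>m. P h m w))"
proof -
  have "(\<exists>f\<in>F1. P (nz (tl1 f)) (f 0) w) \<longleftrightarrow> (\<exists>h\<in>F1. bin h \<and> (\<exists>m. P h m w))" for w
  proof
    assume "\<exists>h\<in>F1. bin h \<and> (\<exists>m. P h m w)"
    then obtain h m where h: "h \<in> F1" "bin h" "P h m w" by blast
    obtain f where "f \<in> F1" "f 0 = m" "tl1 f = h" using tl1_surj[OF h(1)] .
    then show "\<exists>f\<in>F1. P (nz (tl1 f)) (f 0) w" using h nz_bin by metis
  qed (use nz_F1 tl1_F1 bin_nz in blast)
  then show ?thesis using boot_isset_dec[OF assms] by simp
qed

lemma qv_ev: assumes h: "h \<in> F1" "bin h" shows "qv (ev q0c 0 h i) = toQ (cd h i) * dy i"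
proof -
  have "qv (ev q0c 0 h i) \<le> qv (dya (cd h i) i) \<and> qv (dya (cd h i) i) \<le> qv (ev q0c 0 h i)"
  proof (rule dec_induct[where n=i])
    show "dec (\<lambda>_ i. qv (ev q0c 0 h i) \<le> qv (dya (cd h i) i) \<and> qv (dya (cd h i) i) \<le> qv (ev q0c 0 h i))"
      by (intro dec_and dec_qv_le dfn_F1[OF ev(1)[OF h(1)]] dfn_dya dfn_F1[OF cd(1)[OF h(1)]] dfn_arg)
    fix i assume IH: "qv (ev q0c 0 h i) \<le> qv (dya (cd h i) i) \<and> qv (dya (cd h i) i) \<le> qv (ev q0c 0 h i)"
    then have "qv (ev q0c 0 h i) = toQ (cd h i) * dy i" by simp
    moreover have "h i = 0 \<or> h i = 1" using h(2) by (simp add: bin_def)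
    ultimately have "qv (ev q0c 0 h (i + 1)) = toQ (cd h (i + 1)) * dy (i + 1)"
      unfolding ev(3)[OF h(1)] cd(3)[OF h(1)] dy_Suc by (auto simp: toQ_add dy_Suc add_divide_distrib distrib_right)
    then show "qv (ev q0c 0 h (i + 1)) \<le> qv (dya (cd h (i + 1)) (i + 1)) \<and> qv (dya (cd h (i + 1)) (i + 1)) \<le> qv (ev q0c 0 h (i + 1))"
      by simp
  qed (simp add: ev[OF h(1)] cd[OF h(1)])
  then show ?thesis by simp
qed

theorem boot_hbu:
  assumes boot and IND: "\<And>\<phi>. \<phi> \<in> IND_omega \<Longrightarrow> wff [] \<phi> \<Longrightarrow> feval M [] \<phi>"
  shows hbu
  unfolding hbu_def
proof (intro allI impI, elim conjE)
  fix C \<Psi>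
  assume "dfnc C" "dfnc \<Psi>" and closed: "closedS C"
    and unit: "\<forall>x\<in>F1. isR x \<longrightarrow> posR (C x) \<longrightarrow> \<not> ltR x (rco q0c) \<and> \<not> ltR (rco q1c) x"
    and rf: "realfun \<Psi>" and pos: "\<forall>x\<in>F1. isR x \<longrightarrow> posR (\<Psi> x)"
  then have C: "dfn C" and \<Psi>: "dfn \<Psi>" by (simp_all add: dfncD)
  have J: jump by (rule boot_jump[OF assms(1)])
  define in1 where "in1 h k j m \<longleftrightarrow> cd h k = j \<and> qv (dya 2 m) < qv (C (ev q0c 0 h) m)" for h k j m
  \<comment> \<open>The number m packs a witness for membership in \<open>C\<close> and the index of
    an approximation. Of the margin 3, two parts pay for the approximations of the point and of its
    radius; the third is left for the strict comparison of reals.\<close>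
  define in2 where "in2 h k j m \<longleftrightarrow> qv (dya 2 (pf m)) < qv (C (ev q0c 0 h) (pf m)) \<and>
      qv (ad (ad (ev q0c 0 h (ps m)) (mi (\<Psi> (ev q0c 0 h) (ps m)))) (dya 3 (ps m))) < qv (dya j k) \<and>
      qv (ad (dya (j + 1) k) (dya 3 (ps m))) < qv (ad (ev q0c 0 h (ps m)) (\<Psi> (ev q0c 0 h) (ps m)))" for h k j m
  define A where "A k j \<longleftrightarrow> (\<exists>h\<in>F1. bin h \<and> (\<exists>m. in1 h k j m))" for k j
  define B where "B k j \<longleftrightarrow> (\<exists>h\<in>F1. bin h \<and> (\<exists>m. in2 h k j m))" for k j
  define S' where "S' k j \<longleftrightarrow> \<not> A k j \<or> B k j" for k j
  have t: "dfn (\<lambda>f w. tl1 f (ps w))" unfolding tl1_def by (intro dfn_app dfn_plus dfn_ps dfn_arg dfn_const)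
  have e: "dfn (\<lambda>f n. ee (tl1 f) (I f n))" if "dfn I" for I by (rule dfn_ee[OF t that])
  have dC: "dfn (\<lambda>f n. C (ee (tl1 f)) (I f n))" and d\<Psi>: "dfn (\<lambda>f n. \<Psi> (ee (tl1 f)) (I f n))" if "dfn I" for I
    by (rule dfn_fapp[OF C e[OF dfn_ps[OF dfn_arg]] that], rule dfn_fapp[OF \<Psi> e[OF dfn_ps[OF dfn_arg]] that])
  have m: "dfn (\<lambda>f n. f 0)" by (intro dfn_app dfn_const)
  have in1: "dec (\<lambda>f w. in1 (nz (tl1 f)) (K' f w) (I f w) (f 0))" if "dfn K'" "dfn I" for K' I
    unfolding in1_def
    by (intro dec_and dec_eq dec_qv_less dC m dfn_dya dfn_const dfn_cd dfn_nz t that)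
  have in2: "dec (\<lambda>f w. in2 (nz (tl1 f)) (K' f w) (I f w) (f 0))" if "dfn K'" "dfn I" for K' I
    unfolding in2_def
    by (intro dec_and dec_qv_less dC d\<Psi> e m dfn_dya dfn_ad dfn_mi dfn_const dfn_plus dfn_pf dfn_ps that)
  have sA: "isset (\<lambda>w. A (pf w) (ps w))" and sB: "isset (\<lambda>w. B (pf w) (ps w))"
    unfolding A_def B_def
    by (rule boot_bin[OF assms(1)], intro in1 in2 dfn_pf dfn_ps dfn_arg)+
  have S: "isset (\<lambda>w. S' (pf w) (ps w))" unfolding S'_def by (rule isset_or[OF isset_not[OF sA] sB])
  have fan: "\<exists>k. \<forall>j. j < p2 k \<longrightarrow> S' k j"
  proof (rule fan[OF J S])
    fix k j assume s: "S' k j"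
    \<comment> \<open>Both reasons pass to a child: a point with the digits of the child has those
      of the parent, and a neighbourhood that covers an interval covers its halves.\<close>
    have *: "S' (k + 1) (j + j + b)" if b: "b = 0 \<or> b = 1" for b
    proof (cases "A k j")
      case False
      have "\<not> A (k + 1) (j + j + b)"
      proof
        assume "A (k + 1) (j + j + b)"
        then obtain h m where h: "h \<in> F1" "bin h" "in1 h (k + 1) (j + j + b) m" by (auto simp: A_def)
        have "cd h k = j \<and> h k = b"
          by (rule double_cancel) (use h b in \<open>auto simp: in1_def cd(3) bin_def\<close>)
        then have "in1 h k j m" using h(3) by (simp add: in1_def)
        then show False using False h(1,2) by (auto simp: A_def)
      qed
      then show ?thesis by (simp add: S'_def)
    next
      case True
      then obtain h m where h: "h \<in> F1" "bin h" "in2 h k j m" using s by (auto simp: S'_def B_def)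
      have "toQ b = 0 \<or> toQ b = 1" using b by auto
      moreover have "toQ (j + j + b) * dy (k + 1) = toQ j * dy k + toQ b * (dy k / 2)"
        "toQ (j + j + b + 1) * dy (k + 1) = toQ j * dy k + toQ b * (dy k / 2) + dy k / 2"
        unfolding toQ_add dy_Suc by (simp_all add: field_simps)
      moreover have "toQ (j + 1) * dy k = toQ j * dy k + dy k" by (simp add: toQ_add field_simps)
      ultimately have "toQ j * dy k \<le> toQ (j + j + b) * dy (k + 1)" "toQ (j + j + b + 1) * dy (k + 1) \<le> toQ (j + 1) * dy k"
        using dy_pos[of k] by (auto intro: less_imp_le)
      then have "in2 h (k + 1) (j + j + b) m" using h(3) unfolding in2_def qv_ad qv_dya by linarith
      then show ?thesis using h(1,2) by (auto simp: S'_def B_def)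
    qed
    show "S' (k + 1) (j + j) \<and> S' (k + 1) (j + j + 1)" using *[of 0] *[of 1] by simp
  next
    fix h assume h: "h \<in> F1" "bin h"
    let ?y = "ev q0c 0 h"
    have y: "?y \<in> F1" "isR ?y" using ev(1)[OF h(1)] isR_ev[OF h(1)] by auto
    show "\<exists>k. S' k (cd h k)"
    proof (cases "posR (C ?y)")
      case True
      then obtain a where a: "2 * dy a < qv (C ?y a)" by (auto simp: posR)
      obtain b where b: "2 * dy b < qv (\<Psi> ?y b)" using pos y by (auto simp: posR)
      \<comment> \<open>At this level the radius exceeds \<open>4 * dy ?k\<close>, which is the
        length of the interval plus the margin \<open>3 * dy ?k\<close> of
        \<open>in2\<close>.\<close>
      let ?k = "b + 1 + 1"
      have "isR (\<Psi> ?y)" using rf y by (simp add: realfun_def)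
      from isR_le[OF this, of b ?k] have "\<bar>qv (\<Psi> ?y b) - qv (\<Psi> ?y ?k)\<bar> < dy b" by (simp add: add.assoc)
      moreover have "dy b = 4 * dy ?k" by (simp add: dy_Suc)
      ultimately have \<Psi>k: "4 * dy ?k < qv (\<Psi> ?y ?k)" using b by linarith
      have "in2 h ?k (cd h ?k) (pr a ?k)"
        unfolding in2_def using a \<Psi>k dy_pos[of ?k] qv_ev[OF h, of ?k] by (simp add: toQ_add algebra_simps del: dy_pos)
      then show ?thesis using h unfolding S'_def B_def by blast
    next
      case False
      obtain r where r: "0 < qv r" "\<And>z. z \<in> F1 \<Longrightarrow> isR z \<Longrightarrow> inball ?y r z \<Longrightarrow> \<not> posR (C z)"
        using closed False y unfolding closedS_def openP_def by blast
      obtain n where n: "dy n < qv r / 2" using ex_dy_less[of "qv r / 2"] r(1) by auto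
      \<comment> \<open>Equal digits up to n + 1 mean equal approximations at that index, so a point
        of \<open>C\<close> in this interval would lie in the ball that misses
        \<open>C\<close>.\<close>
      have "\<not> A (n + 1) (cd h (n + 1))"
      proof
        assume "A (n + 1) (cd h (n + 1))"
        then obtain g m where g: "g \<in> F1" "bin g" "in1 g (n + 1) (cd h (n + 1)) m" by (auto simp: A_def)
        have "inball ?y r (ev q0c 0 g)" unfolding inball
          using n g(3) by (intro exI[of _ n]) (simp add: qv_ev h g(1,2) in1_def)
        then have "\<not> posR (C (ev q0c 0 g))" using r(2) ev(1) isR_ev g(1) by blast
        moreover have "posR (C (ev q0c 0 g))" using g(3) by (auto simp: in1_def posR)
        ultimately show False by simp
      qed
      then show ?thesis unfolding S'_def by blast
    qed
  qed
  then obtain k where k: "\<And>j. j < p2 k \<Longrightarrow> S' k j" by blast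
  \<comment> \<open>As \<open>C\<close> is given by a function respecting equality of reals, the
    binary expansion of a point of \<open>C\<close> belongs to \<open>C\<close> again.\<close>
  have expand: "\<exists>h\<in>F1. bin h \<and> eqR x (ev q0c 0 h) \<and> posR (C (ev q0c 0 h))" if x: "x \<in> F1" "isR x" "posR (C x)" for x
  proof -
    have "\<not> ltR x (rco q0c)" "\<not> ltR (rco q1c) x" using unit x by blast+
    then have b: "0 \<le> qv (x m) + 2 * dy m" "qv (x m) \<le> 1 + 2 * dy m" for m
      by (simp_all add: ltR_def rco_def not_less)
    have "leq q0c x" unfolding leq_def
    proof
      fix j have "0 \<le> qv (x j) + dy j"
      proof (rule arch[of j])
        fix m assume "j \<le> m"
        then show "0 \<le> qv (x j) + dy j + 4 * dy m" using isR_le[OF x(2), of j m] b(1)[of m] dy_pos[of m] by linarith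
      qed
      then show "qv q0c \<le> qv (x j) + dy j" by simp
    qed
    moreover have "geq (ad q0c (dya 1 0)) x" unfolding geq_def
    proof
      fix j have "qv (x j) \<le> 1 + dy j"
      proof (rule arch[of j])
        fix m assume "j \<le> m"
        then show "qv (x j) \<le> 1 + dy j + 4 * dy m" using isR_le[OF x(2), of j m] b(2)[of m] dy_pos[of m] by linarith
      qed
      then show "qv (x j) \<le> qv (ad q0c (dya 1 0)) + dy j" by simp
    qed
    ultimately obtain h where h: "h \<in> F1" "bin h" "eqR x (ev q0c 0 h)" using greedy[OF J x(1,2)] by blast
    have e: "ev q0c 0 h \<in> F1" "isR (ev q0c 0 h)" using ev(1)[OF h(1)] isR_ev[OF h(1)] by auto
    then have "isR (C x)" "isR (C (ev q0c 0 h))" "eqR (C x) (C (ev q0c 0 h))"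
      using closed x(1,2) h(3) by (auto simp: closedS_def realfun_def)
    from posR_eqR[OF this x(3)] show ?thesis using h by blast
  qed
  show "\<exists>k. \<exists>y. (\<lambda>z. y (pf z) (ps z)) \<in> F1 \<and> (\<forall>i. i < k \<longrightarrow> isR (y i) \<and> posR (C (y i))) \<and>
     (\<forall>x\<in>F1. isR x \<longrightarrow> posR (C x) \<longrightarrow> (\<exists>i. i < k \<and> ltR (rsb (y i) (\<Psi> (y i))) x \<and> ltR x (rad (y i) (\<Psi> (y i)))))"
  proof (cases "\<exists>h\<in>F1. bin h \<and> posR (C (ev q0c 0 h))")
    case False
    have "(\<lambda>z. 0) \<in> F1" by (rule F1I) (rule dfn_const)
    then show ?thesis using False expand by (intro exI[of _ 0] exI[of _ "\<lambda>_ _. 0"]) auto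
  next
    case True
    then obtain h0 m0 where h0: "h0 \<in> F1" "bin h0" "2 * dy m0 < qv (C (ev q0c 0 h0) m0)" by (auto simp: posR)
    have sAk: "isset (\<lambda>i. A k i)"
      unfolding isset_def using dec_isset[OF sA dfn_pr[OF dfn_const dfn_arg]] by simp
    let ?k = "\<lambda>i. if i < p2 k then (0::'n) else 1"
    \<comment> \<open>The choice needs a point of \<open>C\<close> for every index. Intervals
      without points of \<open>C\<close> receive the default \<open>h0\<close>, which is why the
      empty set was treated separately.\<close>
    define Q where "Q h m i \<longleftrightarrow> (if A k i \<and> i < p2 k then in2 h k i m else 2 * dy m < qv (C (ev q0c 0 h) m))" for h m i
    have Q_dec: "dec (\<lambda>f i. Q (nz (tl1 f)) (f 0) i)"
    proof -
      have c: "dec (\<lambda>f i. A k i \<and> i < p2 k)"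
        using sAk by (intro dec_and dec_less dfn_arg dfn_const) (simp add: isset_def)
      have "dec (\<lambda>f i. qv (dya 2 (f 0)) < qv (C (ee (tl1 f)) (f 0)))"
        by (intro dec_qv_less dC m dfn_dya dfn_const)
      then have "dec (\<lambda>f i. (A k i \<and> i < p2 k \<longrightarrow> in2 (nz (tl1 f)) k i (f 0)) \<and>
          (\<not> (A k i \<and> i < p2 k) \<longrightarrow> qv (dya 2 (f 0)) < qv (C (ee (tl1 f)) (f 0))))"
        by (intro dec_and[OF dec_imp[OF c] dec_imp[OF dec_not[OF c]]] in2 dfn_const dfn_arg)
      then show ?thesis unfolding Q_def by (rule dec_cong) auto
    qed
    have "\<exists>y\<in>F01. \<forall>i. i < p2 k \<longrightarrow> (if Q (nz (tl1 (y i))) (y i 0) i then 0 else 1) = (0::'n)"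
    proof (rule IND_choice[OF IND Q_dec[unfolded dec_def]])
      fix i
      have "\<exists>h\<in>F1. bin h \<and> (\<exists>m. Q h m i)"
      proof (cases "A k i \<and> i < p2 k")
        case True
        then have "B k i" using k by (auto simp: S'_def)
        then show ?thesis using True by (auto simp: B_def Q_def)
      qed (use h0 in \<open>auto simp: Q_def\<close>)
      then obtain h m' where h: "h \<in> F1" "bin h" "Q h m' i" by blast
      obtain f where "f \<in> F1" "f 0 = m'" "tl1 f = h" using tl1_surj[OF h(1)] .
      then show "\<exists>f\<in>F1. (if Q (nz (tl1 f)) (f 0) i then 0 else 1) = (0::'n)"
        using h nz_bin[OF h(2)] by (intro bexI[of _ f]) auto
    qed
    then obtain f where f: "f \<in> F01" "\<And>i. i < p2 k \<Longrightarrow> Q (nz (tl1 (f i))) (f i 0) i"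
      by (auto split: if_splits)
    define h where "h i = nz (tl1 (f i))" for i
    have h: "h i \<in> F1" "bin (h i)" for i
      unfolding h_def using nz_F1[OF tl1_F1[OF F01_sec[OF f(1)]]] bin_nz by auto
    define y where "y i = ev q0c 0 (h i)" for i
    have y: "y i \<in> F1" "isR (y i)" for i
      unfolding y_def using ev(1) isR_ev h by auto
    have pC: "posR (C (y i))" if "i < p2 k" for i
      using f(2)[OF that] unfolding Q_def in2_def h_def[symmetric] y_def[symmetric] posR by (auto split: if_splits)
    have "(\<lambda>z. y (pf z) (ps z)) \<in> F1"
    proof (rule F1I)
      have "(\<lambda>z. f (pf z) (ps z)) \<in> F1" using f(1) by (simp add: F01_def)
      from dfn_F1[OF this dfn_pr[OF dfn_pf[OF dfn_pf[OF dfn_arg]] dfn_plus[OF dfn_ps[OF dfn_arg] dfn_const]], of 1]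
      have "dfn (\<lambda>_ w. tl1 (f (pf (pf w))) (ps w))" by (simp add: tl1_def)
      then have "dfn (\<lambda>_ z. ee (tl1 (f (pf z))) (ps z))" by (rule dfn_ee) (intro dfn_ps dfn_arg)
      then show "dfn (\<lambda>_ z. y (pf z) (ps z))" by (simp add: y_def h_def)
    qed
    moreover have "\<exists>i. i < p2 k \<and> ltR (rsb (y i) (\<Psi> (y i))) x \<and> ltR x (rad (y i) (\<Psi> (y i)))"
      if x: "x \<in> F1" "isR x" "posR (C x)" for x
    proof -
      obtain g where g: "g \<in> F1" "bin g" "eqR x (ev q0c 0 g)" "posR (C (ev q0c 0 g))" using expand[OF x] by blast
      let ?j = "cd g k"
      have j: "?j < p2 k" by (rule cd_less[OF g(1,2)])
      have "A k ?j" using g unfolding A_def in1_def posR by (simp, blast)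
      then obtain n where n: "qv (y ?j n) - qv (\<Psi> (y ?j) n) + 3 * dy n < toQ ?j * dy k"
        "toQ (?j + 1) * dy k + 3 * dy n < qv (y ?j n) + qv (\<Psi> (y ?j) n)"
        using f(2)[OF j] j by (auto simp: Q_def in2_def h_def y_def )
      \<comment> \<open>The summand k puts the index beyond level k, and the three further steps
        give \<open>8 * dy ?m \<le> dy n\<close>.\<close>
      let ?m = "n + k + 1 + 1 + 1"
      have le: "n \<le> ?m" "n \<le> ?m + 1" "k \<le> ?m" by (simp_all add: add.assoc add_increasing)
      have \<Psi>y: "isR (\<Psi> (y ?j))" using rf y by (simp add: realfun_def)
      note b = isR_le[OF y(2) le(2), of ?j] isR_le[OF \<Psi>y le(2)]
      have d: "8 * dy ?m \<le> dy n" using dy_add_le(2)[of n k] by (simp add: dy_Suc)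
      have "\<bar>qv (x ?m) - qv (ev q0c 0 g ?m)\<bar> \<le> 2 * dy ?m" using g(3) by (simp add: eqR_def)
      moreover have "toQ ?j * dy k \<le> qv (ev q0c 0 g ?m)" "qv (ev q0c 0 g ?m) \<le> toQ (?j + 1) * dy k"
        using ev_bounds[OF g(1) le(3), of q0c 0] qv_ev[OF g(1,2), of k] dy_pos[of ?m] unfolding toQ_add toQ_1 distrib_right mult_1_left add_0_left
        by linarith+
      ultimately have "qv (y ?j (?m + 1)) - qv (\<Psi> (y ?j) (?m + 1)) + 2 * dy ?m < qv (x ?m)"
        "qv (x ?m) + 2 * dy ?m < qv (y ?j (?m + 1)) + qv (\<Psi> (y ?j) (?m + 1))"
        using n b d dy_pos[of ?m] by linarith+
      then have "ltR (rsb (y ?j) (\<Psi> (y ?j))) x" "ltR x (rad (y ?j) (\<Psi> (y ?j)))"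
        unfolding ltR_def rsb_def rad_def qv_ad qv_mi diff_conv_add_uminus by blast+
      then show ?thesis using j by blast
    qed
    ultimately show ?thesis using y pC by blast
  qed
qed

end

context num_model begin

subsection \<open>Open sets decide uniquely solvable equations\<close>

text \<open>The graph of \<open>f\<close> as a real in \<open>[3n, 3n + 1]\<close>. Its digits vanish infinitely often, so that the
  greedy expansion recovers them.\<close>

definition grd :: "('n \<Rightarrow> 'n) \<Rightarrow> 'n \<Rightarrow> 'n" where "grd f i = (if f (pf i) = ps i then 1 else 0)"
definition enc :: "'n \<Rightarrow> ('n \<Rightarrow> 'n) \<Rightarrow> 'n \<Rightarrow> 'n" where "enc n f = ev (mk (n + n + n) 0 0) 0 (grd f)"

lemma grd_F1: "f \<in> F1 \<Longrightarrow> grd f \<in> F1"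
  unfolding grd_def[abs_def]
  by (rule F1I) (intro dfn_if dec_eq dfn_F1[where g=f] dfn_pf dfn_ps dfn_const dfn_arg)

lemma grd_bin: "bin (grd f)" by (simp add: grd_def bin_def)

lemma grd_zeros: "\<exists>j. i < j \<and> grd f j = 0"
proof -
  \<comment> \<open>A pair off the graph whose code is greater than i.\<close>
  let ?j = "pr (i + 1) (f (i + 1) + 1)"
  have "i + 1 \<le> ?j" by (rule le_pr)
  then have "i < ?j" by (simp add: discrete[of i] Suc_le)
  moreover have "f (i + 1) \<noteq> f (i + 1) + 1" by (metis less_add_one order_less_irrefl)
  ultimately show ?thesis by (intro exI[of _ ?j]) (simp add: grd_def)
qed

lemma dfn_grd: "dfn (\<lambda>f w. H f (pf w) (ps w)) \<Longrightarrow> dfn (\<lambda>f w. grd (H f (pf w)) (ps w))"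
proof -
  assume H: "dfn (\<lambda>f w. H f (pf w) (ps w))"
  have "dfn (\<lambda>f w. H f (pf w) (pf (ps w)))" by (rule dfn_cong2[OF H]) (intro dfn_pf dfn_ps dfn_arg)+
  then show ?thesis unfolding grd_def by (intro dfn_if dec_eq dfn_ps dfn_const dfn_arg)
qed

lemma dfn_enc: "dfn A \<Longrightarrow> dfn (\<lambda>f w. H f (pf w) (ps w)) \<Longrightarrow> dfn I \<Longrightarrow> dfn (\<lambda>f n. enc (A f n) (H f n) (I f n))"
  unfolding enc_def by (intro dfn_ev dfn_grd dfn_mk dfn_plus dfn_const)

lemma enc:
  assumes "f \<in> F1"
  shows "enc n f \<in> F1" "isR (enc n f)" "3 * toQ n \<le> qv (enc n f i)" "qv (enc n f i) \<le> 3 * toQ n + 1"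
  using ev(1)[OF grd_F1[OF assms]] isR_ev[OF grd_F1[OF assms]] ev_range[OF grd_F1[OF assms], where k=0 and p="mk (n + n + n) 0 0" and i=i]
  by (auto simp: enc_def qv_mk toQ_add)

lemma toQ_apart: fixes a b :: 'n shows "toQ a - toQ b < 1 \<Longrightarrow> toQ b - toQ a < 1 \<Longrightarrow> a = b"
proof (rule ccontr)
  assume h: "toQ a - toQ b < 1" "toQ b - toQ a < 1" "a \<noteq> b"
  then have "a + 1 \<le> b \<or> b + 1 \<le> a" by (metis Suc_le less_linear)
  then have "toQ (a + 1) \<le> toQ b \<or> toQ (b + 1) \<le> toQ a" by (simp add: toQ_le)
  then show False using h by (auto simp: toQ_add)
qed

text \<open>By continuity a zero may be truncated to a finite sequence, so a number quantifier
  replaces the one over functions.\<close>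

lemma boot_minus_cont:
  assumes J: jump and c: "\<And>\<Phi>. dfn \<Phi> \<Longrightarrow> cont \<Phi>" and Y: "dfn Y"
  shows "isset (\<lambda>n. \<exists>f\<in>F1. Y f n = 0)"
proof -
  have "dec (\<lambda>_ z. Y (fs (ps z)) (pf z) = 0)"
    by (intro dec_eq dfn_const dfn_fapp[OF Y] dfn_fs dfn_pf dfn_ps dfn_arg)
  then have "isset (\<lambda>n. \<exists>\<tau>. Y (fs \<tau>) n = 0)" by (intro isset_ex[OF J]) (simp add: isset_def)
  moreover have "(\<exists>\<tau>. Y (fs \<tau>) n = 0) \<longleftrightarrow> (\<exists>f\<in>F1. Y f n = 0)" for n
  proof
    assume "\<exists>f\<in>F1. Y f n = 0"
    then obtain f where f: "f \<in> F1" "Y f n = 0" by blast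
    obtain k where k: "\<And>g. g \<in> F1 \<Longrightarrow> agree k f g \<Longrightarrow> Y g n = Y f n"
      using c[OF Y] f(1) unfolding cont_def by metis
    obtain \<tau> where \<tau>: "\<And>i. fs \<tau> i = (if i < k then f i else 0)" using finite_seq[OF f(1)] by blast
    have "agree k f (fs \<tau>)" by (simp add: agree_def \<tau>)
    then show "\<exists>\<tau>. Y (fs \<tau>) n = 0" using k f(2) by force
  qed (use fs_F1 in blast)
  ultimately show ?thesis by simp
qed

theorem opn_boot_minus: assumes J: jump and opn shows boot_minus
  unfolding boot_minus_def
proof (intro allI impI)
  fix Y assume "dfnc Y" and unique: "\<forall>n. \<forall>f\<in>F1. \<forall>g\<in>F1. Y f n = 0 \<and> Y g n = 0 \<longrightarrow> f = g"
  then have Y: "dfn Y" by (simp add: dfncD)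
  show "isset (\<lambda>n. \<exists>f\<in>F1. Y f n = 0)"
  proof (cases E2)
    case False
    show ?thesis
    proof (rule boot_minus_cont[OF J _ Y])
      show "cont \<Phi>" if "dfn \<Phi>" for \<Phi> using that False dichotomy by blast
    qed
  next
    case E: True
    let ?D = "\<lambda>x n. gd (mk (n + n + n) 0 0) 0 (\<lambda>q. leq q x)"
    have dleq: "dec (\<lambda>x w. leq (ps w) x)"
    proof -
      have "dec (\<lambda>x w. \<forall>j. qv (ps w) \<le> qv (ad (x j) (dya 1 j)))"
        by (intro E2_all[OF E] dec_qv_le dfn_ad dfn_dya dfn_app dfn_pf dfn_ps dfn_const dfn_arg)
      then show ?thesis by (simp add: leq_def)
    qed
    have dD: "dfn (\<lambda>x z. ?D x (A x z) (B x z))" if "dfn A" "dfn B" for A B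
      by (intro dfn_gd dleq dfn_mk dfn_plus dfn_const that)
    \<comment> \<open>A digit 1 at the pair (a, b) says that b is the value at a. The second
      alternative makes the search total for reals that code nothing.\<close>
    have hit: "dec (\<lambda>x z. ?D x (pf (pf z)) (pr (ps (pf z)) (ps z)) = 1 \<or> (\<forall>b. ?D x (pf (pf z)) (pr (ps (pf z)) b) \<noteq> 1))"
      by (intro dec_or dec_eq E2_all[OF E] dec_not dD dfn_pr dfn_pf dfn_ps dfn_const dfn_arg)
    have "\<exists>\<Theta>. dfn \<Theta> \<and> (\<forall>x\<in>F1. \<forall>n. (if ?D x (pf (pf (pr n (\<Theta> x n)))) (pr (ps (pf (pr n (\<Theta> x n)))) (ps (pr n (\<Theta> x n)))) = 1 \<or>
        (\<forall>b. ?D x (pf (pf (pr n (\<Theta> x n)))) (pr (ps (pf (pr n (\<Theta> x n)))) b) \<noteq> 1) then 0 else 1) = (0::'n))"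
      by (rule dfn_choice[OF hit[unfolded dec_def]]) auto
    then obtain \<Theta> where \<Theta>: "dfn \<Theta>" "\<And>x n. x \<in> F1 \<Longrightarrow> ?D x (pf n) (pr (ps n) (\<Theta> x n)) = 1 \<or> (\<forall>b. ?D x (pf n) (pr (ps n) b) \<noteq> 1)"
      by (auto split: if_splits)
    \<comment> \<open>The function decoded from the real x under the assumption that x lies in the
      interval belonging to n.\<close>
    define dcd where "dcd x n a = \<Theta> x (pr n a)" for x n a
    have dcd_F1: "dcd x n \<in> F1" if "x \<in> F1" for x n
      unfolding dcd_def using F1_curry[OF c2(3)[OF \<Theta>(1) that]] .
    have dcd: "dcd x n = g" if x: "x \<in> F1" "isR x" and g: "g \<in> F1" and e: "eqR x (enc n g)" for x n g
    proof
      fix a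
      have "?D x n = grd g"
        by (rule greedy_unique[OF J x grd_F1[OF g] grd_bin _ grd_zeros]) (use e in \<open>simp add: enc_def\<close>)
      then have "grd g (pr a (\<Theta> x (pr n a))) = 1 \<or> (\<forall>b. grd g (pr a b) \<noteq> 1)"
        using \<Theta>(2)[OF x(1), of "pr n a"] by simp
      then have "\<Theta> x (pr n a) = g a" unfolding grd_def by (auto split: if_splits)
      then show "dcd x n a = g a" by (simp add: dcd_def)
    qed
    \<comment> \<open>The only candidate for the coded function is computed from x, which eliminates
      the quantifier over functions and makes this predicate decidable under
      \<open>E2\<close>.\<close>
    define P where "P x \<longleftrightarrow> (\<exists>n. Y (dcd x n) n = 0 \<and> eqR x (enc n (dcd x n)))" for x
    have P: "P x \<longleftrightarrow> (\<exists>n. \<exists>g\<in>F1. Y g n = 0 \<and> eqR x (enc n g))" if "x \<in> F1" "isR x" for x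
      unfolding P_def using dcd[OF that] dcd_F1[OF that(1)] by metis
    have P_eqR: "P y" if p: "P x" "x \<in> F1" "isR x" "y \<in> F1" "isR y" "eqR x y" for x y
    proof -
      obtain n g where g: "g \<in> F1" "Y g n = 0" "eqR x (enc n g)" using p(1) P[OF p(2,3)] by blast
      have "eqR y (enc n g)" by (rule eqR_trans[OF p(5,3) enc(2)[OF g(1)] eqR_sym[OF p(6)] g(3)])
      then show ?thesis using P[OF p(4,5)] g by blast
    qed
    have dP: "dec (\<lambda>x _. P x)"
    proof -
      have d: "dfn (\<lambda>x z. dcd x (A x z) (B x z))" if "dfn A" "dfn B" for A B
        unfolding dcd_def by (rule dfn_comp[OF \<Theta>(1) dfn_pr[OF that]])
      have 1: "dfn (\<lambda>x z. Y (dcd x (ps z)) (ps z))"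
        by (rule dfn_fapp[OF Y]) (intro d dfn_pf dfn_ps dfn_arg)+
      have 2: "dfn (\<lambda>x w. dcd x (A x (pf w)) (ps w))" if "dfn A" for A
        by (rule d) (intro dfn_comp[OF that] dfn_pf dfn_ps dfn_arg)+
      have "dec (\<lambda>x k. \<exists>n. Y (dcd x n) n = 0 \<and>
          (\<forall>j. qv (ab (ad (x j) (mi (enc n (dcd x n) j)))) \<le> qv (dya 2 j)))"
        by (intro E2_ex[OF E] E2_all[OF E] dec_and dec_eq 1 2 dfn_const dec_qv_le dfn_ab dfn_ad dfn_mi dfn_dya
          dfn_enc dfn_app dfn_pf dfn_ps dfn_arg)
      then show ?thesis by (simp add: P_def eqR_def)
    qed
    define Z where "Z x n = (if P x then q0c else q1c)" for x and n :: 'n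
    have Z: "dfn Z" unfolding Z_def by (intro dfn_if dP dfn_const)
    have posZ: "posR (Z x) \<longleftrightarrow> \<not> P x" for x
    proof -
      have "dy (0 + 1 + 1) = 1 / 4" using dy_Suc[of "0 + 1"] dy_Suc[of 0] by simp
      then have "2 * dy (0 + 1 + 1) < 1" by simp
      moreover have "\<not> 2 * dy n < 0" for n using dy_pos[of n] by linarith
      ultimately show ?thesis unfolding posR Z_def by auto
    qed
    \<comment> \<open>The intervals [3n, 3n + 1] widened by 1/4 on both sides are 3/2 apart, whereas
      any two approximations of x with index at least 1 differ by less than 1. Hence codes near x
      all belong to the same n.\<close>
    have near: "\<exists>i. 1 \<le> i \<and> 3 * toQ n - 1/4 < qv (x i) \<and> qv (x i) < 3 * toQ n + 5/4"
      if b: "inball x r y" "qv r \<le> 1/4" and g: "g \<in> F1" "eqR y (enc n g)" for x r y n g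
    proof -
      obtain m where m: "\<bar>qv (x (m + 1)) - qv (y (m + 1))\<bar> + 2 * dy m < qv r" using b(1) by (auto simp: inball)
      have "\<bar>qv (y (m + 1)) - qv (enc n g (m + 1))\<bar> \<le> 2 * dy (m + 1)" using g(2) by (simp add: eqR_def)
      then have "\<bar>qv (y (m + 1)) - qv (enc n g (m + 1))\<bar> \<le> dy m" by (simp add: dy_Suc)
      then show ?thesis using m b(2) enc(3,4)[OF g(1), of n "m + 1"] dy_pos[of m] by (intro exI[of _ "m + 1"]) (simp, linarith)
    qed
    have "openS Z"
      unfolding openS_def realfun_def posZ
    proof (intro conjI ballI impI)
      show "isR (Z x)" for x by (simp add: isR_def Z_def)
      show "eqR (Z x) (Z y)" if "x \<in> F1" "isR x" "y \<in> F1" "isR y" "eqR x y" for x y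
        using P_eqR[of x y] P_eqR[of y x] that eqR_sym[of x y] dy_pos by (auto simp: eqR_def Z_def intro: less_imp_le)
      show "openP (\<lambda>x. \<not> P x)"
        unfolding openP_def
      proof (intro ballI impI)
        fix x assume x: "x \<in> F1" "isR x" "\<not> P x"
        obtain r0 where r0: "qv r0 = 1/4" using qv_surj .
        show "\<exists>r. 0 < qv r \<and> (\<forall>y\<in>F1. isR y \<longrightarrow> inball x r y \<longrightarrow> \<not> P y)"
        proof (cases "\<exists>z\<in>F1. isR z \<and> inball x r0 z \<and> P z")
          case False
          then show ?thesis using r0 by (intro exI[of _ r0]) auto
        next
          case True
          then obtain z where z: "z \<in> F1" "isR z" "inball x r0 z" "P z" by blast
          obtain n0 g0 where g0: "g0 \<in> F1" "Y g0 n0 = 0" "eqR z (enc n0 g0)" using z(4) P[OF z(1,2)] by blast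
          let ?w = "enc n0 g0"
          have "\<not> eqR x ?w" using x P g0 by blast
          then obtain j where j: "2 * dy j < \<bar>qv (x j) - qv (?w j)\<bar>" by (auto simp: eqR_def not_le)
          \<comment> \<open>Within radius 1/4 there are codes for one n only, thus by uniqueness
            only the code \<open>?w\<close>. A radius below the distance from x to it, corrected by
            the error \<open>2 * dy j\<close>, leaves no code in the ball.\<close>
          obtain r where r: "qv r = min (1/4) (\<bar>qv (x j) - qv (?w j)\<bar> - 2 * dy j)" using qv_surj .
          have "\<not> P y" if y: "y \<in> F1" "isR y" "inball x r y" for y
          proof
            assume "P y"
            then obtain n g where g: "g \<in> F1" "Y g n = 0" "eqR y (enc n g)" using P[OF y(1,2)] by blast
            have r4: "qv r \<le> 1/4" unfolding r by (rule min.cobounded1)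
            obtain i where i: "1 \<le> i" "3 * toQ n - 1/4 < qv (x i)" "qv (x i) < 3 * toQ n + 5/4"
              using near[OF y(3) r4 g(1,3)] by blast
            obtain i' where i': "1 \<le> i'" "3 * toQ n0 - 1/4 < qv (x i')" "qv (x i') < 3 * toQ n0 + 5/4"
              using near[OF z(3) _ g0(1,3)] r0 by auto
            have d1: "dy 1 = 1 / 2" using dy_Suc[of 0] by simp
            have "\<bar>qv (x 1) - qv (x i)\<bar> < 1/2" "\<bar>qv (x 1) - qv (x i')\<bar> < 1/2"
              using isR_le[OF x(2) i(1)] isR_le[OF x(2) i'(1)] d1 by simp_all
            then have "n = n0" using i i' by (intro toQ_apart) linarith+
            then have "eqR y ?w" using g unique g0 by blast
            obtain m where m: "\<bar>qv (x (m + 1)) - qv (y (m + 1))\<bar> + 2 * dy m < qv r" using y(3) by (auto simp: inball)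
            let ?i = "m + 1"
            have d: "dy m = 2 * dy ?i" by (simp add: dy_Suc)
            have yw: "\<bar>qv (y ?i) - qv (?w ?i)\<bar> \<le> 2 * dy ?i" using \<open>eqR y ?w\<close> by (simp add: eqR_def)
            have "\<bar>qv (x j) - qv (x ?i)\<bar> \<le> dy j \<and> \<bar>qv (?w j) - qv (?w ?i)\<bar> \<le> dy j \<or>
                \<bar>qv (x j) - qv (x ?i)\<bar> \<le> dy ?i \<and> \<bar>qv (?w j) - qv (?w ?i)\<bar> \<le> dy ?i"
            proof (cases "j \<le> ?i")
              case True
              then show ?thesis using isR_le[OF x(2) True] isR_le[OF enc(2)[OF g0(1)] True, of n0] by linarith
            next
              case False
              then have le: "?i \<le> j" by simp
              show ?thesis using isR_le[OF x(2) le] isR_le[OF enc(2)[OF g0(1)] le, of n0] by linarith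
            qed
            moreover have "qv r \<le> \<bar>qv (x j) - qv (?w j)\<bar> - 2 * dy j" by (simp add: r)
            ultimately show False using m yw dy_pos[of ?i] dy_pos[of j] unfolding d by linarith
          qed
          moreover have "0 < qv r" using j by (simp add: r)
          ultimately show ?thesis by blast
        qed
      qed
    qed
    have oZ: "openS (res Z)"
    proof -
      have "isR (res Z x) = isR (Z x)" "eqR (res Z x) (res Z y) = eqR (Z x) (Z y)" "posR (res Z x) = posR (Z x)"
        if "x \<in> F1" "y \<in> F1" for x y using that by simp_all
      then show ?thesis using \<open>openS Z\<close> unfolding openS_def realfun_def openP_def by (simp cong: ball_cong)
    qed
    define X where "X n \<longleftrightarrow> (\<forall>y\<in>F1. isR y \<longrightarrow> inball (rco (pf n)) (mk (pf (ps n) + 1) 0 (ps (ps n))) y \<longrightarrow> posR (res Z y))" for n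
    have X: "isset X" unfolding X_def
      by (rule assms(2)[unfolded opn_def, THEN spec, THEN mp, OF dfnc_res[OF Z], THEN mp, OF oZ])
    \<comment> \<open>This index names the ball with centre 3n and radius 2, since the radius coded
      by (1, 0) is (1 + 1)/(0 + 1).\<close>
    have "isset (\<lambda>n. \<not> X (pr (mk (n + n + n) 0 0) (pr 1 0)))"
      unfolding isset_def by (rule dec_not, rule dec_isset[OF X]) (intro dfn_pr dfn_mk dfn_plus dfn_const dfn_arg)
    moreover have "\<not> X (pr (mk (n + n + n) 0 0) (pr 1 0)) \<longleftrightarrow> (\<exists>f\<in>F1. Y f n = 0)" for n
    proof -
      have r2: "qv (mk (1 + 1) 0 0) = 2" and r2': "qv (mk 2 0 0) = 2" by (simp_all add: qv_mk)
      have q: "qv (mk (n + n + n) 0 0) = 3 * toQ n" by (simp add: qv_mk toQ_add)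
      have Xn: "X (pr (mk (n + n + n) 0 0) (pr 1 0)) \<longleftrightarrow>
          (\<forall>y\<in>F1. isR y \<longrightarrow> inball (rco (mk (n + n + n) 0 0)) (mk (1 + 1) 0 0) y \<longrightarrow> \<not> P y)"
        unfolding X_def by (simp add: posZ cong: ball_cong)
      show ?thesis
      proof
        assume "\<not> X (pr (mk (n + n + n) 0 0) (pr 1 0))"
        then obtain y where y: "y \<in> F1" "isR y" "inball (rco (mk (n + n + n) 0 0)) (mk (1 + 1) 0 0) y" "P y"
          unfolding Xn by blast
        obtain n' g where g: "g \<in> F1" "Y g n' = 0" "eqR y (enc n' g)" using y(4) P[OF y(1,2)] by blast
        obtain m where m: "\<bar>3 * toQ n - qv (y (m + 1))\<bar> + 2 * dy m < 2" using y(3) by (auto simp: inball rco_def q r2')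
        have "\<bar>qv (y (m + 1)) - qv (enc n' g (m + 1))\<bar> \<le> 2 * dy (m + 1)" using g(3) by (simp add: eqR_def)
        then have "\<bar>qv (y (m + 1)) - qv (enc n' g (m + 1))\<bar> \<le> dy m" by (simp add: dy_Suc)
        then have "n = n'" using m enc(3,4)[OF g(1), of n' "m + 1"] dy_pos[of m] by (intro toQ_apart) linarith+
        then show "\<exists>f\<in>F1. Y f n = 0" using g by blast
      next
        assume "\<exists>f\<in>F1. Y f n = 0"
        then obtain f where f: "f \<in> F1" "Y f n = 0" by blast
        have "eqR (enc n f) (enc n f)" using dy_pos by (simp add: eqR_def less_imp_le)
        then have p: "P (enc n f)" using P[OF enc(1,2)[OF f(1)]] f by blast
        have "dy (0 + 1 + 1) = 1 / 4" using dy_Suc[of "0 + 1"] dy_Suc[of 0] by simp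
        then have "inball (rco (mk (n + n + n) 0 0)) (mk (1 + 1) 0 0) (enc n f)"
          unfolding inball rco_def q r2 using enc(3,4)[OF f(1), of n "0 + 1 + 1 + 1"] by (intro exI[of _ "0 + 1 + 1"]) linarith
        then show "\<not> X (pr (mk (n + n + n) 0 0) (pr 1 0))" unfolding Xn using p enc(1,2)[OF f(1)] by blast
      qed
    qed
    ultimately show ?thesis by simp
  qed
qed

end

section \<open>The numbers of a model as a type\<close>

text \<open>The order is not among the data, because it is recovered from addition: a \<le> b iff b
  = a + c for some c.\<close>

definition positive_semiring :: "'b set \<Rightarrow> 'b \<Rightarrow> 'b \<Rightarrow> ('b \<Rightarrow> 'b \<Rightarrow> 'b) \<Rightarrow> ('b \<Rightarrow> 'b \<Rightarrow> 'b) \<Rightarrow> bool" where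
  "positive_semiring A z u p t \<longleftrightarrow> z \<in> A \<and> u \<in> A \<and> z \<noteq> u \<and>
    (\<forall>a\<in>A. p z a = a \<and> t u a = a \<and> t z a = z) \<and>
    (\<forall>a\<in>A. \<forall>b\<in>A. p a b \<in> A \<and> t a b \<in> A \<and> p a b = p b a \<and> t a b = t b a \<and>
       (t a b = z \<longrightarrow> a = z \<or> b = z) \<and> (p a b = z \<longrightarrow> a = z) \<and> ((\<exists>c\<in>A. b = p a c) \<or> (\<exists>c\<in>A. a = p b c))) \<and>
    (\<forall>a\<in>A. \<forall>b\<in>A. \<forall>c\<in>A. p (p a b) c = p a (p b c) \<and> t (t a b) c = t a (t b c) \<and>
       t (p a b) c = p (t a c) (t b c) \<and> (p a c = p b c \<longrightarrow> a = b))"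

lemma positive_semiringD:
  assumes "positive_semiring A z u p t" "a \<in> A" "b \<in> A" "c \<in> A"
  shows "p a b = p b a" "p (p a b) c = p a (p b c)" "p z a = a" "t u a = a" "t a b = t b a" "t (t a b) c = t a (t b c)"
    "t (p a b) c = p (t a c) (t b c)" "t z a = z" "z \<noteq> u"
    "t a b = z \<Longrightarrow> a = z \<or> b = z" "p a c = p b c \<Longrightarrow> a = b" "p a b = z \<Longrightarrow> a = z"
    "(\<exists>c\<in>A. b = p a c) \<or> (\<exists>c\<in>A. a = p b c)" "z \<in> A" "u \<in> A" "p a b \<in> A" "t a b \<in> A"
  using assms unfolding positive_semiring_def by blast+

lemma (in rca) numbers_positive_semiring: "positive_semiring N zr on (\<lambda>x y. x \<oplus> y) (\<lambda>x y. x \<otimes> y)"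
  unfolding positive_semiring_def
proof (intro conjI ballI)
  fix a b assume ab: "a \<in> N" "b \<in> N"
  show "a \<otimes> b = zr \<longrightarrow> a = zr \<or> b = zr" using mul_pos[OF ab] by blast
  show "a \<oplus> b = zr \<longrightarrow> a = zr"
  proof
    assume "a \<oplus> b = zr"
    then have "a \<preceq> zr" using le_iff_add[of a zr] ab by force
    then show "a = zr" using zr_le[OF ab(1)] less_trans[of a zr a] less_irrefl[of a] ab by auto
  qed
  show "(\<exists>c\<in>N. b = a \<oplus> c) \<or> (\<exists>c\<in>N. a = b \<oplus> c)"
    using linear[OF ab] le_iff_add[of a b] le_iff_add[of b a] ab by blast
  fix c assume c: "c \<in> N"
  show "(a \<oplus> b) \<otimes> c = a \<otimes> c \<oplus> b \<otimes> c"
    using distrib_left[of c a b] mul_commute ab c by simp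
  show "a \<oplus> c = b \<oplus> c \<longrightarrow> a = b" using add_right_cancel ab c by blast
qed (use zr_neq_on mul_on mul_commute[of on] in \<open>auto intro: add_commute add_assoc mul_commute mul_assoc\<close>)

text \<open>The default that keeps the type construction meaningful when no counterexample exists: a
  copy of the standard naturals among sets of terms.\<close>

lemma positive_semiring_exists: "\<exists>A z u p t. positive_semiring (A :: tm set set) z u p t"
proof -
  let ?f = "\<lambda>n. {Var n Ty0}"
  have f: "inv ?f {Var n Ty0} = n" for n using inv_f_f[of ?f n] by (simp add: inj_def)
  have "positive_semiring (range ?f) (?f 0) (?f 1) (\<lambda>a b. ?f (inv ?f a + inv ?f b)) (\<lambda>a b. ?f (inv ?f a * inv ?f b))"
    unfolding positive_semiring_def by (auto simp: f algebra_simps dest: le_Suc_ex) (metis le_Suc_ex nat_le_linear)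
  then show ?thesis by blast
qed

section \<open>Reduction to one possible counterexample\<close>

definition models :: "'a interp \<Rightarrow> fm set \<Rightarrow> bool" where
  "models M T \<longleftrightarrow> (\<forall>\<phi>\<in>T. wff [] \<phi> \<longrightarrow> feval M [] \<phi>)"

text \<open>All claims are gathered in one property of a model, so that a single choice of a
  counterexample serves for all of them.\<close>

definition correct :: "'a interp \<Rightarrow> bool" where
  "correct M \<longleftrightarrow>
    (\<forall>\<phi>\<in>insert (OPEN 0) ACA. feval M [] (Imp (BOOT 0) \<phi>)) \<and>
    (models M ACA \<longrightarrow> feval M [] (Imp (OPEN 0) (BOOT_minus 0))) \<and>
    (models M NFP \<longrightarrow> feval M [] (BOOT 0)) \<and>
    (models M IND_omega \<longrightarrow> feval M [] (Imp (BOOT 0) (HBU_closed 0)))"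

lemma (in num_model) correct: "correct M"
proof -
  note s = sat_sentence(2)[OF sat_BOOT] sat_sentence(2)[OF sat_OPEN] sat_sentence(2)[OF sat_BOOT_minus] sat_sentence(2)[OF sat_HBU]
  have "opn \<longrightarrow> boot_minus" if "models M ACA"
    using opn_boot_minus ACA_jump that by (auto simp: models_def)
  moreover have "boot" if "models M NFP" using NFP_boot that by (auto simp: models_def)
  moreover have "boot \<longrightarrow> hbu" if "models M IND_omega" using boot_hbu that by (auto simp: models_def)
  moreover have "feval M [] \<phi>" if boot "\<phi> \<in> ACA" for \<phi> using jump_ACA[OF boot_jump] that by blast
  ultimately show ?thesis unfolding correct_def using boot_opn by (auto simp: s)
qed

text \<open>A type cannot depend on a model. The type below is the carrier of the numbers of one fixed model of
  the base theory, which is a counterexample to \<open>correct\<close> if there is any.\<close>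

definition counterexample :: "tm set interp \<Rightarrow> bool" where
  "counterexample M \<longleftrightarrow> rca M \<and> \<not> correct M"

text \<open>A tuple of operations is chosen instead of a model, so that the default can be any
  suitable semiring.\<close>

definition is_ops :: "tm set set \<times> tm set \<times> tm set \<times> (tm set \<Rightarrow> tm set \<Rightarrow> tm set) \<times> (tm set \<Rightarrow> tm set \<Rightarrow> tm set) \<Rightarrow> bool" where
  "is_ops = (\<lambda>(A, z, u, p, t). positive_semiring A z u p t \<and> ((\<exists>M. counterexample M) \<longrightarrow>
     (\<exists>M. counterexample M \<and> A = Dom M Ty0 \<and> z = con M Zero \<and> u = con M One \<and>
        p = (\<lambda>x y. ap M (ap M (con M Plus) x) y) \<and> t = (\<lambda>x y. ap M (ap M (con M Times) x) y))))"

definition ops where "ops = (SOME X. is_ops X)"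

lemma ops: "is_ops ops"
  unfolding ops_def
proof (rule someI_ex)
  show "\<exists>X. is_ops X"
  proof (cases "\<exists>M. counterexample M")
    case True
    then obtain M where M: "counterexample M" by blast
    then interpret rca M by (simp add: counterexample_def)
    show ?thesis
      by (rule exI[of _ "(Dom M Ty0, con M Zero, con M One, (\<lambda>x y. ap M (ap M (con M Plus) x) y), (\<lambda>x y. ap M (ap M (con M Times) x) y))"])
        (use numbers_positive_semiring M in \<open>auto simp: is_ops_def\<close>)
  next
    case False
    then show ?thesis using positive_semiring_exists by (auto simp: is_ops_def)
  qed
qed

definition "mcarrier = fst ops"
definition "mzero = fst (snd ops)"
definition "mone = fst (snd (snd ops))"
definition "mplus = fst (snd (snd (snd ops)))"
definition "mtimes = snd (snd (snd (snd ops)))"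

lemma mops: "positive_semiring mcarrier mzero mone mplus mtimes"
  and mops_counterexample: "counterexample M \<Longrightarrow> \<exists>M. counterexample M \<and> mcarrier = Dom M Ty0 \<and> mzero = con M Zero \<and>
     mone = con M One \<and> mplus = (\<lambda>x y. ap M (ap M (con M Plus) x) y) \<and> mtimes = (\<lambda>x y. ap M (ap M (con M Times) x) y)"
proof -
  have "ops = (mcarrier, mzero, mone, mplus, mtimes)"
    by (simp add: mcarrier_def mzero_def mone_def mplus_def mtimes_def)
  note o = ops[unfolded this is_ops_def prod.case]
  show "positive_semiring mcarrier mzero mone mplus mtimes" using o by blast
  show "counterexample M \<Longrightarrow> \<exists>M. counterexample M \<and> mcarrier = Dom M Ty0 \<and> mzero = con M Zero \<and>
     mone = con M One \<and> mplus = (\<lambda>x y. ap M (ap M (con M Plus) x) y) \<and> mtimes = (\<lambda>x y. ap M (ap M (con M Times) x) y)"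
    using o by blast
qed

section \<open>The ordered semiring of the chosen model\<close>

typedef model_num = mcarrier
  by (rule exI, rule conjunct1[OF mops[unfolded positive_semiring_def]])

instantiation model_num :: linordered_semidom
begin

definition "0 = Abs_model_num mzero"
definition "1 = Abs_model_num mone"
definition "a + b = Abs_model_num (mplus (Rep_model_num a) (Rep_model_num b))"
definition "a * b = Abs_model_num (mtimes (Rep_model_num a) (Rep_model_num b))"
definition "a \<le> b \<longleftrightarrow> (\<exists>c. b = a + (c::model_num))"
definition "a < b \<longleftrightarrow> a \<le> b \<and> a \<noteq> (b::model_num)"
definition "a - b = (if b \<le> a then THE c. a = b + c else (0::model_num))"

lemma Rep_model_ops:
  "Rep_model_num 0 = mzero" "Rep_model_num 1 = mone"
  "Rep_model_num (a + b) = mplus (Rep_model_num a) (Rep_model_num b)"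
  "Rep_model_num (a * b) = mtimes (Rep_model_num a) (Rep_model_num b)"
  unfolding zero_model_num_def one_model_num_def plus_model_num_def times_model_num_def
  by (rule Abs_model_num_inverse positive_semiringD(14-17)[OF mops Rep_model_num Rep_model_num Rep_model_num])+

lemma model_semiring:
  fixes a b c :: model_num
  shows "a + b = b + a" "a + b + c = a + (b + c)" "0 + a = a" "1 * a = a" "a * b = b * a" "a * b * c = a * (b * c)"
    "(a + b) * c = a * c + b * c" "0 * a = 0" "a * 0 = 0" "(0::model_num) \<noteq> 1"
    "a \<noteq> 0 \<Longrightarrow> b \<noteq> 0 \<Longrightarrow> a * b \<noteq> 0" "a + c = b + c \<Longrightarrow> a = b" "a + b = 0 \<Longrightarrow> a = 0"
proof -
  note d = positive_semiringD[OF mops Rep_model_num[of a] Rep_model_num[of b] Rep_model_num[of c]]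
  note r = Rep_model_num_inject[symmetric] Rep_model_ops
  show "a + b = b + a" "a + b + c = a + (b + c)" "0 + a = a" "1 * a = a" and m: "a * b = b * a" and "a * b * c = a * (b * c)"
    "(a + b) * c = a * c + b * c" and z: "0 * a = 0" and "(0::model_num) \<noteq> 1"
    unfolding r by (rule d)+
  show "a * 0 = 0"
    unfolding r using positive_semiringD(5,8)[OF mops Rep_model_num[of a] d(14) d(14)] positive_semiringD(8)[OF mops Rep_model_num[of a] d(14) d(14)]
    by simp
  show "a \<noteq> 0 \<Longrightarrow> b \<noteq> 0 \<Longrightarrow> a * b \<noteq> 0" "a + c = b + c \<Longrightarrow> a = b" "a + b = 0 \<Longrightarrow> a = 0"
    unfolding r using d(10-12) by blast+
qed

lemma model_total: "(a::model_num) \<le> b \<or> b \<le> a"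
  using positive_semiringD(13)[OF mops Rep_model_num[of a] Rep_model_num[of b] Rep_model_num]
  unfolding less_eq_model_num_def Rep_model_num_inject[symmetric] Rep_model_ops by (metis Rep_model_num_cases)

lemma model_cancel: "a + b = a + c \<Longrightarrow> b = (c::model_num)" "a = a + b \<Longrightarrow> b = 0"
  using model_semiring(1,3,12) by metis+

lemma model_order:
  fixes a b c :: model_num
  shows "a \<le> a" "a \<le> b \<Longrightarrow> b \<le> c \<Longrightarrow> a \<le> c" "a \<le> b \<Longrightarrow> c + a \<le> c + b" "a \<le> b \<Longrightarrow> b \<le> a \<Longrightarrow> a = b"
proof -
  show "a \<le> a" unfolding less_eq_model_num_def using model_semiring(1,3) by metis
  show "a \<le> b \<Longrightarrow> b \<le> c \<Longrightarrow> a \<le> c" "a \<le> b \<Longrightarrow> c + a \<le> c + b"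
    unfolding less_eq_model_num_def using model_semiring(2) by metis+
  assume "a \<le> b" "b \<le> a"
  then obtain x y where "b = a + x" "a = b + y" unfolding less_eq_model_num_def by blast
  then show "a = b" using model_cancel(2)[of a "x + y"] model_semiring(2)[of a x y] model_semiring(13)[of x y] model_semiring(1)[of a 0] model_semiring(3)[of a]
    by simp
qed

lemma model_diff_add: "a + b - a = (b::model_num)"
proof -
  have "a \<le> a + b" unfolding less_eq_model_num_def by blast
  then show ?thesis unfolding minus_model_num_def using model_cancel(1)[of a] by auto
qed

lemma model_diff_none: "\<not> b \<le> a \<Longrightarrow> a - b = (0::model_num)"
  by (simp add: minus_model_num_def)

lemma model_zero_diff: "0 - a = (0::model_num)"
proof (cases "a \<le> 0")
  case True
  then have "a = 0" using model_semiring(13) unfolding less_eq_model_num_def by metis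
  then show ?thesis using model_diff_add[of 0 0] model_semiring(3) by simp
qed (rule model_diff_none)

lemma model_distrib_left: "a * (b + c) = a * b + a * (c::model_num)"
  using model_semiring(5,7) by metis

lemma model_diff:
  fixes a b c :: model_num
  shows "a - b - c = a - (b + c)" "a * (b - c) = a * b - a * c" "b \<le> a \<Longrightarrow> a - b + b = a"
proof -
  show "b \<le> a \<Longrightarrow> a - b + b = a"
    unfolding less_eq_model_num_def using model_diff_add model_semiring(1) by metis
  show "a - b - c = a - (b + c)"
  proof (cases "b + c \<le> a")
    case True
    then obtain d where "a = b + (c + d)" unfolding less_eq_model_num_def using model_semiring(2) by metis
    then show ?thesis using model_diff_add[of b "c + d"] model_diff_add[of c d] model_diff_add[of "b + c" d] model_semiring(2) by metis
  next
    case False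
    have "a - b - c = 0"
    proof (cases "b \<le> a")
      case True
      then obtain x where x: "a = b + x" unfolding less_eq_model_num_def by blast
      then have "\<not> c \<le> x" using False model_order(3) by blast
      then show ?thesis using x model_diff_add model_diff_none by metis
    next
      case False
      then show ?thesis using model_diff_none model_zero_diff by metis
    qed
    then show ?thesis using False model_diff_none by metis
  qed
  show "a * (b - c) = a * b - a * c"
  proof (cases "c \<le> b")
    case True
    then obtain d where "b = c + d" unfolding less_eq_model_num_def by blast
    then show ?thesis using model_diff_add model_distrib_left by metis
  next
    case False
    then obtain d where d: "c = b + d" using model_total unfolding less_eq_model_num_def by metis
    have "a * b - a * c = 0"
    proof (cases "a * c \<le> a * b")
      case True
      moreover have "a * b \<le> a * c" unfolding d model_distrib_left less_eq_model_num_def by blast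
      ultimately have "a * b = a * c" using model_order(4) by blast
      then show ?thesis using model_diff_add[of "a * b" 0] model_semiring(1,3) by metis
    qed (rule model_diff_none)
    then show ?thesis using model_diff_none[OF False] model_semiring(9) by metis
  qed
qed

lemma model_less:
  fixes a b c :: model_num
  shows "a < b \<longleftrightarrow> a \<le> b \<and> \<not> b \<le> a" "(0::model_num) < 1" "a < b \<Longrightarrow> 0 < c \<Longrightarrow> c * a < c * b"
proof -
  show "a < b \<longleftrightarrow> a \<le> b \<and> \<not> b \<le> a" unfolding less_model_num_def using model_order(1,4) by blast
  show "(0::model_num) < 1" unfolding less_model_num_def less_eq_model_num_def using model_semiring(3,10) by metis
  assume h: "a < b" "0 < c"
  then obtain d where d: "b = a + d" unfolding less_model_num_def less_eq_model_num_def by blast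
  have "d \<noteq> 0" using h(1) d model_semiring(1,3) unfolding less_model_num_def by metis
  then have "c * d \<noteq> 0" using h(2) model_semiring(11) unfolding less_model_num_def by metis
  then have "c * a \<noteq> c * b" unfolding d model_distrib_left using model_cancel(2) by metis
  then show "c * a < c * b" unfolding less_model_num_def less_eq_model_num_def d model_distrib_left by blast
qed

instance
  by standard (assumption | rule model_semiring(1-11) model_order(1,3) model_distrib_left model_diff model_diff_add model_less model_total
    | erule (1) model_order(2) model_order(4))+

end

text \<open>The type comes from some counterexample, not necessarily from the given model. That
  counterexample is an instance of \<open>num_model\<close>, where correctness holds.\<close>

lemma rca_correct: assumes "rca (M :: tm set interp)" shows "correct M"
proof (rule ccontr)
  assume "\<not> correct M"
  then have "counterexample M" using assms by (simp add: counterexample_def)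
  from mops_counterexample[OF this] obtain M :: "tm set interp" where M: "counterexample M" "mcarrier = Dom M Ty0"
    "mzero = con M Zero" "mone = con M One" "mplus = (\<lambda>x y. ap M (ap M (con M Plus) x) y)"
    "mtimes = (\<lambda>x y. ap M (ap M (con M Times) x) y)" by blast
  interpret rca M using M(1) by (simp add: counterexample_def)
  interpret num_model M Rep_model_num
  proof
    show "bij_betw Rep_model_num UNIV (Dom M Ty0)"
      unfolding bij_betw_def M(2)[symmetric] using Rep_model_num_inject type_definition.Rep_range[OF type_definition_model_num]
      by (auto simp: inj_def)
    fix a b
    have r: "Rep_model_num x \<in> Dom M Ty0" for x using Rep_model_num M(2) by simp
    have "a \<le> b \<longleftrightarrow> (\<exists>c\<in>Dom M Ty0. Rep_model_num b = ap M (ap M (con M Plus) (Rep_model_num a)) c)"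
      unfolding less_eq_model_num_def Rep_model_num_inject[symmetric] Rep_model_ops M(5)
      using Rep_model_num_cases[unfolded M(2)] r by metis
    then have "a \<le> b \<longleftrightarrow> lss M (Rep_model_num a) (Rep_model_num b) \<or> Rep_model_num a = Rep_model_num b" using le_iff_add[OF r r] by simp
    then show "lss M (Rep_model_num a) (Rep_model_num b) \<longleftrightarrow> a < b"
      unfolding less_model_num_def using less_irrefl[OF r] by (auto simp: Rep_model_num_inject)
  qed (simp_all add: Rep_model_ops M)
  show False using correct M(1) by (simp add: counterexample_def)
qed

section \<open>Well-formedness of the principles\<close>

text \<open>The syntactic part of \<open>den\<close> and \<open>sat\<close>: completeness asks for
  well-formedness of the goal before any model is at hand.\<close>

definition hwt :: "ty list \<Rightarrow> htm \<Rightarrow> ty \<Rightarrow> bool" where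
  "hwt \<Gamma> t \<tau> \<longleftrightarrow> (\<forall>\<Delta>. wt (\<Delta> @ \<Gamma>) (t (length (\<Delta> @ \<Gamma>))) \<and> ty_of (t (length (\<Delta> @ \<Gamma>))) = \<tau>)"
definition hwf :: "ty list \<Rightarrow> hfm \<Rightarrow> bool" where
  "hwf \<Gamma> P \<longleftrightarrow> (\<forall>\<Delta>. wff (\<Delta> @ \<Gamma>) (P (length (\<Delta> @ \<Gamma>))))"
definition ext :: "ty list \<Rightarrow> ty list \<Rightarrow> bool" where
  "ext \<Gamma> \<Gamma>' \<longleftrightarrow> (\<exists>\<Delta>. \<Gamma>' = \<Delta> @ \<Gamma>)"

lemma ext_trans: "ext \<Gamma> \<Gamma>' \<Longrightarrow> ext \<Gamma>' \<Gamma>'' \<Longrightarrow> ext \<Gamma> \<Gamma>''"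
  by (auto simp: ext_def)

lemma hwt_lift: "hwt \<Gamma> t \<tau> \<Longrightarrow> ext \<Gamma> \<Gamma>' \<Longrightarrow> hwt \<Gamma>' t \<tau>"
  by (auto simp: hwt_def ext_def) (metis append.assoc length_append add.assoc)+

lemma hwt_hvar: "hwt (\<tau> # \<Delta> @ \<Gamma>) (hvar \<tau> (length (\<Delta> @ \<Gamma>))) \<tau>"
  by (simp add: hwt_def hvar_def nth_append)

lemma hwt_core:
  "hwt \<Gamma> \<^bold>0 Ty0" "hwt \<Gamma> \<^bold>1 Ty0" "hwt \<Gamma> s Ty0 \<Longrightarrow> hwt \<Gamma> t Ty0 \<Longrightarrow> hwt \<Gamma> (s \<^bold>+ t) Ty0"
  "hwt \<Gamma> s Ty0 \<Longrightarrow> hwt \<Gamma> t Ty0 \<Longrightarrow> hwt \<Gamma> (s \<^bold>* t) Ty0"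
  "hwt \<Gamma> u (\<sigma> \<rightarrow> \<tau>) \<Longrightarrow> hwt \<Gamma> v \<sigma> \<Longrightarrow> hwt \<Gamma> (u \<cdot> v) \<tau>"
  by (auto simp: hwt_def hzero_def hone_def hplus_def htimes_def happ_def hcst_def)

lemma hwf_core:
  "hwt \<Gamma> s Ty0 \<Longrightarrow> hwt \<Gamma> t Ty0 \<Longrightarrow> hwf \<Gamma> (s \<^bold>= t)" "hwt \<Gamma> s Ty0 \<Longrightarrow> hwt \<Gamma> t Ty0 \<Longrightarrow> hwf \<Gamma> (s \<^bold>< t)"
  "hwf \<Gamma> P \<Longrightarrow> hwf \<Gamma> Q \<Longrightarrow> hwf \<Gamma> (P \<^bold>\<longrightarrow> Q)" "hwf \<Gamma> P \<Longrightarrow> hwf \<Gamma> (\<^bold>\<not> P)"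
  "hwf \<Gamma> P \<Longrightarrow> hwf \<Gamma> Q \<Longrightarrow> hwf \<Gamma> (P \<^bold>\<and> Q)" "hwf \<Gamma> P \<Longrightarrow> hwf \<Gamma> Q \<Longrightarrow> hwf \<Gamma> (P \<^bold>\<or> Q)"
  "hwf \<Gamma> P \<Longrightarrow> hwf \<Gamma> Q \<Longrightarrow> hwf \<Gamma> (P \<^bold>\<longleftrightarrow> Q)"
  by (auto simp: hwf_def hwt_def heq_def hless_def himp_def hneg_def hconj_def hdisj_def hiff_def hbot_def)

lemma ext_Cons: "ext \<Gamma> (\<tau> # \<Delta> @ \<Gamma>)"
  by (simp add: ext_def)

lemma hwf_all: "(\<And>\<Gamma>' x. ext \<Gamma> \<Gamma>' \<Longrightarrow> hwt \<Gamma>' x \<tau> \<Longrightarrow> hwf \<Gamma>' (F x)) \<Longrightarrow> hwf \<Gamma> (hall \<tau> F)"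
  unfolding hwf_def[of \<Gamma>] hall_def
  using hwt_hvar ext_Cons unfolding hwf_def by (metis append_Nil length_Cons wff.simps(5))

lemma hwf_ex: "(\<And>\<Gamma>' x. ext \<Gamma> \<Gamma>' \<Longrightarrow> hwt \<Gamma>' x \<tau> \<Longrightarrow> hwf \<Gamma>' (F x)) \<Longrightarrow> hwf \<Gamma> (hex \<tau> F)"
  unfolding hex_def by (intro hwf_core hwf_all)

lemma wt_strengthen:
  "\<not> occurs0 t \<Longrightarrow> wt (\<tau> # \<Gamma>) t \<Longrightarrow> wt \<Gamma> (tsub (\<lambda>n \<rho>. Var (n - 1) \<rho>) t) \<and>
     ty_of (tsub (\<lambda>n \<rho>. Var (n - 1) \<rho>) t) = ty_of t"
  by (induction t) (auto simp: nth_Cons split: nat.splits ty.splits)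

lemma wt_bracket: "wt (\<tau> # \<Gamma>) t \<Longrightarrow> wt \<Gamma> (bracket \<tau> t) \<and> ty_of (bracket \<tau> t) = (\<tau> \<rightarrow> ty_of t)"
proof (induction t)
  case (Var n \<rho>)
  then show ?case by (cases n) auto
next
  case (App s t)
  then obtain \<sigma> where s: "ty_of s = (ty_of t \<rightarrow> \<sigma>)" and w: "wt (\<tau> # \<Gamma>) s" "wt (\<tau> # \<Gamma>) t"
    by (auto split: ty.splits)
  show ?case
  proof (cases "occurs0 (App s t)")
    case True
    then show ?thesis using App.IH w s by auto
  next
    case False
    show ?thesis using False wt_strengthen[OF False App.prems]
      by (simp del: tsub.simps wt.simps ty_of.simps occurs0.simps(3)) simp
  qed
qed simp

lemma hwt_lam: "(\<And>\<Gamma>' x. ext \<Gamma> \<Gamma>' \<Longrightarrow> hwt \<Gamma>' x Ty0 \<Longrightarrow> hwt \<Gamma>' (F x) \<tau>) \<Longrightarrow> hwt \<Gamma> (hlam0 F) (Ty0 \<rightarrow> \<tau>)"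
proof -
  assume F: "\<And>\<Gamma>' x. ext \<Gamma> \<Gamma>' \<Longrightarrow> hwt \<Gamma>' x Ty0 \<Longrightarrow> hwt \<Gamma>' (F x) \<tau>"
  have "wt (Ty0 # \<Delta> @ \<Gamma>) (F (hvar Ty0 (length (\<Delta> @ \<Gamma>))) (Suc (length (\<Delta> @ \<Gamma>)))) \<and>
      ty_of (F (hvar Ty0 (length (\<Delta> @ \<Gamma>))) (Suc (length (\<Delta> @ \<Gamma>)))) = \<tau>" for \<Delta>
    using F[OF ext_Cons hwt_hvar] unfolding hwt_def by (metis append_Nil length_Cons)
  then show ?thesis unfolding hwt_def hlam0_def using wt_bracket by metis
qed

lemma hwt_rec:
  "(\<And>\<Gamma>' k m. ext \<Gamma> \<Gamma>' \<Longrightarrow> hwt \<Gamma>' k Ty0 \<Longrightarrow> hwt \<Gamma>' m Ty0 \<Longrightarrow> hwt \<Gamma>' (F k m) Ty0) \<Longrightarrow>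
     hwt \<Gamma> s Ty0 \<Longrightarrow> hwt \<Gamma> t Ty0 \<Longrightarrow> hwt \<Gamma> (hrec F s t) Ty0"
proof -
  assume F: "\<And>\<Gamma>' k m. ext \<Gamma> \<Gamma>' \<Longrightarrow> hwt \<Gamma>' k Ty0 \<Longrightarrow> hwt \<Gamma>' m Ty0 \<Longrightarrow> hwt \<Gamma>' (F k m) Ty0" and st: "hwt \<Gamma> s Ty0" "hwt \<Gamma> t Ty0"
  have c: "hwt \<Gamma> (hcst Rec0) ((Ty0 \<rightarrow> Ty0 \<rightarrow> Ty0) \<rightarrow> Ty0 \<rightarrow> Ty0 \<rightarrow> Ty0)" by (simp add: hwt_def hcst_def)
  have "hwt \<Gamma> (\<^bold>\<lambda>\<^sub>0 k. \<^bold>\<lambda>\<^sub>0 m. F k m) (Ty0 \<rightarrow> Ty0 \<rightarrow> Ty0)"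
    by (rule hwt_lam, rule hwt_lam) (assumption | rule F | erule hwt_lift | erule ext_trans)+
  from hwt_core(5)[OF hwt_core(5)[OF hwt_core(5)[OF c this] st(1)] st(2)] show ?thesis by (simp add: hrec_def)
qed

lemma hwt_fun:
  "(\<And>\<Gamma>' x. ext \<Gamma> \<Gamma>' \<Longrightarrow> hwt \<Gamma>' x Ty0 \<Longrightarrow> hwt \<Gamma>' (F x) Ty0) \<Longrightarrow> hwt \<Gamma> t Ty0 \<Longrightarrow> hwt \<Gamma> (hfun1 F t) Ty0"
  "(\<And>\<Gamma>' x y. ext \<Gamma> \<Gamma>' \<Longrightarrow> hwt \<Gamma>' x Ty0 \<Longrightarrow> hwt \<Gamma>' y Ty0 \<Longrightarrow> hwt \<Gamma>' (G x y) Ty0) \<Longrightarrow> hwt \<Gamma> s Ty0 \<Longrightarrow> hwt \<Gamma> t Ty0 \<Longrightarrow>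
     hwt \<Gamma> (hfun2 G s t) Ty0"
proof -
  assume F: "\<And>\<Gamma>' x. ext \<Gamma> \<Gamma>' \<Longrightarrow> hwt \<Gamma>' x Ty0 \<Longrightarrow> hwt \<Gamma>' (F x) Ty0" and t: "hwt \<Gamma> t Ty0"
  show "hwt \<Gamma> (hfun1 F t) Ty0" unfolding hfun1_def by (rule hwt_core(5)[OF hwt_lam[OF F] t])
next
  assume G: "\<And>\<Gamma>' x y. ext \<Gamma> \<Gamma>' \<Longrightarrow> hwt \<Gamma>' x Ty0 \<Longrightarrow> hwt \<Gamma>' y Ty0 \<Longrightarrow> hwt \<Gamma>' (G x y) Ty0" and st: "hwt \<Gamma> s Ty0" "hwt \<Gamma> t Ty0"
  have "hwt \<Gamma> (\<^bold>\<lambda>\<^sub>0 x. \<^bold>\<lambda>\<^sub>0 y. G x y) (Ty0 \<rightarrow> Ty0 \<rightarrow> Ty0)"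
    by (rule hwt_lam, rule hwt_lam) (assumption | rule G | erule hwt_lift | erule ext_trans)+
  from hwt_core(5)[OF hwt_core(5)[OF this st(1)] st(2)] show "hwt \<Gamma> (hfun2 G s t) Ty0" by (simp add: hfun2_def)
qed

lemmas hwt_terms = hwt_core hwt_rec hwt_fun

lemma hwt_arith:
  "hwt \<Gamma> t Ty0 \<Longrightarrow> hwt \<Gamma> (hpred t) Ty0" "hwt \<Gamma> t Ty0 \<Longrightarrow> hwt \<Gamma> (htri t) Ty0" "hwt \<Gamma> t Ty0 \<Longrightarrow> hwt \<Gamma> (hpow2 t) Ty0"
  "hwt \<Gamma> c Ty0 \<Longrightarrow> hwt \<Gamma> s Ty0 \<Longrightarrow> hwt \<Gamma> t Ty0 \<Longrightarrow> hwt \<Gamma> (hifz c s t) Ty0"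
  unfolding hpred_def htri_def hpow2_def hifz_def
  by (assumption | rule hwt_terms | erule hwt_lift | erule ext_trans)+

lemma hwt_monus: "hwt \<Gamma> s Ty0 \<Longrightarrow> hwt \<Gamma> t Ty0 \<Longrightarrow> hwt \<Gamma> (hmonus s t) Ty0"
  unfolding hmonus_def by (assumption | rule hwt_terms hwt_arith | erule hwt_lift | erule ext_trans)+

lemma hwt_pair: "hwt \<Gamma> s Ty0 \<Longrightarrow> hwt \<Gamma> t Ty0 \<Longrightarrow> hwt \<Gamma> (hpair s t) Ty0" "hwt \<Gamma> t Ty0 \<Longrightarrow> hwt \<Gamma> (hroot t) Ty0"
  unfolding hpair_def hroot_def by (assumption | rule hwt_terms hwt_arith hwt_monus | erule hwt_lift | erule ext_trans)+

lemma hwt_fst: "hwt \<Gamma> t Ty0 \<Longrightarrow> hwt \<Gamma> (hfst t) Ty0"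
  unfolding hfst_def by (assumption | rule hwt_terms hwt_arith hwt_monus hwt_pair | erule hwt_lift | erule ext_trans)+

lemma hwt_snd: "hwt \<Gamma> t Ty0 \<Longrightarrow> hwt \<Gamma> (hsnd t) Ty0"
  unfolding hsnd_def by (assumption | rule hwt_terms hwt_monus hwt_pair hwt_fst | erule hwt_lift | erule ext_trans)+

lemmas hwt_coding = hwt_terms hwt_arith hwt_monus hwt_pair hwt_fst hwt_snd
lemmas rat_defs = rat_def qpos_def qneg_def qden_def q0_def q1_def

lemma hwt_q:
  "hwt \<Gamma> s Ty0 \<Longrightarrow> hwt \<Gamma> t Ty0 \<Longrightarrow> hwt \<Gamma> (qadd s t) Ty0" "hwt \<Gamma> t Ty0 \<Longrightarrow> hwt \<Gamma> (qminus t) Ty0"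
  "hwt \<Gamma> s Ty0 \<Longrightarrow> hwt \<Gamma> t Ty0 \<Longrightarrow> hwt \<Gamma> (qdyadic s t) Ty0" "hwt \<Gamma> q0 Ty0" "hwt \<Gamma> q1 Ty0"
  unfolding qadd_def qminus_def qdyadic_def rat_defs
  by (assumption | rule hwt_coding | erule hwt_lift | erule ext_trans)+

lemma hwt_qabs: "hwt \<Gamma> t Ty0 \<Longrightarrow> hwt \<Gamma> (qabs t) Ty0" and hwt_qsub: "hwt \<Gamma> s Ty0 \<Longrightarrow> hwt \<Gamma> t Ty0 \<Longrightarrow> hwt \<Gamma> (qsub s t) Ty0"
  unfolding qabs_def qsub_def qpos_def qneg_def
  by (assumption | rule hwt_coding hwt_q | erule hwt_lift | erule ext_trans)+

lemma hwf_q: "hwt \<Gamma> s Ty0 \<Longrightarrow> hwt \<Gamma> t Ty0 \<Longrightarrow> hwf \<Gamma> (s \<^bold><\<^sub>Q t)" "hwt \<Gamma> s Ty0 \<Longrightarrow> hwt \<Gamma> t Ty0 \<Longrightarrow> hwf \<Gamma> (s \<^bold>\<le>\<^sub>Q t)"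
  unfolding qless_def qle_def rat_defs by (assumption | rule hwt_coding hwf_core)+

lemmas hwf_logic = hwf_core hwf_all hwf_ex
lemmas hw_rational = hwt_core hwt_q hwt_qabs hwt_qsub hwf_q hwf_logic hwt_fst hwt_snd hwt_pair

lemma hw_real:
  "hwt \<Gamma> x Ty1 \<Longrightarrow> hwf \<Gamma> (is_real x)" "hwt \<Gamma> x Ty1 \<Longrightarrow> hwt \<Gamma> y Ty1 \<Longrightarrow> hwf \<Gamma> (x \<^bold>=\<^sub>R y)"
  "hwt \<Gamma> x Ty1 \<Longrightarrow> hwt \<Gamma> y Ty1 \<Longrightarrow> hwf \<Gamma> (x \<^bold><\<^sub>R y)" "hwt \<Gamma> x Ty1 \<Longrightarrow> hwt \<Gamma> y Ty1 \<Longrightarrow> hwf \<Gamma> (x \<^bold>\<le>\<^sub>R y)"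
  "hwt \<Gamma> q Ty0 \<Longrightarrow> hwt \<Gamma> (rconst q) Ty1" "hwt \<Gamma> x Ty1 \<Longrightarrow> hwt \<Gamma> y Ty1 \<Longrightarrow> hwt \<Gamma> (radd x y) Ty1"
  "hwt \<Gamma> x Ty1 \<Longrightarrow> hwt \<Gamma> y Ty1 \<Longrightarrow> hwt \<Gamma> (rsub x y) Ty1" "hwt \<Gamma> x Ty1 \<Longrightarrow> hwt \<Gamma> (rabs x) Ty1"
  unfolding is_real_def req_def rless_def rle_def rconst_def radd_def rsub_def rabs_def
  by (assumption | rule hw_rational hwt_lam | erule hwt_lift | erule ext_trans)+

lemma hwf_allR: "(\<And>\<Gamma>' x. ext \<Gamma> \<Gamma>' \<Longrightarrow> hwt \<Gamma>' x Ty1 \<Longrightarrow> hwf \<Gamma>' (F x)) \<Longrightarrow> hwf \<Gamma> (hallR F)"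
  unfolding hallR_def by (intro hwf_logic hw_real)

lemma hwf_ex_set: "(\<And>\<Gamma>' x. ext \<Gamma> \<Gamma>' \<Longrightarrow> hwt \<Gamma>' x Ty1 \<Longrightarrow> hwf \<Gamma>' (F x)) \<Longrightarrow> hwf \<Gamma> (hex_set F)"
  unfolding hex_set_def by (assumption | rule hwf_logic hwt_core | erule hwt_lift | erule ext_trans | blast)+

lemmas hw_set = hwf_allR hwf_ex_set hw_real hw_rational

lemma wff_BOOT: "wff [] (BOOT 0)" and wff_BOOT_minus: "wff [] (BOOT_minus 0)"
  and wff_OPEN: "wff [] (OPEN 0)" and wff_HBU: "wff [] (HBU_closed 0)"
proof -
  note defs = mem_def in_real_set_def in_ball_def open_pred_def open_set_def closed_set_def real_function_def
    center_def radius_def rat_def heqT.simps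
  have w: "wff [] (P 0)" if "hwf [] P" for P
    using that unfolding hwf_def by (drule_tac spec[of _ "[]"]) simp
  have b: "hwf [] BOOT" unfolding BOOT_def defs
    by (assumption | rule hw_set | erule hwt_lift | erule ext_trans)+
  have b': "hwf [] BOOT_minus" unfolding BOOT_minus_def defs
    by (assumption | rule hw_set | erule hwt_lift | erule ext_trans)+
  have o: "hwf [] OPEN" unfolding OPEN_def defs
    by (assumption | rule hw_set | erule hwt_lift | erule ext_trans)+
  have h: "hwf [] HBU_closed" unfolding HBU_closed_def defs
    by (assumption | rule hw_set | erule hwt_lift | erule ext_trans)+
  show "wff [] (BOOT 0)" "wff [] (BOOT_minus 0)" "wff [] (OPEN 0)" "wff [] (HBU_closed 0)"
    by (rule w[OF b] w[OF b'] w[OF o] w[OF h])+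
qed

lemma wff_ACA: assumes "\<phi> \<in> ACA" shows "wff [] \<phi>"
proof -
  obtain \<Gamma> A where A: "\<phi> = closure \<Gamma> ((\<^bold>\<exists>\<^sub>S X. \<^bold>\<forall>\<^sub>0 n. n \<^bold>\<in> X \<^bold>\<longleftrightarrow> A\<langle>[n]\<rangle>) 0)" "wff (Ty0 # \<Gamma>) A"
    using assms by (auto simp: ACA_def)
  have "wff (Ty0 # Ty1 # \<Gamma>) (A\<langle>[hvar Ty0 (Suc 0)]\<rangle> (Suc (Suc 0)))"
    unfolding plug_def by (rule wff_fsub[OF A(2)]) (auto simp: subst_typed_def nth_Cons hvar_def split: nat.split)
  then show ?thesis
    by (simp add: A(1) wff_closure hex_set_def hex_def hall_def hneg_def himp_def hbot_def hconj_def hdisj_def hiff_def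
      heq_def mem_def happ_def hvar_def hzero_def hone_def hcst_def)
qed

theorem theorem4p5:
  shows "(\<forall>\<phi> \<in> insert (OPEN 0) ACA. RCA0_omega \<turnstile> Imp (BOOT 0) \<phi>)
    \<and> RCA0_omega \<union> ACA \<turnstile> Imp (OPEN 0) (BOOT_minus 0)
    \<and> RCA0_omega \<union> IND_omega \<union> NFP \<turnstile> BOOT 0
    \<and> RCA0_omega \<union> IND_omega \<turnstile> Imp (BOOT 0) (HBU_closed 0)"
proof -
  \<comment> \<open>Completeness reduces a claim to models of the base theory, all of which are
    \<open>correct\<close>; the additional axioms enter as \<open>models M T\<close>.\<close>
  have *: "RCA0_omega \<union> T \<turnstile> A"
    if "wff [] A" "\<And>M :: tm set interp. correct M \<Longrightarrow> models M T \<Longrightarrow> feval M [] A" for T A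
  proof (rule completeness[OF that(1)])
    show "(\<lambda>P. P 0) ` extensionality_axioms \<subseteq> RCA0_omega \<union> T" by (auto simp: RCA0_omega_def)
    fix M :: "tm set interp"
    assume M: "ext_interp M" "\<And>B. B \<in> RCA0_omega \<union> T \<Longrightarrow> wff [] B \<Longrightarrow> feval M [] B"
    then have "rca M" by (intro rca.intro rca_axioms.intro) auto
    moreover have "models M T" using M(2) by (simp add: models_def)
    ultimately show "feval M [] A" using that(2) rca_correct by blast
  qed
  have m: "models M (T \<union> U) \<longleftrightarrow> models M T \<and> models M U" for M :: "tm set interp" and T U
    by (auto simp: models_def)
  have "RCA0_omega \<turnstile> Imp (BOOT 0) \<phi>" if "\<phi> \<in> insert (OPEN 0) ACA" for \<phi>
  proof -
    have w: "wff [] (Imp (BOOT 0) \<phi>)" using that wff_BOOT wff_OPEN wff_ACA by auto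
    have "RCA0_omega \<union> {} \<turnstile> Imp (BOOT 0) \<phi>"
      by (rule *[OF w]) (use that in \<open>auto simp: correct_def simp del: feval.simps\<close>)
    then show ?thesis by simp
  qed
  moreover have "RCA0_omega \<union> ACA \<turnstile> Imp (OPEN 0) (BOOT_minus 0)"
    by (rule *) (simp_all add: wff_OPEN wff_BOOT_minus correct_def del: feval.simps)
  moreover have "RCA0_omega \<union> (IND_omega \<union> NFP) \<turnstile> BOOT 0"
    by (rule *) (simp_all add: wff_BOOT correct_def m)
  moreover have "RCA0_omega \<union> IND_omega \<turnstile> Imp (BOOT 0) (HBU_closed 0)"
    by (rule *) (simp_all add: wff_BOOT wff_HBU correct_def del: feval.simps)
  ultimately show ?thesis by (simp add: Un_assoc)
qed

end
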